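(* Let $N$ be a square-free positive integer with distinct prime factors $p_{1},\ldots,p_{t}$, and let $k\geq 2$ be an even integer. Suppose that $f\in\mathcal{S}_{k}(N)^{\mathrm{new}}$ is a newform which is congruent to the Eisenstein eigenform $E=[p_{1}]^{+}\circ\ldots\circ[p_{t}]^{+}E_{k}\in\mathcal{E}_{k}(N)$ modulo $\lambda^{r}$, where $r>0$ is an integer and $\lambda\subset\mathcal{O}_{f}$ is a maximal ideal. If $\ell$ is the residual characteristic of $\lambda$, then \[r\leq \mathrm{ord}_{\lambda}(\ell)\cdot v_{\ell}\left(-\frac{B_{k}}{2k} \prod_{i=1}^{t}(1-p_{i})\right).\]
   Context: $\mathcal{M}_{k}(N)$ is the space of modular forms of weight $k$ for $\Gamma_{0}(N)$, $\mathcal{S}_{k}(N)$ its cuspidal subspace, $\mathcal{E}_{k}(N)$ its Eisenstein subspace and $\mathcal{S}_{k}(N)^{\mathrm{new}}$ the new subspace; $a_{n}(g)$ denotes the $n$-th coefficient of the $q$-expansion of $g$ at infinity ($q=e^{2\pi i\tau}$). $B_{k}$ is the $k$-th Bernoulli number, $\sigma_{k-1}(n)=\sum_{m\mid n}m^{k-1}$, and $E_{k}=-\frac{B_{k}}{2k}+\sum_{n\geq1}\sigma_{k-1}(n)q^{n}$ (a holomorphic function on the upper half-plane; for $k=2$ it is not modular). For a positive integer $d$, $A_{d}$ is the operator $g(\tau)\mapsto g(d\tau)$, and on weight-$k$ objects $[d]^{+}:=\mathrm{id}-d^{k-1}A_{d}$, $[d]^{-}:=\mathrm{id}-A_{d}$;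 these operators commute with each other, and for $k=2$ the composite $[p_1]^+\circ\cdots\circ[p_t]^+E_2$ is a modular form in $\mathcal{E}_2(N)$. A newform $f$ is a normalized Hecke eigenform in $\mathcal{S}_{k}(N)^{\mathrm{new}}$; $K_{f}$ is the number field generated by its coefficients and $\mathcal{O}_{f}$ its ring of integers. For a maximal ideal $\lambda$ of $\mathcal{O}_{f}$, $\mathrm{ord}_{\lambda}$ is the associated valuation ($\lambda^{n}\mid\alpha\mathcal{O}_f \iff n\le \mathrm{ord}_\lambda(\alpha)$), extended to $K_f^\times$; $v_{\ell}$ is the $\ell$-adic valuation on $\mathbb{Q}^\times$. Two eigenforms $f,g$ are congruent modulo $\lambda^{r}$ if $a_{n}(f)\equiv a_{n}(g)\pmod{\lambda^{r}}$ for all $n\geq 0$ (the congruence taken in the localization of $\mathcal{O}_f$ at $\lambda$). *)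

theory Defs
  imports
    "HOL-Complex_Analysis.Complex_Analysis"
    "HOL-Computational_Algebra.Computational_Algebra"
    "HOL-Algebra.Generated_Fields"
    "HOL-Algebra.Ideal_Product"
    "HOL-Algebra.QuotRing"
    "HOL-Algebra.Divisibility"
    "HOL-Algebra.Algebraic_Closure_Type"
    "HOL-Library.Function_Algebras"
begin

unbundle no fps_syntax

section \<open>Modular forms for \<open>\<Gamma>\<^sub>0(N)\<close>\<close>

definition upper_half_plane :: "complex set" where
  "upper_half_plane = {\<tau>. Im \<tau> > 0}"

definition SL2Z :: "(int ^ 2 ^ 2) monoid" where
  "SL2Z = \<lparr>carrier = {A. det A = 1}, mult = (**), one = mat 1\<rparr>"

definition Gamma0 :: "nat \<Rightarrow> (int ^ 2 ^ 2) set" where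
  "Gamma0 N = {A \<in> carrier SL2Z. int N dvd A $ 2 $ 1}"

definition slash :: "nat \<Rightarrow> int ^ 2 ^ 2 \<Rightarrow> (complex \<Rightarrow> complex) \<Rightarrow> complex \<Rightarrow> complex" where
  "slash k A f \<tau> =
     f (moebius (of_int (A $ 1 $ 1)) (of_int (A $ 1 $ 2)) (of_int (A $ 2 $ 1)) (of_int (A $ 2 $ 2)) \<tau>)
       / (of_int (A $ 2 $ 1) * \<tau> + of_int (A $ 2 $ 2)) ^ k"

definition has_q_expansion :: "nat \<Rightarrow> (nat \<Rightarrow> complex) \<Rightarrow> (complex \<Rightarrow> complex) \<Rightarrow> bool" where
  "has_q_expansion h a f \<longleftrightarrow>
     (\<forall>\<tau> \<in> upper_half_plane.
        (\<lambda>n. a n * exp (2 * of_real pi * \<i> * of_nat n * \<tau> / of_nat h)) sums f \<tau>)"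

text \<open>
  Functions on the upper half-plane are represented by total functions which vanish elsewhere,
  so that the sets below are complex vector spaces. Every \<open>f|\<gamma>\<close> is \<open>N\<close>-periodic
  because \<open>\<Gamma>\<^sub>0(N)\<close> contains the principal congruence subgroup of level \<open>N\<close>; hence expansions
  in \<open>exp (2\<pi>i\<tau>/N)\<close> suffice at all cusps.
\<close>

definition modular_forms :: "nat \<Rightarrow> nat \<Rightarrow> (complex \<Rightarrow> complex) set" where
  "modular_forms k N =
     {f. f holomorphic_on upper_half_plane \<and>
         (\<forall>\<tau>. \<tau> \<notin> upper_half_plane \<longrightarrow> f \<tau> = 0) \<and>
         (\<forall>\<gamma> \<in> Gamma0 N. \<forall>\<tau> \<in> upper_half_plane. slash k \<gamma> f \<tau> = f \<tau>) \<and>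
         (\<forall>\<gamma> \<in> carrier SL2Z. \<exists>a. has_q_expansion N a (slash k \<gamma> f))}"

definition cusp_forms :: "nat \<Rightarrow> nat \<Rightarrow> (complex \<Rightarrow> complex) set" where
  "cusp_forms k N =
     {f \<in> modular_forms k N.
        \<forall>\<gamma> \<in> carrier SL2Z. \<exists>a. a 0 = 0 \<and> has_q_expansion N a (slash k \<gamma> f)}"

definition q_coeff :: "(complex \<Rightarrow> complex) \<Rightarrow> nat \<Rightarrow> complex" where
  "q_coeff f = (THE a. has_q_expansion 1 a f)"

definition A_op :: "nat \<Rightarrow> (complex \<Rightarrow> complex) \<Rightarrow> complex \<Rightarrow> complex" where
  "A_op d g \<tau> = g (of_nat d * \<tau>)"


section \<open>Newforms\<close>

definition fundamental_domain :: "complex set" where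
  "fundamental_domain = {\<tau> \<in> upper_half_plane. \<bar>Re \<tau>\<bar> \<le> 1 / 2 \<and> norm \<tau> \<ge> 1}"

text \<open>
  The integral over \<open>\<Gamma>\<^sub>0(N)\H\<close> with respect to \<open>dx dy / y\<^sup>2\<close>, cut into translates of the
  fundamental domain of the full modular group, one for each coset \<open>\<Gamma>\<^sub>0(N)\<gamma>\<close>; the
  integrand does not depend on the representative. It is not divided by the covolume, which is
  irrelevant for orthogonality.
\<close>

definition petersson :: "nat \<Rightarrow> nat \<Rightarrow> (complex \<Rightarrow> complex) \<Rightarrow> (complex \<Rightarrow> complex) \<Rightarrow> complex" where
  "petersson k N f g =
     (\<Sum>C \<in> rcosets\<^bsub>SL2Z\<^esub> (Gamma0 N).
        let \<gamma> = (SOME \<gamma>. \<gamma> \<in> C)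
        in set_lebesgue_integral lborel fundamental_domain
             (\<lambda>\<tau>. slash k \<gamma> f \<tau> * cnj (slash k \<gamma> g \<tau>) * of_real (Im \<tau> ^ k / Im \<tau> ^ 2)))"

definition old_subspace :: "nat \<Rightarrow> nat \<Rightarrow> (complex \<Rightarrow> complex) set" where
  "old_subspace k N =
     module.span (\<lambda>(c :: complex) g \<tau>. c * g \<tau>)
       {A_op d g | d g M. M dvd N \<and> M \<noteq> N \<and> d dvd N div M \<and> g \<in> cusp_forms k M}"

definition new_subspace :: "nat \<Rightarrow> nat \<Rightarrow> (complex \<Rightarrow> complex) set" where
  "new_subspace k N = {f \<in> cusp_forms k N. \<forall>g \<in> old_subspace k N. petersson k N f g = 0}"

text \<open>
  The operator \<open>T\<^sub>n\<close> at level \<open>N\<close> (trivial character), including \<open>U\<^sub>p\<close> for the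
  primes \<open>p\<close> dividing \<open>N\<close>:
  \<open>T\<^sub>n f(\<tau>) = n\<^bsup>k-1\<^esup> \<Sum>\<^bsub>ad=n, (a,N)=1\<^esub> d\<^bsup>-k\<^esup> \<Sum>\<^bsub>0\<le>b<d\<^esub> f((a\<tau>+b)/d)\<close>.
\<close>

definition hecke :: "nat \<Rightarrow> nat \<Rightarrow> nat \<Rightarrow> (complex \<Rightarrow> complex) \<Rightarrow> complex \<Rightarrow> complex" where
  "hecke k N n f \<tau> =
     of_nat n ^ (k - 1) *
     (\<Sum>a | a dvd n \<and> coprime a N. \<Sum>b < n div a.
        f ((of_nat a * \<tau> + of_nat b) / of_nat (n div a)) / of_nat (n div a) ^ k)"

definition newform :: "nat \<Rightarrow> nat \<Rightarrow> (complex \<Rightarrow> complex) \<Rightarrow> bool" where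
  "newform k N f \<longleftrightarrow>
     f \<in> new_subspace k N \<and>
     (\<forall>n\<ge>1. \<exists>c. \<forall>\<tau> \<in> upper_half_plane. hecke k N n f \<tau> = c * f \<tau>) \<and>
     q_coeff f 1 = 1"

definition coeff_field :: "(complex \<Rightarrow> complex) \<Rightarrow> complex set" where
  "coeff_field f = generate_field ring_of_type_algebra (range (q_coeff f))"

definition coeff_integers :: "(complex \<Rightarrow> complex) \<Rightarrow> complex ring" where
  "coeff_integers f =
     ring_of_type_algebra\<lparr>carrier := {x \<in> coeff_field f. algebraic_int x}\<rparr>"


section \<open>Eisenstein series\<close>

definition bernoulli :: "nat \<Rightarrow> rat" where
  "bernoulli n = fact n * fps_nth (fps_X / (fps_exp 1 - 1)) n"

definition divisor_sigma :: "nat \<Rightarrow> nat \<Rightarrow> nat" where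
  "divisor_sigma k n = (\<Sum>m | m dvd n. m ^ k)"

definition eisenstein :: "nat \<Rightarrow> complex \<Rightarrow> complex" where
  "eisenstein k \<tau> =
     (if \<tau> \<in> upper_half_plane
      then of_rat (- bernoulli k / (2 * of_nat k)) +
           suminf (\<lambda>n. of_nat (divisor_sigma (k - 1) (Suc n)) *
                        exp (2 * of_real pi * \<i> * of_nat (Suc n) * \<tau>))
      else 0)"

definition bracket_plus :: "nat \<Rightarrow> nat \<Rightarrow> (complex \<Rightarrow> complex) \<Rightarrow> complex \<Rightarrow> complex" where
  "bracket_plus k d g \<tau> = g \<tau> - of_nat d ^ (k - 1) * A_op d g \<tau>"


section \<open>Valuations and congruences\<close>

definition ord_ideal :: "complex ring \<Rightarrow> complex set \<Rightarrow> complex \<Rightarrow> nat" where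
  "ord_ideal R L \<alpha> =
     (GREATEST n. (L [^]\<^bsub>ideals_set R\<^esub> n) divides\<^bsub>ideals_set R\<^esub> (PIdl\<^bsub>R\<^esub> \<alpha>))"

definition padic_val :: "nat \<Rightarrow> rat \<Rightarrow> int" where
  "padic_val p x =
     (case quotient_of x of (a, b) \<Rightarrow>
        int (multiplicity (int p) a) - int (multiplicity (int p) b))"

definition residual_char :: "complex ring \<Rightarrow> complex set \<Rightarrow> nat" where
  "residual_char R L = group.ord (add_monoid (R Quot L)) \<one>\<^bsub>R Quot L\<^esub>"

text \<open>
  Congruence modulo \<open>L\<^sup>r\<close> in the localization of \<open>R\<close> at \<open>L\<close>: the difference lies in the
  extension of \<open>L\<^sup>r\<close> to the localization.
\<close>

definition cong_local :: "complex ring \<Rightarrow> complex set \<Rightarrow> nat \<Rightarrow> complex \<Rightarrow> complex \<Rightarrow> bool" where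
  "cong_local R L r x y \<longleftrightarrow>
     x - y \<in> {a / s | a s. a \<in> L [^]\<^bsub>ideals_set R\<^esub> r \<and> s \<in> carrier R - L}"

definition forms_congruent ::
    "complex ring \<Rightarrow> complex set \<Rightarrow> nat \<Rightarrow> (complex \<Rightarrow> complex) \<Rightarrow> (complex \<Rightarrow> complex) \<Rightarrow> bool" where
  "forms_congruent R L r f g \<longleftrightarrow> (\<forall>n. cong_local R L r (q_coeff f n) (q_coeff g n))"

end

theory Submission
 imports Defs "HOL-Number_Theory.Cong"
begin

text \<open>
  Suppose the inequality fails. A valuation ring \<open>V\<close> of the complex numbers dominating the localisation of
  \<open>\<O>\<^sub>f\<close> at \<open>\<lambda>\<close> turns the congruence into \<open>v(a\<^sub>n(f) - a\<^sub>n(E)) > max(0, s)\<close>, where \<open>s\<close> is the valuation of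
  \<open>\<rho> = - B\<^sub>k/2k \<Prod>(1 - p)\<close>. For \<open>k = 2\<close> the constant term of \<open>E\<close> is \<open>\<rho>\<close>, a contradiction. For \<open>k \<ge> 4\<close> the
  constant term forces \<open>(1 - p\<^bsup>k-1\<^esup>)/(1 - p)\<close> to be a nonunit for some \<open>p = p\<^sub>0\<close>, and \<open>a\<^sub>p(f)\<^sup>2 = p\<^bsup>k-2\<^esup>\<close> then gives
  \<open>v(p\<^sub>0 - 1) > max(0, s)\<close>, so that \<open>\<beta> = \<rho>/(1 - p\<^sub>0)\<close> has negative valuation. At the cusps with \<open>p\<^sub>0 | c\<close> the form
  \<open>(f - E)/\<rho>\<close> vanishes modulo the maximal ideal, while at the others it agrees, up to the factor \<open>p\<^sub>0\<close>, with the
  form \<open>E'/\<beta>\<close> of level \<open>M = N/p\<^sub>0\<close>. The difference of the two is a form \<open>\<Psi>\<close> of level \<open>N\<close> which modulo the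
  maximal ideal is supported on the cusps with \<open>p\<^sub>0 | c\<close>, contrary to the \<open>q\<close>-expansion principle.

  The last contradiction is obtained by a dimension count: the trace to level one of \<open>\<Psi>\<close> times
  \<open>G(p\<^sub>0\<tau>) H(\<tau>) \<Delta>(M\<tau>)\<^sup>M\<close>, for level one forms \<open>G\<close> and \<open>H\<close>, is congruent to \<open>G(p\<^sub>0\<tau>) H(\<tau>) T\<close> with a fixed nonzero
  series \<open>T\<close>. Letting \<open>G\<close> and \<open>H\<close> vary yields more leading exponents than there are level one forms.
\<close>

section \<open>Expansions in \<open>q\<close>\<close>

text \<open>The obstacle is that the bound involves the factors 1 - p, while the constant term of E
  at infinity involves 1 - p^(k-1). The factors 1 - p belong to other cusps, and a congruence of
  expansions at infinity gives no direct information there. The substitute is that both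
  \<open>f\<close> and E are carried along by the Atkin-Lehner operators: their expansions at every
  cusp are congruent except for the constant terms. For \<open>f\<close> this rests on tying the
  Atkin-Lehner eigenvalue to a_p, which is where newness and the Petersson product enter. A
  valuation ring of all complex numbers holds roots of unity and the coefficients at all cusps at
  once. The price is a comparison of ord with the valuation, which requires that the coefficients of
  \<open>f\<close> generate a number field. The final count has a numerical margin: the maximum
  principle limits the order of vanishing in weight w by w/6 instead of the sharp w/12, a loss of a
  factor 2. The leading exponents of \<open>G(p\<^sub>0\<tau>) H(\<tau>)\<close> are p0 a + b, and
  p0 \<ge> 3 permits three values of b, which outweighs the loss.\<close>

abbreviation HH :: "complex set" where "HH \<equiv> upper_half_plane"

definition qp :: "nat \<Rightarrow> complex \<Rightarrow> complex" where
 "qp h \<tau> = exp (2 * of_real pi * \<i> * \<tau> / of_nat h)"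

lemma HH_iff: "\<tau> \<in> HH \<longleftrightarrow> Im \<tau> > 0"
 by (simp add: upper_half_plane_def)

lemma open_HH: "open HH"
 unfolding upper_half_plane_def by (rule open_halfspace_Im_gt)

lemma convex_HH: "convex HH"
 unfolding upper_half_plane_def by (rule convex_halfspace_Im_gt)

lemma qp_power: "exp (2 * of_real pi * \<i> * of_nat n * \<tau> / of_nat h) = qp h \<tau> ^ n"
 unfolding qp_def exp_of_nat_mult [symmetric] by (simp add: mult_ac)

lemma qp_root: assumes "h > 0" shows "qp h (of_int b) ^ h = 1"
proof -
 have "qp h (of_int b) ^ h = exp (2 * of_real pi * \<i> * of_nat h * of_int b / of_nat h)" by (rule qp_power [symmetric])
 also have "2 * of_real pi * \<i> * of_nat h * of_int b / of_nat h = of_int (2 * b) * of_real pi * \<i>" using assms by (simp add: field_simps)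
 finally show ?thesis by (simp add: exp_eq_1)
qed

lemma has_q_expansion_iff:
 "has_q_expansion h a f \<longleftrightarrow> (\<forall>\<tau>\<in>HH. (\<lambda>n. a n * qp h \<tau> ^ n) sums f \<tau>)" by (simp add: has_q_expansion_def qp_power)

lemma q_expansionD: "has_q_expansion h a f \<Longrightarrow> \<tau> \<in> HH \<Longrightarrow> (\<lambda>n. a n * qp h \<tau> ^ n) sums f \<tau>"
 by (simp add: has_q_expansion_iff)

lemma qp_nonzero [simp]: "qp h \<tau> \<noteq> 0"
 by (simp add: qp_def)

lemma norm_qp: "norm (qp h \<tau>) = exp (- (2 * pi * Im \<tau> / real h))"
 by (simp add: qp_def)

lemma norm_qp_less_1: "h > 0 \<Longrightarrow> \<tau> \<in> HH \<Longrightarrow> norm (qp h \<tau>) < 1"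
 by (simp add: norm_qp HH_iff)

lemma qp_surj:
 assumes "h > 0" "z \<noteq> 0" "norm z < 1"
 obtains \<tau> where "\<tau> \<in> HH" "qp h \<tau> = z"
proof
 define \<tau> where "\<tau> = of_nat h * Ln z / (2 * of_real pi * \<i>)"
 have "ln (norm z) < 0" using assms by simp
 then show "\<tau> \<in> HH" using assms by (simp add: HH_iff \<tau>_def Im_divide power2_eq_square mult_pos_neg divide_neg_pos)
 show "qp h \<tau> = z" using assms by (simp add: qp_def \<tau>_def)
qed

text \<open>\<open>has_q_expansion\<close> only asserts convergence at each point. Since
  \<open>qp h\<close> reaches every nonzero point of the disc, the series converges at a radius
  beyond \<open>norm z\<close>, and this makes it absolutely convergent at \<open>z\<close>.\<close>

lemma q_series_summable:
 assumes "h > 0" "has_q_expansion h a f" "norm z < 1"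
 shows "summable (\<lambda>n. norm (a n * z ^ n))"
proof -
 define x :: complex where "x = of_real ((1 + norm z) / 2)"
 have "\<bar>(1 + norm z) / 2\<bar> = (1 + norm z) / 2" by (rule abs_of_nonneg) simp
 then have x: "norm x = (1 + norm z) / 2" unfolding x_def norm_of_real .
 moreover have "norm z \<ge> 0" by simp
 ultimately have "norm x > 0" by (simp del: norm_ge_zero zero_less_norm_iff)
 then have x0: "x \<noteq> 0" by (metis norm_zero less_irrefl)
 have x1: "norm x < 1" using x assms(3) by simp
 obtain \<tau> where "\<tau> \<in> HH" "qp h \<tau> = x" using qp_surj[OF assms(1) x0 x1] .
 then have "summable (\<lambda>n. a n * x ^ n)" using q_expansionD[OF assms(2)] sums_summable by blast
 moreover have "norm z < norm x" using x assms by simp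
 ultimately show ?thesis by (rule powser_insidea)
qed

lemma q_expansion_cong:
 assumes "has_q_expansion h a f" "\<And>\<tau>. \<tau> \<in> HH \<Longrightarrow> f \<tau> = g \<tau>" "\<And>n. a n = b n"
 shows "has_q_expansion h b g" using assms by (auto simp: has_q_expansion_iff)

lemma q_expansion_const: "has_q_expansion h (\<lambda>n. if n = 0 then c else 0) (\<lambda>_. c)"
proof -
 have "(\<lambda>n. (if n = 0 then c else 0) * x ^ n) = (\<lambda>n. if n = 0 then c else 0)" for x by auto
 then show ?thesis unfolding has_q_expansion_iff using sums_single[of 0 "\<lambda>_. c"] by auto
qed

lemma q_expansion_add:
 "has_q_expansion h a f \<Longrightarrow> has_q_expansion h b g \<Longrightarrow>
  has_q_expansion h (\<lambda>n. a n + b n) (\<lambda>\<tau>. f \<tau> + g \<tau>)" by (auto simp: has_q_expansion_iff ring_distribs intro!: sums_add)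

lemma q_expansion_cmult:
 "has_q_expansion h a f \<Longrightarrow> has_q_expansion h (\<lambda>n. c * a n) (\<lambda>\<tau>. c * f \<tau>)"
 by (auto simp: has_q_expansion_iff mult.assoc intro!: sums_mult)

lemma q_expansion_diff:
 "has_q_expansion h a f \<Longrightarrow> has_q_expansion h b g \<Longrightarrow>
  has_q_expansion h (\<lambda>n. a n - b n) (\<lambda>\<tau>. f \<tau> - g \<tau>)" by (auto simp: has_q_expansion_iff ring_distribs intro!: sums_diff)

lemma q_expansion_sum:
 assumes "finite A" "\<And>i. i \<in> A \<Longrightarrow> has_q_expansion h (a i) (f i)"
 shows "has_q_expansion h (\<lambda>n. \<Sum>i\<in>A. a i n) (\<lambda>\<tau>. \<Sum>i\<in>A. f i \<tau>)"
 using assms by (auto simp: has_q_expansion_iff sum_distrib_right intro!: sums_sum)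

lemma q_expansion_mult:
 assumes "h > 0" "has_q_expansion h a f" "has_q_expansion h b g"
 shows "has_q_expansion h (\<lambda>n. \<Sum>i\<le>n. a i * b (n - i)) (\<lambda>\<tau>. f \<tau> * g \<tau>)" unfolding has_q_expansion_iff
proof
 fix \<tau> assume \<tau>: "\<tau> \<in> HH"
 define z where "z = qp h \<tau>"
 have z: "norm z < 1" using norm_qp_less_1 assms \<tau> by (simp add: z_def)
 have "(\<lambda>k. \<Sum>i\<le>k. (a i * z ^ i) * (b (k - i) * z ^ (k - i))) sums
     ((\<Sum>k. a k * z ^ k) * (\<Sum>k. b k * z ^ k))" using q_series_summable[OF assms(1) _ z] assms by (intro Cauchy_product_sums) auto
 moreover have "(\<Sum>i\<le>k. (a i * z ^ i) * (b (k - i) * z ^ (k - i))) = (\<Sum>i\<le>k. a i * b (k - i)) * z ^ k" for k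
  unfolding sum_distrib_right
 proof (rule sum.cong)
  fix i assume "i \<in> {..k}"
  then have "z ^ k = z ^ i * z ^ (k - i)" by (simp add: power_add [symmetric])
  then show "(a i * z ^ i) * (b (k - i) * z ^ (k - i)) = a i * b (k - i) * z ^ k" by simp
 qed simp
 moreover have "(\<Sum>k. a k * z ^ k) = f \<tau>" "(\<Sum>k. b k * z ^ k) = g \<tau>"
  using sums_unique[OF q_expansionD[OF assms(2) \<tau>]] sums_unique[OF q_expansionD[OF assms(3) \<tau>]] by (simp_all add: z_def)
 ultimately show "(\<lambda>n. (\<Sum>i\<le>n. a i * b (n - i)) * qp h \<tau> ^ n) sums (f \<tau> * g \<tau>)" by (simp add: z_def)
qed

lemma sums_dvd_reindex:
 assumes "t > (0::nat)" "(\<lambda>n. a n * x ^ (t * n)) sums s"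
 shows "(\<lambda>n. (if t dvd n then a (n div t) else 0) * x ^ n) sums (s::complex)"
proof -
 have "strict_mono (\<lambda>n. t * n)" using assms by (auto simp: strict_mono_def)
 then have "(\<lambda>n. (if t dvd t * n then a (t * n div t) else 0) * x ^ (t * n)) sums s \<longleftrightarrow>
    (\<lambda>n. (if t dvd n then a (n div t) else 0) * x ^ n) sums s" by (rule sums_mono_reindex) auto
 then show ?thesis using assms by simp
qed

lemma q_expansion_scale:
 assumes "t > 0" "has_q_expansion h a f"
 shows "has_q_expansion h (\<lambda>n. if t dvd n then a (n div t) else 0) (\<lambda>\<tau>. f (of_nat t * \<tau>))" unfolding has_q_expansion_iff
proof
 fix \<tau> assume "\<tau> \<in> HH"
 then have "of_nat t * \<tau> \<in> HH" using assms by (simp add: HH_iff)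
 moreover have "qp h (of_nat t * \<tau>) = qp h \<tau> ^ t" by (simp add: qp_def exp_of_nat_mult [symmetric] mult_ac)
 ultimately have "(\<lambda>n. a n * qp h \<tau> ^ (t * n)) sums f (of_nat t * \<tau>)"
  using q_expansionD[OF assms(2), of "of_nat t * \<tau>"] by (simp add: power_mult)
 then show "(\<lambda>n. (if t dvd n then a (n div t) else 0) * qp h \<tau> ^ n) sums f (of_nat t * \<tau>)" using assms sums_dvd_reindex by blast
qed

lemma q_expansion_refine:
 assumes "t > 0" "has_q_expansion h a f"
 shows "has_q_expansion (h * t) (\<lambda>n. if t dvd n then a (n div t) else 0) f" unfolding has_q_expansion_iff
proof
 fix \<tau> assume "\<tau> \<in> HH"
 moreover have "qp h \<tau> = qp (h * t) \<tau> ^ t" using assms by (simp add: qp_def exp_of_nat_mult [symmetric] mult_ac)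
 ultimately have "(\<lambda>n. a n * qp (h * t) \<tau> ^ (t * n)) sums f \<tau>" using q_expansionD[OF assms(2), of \<tau>] by (simp add: power_mult)
 then show "(\<lambda>n. (if t dvd n then a (n div t) else 0) * qp (h * t) \<tau> ^ n) sums f \<tau>" using assms sums_dvd_reindex by blast
qed

lemma q_expansion_shift:
 assumes "has_q_expansion h a f"
 shows "has_q_expansion h (\<lambda>n. a n * qp h (of_real s) ^ n) (\<lambda>\<tau>. f (\<tau> + of_real s))" unfolding has_q_expansion_iff
proof
 fix \<tau> assume "\<tau> \<in> HH"
 then have "\<tau> + of_real s \<in> HH" by (simp add: HH_iff)
 moreover have "qp h (\<tau> + of_real s) = qp h (of_real s) * qp h \<tau>"
  unfolding qp_def exp_add [symmetric] by (simp add: algebra_simps add_divide_distrib)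
 ultimately show "(\<lambda>n. a n * qp h (of_real s) ^ n * qp h \<tau> ^ n) sums f (\<tau> + of_real s)"
  using q_expansionD[OF assms, of "\<tau> + of_real s"] by (simp add: power_mult_distrib mult_ac)
qed

lemma q_expansion_divide:
 assumes "d > 0" "has_q_expansion h a f"
 shows "has_q_expansion (h * d) a (\<lambda>\<tau>. f (\<tau> / of_nat d))" unfolding has_q_expansion_iff
proof
 fix \<tau> assume "\<tau> \<in> HH"
 then have "\<tau> / of_nat d \<in> HH" using assms by (simp add: HH_iff Im_divide_of_nat)
 moreover have "qp h (\<tau> / of_nat d) = qp (h * d) \<tau>" by (simp add: qp_def mult_ac)
 ultimately show "(\<lambda>n. a n * qp (h * d) \<tau> ^ n) sums f (\<tau> / of_nat d)" using q_expansionD[OF assms(2), of "\<tau> / of_nat d"] by simp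
qed

text \<open>Expansions at other cusps are obtained from expansions at infinity by such
  substitutions. The new factors are roots of unity, hence units in every valuation ring.\<close>

lemma q_expansion_affine:
 assumes "t > 0" "d > 0" "has_q_expansion h a f"
 shows "has_q_expansion (h * d)
      (\<lambda>n. if t dvd n then a (n div t) * qp (h * d) (of_int b) ^ (n div t) else 0)
      (\<lambda>\<tau>. f ((of_nat t * \<tau> + of_int b) / of_nat d))"
proof -
 have "has_q_expansion (h * d) (\<lambda>n. a n * qp (h * d) (of_int b) ^ n) (\<lambda>\<tau>. f ((\<tau> + of_int b) / of_nat d))"
  using q_expansion_shift[OF q_expansion_divide[OF assms(2,3)], of "of_int b"] by simp
 from q_expansion_scale[OF assms(1) this] show ?thesis by simp
qed

lemma q_expansion_unique:
 assumes "h > 0" "has_q_expansion h a f" "has_q_expansion h b f"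
 shows "a = b"
proof (rule ccontr)
 assume "a \<noteq> b"
 then obtain m where m: "a m \<noteq> b m" by auto
 \<comment> \<open>The variable \<open>qp h \<tau>\<close> never takes the value 0, so the
   difference of the two series is known to vanish only on the punctured disc. Multiplying it by
   \<open>x\<close>, that is shifting the coefficients by one, makes the value at 0 trivially
   0.\<close>
 define d where "d n = (case n of 0 \<Rightarrow> 0 | Suc n \<Rightarrow> a n - b n)" for n
 have sm: "(\<lambda>n. d n * (x - 0) ^ n) sums 0" if "norm (x - 0) < 1" for x
 proof (cases "x = 0")
  case True
  then show ?thesis by (simp add: d_def)
 next
  case False
  have "norm x < 1" using that by simp
  then obtain \<tau> where \<tau>: "\<tau> \<in> HH" "qp h \<tau> = x" using qp_surj[OF assms(1) False] by blast
  then have "(\<lambda>n. a n * x ^ n - b n * x ^ n) sums (f \<tau> - f \<tau>)"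
   using q_expansionD[OF assms(2) \<tau>(1)] q_expansionD[OF assms(3) \<tau>(1)] \<tau>(2) by (intro sums_diff) simp_all
  then have "(\<lambda>n. x * (a n * x ^ n - b n * x ^ n)) sums (x * 0)" by (intro sums_mult) simp
  also have "(\<lambda>n. x * (a n * x ^ n - b n * x ^ n)) = (\<lambda>n. d (Suc n) * x ^ Suc n)" by (auto simp: d_def algebra_simps)
  finally have "(\<lambda>n. d (Suc n) * x ^ Suc n) sums 0" by simp
  then show ?thesis by (subst (asm) sums_Suc_iff) (simp add: d_def)
 qed
 have dm: "d (Suc m) \<noteq> 0" using m by (simp add: d_def)
 show False
 proof (rule powser_0_nonzero[of 1 0 d "\<lambda>_. 0" "Suc m", OF _ sm _ dm])
  fix s :: real assume s: "0 < s" "\<And>z. z \<in> cball (0::complex) s - {0} \<Longrightarrow> (0::complex) \<noteq> 0"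
  have "of_real s \<in> cball (0::complex) s - {0}" using s(1) by auto
  then show False using s(2) by blast
 qed auto
qed

text \<open>\<open>P\<close> is the series with coefficients \<open>a (n + m)\<close>, holomorphic
  on the whole disc. The cusp becomes an interior point, as the maximum modulus principle requires
  later.\<close>

lemma q_expansion_factor:
 assumes "h > 0" "has_q_expansion h a f" "\<And>n. n < m \<Longrightarrow> a n = 0"
 obtains P where "P holomorphic_on ball 0 1" "\<And>\<tau>. \<tau> \<in> HH \<Longrightarrow> f \<tau> = qp h \<tau> ^ m * P (qp h \<tau>)"
proof -
 define P where "P z = (\<Sum>n. a (n + m) * z ^ n)" for z
 have sm: "summable (\<lambda>n. a (n + m) * z ^ n)" if "norm z < 1" for z
 proof (cases "z = 0")
  case False
  have "summable (\<lambda>n. a n * z ^ n)" by (rule summable_norm_cancel[OF q_series_summable[OF assms(1,2) that]])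
  then have "summable (\<lambda>n. a (n + m) * z ^ (n + m))" by (rule summable_ignore_initial_segment)
  then have "summable (\<lambda>n. a (n + m) * z ^ (n + m) / z ^ m)" by (rule summable_divide)
  then show ?thesis using False by (simp add: power_add)
 qed simp
 have "P holomorphic_on ball 0 1" using sm by (intro power_series_holomorphic[where a = "\<lambda>n. a (n + m)"])
   (auto simp: P_def intro!: summable_sums)
 moreover have "f \<tau> = qp h \<tau> ^ m * P (qp h \<tau>)" if "\<tau> \<in> HH" for \<tau>
 proof -
  let ?z = "qp h \<tau>"
  have "(\<lambda>n. ?z ^ m * (a (n + m) * ?z ^ n)) sums (?z ^ m * P ?z)"
   unfolding P_def using sm norm_qp_less_1[OF assms(1) that] by (intro sums_mult summable_sums) auto
  then have "(\<lambda>n. a (n + m) * ?z ^ (n + m)) sums (?z ^ m * P ?z)" by (simp add: power_add mult_ac)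
  then have "(\<lambda>n. a n * ?z ^ n) sums (?z ^ m * P ?z + (\<Sum>i<m. a i * ?z ^ i))" by (rule iffD1[OF sums_iff_shift])
  moreover have "(\<Sum>i<m. a i * ?z ^ i) = 0" using assms(3) by (intro sum.neutral) auto
  ultimately have "(\<lambda>n. a n * ?z ^ n) sums (?z ^ m * P ?z)" by simp
  then show ?thesis using q_expansionD[OF assms(2) that] sums_unique2 by blast
 qed
 ultimately show thesis using that by blast
qed

lemma q_expansion_holomorphic:
 assumes "h > 0" "has_q_expansion h a f"
 shows "f holomorphic_on HH"
proof -
 obtain P where P: "P holomorphic_on ball 0 1" "\<And>\<tau>. \<tau> \<in> HH \<Longrightarrow> f \<tau> = qp h \<tau> ^ 0 * P (qp h \<tau>)"
  using q_expansion_factor[OF assms, of 0] by auto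
 have "qp h holomorphic_on HH" unfolding qp_def by (intro holomorphic_intros) (use assms in auto)
 then have "(P \<circ> qp h) holomorphic_on HH"
  by (rule holomorphic_on_compose_gen[OF _ P(1)]) (use norm_qp_less_1[OF assms(1)] in \<open>auto simp: dist_norm\<close>)
 then show ?thesis using P(2) by (auto intro: holomorphic_transform)
qed

lemma q_expansion_bound:
 assumes "h > 0" "has_q_expansion h a f" "\<And>n. n < m \<Longrightarrow> a n = 0" "y0 > 0"
 obtains C where "C \<ge> 0" "\<And>\<tau>. Im \<tau> \<ge> y0 \<Longrightarrow> norm (f \<tau>) \<le> C * exp (- (2 * pi * real m * Im \<tau> / real h))"
proof -
 obtain P where P: "P holomorphic_on ball 0 1" "\<And>\<tau>. \<tau> \<in> HH \<Longrightarrow> f \<tau> = qp h \<tau> ^ m * P (qp h \<tau>)"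
  using q_expansion_factor[OF assms(1-3)] by auto
 define \<rho> where "\<rho> = exp (- (2 * pi * y0 / real h))"
 have \<rho>: "\<rho> < 1" "\<rho> > 0" using assms by (auto simp: \<rho>_def)
 have "continuous_on (cball 0 \<rho>) P"
  by (rule holomorphic_on_imp_continuous_on, rule holomorphic_on_subset[OF P(1)]) (use \<rho> in auto)
 then have "bounded (P ` cball 0 \<rho>)" by (intro compact_imp_bounded compact_continuous_image) auto
 then obtain C where C: "\<And>z. norm z \<le> \<rho> \<Longrightarrow> norm (P z) \<le> C" by (metis bounded_iff image_eqI mem_cball_0)
 have "norm (P 0) \<le> C" using C \<rho> by simp
 then have C0: "C \<ge> 0" using norm_ge_zero order_trans by blast
 have bnd: "norm (f \<tau>) \<le> C * exp (- (2 * pi * real m * Im \<tau> / real h))" if "Im \<tau> \<ge> y0" for \<tau>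
 proof -
  have "\<tau> \<in> HH" using that assms by (simp add: HH_iff)
  have "2 * pi * y0 / real h \<le> 2 * pi * Im \<tau> / real h" using that assms by (intro divide_right_mono mult_left_mono) auto
  then have "norm (qp h \<tau>) \<le> \<rho>" by (simp add: norm_qp \<rho>_def)
  then have "norm (P (qp h \<tau>)) \<le> C" by (rule C)
  moreover have "norm (qp h \<tau> ^ m) = exp (- (2 * pi * real m * Im \<tau> / real h))"
   by (simp add: norm_power norm_qp exp_of_nat_mult [symmetric] mult_ac)
  ultimately show ?thesis using P(2)[OF \<open>\<tau> \<in> HH\<close>] by (simp add: norm_mult mult.commute mult_right_mono)
 qed
 show thesis by (rule that[OF C0 bnd])
qed

text \<open>Translation by \<open>M\<close> multiplies the \<open>n\<close>-th coefficient by exp(2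
  pi i n/t). By uniqueness of expansions the coefficient vanishes unless this root of unity is
  1.\<close>

lemma q_expansion_descend:
 assumes "M > 0" "t > 0" "has_q_expansion (M * t) a f" "\<And>\<tau>. \<tau> \<in> HH \<Longrightarrow> f (\<tau> + of_nat M) = f \<tau>"
 shows "has_q_expansion M (\<lambda>n. a (n * t)) f" "\<And>n. \<not> t dvd n \<Longrightarrow> a n = 0"
proof -
 have "has_q_expansion (M * t) (\<lambda>n. a n * qp (M * t) (of_real (real M)) ^ n) (\<lambda>\<tau>. f (\<tau> + of_real (real M)))"
  by (rule q_expansion_shift) fact
 then have "has_q_expansion (M * t) (\<lambda>n. a n * qp (M * t) (of_real (real M)) ^ n) f"
  by (rule q_expansion_cong) (use assms(4) in auto)
 then have "(\<lambda>n. a n * qp (M * t) (of_real (real M)) ^ n) = a"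
  by (intro q_expansion_unique[OF _ _ assms(3)]) (use assms(1,2) in auto)
 then have eq: "a n * qp (M * t) (of_real (real M)) ^ n = a n" for n by (rule fun_cong)
 show *: "a n = 0" if "\<not> t dvd n" for n
 proof (rule ccontr)
  assume "a n \<noteq> 0"
  then have "qp (M * t) (of_real (real M)) ^ n = 1" using eq[of n] by simp
  moreover have "2 * of_real pi * \<i> * of_nat n * of_real (real M) / of_nat (M * t) = 2 * of_real pi * \<i> * of_nat n / of_nat t"
   using assms(1,2) by simp
  ultimately have "exp (2 * of_real pi * \<i> * of_nat n / of_nat t) = 1" using qp_power[of n "of_real (real M)" "M * t"] by metis
  then obtain j :: int where "Im (2 * of_real pi * \<i> * of_nat n / of_nat t) = of_int (2 * j) * pi" unfolding exp_eq_1 by blast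
  then have "2 * pi * real n / real t = of_int (2 * j) * pi" by (simp add: Im_divide_of_nat)
  then have "real n = of_int j * real t" using assms(2) by (simp add: field_simps)
  then have "int n = j * int t" by (metis of_int_eq_iff of_int_mult of_int_of_nat_eq)
  then have "int t dvd int n" by simp
  then show False using that by simp
 qed
 show "has_q_expansion M (\<lambda>n. a (n * t)) f" unfolding has_q_expansion_iff
 proof
  fix \<tau> assume "\<tau> \<in> HH"
  then have s: "(\<lambda>n. a n * qp (M * t) \<tau> ^ n) sums f \<tau>" by (rule q_expansionD[OF assms(3)])
  have "strict_mono (\<lambda>n. n * t)" using assms by (auto simp: strict_mono_def)
  moreover have "a n * qp (M * t) \<tau> ^ n = 0" if "n \<notin> range (\<lambda>n. n * t)" for n
  proof -
   have "\<not> t dvd n" using that by (auto simp: dvd_def mult.commute)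
   then show ?thesis using * by simp
  qed
  ultimately have "(\<lambda>n. a (n * t) * qp (M * t) \<tau> ^ (n * t)) sums f \<tau>"
   using s sums_mono_reindex[of "\<lambda>n. n * t" "\<lambda>n. a n * qp (M * t) \<tau> ^ n"] by simp
  moreover have "qp M \<tau> = qp (M * t) \<tau> ^ t" using assms(2) by (simp add: qp_def exp_of_nat_mult [symmetric] mult_ac)
  then have "qp (M * t) \<tau> ^ (n * t) = qp M \<tau> ^ n" for n by (simp add: power_mult [symmetric] mult.commute)
  ultimately show "(\<lambda>n. a (n * t) * qp M \<tau> ^ n) sums f \<tau>" by simp
 qed
qed

lemma q_coeff_eq:
 assumes "has_q_expansion 1 a f" shows "q_coeff f = a"
 unfolding q_coeff_def using assms q_expansion_unique[of 1] by (intro the_equality) auto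

section \<open>Vanishing of modular forms of high order\<close>

text \<open>Reduction theory for a family of functions that is carried into itself by the two
  generators, so that no group action has to be tracked. After a translation, a point below height
  1/2 satisfies \<open>(norm \<sigma>)\<^sup>2 \<le> 1 / 2\<close>, so the inversion at least
  doubles its height; the induction counts the doublings.\<close>

lemma level_one_reduction:
 fixes FF :: "(complex \<Rightarrow> complex) set" and u :: "(complex \<Rightarrow> complex) \<Rightarrow> complex \<Rightarrow> real"
 assumes T: "\<And>F j \<tau>. F \<in> FF \<Longrightarrow> \<tau> \<in> HH \<Longrightarrow> \<exists>G\<in>FF. u F (\<tau> + of_int j) = u G \<tau>"
  and S: "\<And>F \<tau>. F \<in> FF \<Longrightarrow> \<tau> \<in> HH \<Longrightarrow> \<exists>G\<in>FF. u F (- 1 / \<tau>) = u G \<tau>"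
  and F: "F \<in> FF" and \<tau>: "\<tau> \<in> HH"
 obtains G \<sigma> where "G \<in> FF" "\<bar>Re \<sigma>\<bar> \<le> 1 / 2" "Im \<sigma> \<ge> 1 / 2" "u F \<tau> = u G \<sigma>"
proof -
 have shift: "\<exists>G\<in>FF. \<exists>\<sigma>. \<bar>Re \<sigma>\<bar> \<le> 1 / 2 \<and> Im \<sigma> = Im \<tau> \<and> u F \<tau> = u G \<sigma>"
  if "F \<in> FF" "\<tau> \<in> HH" for F \<tau>
 proof -
  define \<sigma> where "\<sigma> = \<tau> - of_int (round (Re \<tau>))"
  have "\<sigma> \<in> HH" using that by (simp add: \<sigma>_def HH_iff)
  from T[OF that(1) this, of "round (Re \<tau>)"] obtain G where "G \<in> FF" "u F \<tau> = u G \<sigma>" by (auto simp: \<sigma>_def)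
  moreover have "\<bar>Re \<sigma>\<bar> \<le> 1 / 2" using of_int_round_abs_le[of "Re \<tau>"] by (simp add: \<sigma>_def abs_minus_commute)
  ultimately show ?thesis by (intro bexI[of _ G] exI[of _ \<sigma>]) (auto simp: \<sigma>_def)
 qed
 have main: "\<exists>G\<in>FF. \<exists>\<sigma>. \<bar>Re \<sigma>\<bar> \<le> 1 / 2 \<and> Im \<sigma> \<ge> 1 / 2 \<and> u F \<tau> = u G \<sigma>"
  if "F \<in> FF" "Im \<tau> > 0" "Im \<tau> * 2 ^ n \<ge> 1 / 2" for n F \<tau> using that
 proof (induction n arbitrary: F \<tau>)
  case 0
  have "\<tau> \<in> HH" using 0 by (simp add: HH_iff)
  from shift[OF 0(1) this] obtain G \<sigma> where "G \<in> FF" "\<bar>Re \<sigma>\<bar> \<le> 1 / 2" "Im \<sigma> = Im \<tau>" "u F \<tau> = u G \<sigma>" by blast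
  with 0 show ?case by (intro bexI[of _ G] exI[of _ \<sigma>]) auto
 next
  case (Suc n)
  have "\<tau> \<in> HH" using Suc.prems by (simp add: HH_iff)
  from shift[OF Suc.prems(1) this] obtain G \<sigma> where G: "G \<in> FF" "\<bar>Re \<sigma>\<bar> \<le> 1 / 2" "Im \<sigma> = Im \<tau>" "u F \<tau> = u G \<sigma>" by blast
  show ?case
  proof (cases "Im \<sigma> \<ge> 1 / 2")
   case True
   with G show ?thesis by (intro bexI[of _ G] exI[of _ \<sigma>]) auto
  next
   case False
   define \<rho> where "\<rho> = - 1 / \<sigma>"
   have im\<sigma>: "Im \<sigma> > 0" using G Suc by simp
   have n1: "(norm \<sigma>)\<^sup>2 = (Re \<sigma>)\<^sup>2 + (Im \<sigma>)\<^sup>2" by (rule cmod_power2)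
   have "(Re \<sigma>)\<^sup>2 \<le> (1 / 2)\<^sup>2" using G(2) by (subst abs_le_square_iff [symmetric]) simp
   moreover have "(Im \<sigma>)\<^sup>2 \<le> (1 / 2)\<^sup>2" using False im\<sigma> by (intro power_mono) auto
   ultimately have n2: "(norm \<sigma>)\<^sup>2 \<le> 1 / 2" using n1 by (simp add: power2_eq_square)
   have n3: "(norm \<sigma>)\<^sup>2 > 0" using im\<sigma> by auto
   have im\<rho>: "Im \<rho> = Im \<sigma> / (norm \<sigma>)\<^sup>2" by (simp add: \<rho>_def Im_divide cmod_power2)
   have "Im \<sigma> / (1 / 2) \<le> Im \<sigma> / (norm \<sigma>)\<^sup>2" using n2 n3 im\<sigma> by (intro divide_left_mono) auto
   then have "2 * Im \<sigma> \<le> Im \<rho>" using im\<rho> by simp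
   then have "2 * Im \<sigma> * 2 ^ n \<le> Im \<rho> * 2 ^ n" by (intro mult_right_mono) auto
   moreover have "Im \<tau> * 2 ^ Suc n = 2 * Im \<sigma> * 2 ^ n" using G(3) by simp
   ultimately have "Im \<rho> * 2 ^ n \<ge> 1 / 2" using Suc.prems(3) by (metis order_trans)
   moreover have \<rho>0: "Im \<rho> > 0" using im\<rho> im\<sigma> n3 by simp
   ultimately have IH: "\<And>F. F \<in> FF \<Longrightarrow> \<exists>G\<in>FF. \<exists>\<sigma>. \<bar>Re \<sigma>\<bar> \<le> 1 / 2 \<and> Im \<sigma> \<ge> 1 / 2 \<and> u F \<rho> = u G \<sigma>" using Suc.IH by blast
   have "\<sigma> \<noteq> 0" using im\<sigma> by auto
   then have "- 1 / \<rho> = \<sigma>" by (simp add: \<rho>_def)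
   moreover have "\<rho> \<in> HH" using \<rho>0 by (simp add: HH_iff)
   ultimately obtain G' where "G' \<in> FF" "u G \<sigma> = u G' \<rho>" using S[OF G(1), of \<rho>] by auto
   then show ?thesis using IH[of G'] G(4) by simp
  qed
 qed
 obtain n where "2 ^ n > (1 / 2) / Im \<tau>" using real_arch_pow[of 2 "(1 / 2) / Im \<tau>"] by auto
 then have "Im \<tau> * 2 ^ n \<ge> 1 / 2" using \<tau> by (simp add: HH_iff field_simps)
 moreover have "Im \<tau> > 0" using \<tau> by (simp add: HH_iff)
 ultimately obtain G \<sigma> where "G \<in> FF" "\<bar>Re \<sigma>\<bar> \<le> 1 / 2" "Im \<sigma> \<ge> 1 / 2" "u F \<tau> = u G \<sigma>" using main[OF F] by blast
 then show thesis by (rule that)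
qed

text \<open>
  The invariant function \<open>|F| y\<^bsup>w/2\<^esup>\<close> attains its supremum at a point with \<open>y \<ge> 1/2\<close>. The
  maximum modulus principle for \<open>F / q\<^sup>m\<close> on discs then excludes a nonzero maximum.
\<close>

theorem high_order_vanishes:
 fixes FF :: "(complex \<Rightarrow> complex) set" and w :: int
 assumes fin: "finite FF" and h: "h > 0" and m: "m > 0" and wm: "w * int h \<le> 6 * int m"
  and ex: "\<And>F. F \<in> FF \<Longrightarrow> \<exists>a. has_q_expansion h a F \<and> (\<forall>n<m. a n = 0)"
  and T: "\<And>F j. F \<in> FF \<Longrightarrow> \<exists>G\<in>FF. \<forall>\<tau>\<in>HH. F (\<tau> + of_int j) = G \<tau>"
  and S: "\<And>F. F \<in> FF \<Longrightarrow> \<exists>G\<in>FF. \<forall>\<tau>\<in>HH. norm (F (- 1 / \<tau>)) = norm (G \<tau>) * norm \<tau> powi w"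
  and F0: "F0 \<in> FF" "\<tau>0 \<in> HH"
 shows "F0 \<tau>0 = 0"
proof (rule ccontr)
 assume nz: "F0 \<tau>0 \<noteq> 0"
 define u where "u F \<tau> = norm (F \<tau>) * exp (of_int w / 2 * ln (Im \<tau>))" for F :: "complex \<Rightarrow> complex" and \<tau>
 \<comment> \<open>The hypothesis \<open>wm\<close> bounds the exponent w/2 of the factor y^(w/2) by
   \<open>\<kappa>\<close>, and pi > 3 makes the decay rate 2 pi m/h of \<open>F\<close> at least
   twice \<open>\<kappa>\<close>. The difference leaves a decay with rate
   \<open>\<kappa>\<close>.\<close>
 define \<kappa> where "\<kappa> = 3 * real m / real h"
 have \<kappa>: "\<kappa> > 0" using h m by (simp add: \<kappa>_def)
 have w\<kappa>: "of_int w / 2 \<le> \<kappa>"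
 proof -
  have "real_of_int (w * int h) \<le> real_of_int (6 * int m)" using wm by (simp only: of_int_le_iff)
  then show ?thesis using h by (simp add: \<kappa>_def field_simps)
 qed
 have uT: "\<exists>G\<in>FF. u F (\<tau> + of_int j) = u G \<tau>" if "F \<in> FF" "\<tau> \<in> HH" for F j \<tau>
  using T[OF that(1), of j] that(2) by (auto simp: u_def)
 have uS: "\<exists>G\<in>FF. u F (- 1 / \<tau>) = u G \<tau>" if F: "F \<in> FF" and \<tau>: "\<tau> \<in> HH" for F \<tau>
 proof -
  from S[OF F] obtain G where G1: "G \<in> FF" "\<forall>\<tau>\<in>HH. norm (F (- 1 / \<tau>)) = norm (G \<tau>) * norm \<tau> powi w" by (elim bexE)
  note G = G1(1) bspec[OF G1(2) \<tau>]
  have t: "norm \<tau> > 0" "Im \<tau> > 0" using \<tau> by (auto simp: HH_iff)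
  have "Im (- 1 / \<tau>) = Im \<tau> / (norm \<tau>)\<^sup>2" by (simp add: Im_divide cmod_power2)
  moreover have "ln ((norm \<tau>)\<^sup>2) = 2 * ln (norm \<tau>)" using t ln_realpow[of "norm \<tau>" 2] by simp
  ultimately have ln: "ln (Im (- 1 / \<tau>)) = ln (Im \<tau>) - 2 * ln (norm \<tau>)" using t ln_div[of "Im \<tau>" "(norm \<tau>)\<^sup>2"] by simp
  have p: "norm \<tau> powi w = exp (of_int w * ln (norm \<tau>))" using t by (simp add: exp_power_int [symmetric])
  have "u F (- 1 / \<tau>) = norm (G \<tau>) * (exp (of_int w * ln (norm \<tau>)) * exp (of_int w / 2 * (ln (Im \<tau>) - 2 * ln (norm \<tau>))))"
   unfolding u_def G(2) ln p by simp
  also have "\<dots> = u G \<tau>" unfolding u_def exp_add [symmetric] by (simp add: algebra_simps)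
  finally have "u F (- 1 / \<tau>) = u G \<tau>" .
  then show ?thesis by (rule bexI[OF _ G(1)])
 qed
 have "\<exists>C. \<forall>\<tau>. Im \<tau> \<ge> 1 / 2 \<longrightarrow> norm (F \<tau>) \<le> C * exp (- (2 * pi * real m * Im \<tau> / real h))" if F: "F \<in> FF" for F
 proof -
  obtain a where a: "has_q_expansion h a F" "\<And>n. n < m \<Longrightarrow> a n = 0" using ex[OF F] by blast
  obtain C where "\<And>\<tau>. Im \<tau> \<ge> 1 / 2 \<Longrightarrow> norm (F \<tau>) \<le> C * exp (- (2 * pi * real m * Im \<tau> / real h))"
   by (rule q_expansion_bound[OF h a, where ?y0.0 = "1 / 2"]) auto
  then show ?thesis by blast
 qed
 then obtain CC where CC: "\<And>F \<tau>. F \<in> FF \<Longrightarrow> Im \<tau> \<ge> 1 / 2 \<Longrightarrow>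
   norm (F \<tau>) \<le> CC F * exp (- (2 * pi * real m * Im \<tau> / real h))" by metis
 define C where "C = Max (insert 1 (CC ` FF))"
 have C1: "C \<ge> 1" and CF: "CC F \<le> C" if "F \<in> FF" for F unfolding C_def using fin that by (auto intro!: Max_ge)
 have decay: "u F \<tau> \<le> C * exp (- (\<kappa> * Im \<tau>))" if "F \<in> FF" "Im \<tau> \<ge> 1" for F \<tau>
 proof -
  define y where "y = Im \<tau>"
  have y: "y \<ge> 1" "ln y \<ge> 0" "ln y \<le> y" using that ln_le_minus_one[of y] by (auto simp: y_def)
  have "of_int w / 2 * ln y \<le> \<kappa> * y" using mult_right_mono[OF w\<kappa> y(2)] mult_left_mono[OF y(3), of \<kappa>] \<kappa> by linarith
  moreover have "2 * pi * real m * y / real h \<ge> 2 * (\<kappa> * y)"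
  proof -
   have "2 * (\<kappa> * y) = (6 * real m * y) / real h" by (simp add: \<kappa>_def)
   also have "\<dots> \<le> 2 * pi * real m * y / real h" using pi_gt3 y by (intro divide_right_mono mult_right_mono) auto
   finally show ?thesis .
  qed
  ultimately have e: "- (2 * pi * real m * y / real h) + of_int w / 2 * ln y \<le> - (\<kappa> * y)" by linarith
  have "norm (F \<tau>) \<le> CC F * exp (- (2 * pi * real m * y / real h))" using CC[OF that(1)] that(2) by (simp add: y_def)
  also have "\<dots> \<le> C * exp (- (2 * pi * real m * y / real h))" using CF[OF that(1)] by (intro mult_right_mono) auto
  finally have "u F \<tau> \<le> C * exp (- (2 * pi * real m * y / real h)) * exp (of_int w / 2 * ln y)"
   unfolding u_def y_def by (intro mult_right_mono) auto
  also have "\<dots> = C * exp (- (2 * pi * real m * y / real h) + of_int w / 2 * ln y)" by (simp only: exp_add mult.assoc)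
  also have "\<dots> \<le> C * exp (- (\<kappa> * y))" using e C1[OF F0(1)] by (intro mult_left_mono) auto
  finally show ?thesis by (simp add: y_def)
 qed
 obtain G1 \<sigma>1 where G1: "G1 \<in> FF" "\<bar>Re \<sigma>1\<bar> \<le> 1 / 2" "Im \<sigma>1 \<ge> 1 / 2" "u F0 \<tau>0 = u G1 \<sigma>1" by (rule level_one_reduction[OF uT uS F0])
 define v where "v = u F0 \<tau>0"
 have v: "v > 0" using nz by (simp add: v_def u_def)
 \<comment> \<open>Above height \<open>Y\<close> the decay keeps every \<open>u F\<close> below the
   value \<open>v\<close>, by t \<le> exp t. The supremum is therefore attained in the compact box
   \<open>D\<close>.\<close>
 define Y where "Y = max 1 (max (Im \<sigma>1) (C / (\<kappa> * v)))"
 have far: "u F \<tau> \<le> v" if "F \<in> FF" "Im \<tau> \<ge> Y" for F \<tau>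
 proof -
  have Y: "Im \<tau> \<ge> 1" "Im \<tau> \<ge> C / (\<kappa> * v)" using that by (auto simp: Y_def)
  have "C \<le> \<kappa> * v * Im \<tau>" using Y(2) \<kappa> v by (simp add: field_simps)
  also have "\<dots> \<le> v * exp (\<kappa> * Im \<tau>)"
  proof -
   have "\<kappa> * Im \<tau> \<le> exp (\<kappa> * Im \<tau>)" using exp_ge_add_one_self[of "\<kappa> * Im \<tau>"] by linarith
   then show ?thesis using v by (simp add: mult.assoc mult.left_commute)
  qed
  finally have "C * exp (- (\<kappa> * Im \<tau>)) \<le> v" by (simp add: exp_minus field_simps)
  then show ?thesis using decay[OF that(1) Y(1)] by linarith
 qed
 define D where "D = cbox (Complex (- 1 / 2) (1 / 2)) (Complex (1 / 2) Y)"
 have D: "\<tau> \<in> D \<longleftrightarrow> \<bar>Re \<tau>\<bar> \<le> 1 / 2 \<and> 1 / 2 \<le> Im \<tau> \<and> Im \<tau> \<le> Y" for \<tau> by (auto simp: D_def cbox_complex_eq abs_le_iff)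
 have \<sigma>1D: "\<sigma>1 \<in> D" using G1 by (auto simp: D Y_def)
 have "\<exists>t\<in>D. \<forall>\<tau>\<in>D. u F \<tau> \<le> u F t" if F: "F \<in> FF" for F
 proof (rule continuous_attains_sup)
  obtain a where a: "has_q_expansion h a F" using ex[OF F] by blast
  have "continuous_on HH F" by (rule holomorphic_on_imp_continuous_on[OF q_expansion_holomorphic[OF h a]])
  moreover have "D \<subseteq> HH" by (auto simp: D HH_iff)
  ultimately have "continuous_on D F" by (rule continuous_on_subset)
  moreover have "\<forall>x\<in>D. Im x \<noteq> 0" by (auto simp: D)
  ultimately show "continuous_on D (u F)" unfolding u_def by (intro continuous_intros) auto
 qed (use \<sigma>1D in \<open>auto simp: D_def\<close>)
 then obtain t where t: "\<And>F. F \<in> FF \<Longrightarrow> t F \<in> D" "\<And>F \<tau>. F \<in> FF \<Longrightarrow> \<tau> \<in> D \<Longrightarrow> u F \<tau> \<le> u F (t F)" by metis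
 have "Max ((\<lambda>F. u F (t F)) ` FF) \<in> (\<lambda>F. u F (t F)) ` FF" using fin F0(1) by (intro Max_in) auto
 then obtain F1 where F1: "F1 \<in> FF" "Max ((\<lambda>F. u F (t F)) ` FF) = u F1 (t F1)" by blast
 have maxF: "u F (t F) \<le> u F1 (t F1)" if "F \<in> FF" for F using fin that by (subst F1(2) [symmetric]) auto
 define \<tau>1 where "\<tau>1 = t F1"
 define M where "M = u F1 \<tau>1"
 have vM: "v \<le> M" using G1 t(2)[OF G1(1) \<sigma>1D] maxF[OF G1(1)] by (simp add: v_def M_def \<tau>1_def)
 have glob: "u F \<tau> \<le> M" if F: "F \<in> FF" and \<tau>: "\<tau> \<in> HH" for F \<tau>
 proof -
  obtain G \<sigma> where G: "G \<in> FF" "\<bar>Re \<sigma>\<bar> \<le> 1 / 2" "Im \<sigma> \<ge> 1 / 2" "u F \<tau> = u G \<sigma>" by (rule level_one_reduction[OF uT uS F \<tau>])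
  show ?thesis
  proof (cases "Im \<sigma> \<le> Y")
   case True
   then have "\<sigma> \<in> D" using G by (simp add: D)
   then show ?thesis using G t(2)[OF G(1)] maxF[OF G(1)] by (force simp: M_def \<tau>1_def)
  next
   case False
   then show ?thesis using far[OF G(1), of \<sigma>] vM G(4) by simp
  qed
 qed
 obtain a where a: "has_q_expansion h a F1" "\<And>n. n < m \<Longrightarrow> a n = 0" using ex[OF F1(1)] by blast
 obtain P where P: "P holomorphic_on ball 0 1" "\<And>\<tau>. \<tau> \<in> HH \<Longrightarrow> F1 \<tau> = qp h \<tau> ^ m * P (qp h \<tau>)"
  using q_expansion_factor[OF h a] by metis
 define g where "g y = 2 * pi * real m / real h * y - of_int w / 2 * ln y" for y
 define y0 where "y0 = Im \<tau>1"
 have y0: "y0 \<ge> 1 / 2" using t(1)[OF F1(1)] by (simp add: y0_def \<tau>1_def D)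
 have Pu: "norm (P (qp h \<tau>)) = u F1 \<tau> * exp (g (Im \<tau>))" if "\<tau> \<in> HH" for \<tau>
 proof -
  have "norm (F1 \<tau>) = exp (- (2 * pi * real m / real h * Im \<tau>)) * norm (P (qp h \<tau>))"
   unfolding P(2)[OF that] by (simp add: norm_mult norm_power norm_qp exp_of_nat_mult [symmetric] mult_ac)
  moreover have "exp (of_int w / 2 * ln (Im \<tau>)) * exp (g (Im \<tau>)) = exp (2 * pi * real m / real h * Im \<tau>)"
   unfolding g_def exp_add [symmetric] by simp
  ultimately show ?thesis by (simp add: u_def mult.assoc exp_minus field_simps)
 qed
 \<comment> \<open>On the circle belonging to height \<open>y\<close> the modulus of
   \<open>P\<close> is at most \<open>M\<close> times exp(\<open>g y\<close>), while at the maximum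
   point it equals \<open>M\<close> times exp(\<open>g y0\<close>). So \<open>g\<close> cannot
   increase towards \<open>y0\<close>, whereas its derivative there is positive because y0 \<ge> 1/2
   and w h \<le> 6 m < 2 pi m. This is the origin of the constant 6.\<close>
 have key: "g y0 \<le> g y" if y: "0 < y" "y < y0" for y
 proof -
  define \<rho> where "\<rho> = exp (- (2 * pi * y / real h))"
  have \<rho>: "0 < \<rho>" "\<rho> < 1" using y h by (auto simp: \<rho>_def)
  have hol: "P holomorphic_on cball 0 \<rho>" by (rule holomorphic_on_subset[OF P(1)]) (use \<rho> in auto)
  have "norm (P (qp h \<tau>1)) \<le> M * exp (g y)"
  proof (rule maximum_modulus_frontier[of P "cball 0 \<rho>"])
   show "P holomorphic_on interior (cball 0 \<rho>)" by (rule holomorphic_on_subset[OF hol]) auto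
   show "continuous_on (closure (cball 0 \<rho>)) P" using holomorphic_on_imp_continuous_on[OF hol] by simp
   have "2 * pi * y / real h \<le> 2 * pi * y0 / real h" using y h by (intro divide_right_mono mult_left_mono) auto
   then show "qp h \<tau>1 \<in> cball 0 \<rho>" by (simp add: norm_qp \<rho>_def y0_def)
   fix z :: complex assume "z \<in> frontier (cball 0 \<rho>)"
   then have z: "norm z = \<rho>" using \<rho> by simp
   then have "z \<noteq> 0" "norm z < 1" using \<rho> by auto
   then obtain \<tau> where \<tau>: "\<tau> \<in> HH" "qp h \<tau> = z" using qp_surj[OF h] by blast
   have "exp (- (2 * pi * Im \<tau> / real h)) = exp (- (2 * pi * y / real h))" using z unfolding \<tau>(2) [symmetric] norm_qp \<rho>_def .
   then have "Im \<tau> = y" using h by auto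
   then show "norm (P z) \<le> M * exp (g y)" using Pu[OF \<tau>(1)] glob[OF F1(1) \<tau>(1)] \<tau>(2) by (simp add: mult_right_mono)
  qed auto
  moreover have "\<tau>1 \<in> HH" using y0 by (simp add: HH_iff y0_def)
  ultimately have "M * exp (g y0) \<le> M * exp (g y)" using Pu[of \<tau>1] by (simp add: M_def y0_def)
  then show ?thesis using v vM by simp
 qed
 have "(g has_real_derivative (2 * pi * real m / real h - of_int w / 2 * (1 / y0))) (at y0)"
  unfolding g_def using y0 h by (auto intro!: derivative_eq_intros simp: field_simps)
 moreover have "2 * pi * real m / real h - of_int w / 2 * (1 / y0) > 0"
 proof -
  have "of_int w / 2 * (1 / y0) \<le> \<kappa> * (1 / y0)" using w\<kappa> y0 by (intro mult_right_mono) auto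
  also have "\<dots> \<le> \<kappa> * 2" using y0 \<kappa> by (intro mult_left_mono) (auto simp: field_simps)
  also have "\<dots> = 6 * real m / real h" by (simp add: \<kappa>_def)
  also have "\<dots> < 2 * pi * real m / real h" using pi_gt3 m h by (intro divide_strict_right_mono mult_strict_right_mono) auto
  finally show ?thesis by simp
 qed
 ultimately obtain d where d: "d > 0" "\<And>x. 0 < x \<Longrightarrow> x < d \<Longrightarrow> g (y0 - x) < g y0" using DERIV_pos_inc_left[of g _ y0] by blast
 define x where "x = min (d / 2) (y0 / 2)"
 have "0 < x" "x < d" "0 < y0 - x" "y0 - x < y0" using d y0 by (auto simp: x_def min_def)
 then show False using d(2)[of x] key[of "y0 - x"] by simp
qed

section \<open>The slash operator\<close>

type_synonym mat2 = "int \<times> int \<times> int \<times> int"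

fun mm :: "mat2 \<Rightarrow> mat2 \<Rightarrow> mat2" where
 "mm (a, b, c, d) (a', b', c', d') = (a * a' + b * c', a * b' + b * d', c * a' + d * c', c * b' + d * d')"

fun mdet :: "mat2 \<Rightarrow> int" where "mdet (a, b, c, d) = a * d - b * c"

fun m21 :: "mat2 \<Rightarrow> int" where "m21 (a, b, c, d) = c"
fun m22 :: "mat2 \<Rightarrow> int" where "m22 (a, b, c, d) = d"

fun minv :: "mat2 \<Rightarrow> mat2" where "minv (a, b, c, d) = (d, - b, - c, a)"

fun den :: "mat2 \<Rightarrow> complex \<Rightarrow> complex" where "den (a, b, c, d) \<tau> = of_int c * \<tau> + of_int d"

fun mob :: "mat2 \<Rightarrow> complex \<Rightarrow> complex" where
 "mob (a, b, c, d) \<tau> = (of_int a * \<tau> + of_int b) / (of_int c * \<tau> + of_int d)"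

text \<open>The weight is an integer because Eichler integrals have weight 2 - k. There is no
  determinant factor: a scalar matrix \<open>(e, 0, 0, e)\<close> acts as e^(-w), and powers of the
  determinant appear explicitly where they matter.\<close>

definition sl :: "int \<Rightarrow> mat2 \<Rightarrow> (complex \<Rightarrow> complex) \<Rightarrow> complex \<Rightarrow> complex" where
 "sl w A f \<tau> = f (mob A \<tau>) * den A \<tau> powi (- w)"

definition SL2 :: "mat2 set" where "SL2 = {A. mdet A = 1}"

definition G0 :: "nat \<Rightarrow> mat2 set" where "G0 N = {A \<in> SL2. int N dvd m21 A}"

lemma mm_assoc: "mm (mm A B) C = mm A (mm B C)"
 by (cases A; cases B; cases C) (simp add: algebra_simps)

lemma mdet_mm: "mdet (mm A B) = mdet A * mdet B"
 by (cases A; cases B) (simp add: algebra_simps)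

lemma mm_one [simp]: "mm A (1, 0, 0, 1) = A" "mm (1, 0, 0, 1) A = A"
 by (cases A; simp)+

lemma mm_minv: "mdet A = 1 \<Longrightarrow> mm A (minv A) = (1, 0, 0, 1)" "mdet A = 1 \<Longrightarrow> mm (minv A) A = (1, 0, 0, 1)"
 by (cases A; simp add: algebra_simps)+

lemma mdet_minv: "mdet (minv A) = mdet A"
 by (cases A) (simp add: algebra_simps)

lemma SL2_mm: "A \<in> SL2 \<Longrightarrow> B \<in> SL2 \<Longrightarrow> mm A B \<in> SL2"
 by (simp add: SL2_def mdet_mm)

lemma SL2_minv: "A \<in> SL2 \<Longrightarrow> minv A \<in> SL2"
 by (simp add: SL2_def mdet_minv)

lemma SL2_one: "(1, 0, 0, 1) \<in> SL2" "(1, j, 0, 1) \<in> SL2" "(0, - 1, 1, 0) \<in> SL2" by (auto simp: SL2_def)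

lemma SL2_det: "A \<in> SL2 \<Longrightarrow> mdet A > 0" by (simp add: SL2_def)

lemma G0_SL2: "A \<in> G0 N \<Longrightarrow> A \<in> SL2" by (simp add: G0_def)

lemma m21_mm: "m21 (mm A B) = m21 A * fst B + m22 A * m21 B"
 by (cases A; cases B) simp

lemma G0_mm: "A \<in> G0 N \<Longrightarrow> B \<in> G0 N \<Longrightarrow> mm A B \<in> G0 N"
 by (auto simp: G0_def SL2_mm m21_mm)

lemma G0_1: "G0 1 = SL2" by (simp add: G0_def)

lemma G0_mono: "M dvd N \<Longrightarrow> G0 N \<subseteq> G0 M"
 by (auto simp: G0_def intro: dvd_trans[of "int M" "int N"])

lemma mm_mob_den:
 assumes "den B \<tau> \<noteq> 0" "den A (mob B \<tau>) \<noteq> 0"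
 shows "mob (mm A B) \<tau> = mob A (mob B \<tau>)" "den (mm A B) \<tau> = den A (mob B \<tau>) * den B \<tau>"
proof -
 obtain a b c d where A: "A = (a, b, c, d)" by (cases A)
 obtain a' b' c' d' where B: "B = (a', b', c', d')" by (cases B)
 define D where "D = of_int c' * \<tau> + of_int d'"
 define n where "n = of_int a' * \<tau> + of_int b'"
 have D: "D \<noteq> 0" using assms(1) by (simp add: B D_def)
 have num: "of_int (a * a' + b * c') * \<tau> + of_int (a * b' + b * d') = (of_int a * (n / D) + of_int b) * D"
 proof -
  have "(of_int a * (n / D) + of_int b) * D = of_int a * n + of_int b * D" using D by (simp add: distrib_right)
  then show ?thesis by (simp add: D_def n_def algebra_simps)
 qed
 have den': "of_int (c * a' + d * c') * \<tau> + of_int (c * b' + d * d') = (of_int c * (n / D) + of_int d) * D"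
 proof -
  have "(of_int c * (n / D) + of_int d) * D = of_int c * n + of_int d * D" using D by (simp add: distrib_right)
  then show ?thesis by (simp add: D_def n_def algebra_simps)
 qed
 have "den (mm A B) \<tau> = of_int (c * a' + d * c') * \<tau> + of_int (c * b' + d * d')" by (simp add: A B)
 also have "\<dots> = den A (mob B \<tau>) * den B \<tau>" unfolding den' by (simp add: A B flip: D_def n_def)
 finally show "den (mm A B) \<tau> = den A (mob B \<tau>) * den B \<tau>" .
 have "mob (mm A B) \<tau> = (of_int (a * a' + b * c') * \<tau> + of_int (a * b' + b * d')) /
   (of_int (c * a' + d * c') * \<tau> + of_int (c * b' + d * d'))" by (simp add: A B)
 also have "\<dots> = mob A (mob B \<tau>)" unfolding num den' using D by (simp add: A B flip: D_def n_def)
 finally show "mob (mm A B) \<tau> = mob A (mob B \<tau>)" .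
qed

lemma den_nonzero: "mdet A > 0 \<Longrightarrow> \<tau> \<in> HH \<Longrightarrow> den A \<tau> \<noteq> 0"
proof (cases A)
 case (fields a b c d)
 assume *: "mdet A > 0" "\<tau> \<in> HH"
 show ?thesis
 proof
  assume "den A \<tau> = 0"
  then have z: "of_int c * \<tau> + of_int d = 0" by (simp add: fields)
  have "Im (of_int c * \<tau> + of_int d) = of_int c * Im \<tau>" by simp
  then have "c = 0" using z *(2) by (simp add: HH_iff)
  then have "d = 0" using z by simp
  then show False using *(1) \<open>c = 0\<close> by (simp add: fields)
 qed
qed

lemma Im_mob: "\<tau> \<in> HH \<Longrightarrow> mdet A > 0 \<Longrightarrow> Im (mob A \<tau>) = of_int (mdet A) * Im \<tau> / (norm (den A \<tau>))\<^sup>2"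
 by (cases A) (simp add: Im_divide cmod_power2, simp add: algebra_simps)

lemma mob_HH: "mdet A > 0 \<Longrightarrow> \<tau> \<in> HH \<Longrightarrow> mob A \<tau> \<in> HH"
 using Im_mob[of \<tau> A] den_nonzero[of A \<tau>] by (simp add: HH_iff)

lemma sl_mm:
 assumes "mdet A > 0" "mdet B > 0" "\<tau> \<in> HH"
 shows "sl w (mm A B) f \<tau> = sl w B (sl w A f) \<tau>"
proof -
 have "den B \<tau> \<noteq> 0" "den A (mob B \<tau>) \<noteq> 0" using den_nonzero[OF assms(2,3)] den_nonzero[OF assms(1) mob_HH[OF assms(2,3)]] by auto
 from mm_mob_den[OF this] show ?thesis by (simp add: sl_def power_int_mult_distrib mult_ac)
qed

lemma sl_cong: "mdet A > 0 \<Longrightarrow> \<tau> \<in> HH \<Longrightarrow> (\<And>\<tau>. \<tau> \<in> HH \<Longrightarrow> f \<tau> = g \<tau>) \<Longrightarrow> sl w A f \<tau> = sl w A g \<tau>"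
 by (simp add: sl_def mob_HH)

lemma sl_mult: "mdet A > 0 \<Longrightarrow> \<tau> \<in> HH \<Longrightarrow> sl (v + w) A (\<lambda>\<tau>. f \<tau> * g \<tau>) \<tau> = sl v A f \<tau> * sl w A g \<tau>"
 using den_nonzero[of A \<tau>] by (simp add: sl_def power_int_diff power_int_minus field_simps)

lemma sl_linear:
 "sl w A (\<lambda>\<tau>. f \<tau> + g \<tau>) \<tau> = sl w A f \<tau> + sl w A g \<tau>"
 "sl w A (\<lambda>\<tau>. f \<tau> - g \<tau>) \<tau> = sl w A f \<tau> - sl w A g \<tau>"
 "sl w A (\<lambda>\<tau>. x * f \<tau>) \<tau> = x * sl w A f \<tau>"
 "sl w A (\<lambda>\<tau>. \<Sum>i\<in>J. F i \<tau>) \<tau> = (\<Sum>i\<in>J. sl w A (F i) \<tau>)" by (simp_all add: sl_def algebra_simps sum_distrib_left sum_distrib_right)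

lemma sl_one [simp]: "sl w (1, 0, 0, 1) f = f"
 by (simp add: sl_def fun_eq_iff)

lemma sl_shift: "sl w (1, j, 0, 1) f \<tau> = f (\<tau> + of_int j)"
 by (simp add: sl_def)

lemma sl_tri: "sl w (a, b, 0, d) f \<tau> = f ((of_int a * \<tau> + of_int b) / of_int d) * of_int d powi (- w)"
 by (simp add: sl_def)

lemma mob_holomorphic: "mdet A > 0 \<Longrightarrow> mob A holomorphic_on HH"
proof (cases A)
 case (fields a b c d)
 assume "mdet A > 0"
 then have "of_int c * \<tau> + of_int d \<noteq> 0" if "\<tau> \<in> HH" for \<tau> using den_nonzero[of A \<tau>] that by (simp add: fields)
 then show ?thesis unfolding fields mob.simps by (intro holomorphic_intros) auto
qed

lemma sl_holomorphic:
 assumes "mdet A > 0" "f holomorphic_on HH"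
 shows "sl w A f holomorphic_on HH"
proof -
 have "(f \<circ> mob A) holomorphic_on HH"
  by (rule holomorphic_on_compose_gen[OF mob_holomorphic assms(2)]) (use assms(1) mob_HH[OF assms(1)] in auto)
 moreover have "den A holomorphic_on HH"
 proof -
  have "den A = (\<lambda>\<tau>. of_int (m21 A) * \<tau> + of_int (m22 A))" by (cases A) auto
  then show ?thesis by (simp only:) (intro holomorphic_intros)
 qed
 ultimately show ?thesis unfolding sl_def using den_nonzero[OF assms(1)] by (intro holomorphic_intros) (auto simp: o_def)
qed

subsection \<open>Hermite normal form and cosets\<close>

text \<open>With the \<open>SL2\<close> factor on the left, slashing by any matrix of positive
  determinant becomes an expansion at a cusp followed by an affine substitution. The number
  \<open>a\<close> is the gcd of the first column.\<close>

lemma hermite: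
 assumes "mdet A > 0"
 obtains B a b d where "B \<in> SL2" "a > 0" "d > 0" "a * d = mdet A" "A = mm B (a, b, 0, d)"
  "m21 A = m21 B * a" "\<And>x. x dvd fst A \<Longrightarrow> x dvd m21 A \<Longrightarrow> x dvd a"
proof -
 obtain x y z w where A: "A = (x, y, z, w)" by (cases A)
 define g where "g = gcd x z"
 obtain u v where uv: "u * x + v * z = g" using bezout_int[of x z] unfolding g_def by metis
 have "x \<noteq> 0 \<or> z \<noteq> 0" using assms by (auto simp: A)
 then have g: "g > 0" by (auto simp: g_def)
 obtain x' where x': "x = g * x'" unfolding g_def using gcd_dvd1 by (metis dvdE)
 obtain z' where z': "z = g * z'" unfolding g_def using gcd_dvd2 by (metis dvdE)
 have "g * (u * x' + v * z') = g * 1" using uv x' z' by (simp add: algebra_simps)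
 then have one: "u * x' + v * z' = 1" using g by (metis mult_left_cancel less_irrefl)
 define d where "d = x' * w - z' * y"
 have gd: "g * d = mdet A" by (simp add: A d_def x' z' algebra_simps)
 then have d: "d > 0" using g assms by (metis zero_less_mult_pos)
 have "mm (x', - v, z', u) (g, u * y + v * w, 0, d) =
   (g * x', (u * x' + v * z') * y, g * z', (u * x' + v * z') * w)" by (simp add: d_def algebra_simps)
 also have "\<dots> = A" by (simp add: A x' z' one)
 finally have 1: "A = mm (x', - v, z', u) (g, u * y + v * w, 0, d)" by (rule sym)
 have 2: "(x', - v, z', u) \<in> SL2" using one by (simp add: SL2_def algebra_simps)
 have 3: "m21 A = m21 (x', - v, z', u) * g" unfolding A z' by simp
 have 4: "x dvd g" if "x dvd fst A" "x dvd m21 A" for x using that by (simp add: A g_def)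
 show thesis by (rule that[OF 2 g d gd 1 3 4])
qed

text \<open>The expression is the lower left entry of \<open>mm A (minv B)\<close>, so on
  \<open>SL2\<close> the relation says that \<open>A\<close> and \<open>B\<close> lie in the same
  coset of \<open>G0 N\<close>: their bottom rows define the same point of the projective line over
  Z/N.\<close>

definition crel :: "nat \<Rightarrow> mat2 \<Rightarrow> mat2 \<Rightarrow> bool" where
 "crel N A B \<longleftrightarrow> int N dvd m21 A * m22 B - m22 A * m21 B"

lemma crel_iff: "A \<in> SL2 \<Longrightarrow> B \<in> SL2 \<Longrightarrow> crel N A B \<longleftrightarrow> mm A (minv B) \<in> G0 N"
proof -
 assume AB: "A \<in> SL2" "B \<in> SL2"
 have "m21 (mm A (minv B)) = m21 A * m22 B - m22 A * m21 B" by (cases A; cases B) simp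
 then show ?thesis using AB by (simp add: crel_def G0_def SL2_mm SL2_minv)
qed

lemma crel_E:
 assumes "A \<in> SL2" "B \<in> SL2" "crel N A B"
 obtains C where "C \<in> G0 N" "A = mm C B"
proof -
 have "mm (mm A (minv B)) B = A" using assms by (simp add: mm_assoc mm_minv SL2_def)
 then show thesis using that[of "mm A (minv B)"] crel_iff[OF assms(1,2)] assms(3) by simp
qed

lemma crel_I: "B \<in> SL2 \<Longrightarrow> C \<in> G0 N \<Longrightarrow> crel N (mm C B) B"
 using crel_iff[OF SL2_mm[OF G0_SL2, of C N B], of B N] by (simp add: mm_assoc mm_minv SL2_def)

lemma crel_refl: "crel N A A" by (simp add: crel_def)

lemma crel_sym: "crel N A B \<Longrightarrow> crel N B A"
 unfolding crel_def by (metis dvd_minus_iff minus_diff_eq mult.commute)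

lemma crel_trans:
 assumes "A \<in> SL2" "B \<in> SL2" "C \<in> SL2" "crel N A B" "crel N B C"
 shows "crel N A C"
proof -
 obtain X1 where X1: "X1 \<in> G0 N" "A = mm X1 B" using crel_E[OF assms(1,2,4)] .
 obtain X2 where X2: "X2 \<in> G0 N" "B = mm X2 C" using crel_E[OF assms(2,3,5)] .
 have "A = mm (mm X1 X2) C" by (simp add: X1(2) X2(2) mm_assoc)
 then show ?thesis using crel_I[OF assms(3) G0_mm[OF X1(1) X2(1)]] by simp
qed

lemma crel_mm:
 assumes "A \<in> SL2" "B \<in> SL2" "C \<in> SL2"
 shows "crel N (mm A C) (mm B C) \<longleftrightarrow> crel N A B"
proof -
 have "m21 (mm A C) * m22 (mm B C) - m22 (mm A C) * m21 (mm B C) =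
   (m21 A * m22 B - m22 A * m21 B) * mdet C" by (cases A; cases B; cases C) (simp add: algebra_simps)
 then show ?thesis using assms by (simp add: crel_def SL2_def)
qed

definition rep :: "nat \<Rightarrow> mat2 \<Rightarrow> mat2" where
 "rep N A = (SOME B. B \<in> SL2 \<and> crel N A B)"

definition Reps :: "nat \<Rightarrow> mat2 set" where "Reps N = rep N ` SL2"

lemma rep_props: assumes "A \<in> SL2" shows "rep N A \<in> SL2" "crel N A (rep N A)"
proof -
 have "rep N A \<in> SL2 \<and> crel N A (rep N A)" unfolding rep_def by (rule someI[of _ A]) (use assms crel_refl in auto)
 then show "rep N A \<in> SL2" "crel N A (rep N A)" by auto
qed

lemma rep_eq_iff: assumes "A \<in> SL2" "B \<in> SL2" shows "rep N A = rep N B \<longleftrightarrow> crel N A B"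
proof
 assume "rep N A = rep N B"
 then show "crel N A B"
  using rep_props[OF assms(1), of N] rep_props[OF assms(2), of N] crel_trans[OF assms(1) _ assms(2)] crel_sym by metis
next
 assume AB: "crel N A B"
 have "(C \<in> SL2 \<and> crel N A C) \<longleftrightarrow> (C \<in> SL2 \<and> crel N B C)" for C using AB crel_trans crel_sym assms by blast
 then show "rep N A = rep N B" unfolding rep_def by simp
qed

lemma Reps_SL2: "Reps N \<subseteq> SL2" using rep_props by (auto simp: Reps_def)

lemma rep_Reps: "R \<in> Reps N \<Longrightarrow> rep N R = R"
 unfolding Reps_def using rep_props rep_eq_iff crel_sym by blast

lemma finite_rows: "N > 0 \<Longrightarrow> finite ((\<lambda>A. (m21 A mod int N, m22 A mod int N)) ` S)"
 by (rule finite_subset[of _ "{0..<int N} \<times> {0..<int N}"]) auto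

lemma crel_rows:
 assumes "m21 A mod int N = m21 B mod int N" "m22 A mod int N = m22 B mod int N"
 shows "crel N A B"
proof -
 have "(m21 A * m22 B) mod int N = (m21 B * m22 A) mod int N" using assms by (metis mod_mult_cong)
 then show ?thesis unfolding crel_def by (simp add: mod_eq_dvd_iff mult.commute)
qed

lemma finite_Reps: assumes "N > 0" shows "finite (Reps N)"
proof -
 define r where "r = (\<lambda>A. (m21 A mod int N, m22 A mod int N))"
 have "inj_on r (Reps N)"
 proof (rule inj_onI)
  fix A B assume AB: "A \<in> Reps N" "B \<in> Reps N" "r A = r B"
  then have "crel N A B" by (intro crel_rows) (auto simp: r_def)
  then show "A = B" using AB rep_eq_iff[of A B N] Reps_SL2 rep_Reps by auto
 qed
 moreover have "finite (r ` Reps N)" unfolding r_def by (rule finite_rows[OF assms])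
 ultimately show ?thesis using finite_imageD by blast
qed

section \<open>Invariant functions and the trace between levels\<close>

definition invariant :: "int \<Rightarrow> nat \<Rightarrow> (complex \<Rightarrow> complex) \<Rightarrow> bool" where
 "invariant w N f \<longleftrightarrow> (\<forall>A\<in>G0 N. \<forall>\<tau>\<in>HH. sl w A f \<tau> = f \<tau>)"

lemma invariantD: "invariant w N f \<Longrightarrow> A \<in> G0 N \<Longrightarrow> \<tau> \<in> HH \<Longrightarrow> sl w A f \<tau> = f \<tau>"
 by (simp add: invariant_def)

lemma sl_crel:
 assumes "invariant w N f" "A \<in> SL2" "B \<in> SL2" "crel N A B" "\<tau> \<in> HH"
 shows "sl w A f \<tau> = sl w B f \<tau>"
proof -
 obtain C where C: "C \<in> G0 N" "A = mm C B" using crel_E[OF assms(2-4)] .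
 have "sl w A f \<tau> = sl w B (sl w C f) \<tau>" unfolding C(2) using C(1) assms by (intro sl_mm) (auto intro: SL2_det G0_SL2)
 also have "\<dots> = sl w B f \<tau>" using invariantD[OF assms(1) C(1)] assms by (intro sl_cong) (auto intro: SL2_det)
 finally show ?thesis .
qed

lemma sl_rep: "invariant w N f \<Longrightarrow> A \<in> SL2 \<Longrightarrow> \<tau> \<in> HH \<Longrightarrow> sl w (rep N A) f \<tau> = sl w A f \<tau>"
 using sl_crel[of w N f "rep N A" A] rep_props[of A N] crel_sym by blast

definition relReps :: "nat \<Rightarrow> nat \<Rightarrow> mat2 set" where "relReps N M = Reps N \<inter> G0 M"

definition trace :: "int \<Rightarrow> nat \<Rightarrow> nat \<Rightarrow> (complex \<Rightarrow> complex) \<Rightarrow> complex \<Rightarrow> complex" where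
 "trace w N M f \<tau> = (\<Sum>R\<in>relReps N M. sl w R f \<tau>)"

lemma crel_G0:
 assumes "M dvd N" "A \<in> G0 M" "B \<in> SL2" "crel N A B"
 shows "B \<in> G0 M"
proof -
 obtain C where C: "C \<in> G0 N" "B = mm C A" using crel_E[OF assms(3) G0_SL2[OF assms(2)] crel_sym[OF assms(4)]] .
 then show ?thesis using G0_mm[of C M A] G0_mono[OF assms(1)] assms(2) by blast
qed

text \<open>Right multiplication by \<open>B\<close> permutes the cosets of \<open>G0 N\<close> in
  \<open>G0 M\<close>; \<open>\<phi>\<close> is this permutation on representatives.\<close>

lemma trace_invariant:
 assumes inv: "invariant w N f" and "N > 0" "M dvd N"
 shows "invariant w M (trace w N M f)" unfolding invariant_def
proof (intro ballI)
 fix B \<tau> assume B: "B \<in> G0 M" and \<tau>: "\<tau> \<in> HH"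
 define \<phi> where "\<phi> R = rep N (mm R B)" for R
 have BS: "B \<in> SL2" using B by (rule G0_SL2)
 have RS: "R \<in> SL2" if "R \<in> relReps N M" for R using that Reps_SL2 by (auto simp: relReps_def)
 have fin: "finite (relReps N M)" using finite_Reps[OF assms(2)] by (simp add: relReps_def)
 have maps: "\<phi> ` relReps N M \<subseteq> relReps N M"
 proof
  fix S assume "S \<in> \<phi> ` relReps N M"
  then obtain R where R: "R \<in> relReps N M" "S = rep N (mm R B)" by (auto simp: \<phi>_def)
  have "mm R B \<in> G0 M" using R(1) B by (auto simp: relReps_def intro: G0_mm)
  then have "S \<in> G0 M" unfolding R(2) using crel_G0[OF assms(3)] rep_props[of "mm R B" N] G0_SL2 by blast
  moreover have "S \<in> Reps N" unfolding R(2) Reps_def using RS[OF R(1)] BS SL2_mm by blast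
  ultimately show "S \<in> relReps N M" by (simp add: relReps_def)
 qed
 have inj: "inj_on \<phi> (relReps N M)"
 proof (rule inj_onI)
  fix R R' assume R: "R \<in> relReps N M" "R' \<in> relReps N M" "\<phi> R = \<phi> R'"
  then have "crel N (mm R B) (mm R' B)" using rep_eq_iff[of "mm R B" "mm R' B" N] RS BS SL2_mm by (auto simp: \<phi>_def)
  then have "rep N R = rep N R'" using crel_mm[of R R' B N] RS R BS rep_eq_iff by blast
  then show "R = R'" using R rep_Reps by (auto simp: relReps_def)
 qed
 have "\<phi> ` relReps N M = relReps N M" using endo_inj_surj[OF fin maps inj] .
 then have bij: "bij_betw \<phi> (relReps N M) (relReps N M)" using inj by (simp add: bij_betw_def)
 have "sl w B (trace w N M f) \<tau> = (\<Sum>R\<in>relReps N M. sl w B (sl w R f) \<tau>)" unfolding trace_def by (rule sl_linear(4))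
 also have "\<dots> = (\<Sum>R\<in>relReps N M. sl w (\<phi> R) f \<tau>)"
 proof (rule sum.cong)
  fix R assume R: "R \<in> relReps N M"
  have "sl w (\<phi> R) f \<tau> = sl w (mm R B) f \<tau>" unfolding \<phi>_def using RS[OF R] BS \<tau> by (intro sl_rep[OF inv]) (auto intro: SL2_mm)
  also have "\<dots> = sl w B (sl w R f) \<tau>" using RS[OF R] BS \<tau> by (intro sl_mm) (auto intro: SL2_det)
  finally show "sl w B (sl w R f) \<tau> = sl w (\<phi> R) f \<tau>" by simp
 qed simp
 also have "\<dots> = trace w N M f \<tau>" unfolding trace_def by (rule sum.reindex_bij_betw[OF bij])
 finally show "sl w B (trace w N M f) \<tau> = trace w N M f \<tau>" .
qed

text \<open>For a coprime factorisation N = a d, the cosets with a | c and c prime to d form a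
  single orbit under translation, of length d. The list is used for the trace from level p M to
  level M, and the count for the leading coefficient of \<open>T\<close>.\<close>

lemma Reps_of_type:
 assumes N: "N = a * d" "coprime a d" "N > 0" and g: "g \<in> SL2" "int a dvd m21 g" "coprime (m21 g) (int d)"
 shows "{R \<in> Reps N. int a dvd m21 R \<and> coprime (m21 R) (int d)} = (\<lambda>j. rep N (mm g (1, int j, 0, 1))) ` {..<d}"
  "inj_on (\<lambda>j. rep N (mm g (1, int j, 0, 1))) {..<d}"
proof -
 have d0: "d > 0" using N by auto
 have gS: "mm g (1, j, 0, 1) \<in> SL2" for j using g(1) by (simp add: SL2_def mdet_mm)
 have m: "m21 (mm g (1, j, 0, 1)) = m21 g" "m22 (mm g (1, j, 0, 1)) = m21 g * j + m22 g" for j by (cases g; simp)+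
 have type_inv: "int a dvd m21 B \<and> coprime (m21 B) (int d)"
  if AB: "A \<in> SL2" "B \<in> SL2" "crel N A B" and A: "int a dvd m21 A" "coprime (m21 A) (int d)" for A B
 proof
  have "A \<in> G0 a" using AB A by (simp add: G0_def)
  then have "B \<in> G0 a" using crel_G0[of a N A B] AB N by simp
  then show "int a dvd m21 B" by (simp add: G0_def)
  obtain C where C: "C \<in> G0 N" "A = mm C B" using crel_E[OF AB] .
  show "coprime (m21 B) (int d)"
  proof (rule coprimeI)
   fix x assume x: "x dvd m21 B" "x dvd int d"
   have "int d dvd m21 C" using C(1) N by (auto simp: G0_def intro: dvd_trans)
   then have "x dvd m21 C" using x by (meson dvd_trans)
   moreover have "m21 A = m21 C * fst B + m22 C * m21 B" unfolding C(2) by (cases C; cases B) simp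
   ultimately have "x dvd m21 A" using x by simp
   then show "is_unit x" using A(2) x(2) by (meson coprime_common_divisor)
  qed
 qed
 show inj: "inj_on (\<lambda>j. rep N (mm g (1, int j, 0, 1))) {..<d}"
 proof (rule inj_onI)
  fix i j assume ij: "i \<in> {..<d}" "j \<in> {..<d}" "rep N (mm g (1, int i, 0, 1)) = rep N (mm g (1, int j, 0, 1))"
  then have "crel N (mm g (1, int i, 0, 1)) (mm g (1, int j, 0, 1))" using rep_eq_iff gS by blast
  then have "int N dvd m21 g * (m21 g * int j + m22 g) - (m21 g * int i + m22 g) * m21 g" by (simp add: crel_def m)
  then have "int N dvd (m21 g * m21 g) * (int j - int i)" by (simp add: algebra_simps)
  then have "int d dvd (m21 g * m21 g) * (int j - int i)" using N by (auto intro: dvd_trans[of "int d" "int N"])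
  moreover have "coprime (int d) (m21 g * m21 g)" using g(3) by (simp add: coprime_commute)
  ultimately have dv: "int d dvd int j - int i" by (simp add: coprime_dvd_mult_right_iff)
  have lt: "\<bar>int j - int i\<bar> < int d" using ij by auto
  show "i = j"
  proof (rule ccontr)
   assume "i \<noteq> j"
   then have "\<bar>int d\<bar> \<le> \<bar>int j - int i\<bar>" using dv by (intro dvd_imp_le_int) auto
   then show False using lt by simp
  qed
 qed
 show "{R \<in> Reps N. int a dvd m21 R \<and> coprime (m21 R) (int d)} = (\<lambda>j. rep N (mm g (1, int j, 0, 1))) ` {..<d}"
 proof (intro equalityI subsetI)
  fix R assume "R \<in> (\<lambda>j. rep N (mm g (1, int j, 0, 1))) ` {..<d}"
  then obtain j where j: "R = rep N (mm g (1, int j, 0, 1))" by blast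
  then show "R \<in> {R \<in> Reps N. int a dvd m21 R \<and> coprime (m21 R) (int d)}"
   using type_inv[OF gS[of "int j"] rep_props(1,2)[OF gS[of "int j"], of N]] g m gS by (auto simp: Reps_def)
 next
  fix R assume "R \<in> {R \<in> Reps N. int a dvd m21 R \<and> coprime (m21 R) (int d)}"
  then have R: "R \<in> Reps N" "int a dvd m21 R" "coprime (m21 R) (int d)" by auto
  have RS: "R \<in> SL2" using R Reps_SL2 by blast
  have "coprime (m21 R * m21 g) (int d)" using R(3) g(3) by simp
  then obtain y where y: "[m21 R * m21 g * y = 1] (mod int d)" using cong_solve_coprime_int by blast
  \<comment> \<open>Equality of the coset of \<open>R\<close> with that of g T^j is a linear
    congruence for \<open>j\<close> modulo \<open>d\<close>, whose coefficient is inverted by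
    \<open>y\<close>. Modulo \<open>a\<close> it holds for every \<open>j\<close>.\<close>
  define j where "j = (y * (m22 R * m21 g - m21 R * m22 g)) mod int d"
  have j: "0 \<le> j" "j < int d" using d0 by (auto simp: j_def)
  have "[m21 R * m21 g * j = m21 R * m21 g * (y * (m22 R * m21 g - m21 R * m22 g))] (mod int d)"
   unfolding j_def by (intro cong_mult cong_refl) (simp add: cong_def)
  also have "m21 R * m21 g * (y * (m22 R * m21 g - m21 R * m22 g)) = (m21 R * m21 g * y) * (m22 R * m21 g - m21 R * m22 g)"
   by (simp add: algebra_simps)
  also have "[\<dots> = 1 * (m22 R * m21 g - m21 R * m22 g)] (mod int d)" by (intro cong_mult y cong_refl)
  finally have "int d dvd m21 R * m21 g * j - (m22 R * m21 g - m21 R * m22 g)" by (simp add: cong_iff_dvd_diff)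
  then have "int d dvd m21 R * (m21 g * j + m22 g) - m22 R * m21 g" by (simp add: algebra_simps)
  moreover have "int a dvd m21 R * (m21 g * j + m22 g) - m22 R * m21 g" using R(2) g(2) by simp
  moreover have "coprime (int a) (int d)" using N(2) by simp
  ultimately have "int a * int d dvd m21 R * (m21 g * j + m22 g) - m22 R * m21 g" by (intro divides_mult)
  then have "crel N R (mm g (1, j, 0, 1))" by (simp add: crel_def m N(1))
  then have "rep N (mm g (1, j, 0, 1)) = R" using rep_eq_iff[OF RS gS, of N j] rep_Reps[OF R(1)] by simp
  then show "R \<in> (\<lambda>j. rep N (mm g (1, int j, 0, 1))) ` {..<d}" using j by (intro image_eqI[of _ _ "nat j"]) auto
 qed
qed

subsection \<open>Cusp forms in terms of the slash operator\<close>

definition of_mat :: "int ^ 2 ^ 2 \<Rightarrow> mat2" where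
 "of_mat A = (A $ 1 $ 1, A $ 1 $ 2, A $ 2 $ 1, A $ 2 $ 2)"

definition to_mat :: "mat2 \<Rightarrow> int ^ 2 ^ 2" where
 "to_mat A = (case A of (a, b, c, d) \<Rightarrow> vector [vector [a, b], vector [c, d]])"

lemma of_mat_to_mat [simp]: "of_mat (to_mat A) = A"
 by (cases A) (simp add: of_mat_def to_mat_def)

lemma mdet_of_mat: "mdet (of_mat A) = det A"
 by (simp add: of_mat_def det_2)

lemma SL2Z_iff: "A \<in> carrier SL2Z \<longleftrightarrow> of_mat A \<in> SL2"
 by (simp add: SL2Z_def SL2_def mdet_of_mat)

lemma Gamma0_iff: "A \<in> Gamma0 N \<longleftrightarrow> of_mat A \<in> G0 N"
 by (simp add: Gamma0_def G0_def SL2Z_iff) (simp add: of_mat_def)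

lemma slash_eq: "slash k A f = sl (int k) (of_mat A) f"
 by (simp add: fun_eq_iff slash_def sl_def of_mat_def moebius_def power_int_minus divide_inverse)

lemma ball_SL2Z: "(\<forall>A\<in>carrier SL2Z. P (of_mat A)) \<longleftrightarrow> (\<forall>A\<in>SL2. P A)"
 using SL2Z_iff of_mat_to_mat by metis

lemma ball_Gamma0: "(\<forall>A\<in>Gamma0 N. P (of_mat A)) \<longleftrightarrow> (\<forall>A\<in>G0 N. P A)"
 using Gamma0_iff of_mat_to_mat by metis

lemma cusp_forms_iff:
 "f \<in> cusp_forms k N \<longleftrightarrow> f holomorphic_on HH \<and> (\<forall>\<tau>. \<tau> \<notin> HH \<longrightarrow> f \<tau> = 0) \<and> invariant (int k) N f \<and>
   (\<forall>A\<in>SL2. \<exists>a. a 0 = 0 \<and> has_q_expansion N a (sl (int k) A f))" unfolding cusp_forms_def modular_forms_def slash_eq invariant_def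
  ball_SL2Z[of "\<lambda>A. \<exists>a. a 0 = 0 \<and> has_q_expansion N a (sl (int k) A f)"]
 using ball_SL2Z[of "\<lambda>A. \<exists>a. has_q_expansion N a (sl (int k) A f)"]
  ball_SL2Z[of "\<lambda>A. \<exists>a. a 0 = 0 \<and> has_q_expansion N a (sl (int k) A f)"]
  ball_Gamma0[of N "\<lambda>A. \<forall>\<tau>\<in>HH. sl (int k) A f \<tau> = f \<tau>"] by auto

section \<open>Positivity of the Petersson product\<close>

lemma power_le_fact_exp: "(x::real) \<ge> 0 \<Longrightarrow> x ^ n \<le> fact n * exp x"
proof -
 assume x: "x \<ge> 0"
 have "(\<Sum>j\<in>{n}. inverse (fact j) * x ^ j) \<le> (\<Sum>j. inverse (fact j) * x ^ j)" using x by (intro sum_le_suminf summable_exp) auto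
 then have "x ^ n / fact n \<le> exp x" by (simp add: exp_def divide_inverse mult.commute)
 then show ?thesis by (simp add: field_simps)
qed

lemma cusp_form_square_bound:
 assumes "k \<ge> 2" "N > 0" "a 0 = 0" "has_q_expansion N a f"
 obtains K c where "K \<ge> 0" "c > 0"
  "\<And>\<tau>. Im \<tau> \<ge> 1 / 2 \<Longrightarrow> (norm (f \<tau>))\<^sup>2 * (Im \<tau> ^ k / Im \<tau> ^ 2) \<le> K * exp (- (c * Im \<tau>))"
proof -
 obtain C where C: "C \<ge> 0" "\<And>\<tau>. Im \<tau> \<ge> 1 / 2 \<Longrightarrow> norm (f \<tau>) \<le> C * exp (- (2 * pi * real 1 * Im \<tau> / real N))"
  by (rule q_expansion_bound[OF assms(2,4), of 1 "1 / 2"]) (use assms(3) in auto)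
 define c where "c = 2 * pi / real N"
 have c: "c > 0" using assms(2) by (simp add: c_def)
 define n where "n = k - 2"
 define K where "K = C\<^sup>2 * (fact n / c ^ n)"
 have "(norm (f \<tau>))\<^sup>2 * (Im \<tau> ^ k / Im \<tau> ^ 2) \<le> K * exp (- (c * Im \<tau>))" if "Im \<tau> \<ge> 1 / 2" for \<tau>
 proof -
  define y where "y = Im \<tau>"
  have y: "y > 0" using that by (simp add: y_def)
  have "k = n + 2" using assms(1) by (simp add: n_def)
  then have "y ^ k = y ^ n * y ^ 2" by (simp only: power_add)
  then have e1: "y ^ k / y ^ 2 = y ^ n" using y by simp
  have "c ^ n * y ^ n \<le> fact n * exp (c * y)" using power_le_fact_exp[of "c * y" n] c y by (simp add: power_mult_distrib)
  then have e2: "y ^ n \<le> fact n / c ^ n * exp (c * y)" using c by (simp add: field_simps)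
  have "norm (f \<tau>) \<le> C * exp (- (c * y))" using C(2)[OF that] by (simp add: c_def y_def)
  then have "(norm (f \<tau>))\<^sup>2 \<le> (C * exp (- (c * y)))\<^sup>2" by (intro power_mono) auto
  then have "(norm (f \<tau>))\<^sup>2 * y ^ n \<le> (C * exp (- (c * y)))\<^sup>2 * (fact n / c ^ n * exp (c * y))"
   using e2 y by (intro mult_mono) auto
  also have "\<dots> = K * (exp (- (c * y)) * (exp (- (c * y)) * exp (c * y)))" by (simp add: K_def power2_eq_square mult_ac)
  also have "\<dots> = K * exp (- (c * y))" by (simp add: exp_add [symmetric])
  finally show ?thesis by (simp add: e1 flip: y_def)
 qed
 moreover have "K \<ge> 0" using c by (simp add: K_def)
 ultimately show thesis using c that by metis
qed

lemma closed_fundamental_domain: "closed fundamental_domain"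
proof -
 have eq: "fundamental_domain = {\<tau>. Im \<tau> \<ge> 1 / 2} \<inter> {\<tau>. - 1 / 2 \<le> Re \<tau>} \<inter> {\<tau>. Re \<tau> \<le> 1 / 2} \<inter> {\<tau>. norm \<tau> \<ge> 1}"
 proof (intro equalityI subsetI)
  fix \<tau> assume \<tau>: "\<tau> \<in> fundamental_domain"
  then have h: "Im \<tau> > 0" "\<bar>Re \<tau>\<bar> \<le> 1 / 2" "norm \<tau> \<ge> 1" by (auto simp: fundamental_domain_def HH_iff)
  have "Im \<tau> \<ge> 1 / 2" using h cmod_le[of \<tau>] by linarith
  then show "\<tau> \<in> {\<tau>. Im \<tau> \<ge> 1 / 2} \<inter> {\<tau>. - 1 / 2 \<le> Re \<tau>} \<inter> {\<tau>. Re \<tau> \<le> 1 / 2} \<inter> {\<tau>. norm \<tau> \<ge> 1}" using h by auto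
 qed (auto simp: fundamental_domain_def HH_iff)
 show ?thesis unfolding eq by (intro closed_Int closed_Collect_le continuous_intros)
qed

lemma fundamental_domain_bounds:
 assumes "\<tau> \<in> fundamental_domain" shows "Im \<tau> \<ge> 1 / 2" "\<bar>Re \<tau>\<bar> \<le> 1 / 2" "\<tau> \<in> HH"
proof -
 have h: "Im \<tau> > 0" "\<bar>Re \<tau>\<bar> \<le> 1 / 2" "norm \<tau> \<ge> 1" using assms by (auto simp: fundamental_domain_def HH_iff)
 then show "Im \<tau> \<ge> 1 / 2" using cmod_le[of \<tau>] by linarith
 show "\<bar>Re \<tau>\<bar> \<le> 1 / 2" "\<tau> \<in> HH" using h by (auto simp: HH_iff)
qed

text \<open>The domain is covered by unit boxes stacked along the imaginary axis. On the n-th one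
  \<open>u\<close> is at most K exp(-c n), so the integral is dominated by a geometric
  series.\<close>

lemma integrable_fundamental_domain:
 fixes u :: "complex \<Rightarrow> real"
 assumes u: "continuous_on fundamental_domain u" "\<And>\<tau>. \<tau> \<in> fundamental_domain \<Longrightarrow> 0 \<le> u \<tau>"
  and b: "K \<ge> 0" "c > 0" "\<And>\<tau>. \<tau> \<in> fundamental_domain \<Longrightarrow> u \<tau> \<le> K * exp (- (c * Im \<tau>))"
 shows "set_integrable lborel fundamental_domain u" unfolding set_integrable_def
proof (rule integrableI_nonneg)
 let ?F = fundamental_domain
 have "(\<lambda>x. indicator ?F x *\<^sub>R u x) \<in> borel_measurable borel"
  by (rule borel_measurable_continuous_on_indicator[OF _ u(1)]) (simp add: closed_fundamental_domain borel_closed)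
 then show "(\<lambda>x. indicator ?F x *\<^sub>R u x) \<in> borel_measurable lborel" by simp
 show "AE x in lborel. 0 \<le> indicator ?F x *\<^sub>R u x" using u(2) by (auto simp: indicator_def)
 define box where "box n = cbox (Complex (- 1 / 2) (real n)) (Complex (1 / 2) (real n + 1))" for n
 have box1: "emeasure lborel (box n) = 1" for n unfolding box_def by (subst emeasure_lborel_cbox) (auto simp: Basis_complex_def)
 have boxes: "box n \<in> sets lborel" for n by (simp add: box_def)
 have le: "ennreal (indicator ?F x *\<^sub>R u x) \<le> (\<Sum>n. ennreal (K * exp (- c) ^ n) * indicator (box n) x)" for x
 proof (cases "x \<in> ?F")
  case True
  define n where "n = nat \<lfloor>Im x\<rfloor>"
  have h: "Im x \<ge> 1 / 2" "\<bar>Re x\<bar> \<le> 1 / 2" using fundamental_domain_bounds[OF True] by auto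
  then have n: "real n \<le> Im x" "Im x \<le> real n + 1" unfolding n_def by linarith+
  have xb: "x \<in> box n" using h n by (auto simp: box_def cbox_complex_eq abs_le_iff)
  have "c * real n \<le> c * Im x" using n b by simp
  then have "K * exp (- (c * Im x)) \<le> K * exp (- (c * real n))" using b by (intro mult_left_mono) auto
  also have "exp (- (c * real n)) = exp (- c) ^ n" by (simp add: exp_of_nat_mult [symmetric] mult.commute)
  finally have "ennreal (indicator ?F x *\<^sub>R u x) \<le> ennreal (K * exp (- c) ^ n) * indicator (box n) x"
   using b(3)[OF True] True xb by (simp add: ennreal_leI)
  also have "\<dots> \<le> (\<Sum>n. ennreal (K * exp (- c) ^ n) * indicator (box n) x)"
  proof -
   have "\<phi> n \<le> suminf \<phi>" for \<phi> :: "nat \<Rightarrow> ennreal" using sum_le_suminf[of \<phi> "{n}"] by simp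
   then show ?thesis .
  qed
  finally show ?thesis .
 qed simp
 have "(\<integral>\<^sup>+ x. ennreal (indicator ?F x *\<^sub>R u x) \<partial>lborel) \<le> (\<integral>\<^sup>+ x. (\<Sum>n. ennreal (K * exp (- c) ^ n) * indicator (box n) x) \<partial>lborel)"
  by (rule nn_integral_mono) (rule le)
 also have "\<dots> = (\<Sum>n. \<integral>\<^sup>+ x. ennreal (K * exp (- c) ^ n) * indicator (box n) x \<partial>lborel)"
  using boxes by (intro nn_integral_suminf) auto
 also have "\<dots> = (\<Sum>n. ennreal (K * exp (- c) ^ n))" using boxes box1 by (simp add: nn_integral_cmult_indicator)
 also have "\<dots> < \<infinity>"
 proof -
  have "summable (\<lambda>n. K * exp (- c) ^ n)" using b by (intro summable_mult summable_geometric) auto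
  then have "(\<Sum>n. ennreal (K * exp (- c) ^ n)) = ennreal (\<Sum>n. K * exp (- c) ^ n)" using b by (intro suminf_ennreal2) auto
  then show ?thesis by simp
 qed
 finally show "(\<integral>\<^sup>+ x. ennreal (indicator ?F x *\<^sub>R u x) \<partial>lborel) < \<infinity>" .
qed

section \<open>Coset spaces and definiteness\<close>

lemma of_mat_mult: "of_mat (A ** B) = mm (of_mat A) (of_mat B)"
 by (simp add: of_mat_def matrix_matrix_mult_def sum_2)

lemma inj_of_mat: "inj of_mat"
 by (rule injI) (simp add: of_mat_def vec_eq_iff forall_2)

lemma of_mat_r_coset:
 assumes "A \<in> carrier SL2Z"
 shows "of_mat ` (Gamma0 N #>\<^bsub>SL2Z\<^esub> A) = {B \<in> SL2. crel N B (of_mat A)}"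
proof -
 have A: "of_mat A \<in> SL2" using assms by (simp add: SL2Z_iff)
 have "of_mat ` (Gamma0 N #>\<^bsub>SL2Z\<^esub> A) = {mm C (of_mat A) | C. C \<in> G0 N}"
 proof (intro equalityI subsetI)
  fix B assume "B \<in> of_mat ` (Gamma0 N #>\<^bsub>SL2Z\<^esub> A)"
  then obtain C where "C \<in> Gamma0 N" "B = of_mat (C ** A)" by (auto simp: r_coset_def SL2Z_def)
  then show "B \<in> {mm C (of_mat A) | C. C \<in> G0 N}" unfolding of_mat_mult Gamma0_iff by blast
 next
  fix B assume "B \<in> {mm C (of_mat A) | C. C \<in> G0 N}"
  then obtain C where C: "C \<in> G0 N" "B = mm C (of_mat A)" by blast
  then have "to_mat C \<in> Gamma0 N" "B = of_mat (to_mat C ** A)" by (simp_all add: of_mat_mult Gamma0_iff)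
  then show "B \<in> of_mat ` (Gamma0 N #>\<^bsub>SL2Z\<^esub> A)" by (auto simp: r_coset_def SL2Z_def)
 qed
 also have "\<dots> = {B \<in> SL2. crel N B (of_mat A)}"
 proof (intro equalityI subsetI)
  fix B assume "B \<in> {mm C (of_mat A) | C. C \<in> G0 N}"
  then obtain C where C: "C \<in> G0 N" "B = mm C (of_mat A)" by blast
  then show "B \<in> {B \<in> SL2. crel N B (of_mat A)}" using crel_I[OF A C(1)] SL2_mm[OF G0_SL2[OF C(1)] A] by simp
 next
  fix B assume "B \<in> {B \<in> SL2. crel N B (of_mat A)}"
  then obtain C where "C \<in> G0 N" "B = mm C (of_mat A)" using crel_E[OF _ A] by blast
  then show "B \<in> {mm C (of_mat A) | C. C \<in> G0 N}" by blast
 qed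
 finally show ?thesis .
qed

text \<open>\<open>petersson\<close> is a sum over this set, and a sum over an infinite set is 0 by
  convention; finiteness is what gives its vanishing a meaning.\<close>

lemma finite_rcosets:
 assumes "N > 0" shows "finite (rcosets\<^bsub>SL2Z\<^esub> (Gamma0 N))"
proof (rule finite_imageD)
 define cls where "cls A = {B \<in> SL2. crel N B A}" for A
 have "cls A = cls (rep N A)" if "A \<in> SL2" for A
  using that rep_props[OF that, of N] crel_trans crel_sym unfolding cls_def by blast
 then have "cls ` SL2 \<subseteq> cls ` Reps N" unfolding Reps_def by blast
 then have "finite (cls ` SL2)" using finite_Reps[OF assms] finite_surj by blast
 moreover have "(\<lambda>C. of_mat ` C) ` (rcosets\<^bsub>SL2Z\<^esub> (Gamma0 N)) \<subseteq> cls ` SL2"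
  using of_mat_r_coset SL2Z_iff by (auto simp: RCOSETS_def cls_def)
 ultimately show "finite ((\<lambda>C. of_mat ` C) ` (rcosets\<^bsub>SL2Z\<^esub> (Gamma0 N)))" by (rule rev_finite_subset)
 show "inj_on (\<lambda>C. of_mat ` C) (rcosets\<^bsub>SL2Z\<^esub> (Gamma0 N))" using inj_of_mat by (auto intro!: inj_onI simp: inj_image_eq_iff)
qed

text \<open>All terms are nonnegative, so already the term of the trivial coset vanishes. Its
  integrand \<open>u f\<close> is continuous, hence \<open>f\<close> vanishes on a disc inside the
  fundamental domain, and by the identity theorem on the whole half-plane.\<close>

theorem petersson_definite:
 assumes k: "k \<ge> 2" and N: "N > 0" and f: "f \<in> cusp_forms k N" and z: "petersson k N f f = 0" and "\<tau> \<in> HH"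
 shows "f \<tau> = 0"
proof -
 let ?F = fundamental_domain
 define u where "u g \<tau> = (norm (g \<tau>))\<^sup>2 * (Im \<tau> ^ k / Im \<tau> ^ 2)" for g :: "complex \<Rightarrow> complex" and \<tau>
 define I where "I \<gamma> = (LINT x:?F|lborel. u (slash k \<gamma> f) x)" for \<gamma>
 have I0: "I \<gamma> \<ge> 0" for \<gamma> unfolding I_def set_lebesgue_integral_def
  by (rule integral_nonneg_AE) (auto simp: indicator_def u_def fundamental_domain_def HH_iff)
 have eq: "set_lebesgue_integral lborel ?F (\<lambda>\<tau>. slash k \<gamma> f \<tau> * cnj (slash k \<gamma> f \<tau>) * of_real (Im \<tau> ^ k / Im \<tau> ^ 2)) = of_real (I \<gamma>)" for \<gamma>
  unfolding I_def set_integral_complex_of_real [symmetric]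
  by (rule arg_cong[of _ _ "set_lebesgue_integral lborel ?F"]) (auto simp: u_def complex_mult_cnj cmod_power2 fun_eq_iff)
 define CC where "CC = rcosets\<^bsub>SL2Z\<^esub> (Gamma0 N)"
 have "(\<Sum>C\<in>CC. complex_of_real (I (SOME \<gamma>. \<gamma> \<in> C))) = 0" using z unfolding petersson_def Let_def eq CC_def .
 then have s: "(\<Sum>C\<in>CC. I (SOME \<gamma>. \<gamma> \<in> C)) = 0" by (simp only: of_real_sum [symmetric] of_real_eq_0_iff)
 have one: "mat 1 \<in> carrier SL2Z" by (simp add: SL2Z_def)
 have C0: "Gamma0 N \<in> CC"
 proof -
  have "Gamma0 N #>\<^bsub>SL2Z\<^esub> mat 1 = Gamma0 N" by (auto simp: r_coset_def SL2Z_def)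
  then show ?thesis unfolding CC_def RCOSETS_def using one by blast
 qed
 \<comment> \<open>The representative picked by \<open>SOME\<close> is an unknown element of
   \<open>Gamma0 N\<close>; by invariance of \<open>f\<close> it may be treated as the
   identity.\<close>
 define \<gamma> where "\<gamma> = (SOME \<gamma>. \<gamma> \<in> Gamma0 N)"
 have "mat 1 \<in> Gamma0 N" using one by (simp add: Gamma0_def mat_def)
 then have \<gamma>: "\<gamma> \<in> Gamma0 N" unfolding \<gamma>_def by (rule someI)
 have "I \<gamma> = 0" using s I0 C0 finite_rcosets[OF N] unfolding CC_def \<gamma>_def by (simp add: sum_nonneg_eq_0_iff)
 have F: "f holomorphic_on HH" "invariant (int k) N f" using f by (auto simp: cusp_forms_iff)
 have sf: "slash k \<gamma> f x = f x" if "x \<in> HH" for x unfolding slash_eq using invariantD[OF F(2) _ that] \<gamma> Gamma0_iff by blast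
 obtain a where a: "a 0 = 0" "has_q_expansion N a (sl (int k) (1, 0, 0, 1) f)"
  using f SL2_one(1) unfolding cusp_forms_iff by blast
 then have a': "has_q_expansion N a f" by simp
 obtain K c where K: "K \<ge> 0" "c > 0" "\<And>\<tau>. Im \<tau> \<ge> 1 / 2 \<Longrightarrow> u f \<tau> \<le> K * exp (- (c * Im \<tau>))"
  unfolding u_def using cusp_form_square_bound[OF k N a(1) a'] by metis
 have cont: "continuous_on HH (u f)" unfolding u_def using holomorphic_on_imp_continuous_on[OF F(1)]
  by (intro continuous_intros) (auto simp: HH_iff)
 have int: "set_integrable lborel ?F (u f)"
 proof (rule integrable_fundamental_domain[OF _ _ K(1,2)])
  show "continuous_on ?F (u f)" by (rule continuous_on_subset[OF cont]) (auto simp: fundamental_domain_def)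
  show "u f x \<le> K * exp (- (c * Im x))" if "x \<in> ?F" for x using K(3) fundamental_domain_bounds[OF that] by simp
  show "0 \<le> u f x" if "x \<in> ?F" for x using that by (simp add: u_def fundamental_domain_def HH_iff)
 qed
 have "(LINT x:?F|lborel. u f x) = I \<gamma>" unfolding I_def set_lebesgue_integral_def
  by (rule Bochner_Integration.integral_cong) (auto simp: indicator_def u_def sf fundamental_domain_bounds)
 then have "(LINT x|lborel. indicator ?F x *\<^sub>R u f x) = 0" using \<open>I \<gamma> = 0\<close> by (simp add: set_lebesgue_integral_def)
 then have AE: "AE x in lborel. indicator ?F x *\<^sub>R u f x = 0" using int unfolding set_integrable_def
  by (subst (asm) integral_nonneg_eq_0_iff_AE) (auto simp: indicator_def u_def fundamental_domain_def HH_iff)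
 define U where "U = ball (Complex 0 3) (1 / 2)"
 have U: "x \<in> ?F" if "x \<in> U" for x
 proof -
  have "norm (x - Complex 0 3) < 1 / 2" using that by (simp add: U_def dist_norm norm_minus_commute)
  then have h: "\<bar>Re (x - Complex 0 3)\<bar> < 1 / 2" "\<bar>Im (x - Complex 0 3)\<bar> < 1 / 2"
   using abs_Re_le_cmod[of "x - Complex 0 3"] abs_Im_le_cmod[of "x - Complex 0 3"] by linarith+
  then have "\<bar>Re x\<bar> \<le> 1 / 2" and h2: "\<bar>Im x - 3\<bar> < 1 / 2" by auto
  moreover from h2 have "Im x > 2" unfolding abs_less_iff by linarith
  moreover from calculation(3) have "norm x \<ge> 1" using abs_Im_le_cmod[of x] by linarith
  ultimately show ?thesis by (simp add: fundamental_domain_def HH_iff)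
 qed
 define W where "W = {x \<in> U. u f x \<noteq> 0}"
 have "open W"
 proof -
  have "continuous_on U (u f)" using U fundamental_domain_bounds(3) by (intro continuous_on_subset[OF cont]) blast
  then have "open (U \<inter> u f -` (- {0}))" by (intro continuous_open_preimage) (auto simp: U_def)
  moreover have "W = U \<inter> u f -` (- {0})" by (auto simp: W_def)
  ultimately show ?thesis by simp
 qed
 have "AE x in lborel. x \<notin> W" using AE by eventually_elim (auto simp: W_def U)
 then have "W \<in> null_sets lborel" using \<open>open W\<close> by (subst AE_iff_null_sets) auto
 then have "negligible W" by (simp add: negligible_iff_null_sets null_sets_completionI)
 then have "W = {}" using open_not_negligible[OF \<open>open W\<close>] by blast
 then have fU: "f x = 0" if "x \<in> U" for x
  using that fundamental_domain_bounds(3)[OF U[OF that]] by (auto simp: W_def u_def HH_iff)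
 show ?thesis
 proof (rule analytic_continuation_open[of U HH f "\<lambda>_. 0"])
  show "U \<subseteq> HH" using U fundamental_domain_bounds(3) by blast
  show "U \<noteq> {}" by (auto simp: U_def)
  show "connected HH" by (rule convex_connected[OF convex_HH])
 qed (use F fU open_HH \<open>\<tau> \<in> HH\<close> in \<open>auto simp: U_def\<close>)
qed

section \<open>Atkin--Lehner operators on newforms\<close>

lemma cusp_form_q_expansion:
 assumes "f \<in> cusp_forms k N" "N > 0"
 shows "has_q_expansion 1 (q_coeff f) f" "q_coeff f 0 = 0"
proof -
 obtain a where a: "a 0 = 0" "has_q_expansion N a (sl (int k) (1, 0, 0, 1) f)"
  using assms(1) SL2_one(1) unfolding cusp_forms_iff by blast
 have inv: "invariant (int k) N f" using assms(1) by (simp add: cusp_forms_iff)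
 have "f (\<tau> + of_nat 1) = f \<tau>" if "\<tau> \<in> HH" for \<tau>
  using invariantD[OF inv, of "(1, 1, 0, 1)", OF _ that] sl_shift[of "int k" 1 f \<tau>] by (simp add: G0_def SL2_def)
 then have e: "has_q_expansion 1 (\<lambda>n. a (n * N)) f" using q_expansion_descend(1)[of 1 N a f] assms(2) a(2) by simp
 then have "q_coeff f = (\<lambda>n. a (n * N))" by (rule q_coeff_eq)
 then show "has_q_expansion 1 (q_coeff f) f" "q_coeff f 0 = 0" using e a(1) by simp_all
qed

text \<open>Leaving the width unspecified makes the notion stable under sums and affine
  substitutions. For invariant functions the right width is recovered in
  \<open>cusp_formsI\<close>.\<close>

definition cuspidal_at_infinity :: "(complex \<Rightarrow> complex) \<Rightarrow> bool" where
 "cuspidal_at_infinity F \<longleftrightarrow> (\<exists>h>0. \<exists>a. a 0 = 0 \<and> has_q_expansion h a F)"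

lemma cuspidal_cong: "cuspidal_at_infinity F \<Longrightarrow> (\<And>\<tau>. \<tau> \<in> HH \<Longrightarrow> F \<tau> = G \<tau>) \<Longrightarrow> cuspidal_at_infinity G"
 unfolding cuspidal_at_infinity_def using q_expansion_cong by metis

lemma cuspidal_cmult: "cuspidal_at_infinity F \<Longrightarrow> cuspidal_at_infinity (\<lambda>\<tau>. c * F \<tau>)"
 unfolding cuspidal_at_infinity_def
proof (elim exE conjE)
 fix h a assume "0 < h" "a 0 = (0::complex)" "has_q_expansion h a F"
 then show "\<exists>h>0. \<exists>a. a 0 = 0 \<and> has_q_expansion h a (\<lambda>\<tau>. c * F \<tau>)"
  using q_expansion_cmult[of h a F c] by (intro exI[of _ h] conjI exI[of _ "\<lambda>n. c * a n"]) auto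
qed

lemma cuspidal_add:
 assumes "cuspidal_at_infinity F" "cuspidal_at_infinity G"
 shows "cuspidal_at_infinity (\<lambda>\<tau>. F \<tau> + G \<tau>)"
proof -
 obtain h a where F: "h > 0" "a 0 = 0" "has_q_expansion h a F" using assms(1) by (auto simp: cuspidal_at_infinity_def)
 obtain g b where G: "g > 0" "b 0 = 0" "has_q_expansion g b G" using assms(2) by (auto simp: cuspidal_at_infinity_def)
 have "has_q_expansion (h * g) (\<lambda>n. if g dvd n then a (n div g) else 0) F" using q_expansion_refine[OF G(1) F(3)] .
 moreover have "has_q_expansion (h * g) (\<lambda>n. if h dvd n then b (n div h) else 0) G"
  using q_expansion_refine[OF F(1) G(3)] by (simp add: mult.commute)
 ultimately have "has_q_expansion (h * g) (\<lambda>n. (if g dvd n then a (n div g) else 0) + (if h dvd n then b (n div h) else 0)) (\<lambda>\<tau>. F \<tau> + G \<tau>)"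
  by (rule q_expansion_add)
 then show ?thesis unfolding cuspidal_at_infinity_def using F G
  by (intro exI[of _ "h * g"] conjI exI[of _ "\<lambda>n. (if g dvd n then a (n div g) else 0) + (if h dvd n then b (n div h) else 0)"]) auto
qed

lemma cuspidal_sum:
 "finite J \<Longrightarrow> (\<And>i. i \<in> J \<Longrightarrow> cuspidal_at_infinity (F i)) \<Longrightarrow> cuspidal_at_infinity (\<lambda>\<tau>. \<Sum>i\<in>J. F i \<tau>)"
proof (induction J rule: finite_induct)
 case empty
 have "has_q_expansion 1 (\<lambda>n. if n = 0 then 0 else 0) (\<lambda>_. 0)" by (rule q_expansion_const)
 then show ?case unfolding cuspidal_at_infinity_def by (auto intro!: exI[of _ "1::nat"])
next
 case (insert i J)
 then show ?case using cuspidal_add[of "F i" "\<lambda>\<tau>. \<Sum>i\<in>J. F i \<tau>"] by simp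
qed

lemma cuspidal_affine:
 assumes "cuspidal_at_infinity F" "t > 0" "d > 0"
 shows "cuspidal_at_infinity (\<lambda>\<tau>. F ((of_int t * \<tau> + of_int b) / of_int d))"
proof -
 obtain h a where F: "h > 0" "a 0 = 0" "has_q_expansion h a F" using assms(1) by (auto simp: cuspidal_at_infinity_def)
 have td: "nat t > 0" "nat d > 0" "of_nat (nat t) = (of_int t :: complex)" "of_nat (nat d) = (of_int d :: complex)"
  using assms by auto
 from q_expansion_affine[OF td(1,2) F(3), of b]
 have e: "has_q_expansion (h * nat d) (\<lambda>n. if nat t dvd n then a (n div nat t) * qp (h * nat d) (of_int b) ^ (n div nat t) else 0)
   (\<lambda>\<tau>. F ((of_int t * \<tau> + of_int b) / of_int d))" unfolding td(3,4) .
 show ?thesis unfolding cuspidal_at_infinity_def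
  using F td e by (intro exI[of _ "h * nat d"] conjI exI[of _ "\<lambda>n. if nat t dvd n then a (n div nat t) * qp (h * nat d) (of_int b) ^ (n div nat t) else 0"]) auto
qed

lemma cuspidal_sl:
 assumes "\<And>B. B \<in> SL2 \<Longrightarrow> cuspidal_at_infinity (sl w B f)" "mdet A > 0"
 shows "cuspidal_at_infinity (sl w A f)"
proof -
 obtain B a b d where B: "B \<in> SL2" "a > 0" "d > 0" "A = mm B (a, b, 0, d)" using hermite[OF assms(2)] by metis
 have "cuspidal_at_infinity (\<lambda>\<tau>. of_int d powi (- w) * sl w B f ((of_int a * \<tau> + of_int b) / of_int d))"
  by (intro cuspidal_cmult cuspidal_affine assms(1) B)
 then show ?thesis
 proof (rule cuspidal_cong)
  fix \<tau> assume "\<tau> \<in> HH"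
  then have "sl w A f \<tau> = sl w (a, b, 0, d) (sl w B f) \<tau>" unfolding B(4) using B by (intro sl_mm) (auto intro: SL2_det)
  then show "of_int d powi (- w) * sl w B f ((of_int a * \<tau> + of_int b) / of_int d) = sl w A f \<tau>" by (simp add: sl_tri)
 qed
qed

lemma sl_periodic:
 assumes inv: "invariant w M G" and A: "A \<in> SL2" and \<tau>: "\<tau> \<in> HH"
 shows "sl w A G (\<tau> + of_nat M) = sl w A G \<tau>"
proof -
 have "sl w A G (\<tau> + of_nat M) = sl w (1, int M, 0, 1) (sl w A G) \<tau>" by (simp add: sl_shift)
 also have "\<dots> = sl w (mm A (1, int M, 0, 1)) G \<tau>" using A \<tau> by (intro sl_mm [symmetric]) (auto intro: SL2_det)
 also have "\<dots> = sl w A G \<tau>"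
 proof (rule sl_crel[OF inv _ A _ \<tau>])
  show "mm A (1, int M, 0, 1) \<in> SL2" using A SL2_one SL2_mm by blast
  show "crel M (mm A (1, int M, 0, 1)) A" by (cases A) (simp add: crel_def algebra_simps)
 qed
 finally show ?thesis .
qed

lemma cusp_formsI:
 assumes "M > 0" and hol: "G holomorphic_on HH" and off: "\<And>\<tau>. \<tau> \<notin> HH \<Longrightarrow> G \<tau> = 0"
  and inv: "invariant (int k) M G" and c: "\<And>A. A \<in> SL2 \<Longrightarrow> cuspidal_at_infinity (sl (int k) A G)"
 shows "G \<in> cusp_forms k M" unfolding cusp_forms_iff
proof (intro conjI allI impI ballI)
 fix A assume A: "A \<in> SL2"
 obtain h a where a: "h > 0" "a 0 = 0" "has_q_expansion h a (sl (int k) A G)"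
  using c[OF A] by (auto simp: cuspidal_at_infinity_def)
 have "has_q_expansion (M * h) (\<lambda>n. if M dvd n then a (n div M) else 0) (sl (int k) A G)"
  using q_expansion_refine[OF assms(1) a(3)] by (simp add: mult.commute)
 from q_expansion_descend(1)[OF assms(1) a(1) this sl_periodic[OF inv A]] a(2)
 show "\<exists>a. a 0 = 0 \<and> has_q_expansion M a (sl (int k) A G)" by (intro exI conjI) auto
qed (use assms in auto)

lemma cusp_form_cuspidal: "f \<in> cusp_forms k N \<Longrightarrow> N > 0 \<Longrightarrow> A \<in> SL2 \<Longrightarrow> cuspidal_at_infinity (sl (int k) A f)"
 unfolding cusp_forms_iff cuspidal_at_infinity_def by blast

section \<open>Hecke eigenvalues are Fourier coefficients\<close>

lemma sum_periodic_int:
 fixes g :: "int \<Rightarrow> complex"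
 assumes "p > 0" "\<And>x y. [x = y] (mod int p) \<Longrightarrow> g x = g y"
 shows "(\<Sum>j<p. g (b + int j)) = (\<Sum>j<p. g (int j))"
proof -
 define \<phi> where "\<phi> j = nat ((b + int j) mod int p)" for j :: nat
 have \<phi>: "int (\<phi> j) = (b + int j) mod int p" for j using assms(1) by (simp add: \<phi>_def)
 have inj: "inj_on \<phi> {..<p}"
 proof (rule inj_onI)
  fix i j assume ij: "i \<in> {..<p}" "j \<in> {..<p}" "\<phi> i = \<phi> j"
  then have "(b + int i) mod int p = (b + int j) mod int p" using \<phi> by metis
  then have "[b + int i = b + int j] (mod int p)" by (simp add: cong_def)
  then have "[int i = int j] (mod int p)" by (rule cong_add_lcancel[THEN iffD1])
  then show "i = j" using ij by (simp add: cong_def)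
 qed
 have maps: "\<phi> ` {..<p} \<subseteq> {..<p}" using assms(1) by (auto simp: \<phi>_def nat_less_iff)
 have "bij_betw \<phi> {..<p} {..<p}" using inj endo_inj_surj[OF _ maps inj] by (simp add: bij_betw_def)
 then have "(\<Sum>j<p. g (int (\<phi> j))) = (\<Sum>j<p. g (int j))" by (rule sum.reindex_bij_betw)
 moreover have "g (int (\<phi> j)) = g (b + int j)" for j by (rule assms(2)) (simp add: \<phi> cong_def)
 ultimately show ?thesis by simp
qed

lemma power_pred: "k \<ge> 1 \<Longrightarrow> (x::complex) ^ k = x ^ (k - 1) * x"
 by (cases k) auto

lemma root_of_unity_sum:
 assumes "a > 1" "a dvd d"
 shows "(\<Sum>b<d. exp (2 * of_real pi * \<i> / of_nat a) ^ b) = 0"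
proof -
 define z where "z = exp (2 * of_real pi * \<i> / of_nat a)"
 have z1: "z \<noteq> 1"
 proof
  assume "z = 1"
  then obtain n :: int where "Im (2 * of_real pi * \<i> / of_nat a) = of_int (2 * n) * pi" unfolding z_def exp_eq_1 by blast
  then have "2 * pi / real a = of_int (2 * n) * pi" by (simp add: Im_divide_of_nat)
  then have "1 = of_int n * real a" using assms by (simp add: field_simps)
  then have "1 = n * int a" by (metis of_int_1 of_int_eq_iff of_int_mult of_int_of_nat_eq)
  then have "int a dvd 1" by (metis dvd_triv_right)
  then show False using assms by simp
 qed
 have "z ^ a = 1" using assms by (simp add: z_def exp_of_nat_mult [symmetric])
 then have "z ^ d = 1" using assms(2) by (auto simp: power_mult elim!: dvdE)
 then show ?thesis using z1 by (simp add: sum_gp_strict flip: z_def)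
qed

text \<open>The coefficient of q is compared on both sides of T_n f = c f. The term a = 1
  contributes the n-th coefficient of \<open>f\<close>. For a > 1 either a divisibility condition
  fails, or the sum over b runs through full periods of a nontrivial root of unity and
  vanishes.\<close>

theorem hecke_eigenvalue:
 assumes nf: "newform k N f" and N: "N > 0" and n: "n \<ge> 1" and k: "k \<ge> 1" and \<tau>: "\<tau> \<in> HH"
 shows "hecke k N n f \<tau> = q_coeff f n * f \<tau>"
proof -
 have fc: "f \<in> cusp_forms k N" using nf by (simp add: newform_def new_subspace_def)
 define cf where "cf = q_coeff f"
 have e: "has_q_expansion 1 cf f" using cusp_form_q_expansion[OF fc N] by (simp add: cf_def)
 obtain c where c: "\<And>\<tau>. \<tau> \<in> HH \<Longrightarrow> hecke k N n f \<tau> = c * f \<tau>" using nf n unfolding newform_def by blast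
 have c1: "cf 1 = 1" using nf by (simp add: newform_def cf_def)
 define D where "D = {a. a dvd n \<and> coprime a N}"
 have finD: "finite D" unfolding D_def using n by (intro finite_subset[OF _ finite_divisors_nat[of n]]) auto
 define G where "G a b m = (if a dvd m then cf (m div a) * qp (n div a) (of_int (int b)) ^ (m div a) else 0)" for a b m
 define G' where "G' a b m = (if a dvd m then G a b (m div a) else 0) * (1 / of_nat (n div a) ^ k)" for a b m
 have E: "has_q_expansion n (G' a b) (\<lambda>\<tau>. f ((of_nat a * \<tau> + of_nat b) / of_nat (n div a)) / of_nat (n div a) ^ k)"
  if a: "a \<in> D" for a b
 proof -
  have a0: "a > 0" "n div a > 0" "n div a * a = n" using a n by (auto simp: D_def dvd_div_eq_0_iff intro: Nat.gr0I)
  have "has_q_expansion (1 * (n div a)) (G a b) (\<lambda>\<tau>. f ((of_nat a * \<tau> + of_int (int b)) / of_nat (n div a)))"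
   unfolding G_def using q_expansion_affine[OF a0(1,2) e, of "int b"] by (simp only: mult_1)
  from q_expansion_refine[OF a0(1) this]
  have "has_q_expansion n (\<lambda>m. if a dvd m then G a b (m div a) else 0) (\<lambda>\<tau>. f ((of_nat a * \<tau> + of_nat b) / of_nat (n div a)))"
   using a0 by simp
  from q_expansion_cmult[OF this, of "1 / of_nat (n div a) ^ k"] show ?thesis by (rule q_expansion_cong) (auto simp: G'_def)
 qed
 have H: "has_q_expansion n (\<lambda>m. of_nat n ^ (k - 1) * (\<Sum>a\<in>D. \<Sum>b<n div a. G' a b m)) (hecke k N n f)"
  unfolding hecke_def [abs_def] D_def [symmetric] by (intro q_expansion_cmult q_expansion_sum E finD) auto
 have "has_q_expansion n (\<lambda>m. c * (if n dvd m then cf (m div n) else 0)) (\<lambda>\<tau>. c * f \<tau>)"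
  using q_expansion_cmult[OF q_expansion_refine[OF _ e, of n]] n by simp
 then have "has_q_expansion n (\<lambda>m. c * (if n dvd m then cf (m div n) else 0)) (hecke k N n f)"
  by (rule q_expansion_cong) (use c in auto)
 then have "(\<lambda>m. of_nat n ^ (k - 1) * (\<Sum>a\<in>D. \<Sum>b<n div a. G' a b m)) = (\<lambda>m. c * (if n dvd m then cf (m div n) else 0))"
  by (intro q_expansion_unique[OF _ H]) (use n in auto)
 \<comment> \<open>All expansions are written in width \<open>n\<close>, so the coefficient of q is
   the one with index \<open>n\<close>.\<close>
 then have "of_nat n ^ (k - 1) * (\<Sum>a\<in>D. \<Sum>b<n div a. G' a b n) = c * (if n dvd n then cf (n div n) else 0)" by (rule fun_cong)
 then have "c = of_nat n ^ (k - 1) * (\<Sum>a\<in>D. \<Sum>b<n div a. G' a b n)" using n c1 by simp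
 also have "(\<Sum>a\<in>D. \<Sum>b<n div a. G' a b n) = (\<Sum>a\<in>D. if a = 1 then of_nat n * cf n / of_nat n ^ k else 0)"
 proof (rule sum.cong)
  fix a assume a: "a \<in> D"
  then have an: "a dvd n" "a > 0" "n div a > 0" using n by (auto simp: D_def dvd_div_eq_0_iff intro: Nat.gr0I)
  define d where "d = n div a"
  have dd: "d > 0" using an by (simp add: d_def)
  have G': "G' a b n = (if a dvd d then cf (d div a) * qp d (of_int (int b)) ^ (d div a) else 0) * (1 / of_nat d ^ k)" for b
   using an by (simp add: G'_def G_def d_def)
  show "(\<Sum>b<n div a. G' a b n) = (if a = 1 then of_nat n * cf n / of_nat n ^ k else 0)"
  proof (cases "a = 1")
   case True
   have "qp d (of_nat b) ^ d = 1" for b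
   proof -
    show ?thesis using qp_root[OF dd, of "int b"] by simp
   qed
   then have "G' a b n = cf d * (1 / of_nat d ^ k)" for b unfolding G' using True by simp
   then show ?thesis using True by (simp add: d_def)
  next
   case False
   then have a1: "a > 1" using an by simp
   show ?thesis
   proof (cases "a dvd d")
    case True
    then have da: "d div a > 0" "d div a * a = d" using dd by (auto simp: dvd_div_eq_0_iff intro: Nat.gr0I)
    have "qp d (of_int (int b)) ^ (d div a) = exp (2 * of_real pi * \<i> / of_nat a) ^ b" for b
    proof -
     have "of_nat d = (of_nat (d div a) * of_nat a :: complex)" using da(2) by (metis of_nat_mult)
     then have "2 * of_real pi * \<i> * of_nat (d div a) * of_nat b / of_nat d = of_nat b * (2 * of_real pi * \<i> / of_nat a)"
      using da an by (simp add: field_simps)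
     then show ?thesis unfolding exp_of_nat_mult [symmetric]
      using qp_power[of "d div a" "of_nat b" d] by (simp only: of_int_of_nat_eq)
    qed
    then have g: "G' a b n = cf (d div a) * (1 / of_nat d ^ k) * exp (2 * of_real pi * \<i> / of_nat a) ^ b" for b
     unfolding G' using True by simp
    have "(\<Sum>b<d. G' a b n) = cf (d div a) * (1 / of_nat d ^ k) * (\<Sum>b<d. exp (2 * of_real pi * \<i> / of_nat a) ^ b)"
     by (simp only: g sum_distrib_left)
    then show ?thesis using False root_of_unity_sum[OF a1 True] by (simp add: d_def)
   next
    case f: False
    then show ?thesis using False by (simp add: G')
   qed
  qed
 qed simp
 also have "\<dots> = of_nat n * cf n / of_nat n ^ k" using finD by (simp add: sum.delta' D_def)
 also have "of_nat n ^ (k - 1) * (of_nat n * cf n / of_nat n ^ k) = cf n"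
 proof -
  have "of_nat n ^ k = (of_nat n ^ (k - 1) * of_nat n :: complex)" using k by (intro power_pred)
  then show ?thesis using n by simp
 qed
 finally show ?thesis using c[OF \<tau>] by (simp add: cf_def)
qed

text \<open>
  For a prime \<open>p\<close> exactly dividing \<open>N = p M\<close>, the matrix \<open>W = (p x, y; N, p)\<close> with \<open>p x - M y = 1\<close>
 represents the Atkin--Lehner operator; the slash operator is not normalised by the determinant.
 The trace \<open>G\<close> of \<open>f|W\<close> to level \<open>M\<close> is a combination of \<open>f|W\<close> and \<open>U\<^sub>p f = c f\<close>. Applying \<open>W\<close>
 once more expresses a multiple of \<open>f\<close> through \<open>G(\<tau>)\<close> and \<open>G(p\<tau>)\<close>, so \<open>f\<close> would be an oldform
 unless \<open>c\<^sup>2 = p\<^bsup>k-2\<^esup>\<close>.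
\<close>

locale atkin_lehner =
 fixes k N p M :: nat and f :: "complex \<Rightarrow> complex" and x y :: int
 assumes k: "k \<ge> 2" and N: "N = p * M" and p: "Factorial_Ring.prime p" and cop: "coprime p M" and M: "M > 0"
  and nf: "newform k N f" and xy: "int p * x - int M * y = 1"
begin

definition W :: mat2 where "W = (int p * x, y, int N, int p)"

lemma p0: "p > 0" using p by (simp add: prime_gt_0_nat)

lemma N0: "N > 0" using p0 M N by simp

lemma W_alt: "W = (int p * x, y, int p * int M, int p)"
 unfolding W_def by (simp add: N)

lemma mdet_W: "mdet W = int p"
proof -
 have "mdet W = int p * (int p * x - int M * y)" by (simp add: W_alt algebra_simps)
 then show ?thesis by (simp add: xy)
qed

lemma mdet_W_pos: "mdet W > 0" using mdet_W p0 by simp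

lemma f_cusp: "f \<in> cusp_forms k N" using nf by (simp add: newform_def new_subspace_def)

lemma f_inv: "invariant (int k) N f" using f_cusp by (simp add: cusp_forms_iff)

definition c where "c = q_coeff f p"

lemma W_normalizes:
 assumes "A \<in> G0 N"
 obtains A' where "A' \<in> G0 N" "mm W A = mm A' W"
proof -
 obtain a b e d where A: "A = (a, b, int N * e, d)" using assms by (cases A) (auto simp: G0_def elim!: dvdE)
 have det: "a * d - b * (int N * e) = 1" using assms by (simp add: A G0_def SL2_def)
 define P Q where "P = int p" and "Q = int M"
 have r: "P * x - Q * y = 1" using xy by (simp add: P_def Q_def)
 have NN: "int N = P * Q" by (simp add: N P_def Q_def)
 \<comment> \<open>These are the entries of W A W^(-1), with the division by det W = p carried out
   by means of N = P Q.\<close>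
 define A' where "A' = (P * x * a + y * P * Q * e - (P * x * b + y * d) * Q, - x * a * y - y * y * Q * e + (P * x * b + y * d) * x,
   P * Q * (a + P * e - Q * b - d), - (Q * a + P * Q * e) * y + (P * Q * b + P * d) * x)"
 have eq: "mm W A = mm A' W"
 proof -
  have "(P * x * a + y * P * Q * e - (P * x * b + y * d) * Q) * (P * x) + (- x * a * y - y * y * Q * e + (P * x * b + y * d) * x) * (P * Q)
    = (P * x * a + y * (P * Q * e)) * (P * x - Q * y)" by (simp add: algebra_simps)
  moreover have "(P * x * a + y * P * Q * e - (P * x * b + y * d) * Q) * y + (- x * a * y - y * y * Q * e + (P * x * b + y * d) * x) * P
    = (P * x * b + y * d) * (P * x - Q * y)" by (simp add: algebra_simps)
  moreover have "P * Q * (a + P * e - Q * b - d) * (P * x) + (- (Q * a + P * Q * e) * y + (P * Q * b + P * d) * x) * (P * Q)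
    = (P * Q * a + P * (P * Q * e)) * (P * x - Q * y)" by (simp add: algebra_simps)
  moreover have "P * Q * (a + P * e - Q * b - d) * y + (- (Q * a + P * Q * e) * y + (P * Q * b + P * d) * x) * P
    = (P * Q * b + P * d) * (P * x - Q * y)" by (simp add: algebra_simps)
  moreover have "mm W A = (P * x * a + y * (P * Q * e), P * x * b + y * d, P * Q * a + P * (P * Q * e), P * Q * b + P * d)"
   by (simp add: W_alt A NN flip: P_def Q_def)
  moreover have "mm A' W = ((P * x * a + y * P * Q * e - (P * x * b + y * d) * Q) * (P * x) + (- x * a * y - y * y * Q * e + (P * x * b + y * d) * x) * (P * Q),
   (P * x * a + y * P * Q * e - (P * x * b + y * d) * Q) * y + (- x * a * y - y * y * Q * e + (P * x * b + y * d) * x) * P,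
   P * Q * (a + P * e - Q * b - d) * (P * x) + (- (Q * a + P * Q * e) * y + (P * Q * b + P * d) * x) * (P * Q),
   P * Q * (a + P * e - Q * b - d) * y + (- (Q * a + P * Q * e) * y + (P * Q * b + P * d) * x) * P)"
   unfolding A'_def W_alt P_def [symmetric] Q_def [symmetric] by (simp only: mm.simps)
  ultimately show ?thesis by (simp only: r mult_1_right)
 qed
 have "mdet W * mdet A = mdet A' * mdet W" using arg_cong[OF eq, of mdet] by (simp add: mdet_mm)
 moreover have "mdet A = 1" using det by (simp add: A)
 ultimately have "mdet A' = 1" using mdet_W_pos by simp
 then have "A' \<in> G0 N" by (simp add: G0_def SL2_def) (simp add: A'_def NN)
 then show thesis using that eq by blast
qed

definition g where "g = sl (int k) W f"

lemma g_inv: "invariant (int k) N g"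
 unfolding invariant_def
proof (intro ballI)
 fix A \<tau> assume A: "A \<in> G0 N" and \<tau>: "\<tau> \<in> HH"
 obtain A' where A': "A' \<in> G0 N" "mm W A = mm A' W" using W_normalizes[OF A] .
 have dA: "mdet A > 0" "mdet A' > 0" using A A' G0_SL2 SL2_det by blast+
 have "sl (int k) A g \<tau> = sl (int k) (mm W A) f \<tau>" unfolding g_def by (rule sl_mm [symmetric, OF mdet_W_pos dA(1) \<tau>])
 also have "\<dots> = sl (int k) W (sl (int k) A' f) \<tau>" unfolding A'(2) by (rule sl_mm[OF dA(2) mdet_W_pos \<tau>])
 also have "\<dots> = g \<tau>" unfolding g_def by (rule sl_cong[OF mdet_W_pos \<tau>]) (rule invariantD[OF f_inv A'(1)])
 finally show "sl (int k) A g \<tau> = g \<tau>" .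
qed

text \<open>The square of \<open>W\<close> is p times an element of \<open>G0 N\<close>, and the
  scalar p acts as p^(-k).\<close>

lemma g_W: assumes \<tau>: "\<tau> \<in> HH" shows "sl (int k) W g \<tau> = f \<tau> / of_nat p ^ k"
proof -
 define P Q where "P = int p" and "Q = int M"
 have r: "P * x - Q * y = 1" using xy by (simp add: P_def Q_def)
 have NN: "int N = P * Q" by (simp add: N P_def Q_def)
 define B where "B = (P * x * x + y * Q, x * y + y, P * Q * (x + 1), Q * y + P)"
 have eq: "mm W W = mm (P, 0, 0, P) B" unfolding W_alt P_def [symmetric] Q_def [symmetric] B_def by (simp add: algebra_simps)
 have "(P * x * x + y * Q) * (Q * y + P) - (x * y + y) * (P * Q * (x + 1)) = (P * x - Q * y) * (P * x - Q * y)"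
  by (simp add: algebra_simps)
 then have "(P * x * x + y * Q) * (Q * y + P) - (x * y + y) * (P * Q * (x + 1)) = 1" by (simp add: r)
 then have B: "B \<in> G0 N" by (simp add: B_def G0_def SL2_def NN)
 have dB: "mdet B > 0" using B G0_SL2 SL2_det by blast
 have dP: "mdet (P, 0, 0, P) > 0" using p0 by (simp add: P_def)
 have "sl (int k) W g \<tau> = sl (int k) (mm W W) f \<tau>" unfolding g_def by (rule sl_mm [symmetric, OF mdet_W_pos mdet_W_pos \<tau>])
 also have "\<dots> = sl (int k) B (sl (int k) (P, 0, 0, P) f) \<tau>" unfolding eq by (rule sl_mm[OF dP dB \<tau>])
 also have "\<dots> = sl (int k) B (\<lambda>\<tau>. (1 / of_nat p ^ k) * f \<tau>) \<tau>"
  by (rule sl_cong[OF dB \<tau>]) (use p0 in \<open>simp add: sl_def P_def power_int_minus field_simps\<close>)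
 also have "\<dots> = (1 / of_nat p ^ k) * sl (int k) B f \<tau>" by (rule sl_linear(3))
 finally show ?thesis using invariantD[OF f_inv B \<tau>] by simp
qed

lemma Up_f: assumes \<tau>: "\<tau> \<in> HH" shows "(\<Sum>b<p. f ((\<tau> + of_nat b) / of_nat p)) = of_nat p * c * f \<tau>"
proof -
 have D: "{a. a dvd p \<and> coprime a N} = {1}" using p N by (auto simp: prime_nat_iff dest: coprime_common_divisor[of p N p])
 have "hecke k N p f \<tau> = of_nat p ^ (k - 1) * (\<Sum>b<p. f ((\<tau> + of_nat b) / of_nat p) / of_nat p ^ k)" unfolding hecke_def D by simp
 also have "\<dots> = (of_nat p ^ (k - 1) / of_nat p ^ k) * (\<Sum>b<p. f ((\<tau> + of_nat b) / of_nat p))"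
  by (simp add: sum_divide_distrib [symmetric])
 also have "of_nat p ^ k = (of_nat p ^ (k - 1) * of_nat p :: complex)" using k by (intro power_pred) simp
 finally have "hecke k N p f \<tau> = (1 / of_nat p) * (\<Sum>b<p. f ((\<tau> + of_nat b) / of_nat p))" using p0 by simp
 moreover have "hecke k N p f \<tau> = c * f \<tau>" unfolding c_def using hecke_eigenvalue[OF nf N0 _ _ \<tau>, of p] p0 k by simp
 ultimately show ?thesis using p0 by (simp add: field_simps)
qed

text \<open>This is the trace of \<open>g\<close> from level N to level M, as \<open>trace_g\<close>
  shows. The value 0 off the half-plane is what \<open>cusp_forms\<close> demands.\<close>

definition G where "G \<tau> = (if \<tau> \<in> HH then g \<tau> + c / of_nat p ^ (k - 1) * f \<tau> else 0)"

text \<open>Of the p + 1 cosets of \<open>G0 N\<close> in \<open>G0 M\<close>, the trivial one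
  contributes \<open>g\<close>. On the others W g0 T^j equals an element of \<open>G0 N\<close>
  times (1, b + j; 0, p), so together they form the sum defining U_p f, up to a power of p.\<close>

lemma trace_g: assumes \<tau>: "\<tau> \<in> HH" shows "trace (int k) N M g \<tau> = G \<tau>"
proof -
 define g0 :: mat2 where "g0 = (1, 0, int M, 1)"
 have g0: "g0 \<in> SL2" "int M dvd m21 g0" "coprime (m21 g0) (int p)" using cop by (auto simp: g0_def SL2_def coprime_commute)
 define R1 where "R1 = {R \<in> Reps N. int N dvd m21 R \<and> coprime (m21 R) (int 1)}"
 define R2 where "R2 = {R \<in> Reps N. int M dvd m21 R \<and> coprime (m21 R) (int p)}"
 have R1: "R1 = {rep N (1, 0, 0, 1)}"
  unfolding R1_def using Reps_of_type(1)[of N N 1 "(1, 0, 0, 1)"] N0 SL2_one(1) by (simp add: lessThan_Suc)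
 have R2: "R2 = (\<lambda>j. rep N (mm g0 (1, int j, 0, 1))) ` {..<p}" "inj_on (\<lambda>j. rep N (mm g0 (1, int j, 0, 1))) {..<p}"
  unfolding R2_def using Reps_of_type[of N M p g0] g0 N0 N cop by (simp_all add: coprime_commute mult.commute)
 have un: "relReps N M = R1 \<union> R2"
 proof (intro equalityI subsetI)
  fix R assume "R \<in> relReps N M"
  then have R: "R \<in> Reps N" "int M dvd m21 R" by (auto simp: relReps_def G0_def)
  show "R \<in> R1 \<union> R2"
  proof (cases "int p dvd m21 R")
   case True
   then have "int p * int M dvd m21 R" using R cop by (intro divides_mult) auto
   then show ?thesis using R by (simp add: R1_def N)
  next
   case False
   have "Factorial_Ring.prime (int p)" using p by simp
   then have "coprime (m21 R) (int p)" using False prime_imp_coprime coprime_commute by blast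
   then show ?thesis using R by (simp add: R2_def)
  qed
 next
  fix R assume "R \<in> R1 \<union> R2"
  moreover have "int M dvd int N" by (simp add: N)
  ultimately show "R \<in> relReps N M" using Reps_SL2 by (auto simp: R1_def R2_def relReps_def G0_def intro: dvd_trans)
 qed
 have disj: "R1 \<inter> R2 = {}"
 proof (rule ccontr)
  assume "R1 \<inter> R2 \<noteq> {}"
  then obtain R where R: "int N dvd m21 R" "coprime (m21 R) (int p)" by (auto simp: R1_def R2_def)
  have "int p dvd m21 R" using R(1) by (auto simp: N intro: dvd_trans[of "int p" "int p * int M"])
  then have "is_unit (int p)" using R(2) by (meson coprime_common_divisor dvd_refl)
  then show False using p by (auto dest: prime_gt_1_nat)
 qed
 have "trace (int k) N M g \<tau> = (\<Sum>R\<in>R1. sl (int k) R g \<tau>) + (\<Sum>R\<in>R2. sl (int k) R g \<tau>)"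
  unfolding trace_def un by (rule sum.union_disjoint) (use disj in \<open>auto simp: R1 R2(1)\<close>)
 also have "(\<Sum>R\<in>R1. sl (int k) R g \<tau>) = g \<tau>" unfolding R1 using sl_rep[OF g_inv SL2_one(1) \<tau>] by simp
 also have "(\<Sum>R\<in>R2. sl (int k) R g \<tau>) = (\<Sum>j<p. sl (int k) (rep N (mm g0 (1, int j, 0, 1))) g \<tau>)"
  unfolding R2(1) by (subst sum.reindex[OF R2(2)]) simp
 also have "\<dots> = (\<Sum>j<p. sl (int k) (mm g0 (1, int j, 0, 1)) g \<tau>)" by (intro sum.cong sl_rep[OF g_inv _ \<tau>] SL2_mm g0 SL2_one) simp
 also have "\<dots> = c / of_nat p ^ (k - 1) * f \<tau>"
 proof -
  define A where "A = mm W g0"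
  have A: "mdet A = int p" by (simp add: A_def mdet_mm mdet_W g0_def)
  have Aent: "fst A = int p * x + y * int M" "m21 A = 2 * int N"
  proof -
   show "fst A = int p * x + y * int M" by (simp add: A_def W_alt g0_def)
   have "m21 A = 2 * (int p * int M)" by (simp add: A_def W_alt g0_def)
   then show "m21 A = 2 * int N" by (simp add: N)
  qed
  have Adet: "mdet A > 0" using A p0 by simp
  obtain B a b d where B: "B \<in> SL2" "a > 0" "d > 0" "a * d = mdet A" "A = mm B (a, b, 0, d)" "m21 A = m21 B * a"
   using hermite[OF Adet] by metis
  \<comment> \<open>As a divisor of p, \<open>a\<close> is 1 or p. The upper left entry of W g0 is p
    x + y M, which p does not divide because y M is congruent to -1.\<close>
  have a1: "a = 1"
  proof -
   have a_dvd: "a dvd fst A"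
   proof -
    have "fst A = fst B * a" unfolding B(5) by (cases B) simp
    then show ?thesis by simp
   qed
   have "a dvd int p" using B(4) A by (metis dvd_triv_left)
   moreover have "\<not> int p dvd fst A"
   proof
    assume "int p dvd fst A"
    then have "int p dvd y * int M" unfolding Aent by (simp add: dvd_add_right_iff)
    then have "int p dvd int p * x - int M * y" by (simp add: mult.commute)
    then show False unfolding xy using p by (auto dest: prime_gt_1_nat)
   qed
   ultimately have "a dvd int p" "a \<noteq> int p" using a_dvd by auto
   moreover have "\<forall>m. 0 \<le> m \<and> m dvd int p \<longrightarrow> m = 1 \<or> m = int p" using p prime_int_iff[of "int p"] by simp
   from this[rule_format, of a] have "a dvd int p \<Longrightarrow> a = 1 \<or> a = int p" using B(2) by simp
   ultimately show ?thesis by blast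
  qed
  have d: "d = int p" using B(4) a1 A by simp
  have "m21 B = 2 * int N" using B(6) a1 Aent(2) by simp
  then have BN: "B \<in> G0 N" using B(1) by (simp add: G0_def)
  have T: "sl (int k) (mm g0 (1, j, 0, 1)) g \<tau> = f ((\<tau> + of_int (b + j)) / of_nat p) / of_nat p ^ k" for j
  proof -
   have "sl (int k) (mm g0 (1, j, 0, 1)) g \<tau> = sl (int k) (mm W (mm g0 (1, j, 0, 1))) f \<tau>"
    unfolding g_def by (rule sl_mm [symmetric, OF mdet_W_pos _ \<tau>]) (simp add: mdet_mm g0_def)
   also have "mm W (mm g0 (1, j, 0, 1)) = mm B (1, b + j, 0, int p)"
   proof -
    have WB: "mm W g0 = mm B (1, b, 0, int p)" using B(5) a1 d by (simp only: A_def)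
    have "mm W (mm g0 (1, j, 0, 1)) = mm (mm W g0) (1, j, 0, 1)" by (rule mm_assoc [symmetric])
    also have "\<dots> = mm B (mm (1, b, 0, int p) (1, j, 0, 1))" unfolding WB by (rule mm_assoc)
    also have "mm (1, b, 0, int p) (1, j, 0, 1) = (1, b + j, 0, int p)" by (simp add: add.commute)
    finally show ?thesis .
   qed
   also have "sl (int k) (mm B (1, b + j, 0, int p)) f \<tau> = sl (int k) (1, b + j, 0, int p) (sl (int k) B f) \<tau>"
    by (rule sl_mm[OF SL2_det[OF B(1)] _ \<tau>]) (use p0 in simp)
   also have "\<dots> = sl (int k) (1, b + j, 0, int p) f \<tau>" by (rule sl_cong[OF _ \<tau>]) (use p0 invariantD[OF f_inv BN] in auto)
   finally show ?thesis by (simp add: sl_tri power_int_minus divide_inverse)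
  qed
  have per: "f (\<tau>' + of_int j) = f \<tau>'" if "\<tau>' \<in> HH" for \<tau>' j
   using invariantD[OF f_inv, of "(1, j, 0, 1)", OF _ that] by (simp add: sl_shift G0_def SL2_def)
  have "(\<Sum>j<p. sl (int k) (mm g0 (1, int j, 0, 1)) g \<tau>) = (\<Sum>j<p. f ((\<tau> + of_int (b + int j)) / of_nat p) / of_nat p ^ k)"
   by (simp only: T)
  also have "\<dots> = (\<Sum>j<p. f ((\<tau> + of_int (int j)) / of_nat p) / of_nat p ^ k)"
  proof (rule sum_periodic_int[OF p0])
   fix u v :: int assume "[u = v] (mod int p)"
   then obtain q where q: "u = v + int p * q" by (metis cong_iff_lin cong_sym)
   have "(\<tau> + of_int u) / of_nat p = (\<tau> + of_int v) / of_nat p + of_int q" using p0 by (simp add: q field_simps)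
   moreover have "(\<tau> + of_int v) / of_nat p \<in> HH" using \<tau> p0 by (simp add: HH_iff Im_divide_of_nat)
   ultimately show "f ((\<tau> + of_int u) / of_nat p) / of_nat p ^ k = f ((\<tau> + of_int v) / of_nat p) / of_nat p ^ k" using per by simp
  qed
  also have "\<dots> = (of_nat p * c * f \<tau>) / of_nat p ^ k" using Up_f[OF \<tau>] by (simp add: sum_divide_distrib [symmetric])
  also have "of_nat p ^ k = (of_nat p ^ (k - 1) * of_nat p :: complex)" using k by (intro power_pred) simp
  finally show ?thesis using p0 by simp
 qed
 finally show ?thesis using \<tau> by (simp add: G_def)
qed

lemma G_inv: "invariant (int k) M G"
proof -
 have "invariant (int k) M (trace (int k) N M g)" by (rule trace_invariant[OF g_inv N0]) (simp add: N)
 note t = this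
 show ?thesis unfolding invariant_def
 proof (intro ballI)
  fix A \<tau> assume A: "A \<in> G0 M" and \<tau>: "\<tau> \<in> HH"
  have "sl (int k) A G \<tau> = sl (int k) A (trace (int k) N M g) \<tau>"
   by (rule sl_cong[OF SL2_det[OF G0_SL2[OF A]] \<tau>]) (simp add: trace_g)
  then show "sl (int k) A G \<tau> = G \<tau>" using invariantD[OF t A \<tau>] trace_g[OF \<tau>] by simp
 qed
qed

lemma G_cusp: "G \<in> cusp_forms k M"
proof (rule cusp_formsI[OF M _ _ G_inv])
 have fh: "f holomorphic_on HH" using f_cusp by (simp add: cusp_forms_iff)
 then have "(\<lambda>\<tau>. g \<tau> + c / of_nat p ^ (k - 1) * f \<tau>) holomorphic_on HH"
  unfolding g_def by (intro holomorphic_intros sl_holomorphic mdet_W_pos)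
 then show "G holomorphic_on HH" by (rule holomorphic_transform) (simp add: G_def)
 show "G \<tau> = 0" if "\<tau> \<notin> HH" for \<tau> using that by (simp add: G_def)
 fix A assume A: "A \<in> SL2"
 have c1: "cuspidal_at_infinity (sl (int k) (mm W A) f)"
  by (rule cuspidal_sl[OF cusp_form_cuspidal[OF f_cusp N0]]) (use A mdet_W_pos in \<open>auto simp: mdet_mm SL2_def\<close>)
 have c2: "cuspidal_at_infinity (sl (int k) A f)" by (rule cusp_form_cuspidal[OF f_cusp N0 A])
 from cuspidal_add[OF c1 cuspidal_cmult[OF c2, of "c / of_nat p ^ (k - 1)"]]
 show "cuspidal_at_infinity (sl (int k) A G)"
 proof (rule cuspidal_cong)
  fix \<tau> assume \<tau>: "\<tau> \<in> HH"
  have "sl (int k) A G \<tau> = sl (int k) A (\<lambda>\<tau>. g \<tau> + c / of_nat p ^ (k - 1) * f \<tau>) \<tau>"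
   by (rule sl_cong[OF SL2_det[OF A] \<tau>]) (simp add: G_def)
  also have "\<dots> = sl (int k) A g \<tau> + c / of_nat p ^ (k - 1) * sl (int k) A f \<tau>" by (simp only: sl_linear(1,3))
  also have "sl (int k) A g \<tau> = sl (int k) (mm W A) f \<tau>"
   unfolding g_def by (rule sl_mm [symmetric, OF mdet_W_pos SL2_det[OF A] \<tau>])
  finally show "sl (int k) (mm W A) f \<tau> + c / of_nat p ^ (k - 1) * sl (int k) A f \<tau> = sl (int k) A G \<tau>" by simp
 qed
qed

text \<open>\<open>W\<close> factors as an element of \<open>G0 M\<close> times diag(p, 1), so on
  forms of level M it acts as the substitution p \<tau>.\<close>

lemma G_W: assumes \<tau>: "\<tau> \<in> HH" shows "sl (int k) W G \<tau> = G (of_nat p * \<tau>)"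
proof -
 define B where "B = (x, y, int M, int p)"
 have B: "B \<in> G0 M" using xy by (simp add: B_def G0_def SL2_def algebra_simps)
 have W: "W = mm B (int p, 0, 0, 1)" by (simp add: W_alt B_def mult.commute)
 have "sl (int k) W G \<tau> = sl (int k) (int p, 0, 0, 1) (sl (int k) B G) \<tau>"
  unfolding W by (rule sl_mm[OF SL2_det[OF G0_SL2[OF B]] _ \<tau>]) (use p0 in simp)
 also have "\<dots> = sl (int k) (int p, 0, 0, 1) G \<tau>" by (rule sl_cong[OF _ \<tau>]) (use p0 invariantD[OF G_inv B] in auto)
 finally show ?thesis by (simp add: sl_tri)
qed

lemma key_relation:
 assumes \<tau>: "\<tau> \<in> HH"
 shows "G (of_nat p * \<tau>) = (1 / of_nat p ^ k - (c / of_nat p ^ (k - 1))\<^sup>2) * f \<tau> + c / of_nat p ^ (k - 1) * G \<tau>"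
proof -
 define r where "r = c / of_nat p ^ (k - 1)"
 have "G (of_nat p * \<tau>) = sl (int k) W (\<lambda>\<tau>. g \<tau> + r * f \<tau>) \<tau>"
  unfolding G_W[OF \<tau>, symmetric] by (rule sl_cong[OF mdet_W_pos \<tau>]) (simp add: G_def r_def)
 also have "\<dots> = f \<tau> / of_nat p ^ k + r * g \<tau>" using g_W[OF \<tau>] by (simp only: sl_linear(1,3)) (simp add: g_def)
 also have "g \<tau> = G \<tau> - r * f \<tau>" using \<tau> by (simp add: G_def r_def)
 finally show ?thesis unfolding r_def [symmetric] by (simp add: algebra_simps power2_eq_square)
qed

lemma f_nonzero: "\<exists>\<tau>\<in>HH. f \<tau> \<noteq> 0"
proof (rule ccontr)
 assume "\<not> ?thesis"
 then have z: "f \<tau> = 0" if "\<tau> \<in> HH" for \<tau> using that by blast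
 have "has_q_expansion 1 (\<lambda>n. if n = 0 then 0 else 0) f" by (rule q_expansion_cong[OF q_expansion_const[of 1 0]]) (use z in auto)
 then have "q_coeff f 1 = 0" by (simp add: q_coeff_eq)
 then show False using nf by (simp add: newform_def)
qed

theorem c_squared: "c\<^sup>2 = of_nat p ^ (k - 2)"
proof (rule ccontr)
 assume ne: "c\<^sup>2 \<noteq> of_nat p ^ (k - 2)"
 define r where "r = c / of_nat p ^ (k - 1)"
 define s where "s = 1 / of_nat p ^ k - r\<^sup>2"
 have s0: "s \<noteq> 0"
 proof
  assume "s = 0"
  then have "r\<^sup>2 = 1 / of_nat p ^ k" by (simp add: s_def)
  then have "c\<^sup>2 * of_nat p ^ k = (of_nat p ^ (k - 1))\<^sup>2" using p0 by (simp add: r_def power_divide field_simps)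
  moreover have "(of_nat p ^ (k - 1))\<^sup>2 = (of_nat p ^ (k - 2) * of_nat p ^ k :: complex)"
   unfolding power_mult [symmetric] power_add [symmetric] using k by (intro arg_cong[of _ _ "\<lambda>n. of_nat p ^ n"]) simp
  ultimately show False using ne p0 by simp
 qed
 interpret fm: Modules.module "\<lambda>(c::complex) (g :: complex \<Rightarrow> complex) \<tau>. c * g \<tau>"
  by unfold_locales (auto simp: fun_eq_iff algebra_simps)
 have gen: "A_op d G \<in> {A_op d g | d g M. M dvd N \<and> M \<noteq> N \<and> d dvd N div M \<and> g \<in> cusp_forms k M}" if "d dvd p" for d
 proof -
  have "M dvd N" "M \<noteq> N" "N div M = p" using N M p0 prime_gt_1_nat[OF p] by auto
  then show ?thesis using G_cusp that by blast
 qed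
 have "(\<lambda>\<tau>. (1 / s) * A_op p G \<tau>) - (\<lambda>\<tau>. (r / s) * A_op 1 G \<tau>) \<in> old_subspace k N" unfolding old_subspace_def
  by (intro fm.span_diff fm.span_scale fm.span_base gen) auto
 moreover have "(\<lambda>\<tau>. (1 / s) * A_op p G \<tau>) - (\<lambda>\<tau>. (r / s) * A_op 1 G \<tau>) = f"
 proof
  fix \<tau>
  show "((\<lambda>\<tau>. (1 / s) * A_op p G \<tau>) - (\<lambda>\<tau>. (r / s) * A_op 1 G \<tau>)) \<tau> = f \<tau>"
  proof (cases "\<tau> \<in> HH")
   case True
   have "G (of_nat p * \<tau>) - r * G \<tau> = s * f \<tau>" using key_relation[OF True] by (simp add: s_def r_def)
   then have "(G (of_nat p * \<tau>) - r * G \<tau>) / s = f \<tau>" using s0 by simp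
   then show ?thesis by (simp add: A_op_def diff_divide_distrib)
  next
   case False
   then have "of_nat p * \<tau> \<notin> HH" using p0 by (simp add: HH_iff zero_less_mult_iff)
   moreover have "f \<tau> = 0" using f_cusp False by (simp add: cusp_forms_iff)
   ultimately show ?thesis using False by (simp add: A_op_def G_def)
  qed
 qed
 ultimately have "f \<in> old_subspace k N" by simp
 then have "petersson k N f f = 0" using nf by (simp add: newform_def new_subspace_def)
 then have "\<forall>\<tau>\<in>HH. f \<tau> = 0" using petersson_definite[OF k N0 f_cusp] by blast
 then show False using f_nonzero by blast
qed

text \<open>Now the coefficient of \<open>f\<close> in \<open>key_relation\<close> is 0, so G(p
  \<tau>) = r G(\<tau>) with r nonzero. For the coefficients this reads b(n/p) = r b(n), and
  together with b(0) = 0 it forces G = 0, that is f|W = - r f.\<close>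

theorem f_W: assumes \<tau>: "\<tau> \<in> HH" shows "sl (int k) W f \<tau> = - (c / of_nat p ^ (k - 1)) * f \<tau>"
proof -
 define r where "r = c / of_nat p ^ (k - 1)"
 have "r\<^sup>2 = 1 / of_nat p ^ k"
 proof -
  have "(of_nat p ^ (k - 1))\<^sup>2 = (of_nat p ^ (k - 2) * of_nat p ^ k :: complex)"
   unfolding power_mult [symmetric] power_add [symmetric] using k by (intro arg_cong[of _ _ "\<lambda>n. of_nat p ^ n"]) simp
  then show ?thesis using p0 by (simp add: r_def power_divide c_squared)
 qed
 then have r0: "r \<noteq> 0" using p0 by auto
 have GG: "G (of_nat p * \<tau>) = r * G \<tau>" if "\<tau> \<in> HH" for \<tau> using key_relation[OF that] \<open>r\<^sup>2 = _\<close> by (simp add: r_def)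
 define b where "b = q_coeff G"
 have b: "has_q_expansion 1 b G" "b 0 = 0" using cusp_form_q_expansion[OF G_cusp M] by (simp_all add: b_def)
 have "has_q_expansion 1 (\<lambda>n. if p dvd n then b (n div p) else 0) (\<lambda>\<tau>. r * G \<tau>)"
  by (rule q_expansion_cong[OF q_expansion_scale[OF p0 b(1)]]) (use GG in auto)
 from q_expansion_unique[OF zero_less_one this q_expansion_cmult[OF b(1)]]
 have rec: "(if p dvd n then b (n div p) else 0) = r * b n" for n by (rule fun_cong)
 have "b n = 0" for n
 proof (induction n rule: less_induct)
  case (less n)
  show ?case
  proof (cases "n = 0 \<or> \<not> p dvd n")
   case True
   then show ?thesis using b(2) rec[of n] r0 by auto
  next
   case False
   then have "n div p < n" using prime_gt_1_nat[OF p] by (intro div_less_dividend) auto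
   then show ?thesis using less rec[of n] r0 False by simp
  qed
 qed
 then have "(\<lambda>n. b n * qp 1 \<tau> ^ n) = (\<lambda>_. 0)" by simp
 then have "(\<lambda>_. 0) sums G \<tau>" using q_expansionD[OF b(1) \<tau>] by (simp only:)
 then have "G \<tau> = 0" using sums_unique2[OF _ sums_zero] by blast
 then show ?thesis using \<tau> by (simp add: G_def g_def r_def add_eq_0_iff2)
qed

end

section \<open>Valuation rings of the complex numbers\<close>

definition is_subring :: "complex set \<Rightarrow> bool" where
 "is_subring A \<longleftrightarrow> 1 \<in> A \<and> (\<forall>x\<in>A. \<forall>y\<in>A. x - y \<in> A \<and> x * y \<in> A)"

lemma is_subringD:
 assumes "is_subring A"
 shows "1 \<in> A" "0 \<in> A" "x \<in> A \<Longrightarrow> y \<in> A \<Longrightarrow> x - y \<in> A" "x \<in> A \<Longrightarrow> y \<in> A \<Longrightarrow> x * y \<in> A"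
  "x \<in> A \<Longrightarrow> - x \<in> A" "x \<in> A \<Longrightarrow> y \<in> A \<Longrightarrow> x + y \<in> A"
proof -
 show 1: "1 \<in> A" and d: "\<And>x y. x \<in> A \<Longrightarrow> y \<in> A \<Longrightarrow> x - y \<in> A"
  and m: "x \<in> A \<Longrightarrow> y \<in> A \<Longrightarrow> x * y \<in> A" for x y using assms by (auto simp: is_subring_def)
 show 0: "0 \<in> A" using d[OF 1 1] by simp
 show n: "- x \<in> A" if "x \<in> A" for x using d[OF 0 that] by simp
 show "x + y \<in> A" if "x \<in> A" "y \<in> A" using d[OF that(1) n[OF that(2)]] by simp
qed

lemma is_subring_sum: "is_subring A \<Longrightarrow> (\<And>i. i \<in> J \<Longrightarrow> f i \<in> A) \<Longrightarrow> (\<Sum>i\<in>J. f i) \<in> A"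
 by (induction J rule: infinite_finite_induct) (auto intro: is_subringD)

lemma is_subring_power: "is_subring A \<Longrightarrow> x \<in> A \<Longrightarrow> x ^ n \<in> A"
 by (induction n) (auto intro: is_subringD)

text \<open>The ideal generated by \<open>L\<close> in the ring \<open>A\<close>. Membership is
  built up from finitely many elements of \<open>A\<close>, which is what lets it pass to unions of
  chains.\<close>

inductive_set extended_ideal :: "complex set \<Rightarrow> complex set \<Rightarrow> complex set" for L A where
 zero: "0 \<in> extended_ideal L A"
| step: "x \<in> extended_ideal L A \<Longrightarrow> l \<in> L \<Longrightarrow> a \<in> A \<Longrightarrow> l * a + x \<in> extended_ideal L A"

lemma extended_ideal_add:
 assumes "x \<in> extended_ideal L A" "y \<in> extended_ideal L A"
 shows "x + y \<in> extended_ideal L A" using assms(1) by (induction) (auto simp: add.assoc intro: assms(2) extended_ideal.step)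

lemma extended_ideal_mult:
 assumes "is_subring A" "x \<in> extended_ideal L A" "y \<in> A"
 shows "y * x \<in> extended_ideal L A" using assms(2)
proof induction
 case (step x l a)
 have "l * (y * a) + y * x \<in> extended_ideal L A" using step assms by (intro extended_ideal.step) (auto intro: is_subringD)
 then show ?case by (simp add: algebra_simps)
qed (auto intro: extended_ideal.zero)

lemma extended_ideal_uminus:
 "is_subring A \<Longrightarrow> x \<in> extended_ideal L A \<Longrightarrow> - x \<in> extended_ideal L A"
 using extended_ideal_mult[of A x L "- 1"] is_subringD(1,5)[of A] by auto

lemma extended_ideal_sum:
 "(\<And>i. i \<in> J \<Longrightarrow> f i \<in> extended_ideal L A) \<Longrightarrow> (\<Sum>i\<in>J. f i) \<in> extended_ideal L A"
 by (induction J rule: infinite_finite_induct) (auto intro: extended_ideal.zero extended_ideal_add)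

lemma extended_ideal_mono: "A \<subseteq> B \<Longrightarrow> extended_ideal L A \<subseteq> extended_ideal L B"
proof
 fix x assume "A \<subseteq> B" "x \<in> extended_ideal L A"
 from this(2) show "x \<in> extended_ideal L B" by induction (use \<open>A \<subseteq> B\<close> in \<open>auto intro: extended_ideal.intros\<close>)
qed

lemma extended_ideal_subset: "is_subring A \<Longrightarrow> L \<subseteq> A \<Longrightarrow> extended_ideal L A \<subseteq> A"
proof
 fix x assume A: "is_subring A" "L \<subseteq> A" "x \<in> extended_ideal L A"
 from A(3) show "x \<in> A" by induction (use A(1,2) in \<open>auto intro!: is_subringD(6)[OF A(1)] is_subringD(4)[OF A(1)] is_subringD(2)[OF A(1)]\<close>)
qed

definition adjoin :: "complex set \<Rightarrow> complex \<Rightarrow> complex set" where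
 "adjoin A x = {poly p x | p. \<forall>i. Polynomial.coeff p i \<in> A}"

lemma adjoin_subring: assumes "is_subring A" shows "is_subring (adjoin A x)"
 unfolding is_subring_def
proof (intro conjI ballI)
 have "\<forall>i. Polynomial.coeff (1 :: complex poly) i \<in> A" using is_subringD(1,2)[OF assms] by (auto simp: coeff_1)
 then show "1 \<in> adjoin A x" unfolding adjoin_def by (auto intro!: exI[of _ 1])
 fix u v assume "u \<in> adjoin A x" "v \<in> adjoin A x"
 then obtain p q where p: "u = poly p x" "\<forall>i. Polynomial.coeff p i \<in> A" and q: "v = poly q x" "\<forall>i. Polynomial.coeff q i \<in> A"
  unfolding adjoin_def by blast
 have "\<forall>i. Polynomial.coeff (p - q) i \<in> A" using p q assms by (auto intro: is_subringD)
 then show "u - v \<in> adjoin A x" unfolding adjoin_def p(1) q(1) by (auto intro!: exI[of _ "p - q"])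
 have "\<forall>i. Polynomial.coeff (p * q) i \<in> A" using p q assms by (auto simp: coeff_mult intro!: is_subring_sum is_subringD(4))
 then show "u * v \<in> adjoin A x" unfolding adjoin_def p(1) q(1) by (auto intro!: exI[of _ "p * q"])
qed

lemma adjoin_subset: assumes "is_subring A" shows "A \<subseteq> adjoin A x"
proof
 fix a assume "a \<in> A"
 then have "\<forall>i. Polynomial.coeff [:a:] i \<in> A" using is_subringD(2)[OF assms] by (auto simp: coeff_pCons split: nat.splits)
 then show "a \<in> adjoin A x" unfolding adjoin_def by (auto intro!: exI[of _ "[:a:]"])
qed

lemma adjoin_mem: assumes "is_subring A" shows "x \<in> adjoin A x"
proof -
 have "\<forall>i. Polynomial.coeff [:0, 1:] i \<in> A" using is_subringD(1,2)[OF assms] by (auto simp: coeff_pCons split: nat.splits)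
 then show "x \<in> adjoin A x" unfolding adjoin_def by (auto intro!: exI[of _ "[:0, 1:]"])
qed

lemma extended_ideal_adjoin:
 assumes "is_subring A" "y \<in> extended_ideal L (adjoin A x)"
 shows "\<exists>n c. (\<forall>i. c i \<in> extended_ideal L A) \<and> y = (\<Sum>i\<le>n. c i * x ^ i)"
proof -
 from assms(2) have "\<exists>p. (\<forall>i. Polynomial.coeff p i \<in> extended_ideal L A) \<and> y = poly p x"
 proof induction
  case zero
  then show ?case by (auto intro!: exI[of _ 0] extended_ideal.zero)
 next
  case (step y l a)
  then obtain p where p: "\<forall>i. Polynomial.coeff p i \<in> extended_ideal L A" "y = poly p x" by blast
  obtain q where q: "\<forall>i. Polynomial.coeff q i \<in> A" "a = poly q x" using step(3) unfolding adjoin_def by blast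
  have "\<forall>i. Polynomial.coeff (Polynomial.smult l q + p) i \<in> extended_ideal L A"
   using p q step(2) by (auto intro: extended_ideal.step)
  then show ?case using p q by (intro exI[of _ "Polynomial.smult l q + p"]) auto
 qed
 then obtain p where "\<forall>i. Polynomial.coeff p i \<in> extended_ideal L A" "y = poly p x" by blast
 then show ?thesis by (intro exI[of _ "Polynomial.degree p"] exI[of _ "Polynomial.coeff p"]) (auto simp: poly_altdef)
qed

text \<open>The relation for \<open>inverse x\<close>, multiplied by x^n and divided by the unit 1 -
  b 0, expresses x^n through lower powers with coefficients in the ideal. Substituting this removes
  the top term of the relation for \<open>x\<close>.\<close>

lemma lower_degree_relation:
 fixes x :: complex
 assumes A: "is_subring A" "L \<subseteq> A" and un: "\<And>y. y \<in> extended_ideal L A \<Longrightarrow> 1 - y \<noteq> 0 \<and> inverse (1 - y) \<in> A"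
  and c: "\<forall>i. c i \<in> extended_ideal L A" "(\<Sum>i\<le>n. c i * x ^ i) = 1"
  and b: "\<forall>i. b i \<in> extended_ideal L A" "(\<Sum>i\<le>m. b i * inverse x ^ i) = 1"
  and "m \<le> n" "n > 0" "x \<noteq> 0"
 shows "\<exists>c. (\<forall>i. c i \<in> extended_ideal L A) \<and> (\<Sum>i\<le>n - 1. c i * x ^ i) = 1"
proof -
 define v where "v = inverse (1 - b 0)"
 have v: "v \<in> A" "1 - b 0 \<noteq> 0" using un[of "b 0"] b(1) by (auto simp: v_def)
 define b' where "b' j = (if j \<le> m then v * b j else 0)" for j
 have b': "b' j \<in> extended_ideal L A" for j
  using b(1) v A(1) by (auto simp: b'_def intro: extended_ideal_mult extended_ideal.zero)
 have "(\<Sum>i\<le>m. b i * inverse x ^ i) = b 0 + (\<Sum>i\<in>{1..m}. b i * inverse x ^ i)" by (simp add: atMost_atLeast0 sum.atLeast_Suc_atMost)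
 then have "(\<Sum>i\<in>{1..m}. b i * inverse x ^ i) = 1 - b 0" using b(2) by (simp add: algebra_simps)
 then have "(\<Sum>i\<in>{1..m}. v * b i * inverse x ^ i) = 1" using v by (simp add: v_def sum_distrib_left [symmetric] mult.assoc)
 moreover have "(\<Sum>i\<in>{1..n}. b' i * inverse x ^ i) = (\<Sum>i\<in>{1..m}. v * b i * inverse x ^ i)"
  using \<open>m \<le> n\<close> by (intro sum.mono_neutral_cong_right) (auto simp: b'_def)
 ultimately have one: "(\<Sum>i\<in>{1..n}. b' i * inverse x ^ i) = 1" by simp
 define c' where "c' i = c i + c n * b' (n - i)" for i
 have "(\<Sum>i\<in>{1..n}. b' i * inverse x ^ i) * x ^ n = (\<Sum>i\<in>{1..n}. b' i * x ^ (n - i))" unfolding sum_distrib_right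
 proof (rule sum.cong)
  fix i assume "i \<in> {1..n}"
  then have "x ^ n = x ^ (n - i) * x ^ i" by (simp add: power_add [symmetric])
  then show "b' i * inverse x ^ i * x ^ n = b' i * x ^ (n - i)" using \<open>x \<noteq> 0\<close> by (simp add: power_inverse)
 qed simp
 also have "\<dots> = (\<Sum>i<n. b' (n - i) * x ^ i)" by (rule sum.reindex_bij_witness[of _ "\<lambda>i. n - i" "\<lambda>i. n - i"]) auto
 finally have xn: "x ^ n = (\<Sum>i<n. b' (n - i) * x ^ i)" using one by simp
 have "{..n} = insert n {..<n}" by auto
 then have "(\<Sum>i\<le>n. c i * x ^ i) = c n * x ^ n + (\<Sum>i<n. c i * x ^ i)" by simp
 moreover have "(\<Sum>i<n. c' i * x ^ i) = (\<Sum>i<n. c i * x ^ i) + c n * (\<Sum>i<n. b' (n - i) * x ^ i)"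
  by (simp add: c'_def ring_distribs sum.distrib sum_distrib_left mult.assoc)
 ultimately have "(\<Sum>i<n. c' i * x ^ i) = 1" using c(2) xn by (simp add: add.commute)
 moreover have "{..<n} = {..n - 1}" using \<open>n > 0\<close> by auto
 moreover have "\<forall>i. c' i \<in> extended_ideal L A"
 proof
  fix i
  have "b' (n - i) * c n \<in> extended_ideal L A"
   using b'[of "n - i"] c(1) A extended_ideal_subset[OF A] by (intro extended_ideal_mult) auto
  then show "c' i \<in> extended_ideal L A" unfolding c'_def using c(1) by (simp add: extended_ideal_add mult.commute)
 qed
 ultimately show ?thesis by (intro exI[of _ c']) simp
qed

text \<open>Chevalley's extension theorem. A subring maximal among those in which \<open>L\<close>
  does not generate the unit ideal contains x or 1/x: otherwise \<open>L\<close> generates the unit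
  ideal after adjoining either of them, and two such relations of least degree contradict
  \<open>lower_degree_relation\<close>.\<close>

theorem exists_valuation_ring:
 assumes R: "is_subring R" "1 \<notin> extended_ideal L R" and LR: "L \<subseteq> R"
 obtains V where "is_subring V" "R \<subseteq> V" "1 \<notin> extended_ideal L V" "\<And>x. x \<notin> V \<Longrightarrow> inverse x \<in> V"
proof -
 define AA where "AA = {A. is_subring A \<and> R \<subseteq> A \<and> 1 \<notin> extended_ideal L A}"
 have "\<exists>V\<in>AA. \<forall>A\<in>AA. V \<subseteq> A \<longrightarrow> A = V"
 proof (rule subset_Zorn_nonempty)
  show "AA \<noteq> {}" using R by (auto simp: AA_def)
  fix C assume ne: "C \<noteq> {}" and ch: "subset.chain AA C"
  then have CA: "C \<subseteq> AA" and tot: "\<And>A B. A \<in> C \<Longrightarrow> B \<in> C \<Longrightarrow> A \<subseteq> B \<or> B \<subseteq> A" by (auto simp: subset_chain_def)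
  have sr: "is_subring A" if "A \<in> C" for A using CA that by (auto simp: AA_def)
  have "is_subring (\<Union>C)" unfolding is_subring_def
  proof (intro conjI ballI)
   show "1 \<in> \<Union>C" using ne sr is_subringD(1) by blast
   fix x y assume "x \<in> \<Union>C" "y \<in> \<Union>C"
   then obtain A B where AB: "A \<in> C" "x \<in> A" "B \<in> C" "y \<in> B" by blast
   then obtain D where D: "D \<in> C" "x \<in> D" "y \<in> D" using tot[of A B] by blast
   show "x - y \<in> \<Union>C" "x * y \<in> \<Union>C" using D is_subringD(3,4)[OF sr[OF D(1)]] by blast+
  qed
  moreover have "R \<subseteq> \<Union>C" using ne CA by (auto simp: AA_def)
  moreover have "\<exists>A\<in>C. x \<in> extended_ideal L A" if "x \<in> extended_ideal L (\<Union>C)" for x using that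
  proof induction
   case zero
   then show ?case using ne extended_ideal.zero by blast
  next
   case (step x l a)
   then obtain A B where AB: "A \<in> C" "x \<in> extended_ideal L A" "B \<in> C" "a \<in> B" by blast
   then obtain D where D: "D \<in> C" "A \<subseteq> D" "B \<subseteq> D" using tot[of A B] by blast
   have "x \<in> extended_ideal L D" "a \<in> D" using AB D extended_ideal_mono by blast+
   then show ?case using D(1) step(2) extended_ideal.step by blast
  qed
  then have "1 \<notin> extended_ideal L (\<Union>C)" using CA by (auto simp: AA_def)
  ultimately show "\<Union>C \<in> AA" by (simp add: AA_def)
 qed
 then obtain V where V: "is_subring V" "R \<subseteq> V" and oneV: "1 \<notin> extended_ideal L V"
  and maxV: "\<And>A. A \<in> AA \<Longrightarrow> V \<subseteq> A \<Longrightarrow> A = V" by (auto simp: AA_def)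
 define I where "I = extended_ideal L V"
 have rel: "\<exists>n c. (\<forall>i. c i \<in> I) \<and> (\<Sum>i\<le>n. c i * x ^ i) = 1" if "x \<notin> V" for x
 proof -
  have "adjoin V x \<notin> AA" using maxV[of "adjoin V x"] adjoin_subset[OF V(1)] adjoin_mem[OF V(1)] that by blast
  then have "1 \<in> extended_ideal L (adjoin V x)" using adjoin_subring[OF V(1)] adjoin_subset[OF V(1)] V(2) by (auto simp: AA_def)
  from extended_ideal_adjoin[OF V(1) this] show ?thesis unfolding I_def by (metis (no_types))
 qed
 \<comment> \<open>Put d = 1 - y. If 1/d were not in \<open>V\<close>, the relation obtained by
   adjoining it would give d^n in \<open>I\<close>, while d is congruent to 1 modulo
   \<open>I\<close>.\<close>
 have un: "1 - y \<noteq> 0 \<and> inverse (1 - y) \<in> V" if y: "y \<in> extended_ideal L V" for y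
 proof
  show d: "1 - y \<noteq> 0" using y oneV by auto
  show "inverse (1 - y) \<in> V"
  proof (rule ccontr)
   assume "inverse (1 - y) \<notin> V"
   then obtain n c where c: "\<forall>i. c i \<in> I" "(\<Sum>i\<le>n. c i * inverse (1 - y) ^ i) = 1" using rel by blast
   define d where "d = 1 - y"
   have yV: "y \<in> V" using y extended_ideal_subset[OF V(1)] LR V(2) by blast
   have dV: "d \<in> V" using yV is_subringD(1,3)[OF V(1)] by (auto simp: d_def)
   have "d \<noteq> 0" using d by (simp add: d_def)
   have "(\<Sum>i\<le>n. c i * inverse d ^ i) * d ^ n = (\<Sum>i\<le>n. d ^ (n - i) * c i)" unfolding sum_distrib_right
   proof (rule sum.cong)
    fix i assume "i \<in> {..n}"
    then have "d ^ n = d ^ (n - i) * d ^ i" by (simp add: power_add [symmetric])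
    then show "c i * inverse d ^ i * d ^ n = d ^ (n - i) * c i" using \<open>d \<noteq> 0\<close> by (simp add: power_inverse)
   qed simp
   also have "\<dots> \<in> I" unfolding I_def using c(1) dV
    by (intro extended_ideal_sum extended_ideal_mult[OF V(1)] is_subring_power[OF V(1)]) (auto simp: I_def)
   finally have dn: "d ^ n \<in> I" using c(2) by (simp add: d_def)
   have "1 - d ^ n = (\<Sum>i<n. d ^ i) * y" by (simp add: one_diff_power_eq d_def)
   also have "\<dots> \<in> I"
    unfolding I_def using dV y by (intro extended_ideal_mult[OF V(1)] is_subring_sum[OF V(1)] is_subring_power[OF V(1)])
   finally have "(1 - d ^ n) + d ^ n \<in> I" using dn unfolding I_def by (intro extended_ideal_add)
   then show False using oneV by (simp add: I_def)
  qed
 qed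
 have dich: "inverse x \<in> V" if x: "x \<notin> V" for x
 proof (rule ccontr)
  assume ix: "inverse x \<notin> V"
  have x0: "x \<noteq> 0" using x is_subringD(2)[OF V(1)] by blast
  define Q where "Q x n \<longleftrightarrow> (\<exists>c. (\<forall>i. c i \<in> I) \<and> (\<Sum>i\<le>n. c i * x ^ i) = 1)" for x :: complex and n
  have Q1: "\<exists>n. Q x n" "\<exists>n. Q (inverse x) n" using rel[OF x] rel[OF ix] by (auto simp: Q_def)
  have Q0: "\<not> Q z 0" for z
  proof
   assume "Q z 0"
   then obtain c :: "nat \<Rightarrow> complex" where "\<forall>i. c i \<in> I" "c 0 = 1" by (auto simp: Q_def)
   then show False using oneV by (metis I_def)
  qed
  have lower: "Q z (n - 1)" if zn: "Q z n" "Q (inverse z) m" "m \<le> n" "n > 0" "z \<noteq> 0" for z n m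
  proof -
   obtain c where c: "\<forall>i. c i \<in> I" "(\<Sum>i\<le>n. c i * z ^ i) = 1" using zn(1) by (auto simp: Q_def)
   obtain b where b: "\<forall>i. b i \<in> I" "(\<Sum>i\<le>m. b i * inverse z ^ i) = 1" using zn(2) by (auto simp: Q_def)
   show ?thesis unfolding Q_def I_def
    by (rule lower_degree_relation[OF V(1) _ un _ c(2) _ b(2)]) (use c b zn LR V(2) in \<open>auto simp: I_def\<close>)
  qed
  define n1 n2 where "n1 = (LEAST n. Q x n)" and "n2 = (LEAST n. Q (inverse x) n)"
  have n: "Q x n1" "Q (inverse x) n2" unfolding n1_def n2_def using Q1 by (auto intro: LeastI_ex)
  have pos: "n1 > 0" "n2 > 0" using n Q0 by (metis gr0I)+
  show False
  proof (cases "n2 \<le> n1")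
   case True
   then have "Q x (n1 - 1)" using lower[OF n(1,2)] pos x0 by blast
   then have "n1 \<le> n1 - 1" unfolding n1_def by (rule Least_le)
   then show False using pos by simp
  next
   case False
   then have "Q (inverse x) (n2 - 1)" using lower[OF n(2), of n1] n(1) pos x0 by simp
   then have "n2 \<le> n2 - 1" unfolding n2_def by (rule Least_le)
   then show False using pos by simp
  qed
 qed
 show thesis by (rule that[OF V oneV dich])
qed

section \<open>Units and nonunits of a valuation ring\<close>

locale complex_valuation_ring =
 fixes V :: "complex set"
 assumes subring: "is_subring V" and dichotomy: "x \<notin> V \<Longrightarrow> inverse x \<in> V"
begin

definition mx :: "complex set" where "mx = {x \<in> V. x = 0 \<or> inverse x \<notin> V}"

lemmas V_intros = is_subringD[OF subring] is_subring_sum[OF subring] is_subring_power[OF subring]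

lemma mx_subset: "mx \<subseteq> V" by (auto simp: mx_def)

lemma mx_0: "0 \<in> mx" using V_intros(2) by (simp add: mx_def)

lemma one_notin_mx: "1 \<notin> mx" using V_intros(1) by (simp add: mx_def)

lemma unitD: "x \<in> V \<Longrightarrow> x \<notin> mx \<Longrightarrow> inverse x \<in> V" by (auto simp: mx_def)

lemma inverse_mx: assumes "x \<notin> V" shows "inverse x \<in> mx"
 using assms dichotomy[OF assms] V_intros(2) by (auto simp: mx_def)

lemma mx_mult: assumes "x \<in> V" "y \<in> mx" shows "x * y \<in> mx"
proof (cases "x * y = 0")
 case False
 have "inverse (x * y) \<notin> V"
 proof
  assume "inverse (x * y) \<in> V"
  then have "x * inverse (x * y) \<in> V" using assms V_intros(4) by blast
  moreover have "x * inverse (x * y) = inverse y" using False by (simp add: field_simps)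
  ultimately have "inverse y \<in> V" by (simp only:)
  then show False using assms False by (auto simp: mx_def)
 qed
 then show ?thesis using assms V_intros(4) by (auto simp: mx_def)
qed (use mx_0 in \<open>auto simp only:\<close>)

lemma mx_uminus: "x \<in> mx \<Longrightarrow> - x \<in> mx"
 using mx_mult[of "- 1" x] V_intros(1,5) by auto

lemma mx_add_aux: assumes "x \<in> mx" "y \<in> mx" "x / y \<in> V" shows "x + y \<in> mx"
proof (cases "y = 0")
 case False
 then have "x + y = (x / y + 1) * y" by (simp add: field_simps)
 then show ?thesis using mx_mult[OF V_intros(6)[OF assms(3) V_intros(1)] assms(2)] by simp
qed (use assms in simp)

lemma mx_add: assumes "x \<in> mx" "y \<in> mx" shows "x + y \<in> mx"
proof (cases "x / y \<in> V")
 case False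
 then have "y / x \<in> V" using dichotomy[OF False] by simp
 then show ?thesis using mx_add_aux[OF assms(2,1)] by (simp add: add.commute)
qed (use assms mx_add_aux in blast)

lemma mx_diff: "x \<in> mx \<Longrightarrow> y \<in> mx \<Longrightarrow> x - y \<in> mx"
 using mx_add[of x "- y"] mx_uminus by simp

lemma mx_sum: "(\<And>i. i \<in> J \<Longrightarrow> f i \<in> mx) \<Longrightarrow> (\<Sum>i\<in>J. f i) \<in> mx"
 by (induction J rule: infinite_finite_induct) (auto intro: mx_0 mx_add)

lemma unit_mult_notin_mx: assumes "x \<in> V" "x \<notin> mx" "y \<notin> mx" shows "x * y \<notin> mx"
proof
 assume "x * y \<in> mx"
 then have "inverse x * (x * y) \<in> mx" using unitD[OF assms(1,2)] mx_mult by blast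
 moreover have "x \<noteq> 0" using assms mx_0 by auto
 then have "inverse x * (x * y) = y" by (simp add: mult.assoc [symmetric])
 ultimately show False using assms(3) by (simp only:)
qed

text \<open>The case X^n - a of integral closedness. Its purpose is that \<open>V\<close> contains
  all roots of unity, which occur in the expansions at the cusps.\<close>

lemma root_in_V: assumes "x ^ n \<in> V" "n > 0" shows "x \<in> V"
proof (rule ccontr)
 assume x: "x \<notin> V"
 then have ix: "inverse x \<in> mx" by (rule inverse_mx)
 have "x \<noteq> 0" using x V_intros(2) by auto
 have "inverse x ^ n \<in> mx" using ix \<open>n > 0\<close> mx_mult[OF V_intros(8)[of "inverse x" "n - 1"], of "inverse x"] mx_subset
  by (cases n) (auto simp: mult.commute)
 then have "x ^ n * inverse x ^ n \<in> mx" using assms mx_mult by blast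
 then show False using \<open>x \<noteq> 0\<close> one_notin_mx by (simp add: power_inverse)
qed

lemma root_of_unity_in_V: assumes "x ^ n = 1" "n > 0" shows "x \<in> V" "x \<notin> mx"
proof -
 show "x \<in> V" using root_in_V[of x n] assms V_intros(1) by simp
 show "x \<notin> mx"
 proof
  assume "x \<in> mx"
  then have "x ^ (n - 1) * x \<in> mx" using mx_mult V_intros(8) mx_subset by blast
  moreover have "x ^ (n - 1) * x = x ^ n" using \<open>n > 0\<close> by (cases n) auto
  ultimately show False using assms one_notin_mx by simp
 qed
qed

lemma of_nat_in_V: "of_nat n \<in> V" by (induction n) (auto intro: V_intros)

lemma of_int_in_V: "of_int n \<in> V"
 by (cases n rule: int_cases2) (auto intro!: V_intros of_nat_in_V)

text \<open>An element of least valuation in a finite family. Division by it makes a linear relation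
  primitive: all coefficients lie in \<open>V\<close> and one of them is 1.\<close>

lemma dominating_element:
 assumes "finite J" "j0 \<in> J" "c j0 \<noteq> 0"
 shows "\<exists>j\<in>J. c j \<noteq> 0 \<and> (\<forall>i\<in>J. c i / c j \<in> V)" using assms
proof (induction J arbitrary: j0 rule: finite_induct)
 case (insert k J)
 show ?case
 proof (cases "\<exists>j\<in>J. c j \<noteq> 0")
  case False
  then have "c k \<noteq> 0" using insert by auto
  then show ?thesis using False V_intros(1,2) by (intro bexI[of _ k]) auto
 next
  case True
  then obtain j where j: "j \<in> J" "c j \<noteq> 0" "\<forall>i\<in>J. c i / c j \<in> V" using insert.IH by blast
  show ?thesis
  proof (cases "c k / c j \<in> V")
   case True
   then show ?thesis using j by (intro bexI[of _ j]) auto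
  next
   case False
   then have jk: "c j / c k \<in> V" "c k \<noteq> 0" using dichotomy[OF False] V_intros(2) by auto
   have "c i / c k \<in> V" if "i \<in> J" for i
   proof -
    have "c i / c k = (c i / c j) * (c j / c k)" using j by simp
    then show ?thesis using V_intros(4)[OF _ jk(1), of "c i / c j"] j that by simp
   qed
   then show ?thesis using jk V_intros(1) by (intro bexI[of _ k]) auto
  qed
 qed
qed simp

end

section \<open>Eisenstein series\<close>

lemma q_expansion_deriv:
 assumes "h > 0" "has_q_expansion h a f"
 obtains f' where "\<And>\<tau>. \<tau> \<in> HH \<Longrightarrow> (f has_field_derivative f' \<tau>) (at \<tau>)"
  "has_q_expansion h (\<lambda>n. 2 * of_real pi * \<i> * of_nat n / of_nat h * a n) f'"
proof -
 define P where "P z = (\<Sum>n. a n * z ^ n)" for z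
 define Q where "Q z = (\<Sum>n. diffs a n * z ^ n)" for z
 define f' where "f' \<tau> = Q (qp h \<tau>) * (2 * of_real pi * \<i> / of_nat h * qp h \<tau>)" for \<tau>
 have sm: "summable (\<lambda>n. a n * z ^ n)" if "norm z < 1" for z by (rule summable_norm_cancel[OF q_series_summable[OF assms that]])
 have dP: "(P has_field_derivative Q z) (at z)" if "norm z < 1" for z
  unfolding P_def Q_def by (rule termdiffs_strong'[of 1]) (use sm that in auto)
 have sQ: "(\<lambda>n. diffs a n * z ^ n) sums Q z" if "norm z < 1" for z
  by (rule termdiffs_sums_strong[of 1 a P, OF _ dP]) (use sm that in \<open>auto simp: P_def intro: summable_sums\<close>)
 have fP: "f \<tau> = P (qp h \<tau>)" if "\<tau> \<in> HH" for \<tau> using q_expansionD[OF assms(2) that] by (simp add: P_def sums_iff)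
 have "(f has_field_derivative f' \<tau>) (at \<tau>)" if "\<tau> \<in> HH" for \<tau>
 proof -
  have "(qp h has_field_derivative (2 * of_real pi * \<i> / of_nat h * qp h \<tau>)) (at \<tau>)"
   unfolding qp_def using assms(1) by (auto intro!: derivative_eq_intros)
  from DERIV_chain2[OF dP[OF norm_qp_less_1[OF assms(1) that]] this]
  have "((\<lambda>\<tau>. P (qp h \<tau>)) has_field_derivative f' \<tau>) (at \<tau>)" by (simp add: f'_def)
  then show ?thesis by (rule has_field_derivative_transform_within_open[OF _ open_HH that]) (simp add: fP)
 qed
 moreover have "has_q_expansion h (\<lambda>n. 2 * of_real pi * \<i> * of_nat n / of_nat h * a n) f'" unfolding has_q_expansion_iff
 proof
  fix \<tau> assume "\<tau> \<in> HH"
  define z where "z = qp h \<tau>"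
  define c where "c = 2 * of_real pi * \<i> / of_nat h"
  have "norm z < 1" using norm_qp_less_1[OF assms(1) \<open>\<tau> \<in> HH\<close>] by (simp add: z_def)
  then have "(\<lambda>n. diffs a n * z ^ n * (c * z)) sums (Q z * (c * z))" by (intro sums_mult2 sQ)
  also have "(\<lambda>n. diffs a n * z ^ n * (c * z)) = (\<lambda>n. c * of_nat (Suc n) * a (Suc n) * z ^ Suc n)"
   by (auto simp: diffs_def mult_ac)
  finally have "(\<lambda>n. c * of_nat n * a n * z ^ n) sums (Q z * (c * z) + c * of_nat 0 * a 0 * z ^ 0)"
   by (subst (asm) sums_Suc_iff) simp
  then show "(\<lambda>n. 2 * of_real pi * \<i> * of_nat n / of_nat h * a n * qp h \<tau> ^ n) sums f' \<tau>"
   by (simp add: f'_def z_def c_def mult_ac)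
 qed
 ultimately show thesis using that by blast
qed

lemma geometric_q_expansion: "has_q_expansion 1 (\<lambda>_. 1) (\<lambda>\<tau>. 1 / (1 - qp 1 \<tau>))"
 unfolding has_q_expansion_iff using norm_qp_less_1[of 1] geometric_sums by auto

lemma power_q_expansion:
 obtains f where "has_q_expansion 1 (\<lambda>n. of_nat n ^ p) f"
proof -
 have "\<exists>f. has_q_expansion 1 (\<lambda>n. of_nat n ^ p) f"
 proof (induction p)
  case 0
  then show ?case using geometric_q_expansion by auto
 next
  case (Suc p)
  then obtain f where f: "has_q_expansion 1 (\<lambda>n. of_nat n ^ p) f" by blast
  obtain f' where "has_q_expansion 1 (\<lambda>n. 2 * of_real pi * \<i> * of_nat n / of_nat 1 * of_nat n ^ p) f'"
   by (rule q_expansion_deriv[OF _ f]) auto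
  from q_expansion_cmult[OF this, of "1 / (2 * of_real pi * \<i>)"]
  have "has_q_expansion 1 (\<lambda>n. of_nat n ^ Suc p) (\<lambda>\<tau>. 1 / (2 * of_real pi * \<i>) * f' \<tau>)" by (rule q_expansion_cong) auto
  then show ?case by blast
 qed
 then show thesis using that by blast
qed

lemma q_expansion_poly_growth:
 assumes "\<And>n. norm (a n) \<le> C * real n ^ p" "\<And>\<tau>. \<tau> \<in> HH \<Longrightarrow> f \<tau> = (\<Sum>n. a n * qp 1 \<tau> ^ n)"
 shows "has_q_expansion 1 a f" unfolding has_q_expansion_iff
proof
 fix \<tau> assume \<tau>: "\<tau> \<in> HH"
 obtain g where g: "has_q_expansion 1 (\<lambda>n. of_nat n ^ p) g" by (rule power_q_expansion)
 have "summable (\<lambda>n. norm (of_nat n ^ p * qp 1 \<tau> ^ n))" by (rule q_series_summable[OF _ g norm_qp_less_1[OF _ \<tau>]]) auto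
 then have "summable (\<lambda>n. C * norm (of_nat n ^ p * qp 1 \<tau> ^ n))" by (rule summable_mult)
 then have "summable (\<lambda>n. a n * qp 1 \<tau> ^ n)"
 proof (rule summable_comparison_test'[where N = 0])
  fix n
  show "norm (a n * qp 1 \<tau> ^ n) \<le> C * norm (of_nat n ^ p * qp 1 \<tau> ^ n)" using mult_right_mono[OF assms(1)[of n], of "norm (qp 1 \<tau>) ^ n"]
   by (simp add: norm_mult norm_power mult.assoc)
 qed
 then show "(\<lambda>n. a n * qp 1 \<tau> ^ n) sums f \<tau>" using assms(2)[OF \<tau>] by (simp add: summable_sums)
qed

section \<open>The cotangent function and its derivatives\<close>

lemma Digamma_reflection:
 fixes z :: complex
 assumes "z \<notin> \<int>"
 shows "Digamma (1 - z) - Digamma z = of_real pi * cos (of_real pi * z) / sin (of_real pi * z)"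
proof -
 have nz: "z \<notin> \<int>\<^sub>\<le>\<^sub>0" "1 - z \<notin> \<int>\<^sub>\<le>\<^sub>0"
 proof -
  show "z \<notin> \<int>\<^sub>\<le>\<^sub>0" using assms nonpos_Ints_Int by blast
  show "1 - z \<notin> \<int>\<^sub>\<le>\<^sub>0"
  proof
   assume "1 - z \<in> \<int>\<^sub>\<le>\<^sub>0"
   then have "1 - z \<in> \<int>" by (rule nonpos_Ints_Int)
   then have "1 - (1 - z) \<in> \<int>" by (intro Ints_diff) auto
   then show False using assms by simp
  qed
 qed
 have s: "sin (of_real pi * z) \<noteq> 0"
 proof
  assume "sin (of_real pi * z) = 0"
  then obtain n :: int where "of_real pi * z = of_real (of_int n * pi)" unfolding sin_eq_0 by blast
  then have "z = of_int n" by simp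
  then show False using assms by simp
 qed
 have "((\<lambda>z. Gamma z * Gamma (1 - z)) has_field_derivative
     (Gamma z * Digamma z * Gamma (1 - z) + Gamma (1 - z) * Digamma (1 - z) * (- 1) * Gamma z)) (at z)"
  using nz by (auto intro!: derivative_eq_intros)
 moreover have "((\<lambda>z. Gamma z * Gamma (1 - z)) has_field_derivative
     (- (of_real pi * (cos (of_real pi * z) * of_real pi)) / (sin (of_real pi * z))\<^sup>2)) (at z)" unfolding Gamma_reflection_complex
  using s by (auto intro!: derivative_eq_intros simp: power2_eq_square)
 ultimately have "Gamma z * Digamma z * Gamma (1 - z) + Gamma (1 - z) * Digamma (1 - z) * (- 1) * Gamma z =
   - (of_real pi * (cos (of_real pi * z) * of_real pi)) / (sin (of_real pi * z))\<^sup>2" by (rule DERIV_unique)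
 then have "(Gamma z * Gamma (1 - z)) * (Digamma (1 - z) - Digamma z) =
   of_real pi * of_real pi * cos (of_real pi * z) / (sin (of_real pi * z))\<^sup>2" by (simp add: algebra_simps)
 then have "(of_real pi / sin (of_real pi * z)) * (Digamma (1 - z) - Digamma z) =
   (of_real pi / sin (of_real pi * z)) * (of_real pi * cos (of_real pi * z) / sin (of_real pi * z))"
  by (simp add: Gamma_reflection_complex power2_eq_square)
 then show ?thesis using s by (subst (asm) mult_left_cancel) auto
qed

lemma pi_cot_eq:
 assumes "sin (of_real pi * z) \<noteq> 0"
 shows "of_real pi * cos (of_real pi * z) / sin (of_real pi * z) =
  of_real pi * \<i> - 2 * of_real pi * \<i> / (1 - exp (2 * of_real pi * \<i> * (z :: complex)))"
proof -
 define E where "E = exp (\<i> * (of_real pi * z))"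
 have E: "E \<noteq> 0" by (simp add: E_def)
 have E2: "exp (2 * of_real pi * \<i> * z) = E\<^sup>2" by (simp add: E_def exp_of_nat_mult [symmetric] mult_ac)
 have m: "exp (- (\<i> * (of_real pi * z))) = 1 / E" by (simp add: E_def exp_minus divide_inverse)
 have c: "cos (of_real pi * z) = (E + 1 / E) / 2" and s: "sin (of_real pi * z) = (E - 1 / E) / (2 * \<i>)"
  by (simp_all add: cos_exp_eq sin_exp_eq m flip: E_def)
 have "E - 1 / E \<noteq> 0" using assms s by auto
 then have "1 - E\<^sup>2 \<noteq> 0" using E by (auto simp: field_simps power2_eq_square)
 define D where "D = 1 - E\<^sup>2"
 have D: "D \<noteq> 0" using \<open>1 - E\<^sup>2 \<noteq> 0\<close> by (simp add: D_def)
 have c': "(E + 1 / E) / 2 = (2 - D) / (2 * E)" and s': "(E - 1 / E) / (2 * \<i>) = - D / (2 * \<i> * E)"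
 proof -
  have "E + 1 / E = (2 - D) / E" "E - 1 / E = - D / E"
   unfolding D_def using E by (simp_all add: diff_divide_distrib add_divide_distrib power2_eq_square)
  then show "(E + 1 / E) / 2 = (2 - D) / (2 * E)" "(E - 1 / E) / (2 * \<i>) = - D / (2 * \<i> * E)" by (simp_all add: mult.commute)
 qed
 have "of_real pi * ((2 - D) / (2 * E)) / (- D / (2 * \<i> * E)) = - (of_real pi * \<i> * (2 - D)) / D" using E by simp
 also have "\<dots> = of_real pi * \<i> - 2 * of_real pi * \<i> / D" using D by (simp add: diff_divide_distrib right_diff_distrib)
 finally show ?thesis unfolding c s E2 c' s' by (simp add: D_def)
qed

lemma HH_not_Ints: "\<tau> \<in> HH \<Longrightarrow> \<tau> \<notin> \<int>"
 by (auto simp: HH_iff Ints_def)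

lemma HH_not_nonpos:
 assumes "\<tau> \<in> HH" shows "\<tau> \<notin> \<int>\<^sub>\<le>\<^sub>0" "1 - \<tau> \<notin> \<int>\<^sub>\<le>\<^sub>0" "1 + \<tau> \<notin> \<int>\<^sub>\<le>\<^sub>0"
 using assms by (auto simp: HH_iff nonpos_Ints_def complex_eq_iff)

text \<open>The n-th derivative of pi cot(pi \<tau>). For n > 0 it is, up to sign and n!, the sum of
  (\<tau> + d)^(-n-1) over all integers d, cut at d = 0 into two Polygamma series.\<close>

definition polygamma_pair :: "nat \<Rightarrow> complex \<Rightarrow> complex" where
 "polygamma_pair n \<tau> = (-1) ^ n * Polygamma n (1 - \<tau>) - Polygamma n \<tau>"

lemma polygamma_pair_q_expansion:
 assumes "n > 0"
 shows "has_q_expansion 1 (\<lambda>m. - ((2 * of_real pi * \<i>) ^ Suc n) * of_nat m ^ n) (polygamma_pair n)"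
proof -
 have der: "(polygamma_pair n has_field_derivative polygamma_pair (Suc n) \<tau>) (at \<tau>)" if "\<tau> \<in> HH" for n \<tau>
  unfolding polygamma_pair_def using HH_not_nonpos[OF that] by (auto intro!: derivative_eq_intros simp: algebra_simps)
 have pp0: "polygamma_pair 0 \<tau> = of_real pi * \<i> - 2 * of_real pi * \<i> * (1 / (1 - qp 1 \<tau>))" if "\<tau> \<in> HH" for \<tau>
 proof -
  have "sin (of_real pi * \<tau>) \<noteq> 0"
  proof
   assume "sin (of_real pi * \<tau>) = 0"
   then obtain j :: int where "of_real pi * \<tau> = of_real (of_int j * pi)" unfolding sin_eq_0 by blast
   then have "\<tau> = of_int j" by simp
   then show False using HH_not_Ints[OF that] by simp
  qed
  then show ?thesis using Digamma_reflection[OF HH_not_Ints[OF that]] pi_cot_eq[of \<tau>] by (simp add: polygamma_pair_def qp_def)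
 qed
 have main: "has_q_expansion 1 (\<lambda>m. - ((2 * of_real pi * \<i>) ^ Suc (Suc n)) * of_nat m ^ Suc n) (polygamma_pair (Suc n))" for n
 proof (induction n)
  case 0
  have "has_q_expansion 1 (\<lambda>m. (if m = 0 then of_real pi * \<i> else 0) - 2 * of_real pi * \<i> * 1)
    (\<lambda>\<tau>. of_real pi * \<i> - 2 * of_real pi * \<i> * (1 / (1 - qp 1 \<tau>)))"
   by (intro q_expansion_diff q_expansion_const q_expansion_cmult geometric_q_expansion)
  then have q: "has_q_expansion 1 (\<lambda>m. (if m = 0 then of_real pi * \<i> else 0) - 2 * of_real pi * \<i> * 1) (polygamma_pair 0)"
   by (rule q_expansion_cong) (rule pp0 [symmetric], auto)
  obtain f' where f': "\<And>\<tau>. \<tau> \<in> HH \<Longrightarrow> (polygamma_pair 0 has_field_derivative f' \<tau>) (at \<tau>)"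
   "has_q_expansion 1 (\<lambda>m. 2 * of_real pi * \<i> * of_nat m / of_nat 1 * ((if m = 0 then of_real pi * \<i> else 0) - 2 * of_real pi * \<i> * 1)) f'"
   by (rule q_expansion_deriv[OF _ q]) auto
  show ?case by (rule q_expansion_cong[OF f'(2)]) (use DERIV_unique[OF f'(1) der[of _ 0]] in auto)
 next
  case (Suc n)
  obtain f' where f': "\<And>\<tau>. \<tau> \<in> HH \<Longrightarrow> (polygamma_pair (Suc n) has_field_derivative f' \<tau>) (at \<tau>)"
   "has_q_expansion 1 (\<lambda>m. 2 * of_real pi * \<i> * of_nat m / of_nat 1 * (- ((2 * of_real pi * \<i>) ^ Suc (Suc n)) * of_nat m ^ Suc n)) f'"
   by (rule q_expansion_deriv[OF _ Suc]) auto
  show ?case by (rule q_expansion_cong[OF f'(2)]) (use DERIV_unique[OF f'(1) der[of _ "Suc n"]] in \<open>auto simp: mult_ac\<close>)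
 qed
 then show ?thesis using assms main[of "n - 1"] by simp
qed

section \<open>Bernoulli numbers and the zeta values at even integers\<close>

abbreviation cpi :: complex where "cpi \<equiv> 2 * of_real pi * \<i>"

lemma bernoulli_fps: "(fps_X / (fps_exp 1 - 1)) * (fps_exp 1 - 1) = (fps_X :: rat fps)"
proof -
 have nz: "fps_exp 1 - 1 \<noteq> (0 :: rat fps)"
 proof
  assume "fps_exp 1 - 1 = (0 :: rat fps)"
  then have "fps_nth (fps_exp 1 - 1 :: rat fps) 1 = 0" by simp
  then show False by simp
 qed
 have "fps_exp 1 - 1 dvd (fps_X :: rat fps)"
 proof -
  have "subdegree (fps_exp 1 - 1 :: rat fps) = 1" by (rule subdegreeI) auto
  then show ?thesis using nz by (simp add: fps_dvd_iff)
 qed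
 then show ?thesis by simp
qed

text \<open>The series X/(exp X - 1) with 2 pi i X in place of X.\<close>

definition bfps :: "complex fps" where
 "bfps = Abs_fps (\<lambda>n. of_rat (bernoulli n / fact n) * cpi ^ n)"

lemma bfps_mult: "bfps * (fps_exp cpi - 1) = fps_const cpi * fps_X"
proof (rule fps_ext)
 fix n
 define b where "b i = fps_nth (fps_X / (fps_exp 1 - 1) :: rat fps) i" for i
 have b: "bernoulli i / fact i = b i" for i by (simp add: bernoulli_def b_def)
 have e: "fps_nth (fps_exp cpi - 1) j = of_rat (fps_nth (fps_exp 1 - 1 :: rat fps) j) * cpi ^ j" for j
 proof -
  have "of_rat (fact j) = (fact j :: complex)" by (metis of_nat_fact of_rat_of_nat_eq)
  then show ?thesis by (cases "j = 0") (auto simp: of_rat_divide)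
 qed
 have "fps_nth (bfps * (fps_exp cpi - 1)) n = (\<Sum>i=0..n. of_rat (b i) * cpi ^ i * (of_rat (fps_nth (fps_exp 1 - 1 :: rat fps) (n - i)) * cpi ^ (n - i)))"
  by (simp only: fps_mult_nth bfps_def fps_nth_Abs_fps e b)
 also have "\<dots> = (\<Sum>i=0..n. of_rat (b i * fps_nth (fps_exp 1 - 1 :: rat fps) (n - i)) * cpi ^ n)"
 proof (rule sum.cong)
  fix i assume "i \<in> {0..n}"
  then have "cpi ^ n = cpi ^ i * cpi ^ (n - i)" by (simp add: power_add [symmetric] del: power_mult_distrib)
  then show "of_rat (b i) * cpi ^ i * (of_rat (fps_nth (fps_exp 1 - 1 :: rat fps) (n - i)) * cpi ^ (n - i)) =
    of_rat (b i * fps_nth (fps_exp 1 - 1 :: rat fps) (n - i)) * cpi ^ n" by (simp only: of_rat_mult mult_ac)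
 qed simp
 also have "\<dots> = of_rat (fps_nth ((fps_X / (fps_exp 1 - 1)) * (fps_exp 1 - 1) :: rat fps) n) * cpi ^ n"
  by (simp only: fps_mult_nth b_def of_rat_sum sum_distrib_right)
 also have "\<dots> = fps_nth (fps_const cpi * fps_X) n" unfolding bernoulli_fps by (cases "n = 1") auto
 finally show "fps_nth (bfps * (fps_exp cpi - 1)) n = fps_nth (fps_const cpi * fps_X) n" .
qed

text \<open>The function z H(z) is pi z cot(pi z) - 1. Its Taylor coefficients are Bernoulli numbers
  through the exponential form of the cotangent, and zeta values through the derivatives of
  \<open>Digamma\<close> at 1.\<close>

theorem euler_zeta_even:
 assumes "even k" "k \<ge> 2"
 shows "(\<lambda>n. inverse ((1 + of_nat n) ^ k)) sums (- (of_rat (bernoulli k / fact k) * cpi ^ k) / 2)"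
proof -
 \<comment> \<open>Having \<open>1 + z\<close> instead of \<open>z\<close> in the second term
   removes the pole at 0, so that \<open>H\<close> has a Taylor series there.\<close>
 define H :: "complex \<Rightarrow> complex" where "H z = Digamma (1 - z) - Digamma (1 + z)" for z
 define D where "D n z = (-1) ^ n * Polygamma n (1 - z) - Polygamma n (1 + z)" for n :: nat and z :: complex
 have np: "1 - z \<notin> \<int>\<^sub>\<le>\<^sub>0" "1 + z \<notin> \<int>\<^sub>\<le>\<^sub>0" if "z \<in> ball 0 1" for z :: complex
 proof -
  have "\<bar>Re z\<bar> < 1" using that abs_Re_le_cmod[of z] by simp
  then have "Re (1 - z) > 0" "Re (1 + z) > 0" by auto
  then show "1 - z \<notin> \<int>\<^sub>\<le>\<^sub>0" "1 + z \<notin> \<int>\<^sub>\<le>\<^sub>0" by (force elim!: nonpos_Ints_cases)+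
 qed
 have der: "(D n has_field_derivative D (Suc n) z) (at z)" if "z \<in> ball 0 1" for n z
  unfolding D_def using np[OF that] by (auto intro!: derivative_eq_intros simp: algebra_simps)
 have hd: "(deriv ^^ n) H z = D n z" if "z \<in> ball 0 1" for n z using that
 proof (induction n arbitrary: z)
  case 0
  then show ?case by (simp add: H_def D_def)
 next
  case (Suc n)
  have "((deriv ^^ n) H has_field_derivative D (Suc n) z) (at z)"
   by (rule has_field_derivative_transform_within_open[OF der[OF Suc.prems] open_ball Suc.prems])
    (use Suc.IH in auto)
  then show ?case by (simp add: DERIV_imp_deriv)
 qed
 have "H holomorphic_on ball 0 1"
 proof -
  have "D 0 holomorphic_on ball 0 1" using der by (auto simp: holomorphic_on_open intro!: exI)
  moreover have "D 0 = H" by (simp add: D_def H_def fun_eq_iff)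
  ultimately show ?thesis by simp
 qed
 then have "H analytic_on {0}" by (rule holomorphic_on_imp_analytic_at) auto
 then have Hx: "H has_fps_expansion fps_expansion H 0" by (rule analytic_at_imp_has_fps_expansion_0)
 define F where "F = fps_expansion H 0"
 \<comment> \<open>The identity is compared after multiplication by exp(2 pi i z) - 1, so that both
   sides are power series; the factor is then cancelled formally.\<close>
 have L: "(\<lambda>z. (z * H z) * (exp (cpi * z) - 1)) has_fps_expansion (fps_X * F) * (fps_exp cpi - 1)"
  unfolding F_def using Hx by (intro fps_expansion_intros)
 have R: "(\<lambda>z. (of_real pi * \<i> * z - 1) * (exp (cpi * z) - 1) + cpi * z) has_fps_expansion
   (fps_const (of_real pi * \<i>) * fps_X - 1) * (fps_exp cpi - 1) + fps_const cpi * fps_X" by (intro fps_expansion_intros)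
 have eq: "(z * H z) * (exp (cpi * z) - 1) = (of_real pi * \<i> * z - 1) * (exp (cpi * z) - 1) + cpi * z"
  if z: "z \<in> ball 0 1" for z
 proof (cases "z = 0")
  case False
  have zi: "z \<notin> \<int>"
  proof
   assume "z \<in> \<int>"
   then obtain n where n: "z = of_int n" by (auto elim: Ints_cases)
   then have "\<bar>n\<bar> < 1" using z by (simp add: of_int_abs [symmetric] del: of_int_abs)
   then show False using n False by simp
  qed
  have s: "sin (of_real pi * z) \<noteq> 0"
  proof
   assume "sin (of_real pi * z) = 0"
   then obtain n :: int where "of_real pi * z = of_real (of_int n * pi)" unfolding sin_eq_0 by blast
   then have "z = of_int n" by simp
   then show False using zi by simp
  qed
  have e1: "1 - exp (cpi * z) \<noteq> 0"
  proof
   assume "1 - exp (cpi * z) = 0"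
   then have "exp (cpi * z) = 1" by simp
   then obtain n :: int where "Re (cpi * z) = 0" "Im (cpi * z) = of_int (2 * n) * pi" unfolding exp_eq_1 by blast
   then have "z = of_int n" by (simp add: complex_eq_iff)
   then show False using zi by simp
  qed
  have "Digamma (z + 1) = Digamma z + 1 / z" using Digamma_plus1[OF False] by simp
  then have "H z = Digamma (1 - z) - Digamma z - 1 / z" by (simp add: H_def add.commute)
  also have "\<dots> = of_real pi * \<i> - cpi / (1 - exp (cpi * z)) - 1 / z" unfolding Digamma_reflection[OF zi] pi_cot_eq[OF s] by simp
  finally have "z * H z = z * (of_real pi * \<i> - cpi / (1 - exp (cpi * z)) - 1 / z)" by (rule arg_cong)
  then have "z * H z = z * (of_real pi * \<i>) - z * (cpi / (1 - exp (cpi * z))) - 1"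
   using False by (simp only: right_diff_distrib) simp
  then have "z * H z * (1 - exp (cpi * z)) =
    (z * (of_real pi * \<i>) - 1) * (1 - exp (cpi * z)) - z * cpi" using e1 by (simp add: left_diff_distrib)
  then show ?thesis by (simp add: algebra_simps)
 qed simp
 have ev: "eventually (\<lambda>z. (z * H z) * (exp (cpi * z) - 1) = (of_real pi * \<i> * z - 1) * (exp (cpi * z) - 1) + cpi * z) (nhds 0)"
 proof -
  have "eventually (\<lambda>z. z \<in> ball 0 1) (nhds (0::complex))" by (intro eventually_nhds_in_open) auto
  then show ?thesis by (rule eventually_mono) (rule eq)
 qed
 have L': "(\<lambda>z. (of_real pi * \<i> * z - 1) * (exp (cpi * z) - 1) + cpi * z) has_fps_expansion (fps_X * F) * (fps_exp cpi - 1)"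
  using L unfolding has_fps_expansion_cong[OF ev refl] .
 have "(fps_X * F) * (fps_exp cpi - 1) = (fps_const (of_real pi * \<i>) * fps_X - 1) * (fps_exp cpi - 1) + fps_const cpi * fps_X"
  by (rule fps_ext) (simp only: fps_nth_fps_expansion[OF L'] fps_nth_fps_expansion[OF R])
 also have "\<dots> = (fps_const (of_real pi * \<i>) * fps_X - 1 + bfps) * (fps_exp cpi - 1)"
  by (simp only: bfps_mult [symmetric] distrib_right)
 finally have "fps_X * F = fps_const (of_real pi * \<i>) * fps_X - 1 + bfps"
 proof -
  have "fps_nth (fps_exp cpi - 1) 1 \<noteq> 0" by simp
  then have "fps_exp cpi - 1 \<noteq> 0" by (metis fps_zero_nth)
  moreover assume "fps_X * F * (fps_exp cpi - 1) = (fps_const (of_real pi * \<i>) * fps_X - 1 + bfps) * (fps_exp cpi - 1)"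
  ultimately show ?thesis by (simp only: mult_cancel_right) simp
 qed
 then have "fps_nth (fps_X * F) k = fps_nth (fps_const (of_real pi * \<i>) * fps_X - 1 + bfps) k" by simp
 then have "fps_nth F (k - 1) = of_rat (bernoulli k / fact k) * cpi ^ k"
  using assms by (simp add: bfps_def fps_mult_fps_X_commute)
 moreover have "fps_nth F (k - 1) = D (k - 1) 0 / fact (k - 1)"
  unfolding F_def using fps_nth_fps_expansion[OF Hx, of "k - 1"] hd[of 0 "k - 1"] by simp
 moreover have "odd (k - 1)" using assms by simp
 then have "D (k - 1) 0 = - 2 * Polygamma (k - 1) 1" by (simp add: D_def)
 ultimately have P: "Polygamma (k - 1) 1 / fact (k - 1) = - (of_rat (bernoulli k / fact k) * cpi ^ k) / 2"
  by (simp add: field_simps)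
 have "(\<lambda>j. inverse ((1 + of_nat j) ^ Suc (k - 1))) sums ((-1) ^ Suc (k - 1) * Polygamma (k - 1) 1 / fact (k - 1) :: complex)"
  by (rule Polygamma_LIMSEQ) (use assms in auto)
 moreover have "Suc (k - 1) = k" using assms by simp
 ultimately show ?thesis using P assms(1) by simp
qed

corollary bernoulli_even_nonzero:
 assumes "even k" "k \<ge> 2" shows "bernoulli k \<noteq> 0"
proof
 assume "bernoulli k = 0"
 then have s: "(\<lambda>n. inverse ((1 + of_nat n) ^ k) :: complex) sums 0" using euler_zeta_even[OF assms] by simp
 have "(\<lambda>n. Re (inverse ((1 + of_nat n) ^ k))) sums Re 0" by (rule sums_Re[OF s])
 moreover have "inverse ((1 + of_nat n) ^ k) = complex_of_real (inverse ((1 + real n) ^ k))" for n by simp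
 then have "Re (inverse ((1 + of_nat n) ^ k)) = inverse ((1 + real n) ^ k)" for n by (simp only: Re_complex_of_real)
 ultimately have "(\<lambda>n. inverse ((1 + real n) ^ k)) sums 0" by (simp only: zero_complex.sel)
 moreover from this have "0 < (\<Sum>n. inverse ((1 + real n) ^ k))" by (intro suminf_pos) (auto simp: sums_iff add_pos_nonneg)
 ultimately show False by (simp add: sums_iff)
qed

lemma bernoulli_values: "bernoulli 4 = - 1 / 30" "bernoulli 6 = 1 / 42"
proof -
 define b where "b i = fps_nth (fps_X / (fps_exp 1 - 1) :: rat fps) i" for i
 have rec: "(\<Sum>i=0..n. b i * fps_nth (fps_exp 1 - 1 :: rat fps) (n - i)) = fps_nth fps_X n" for n
  using arg_cong[OF bernoulli_fps, of "\<lambda>f. fps_nth f n"] by (simp only: fps_mult_nth b_def)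
 have b0: "b 0 = 1" using rec[of 1] by (simp add: sum.atLeast0_atMost_Suc numeral_eq_Suc fact_numeral)
 have b1: "b 1 = - 1 / 2" using rec[of 2] b0 by (simp add: sum.atLeast0_atMost_Suc numeral_eq_Suc)
 have b2: "b 2 = 1 / 12" using rec[of 3] b0 b1 by (simp add: sum.atLeast0_atMost_Suc numeral_eq_Suc)
 have b3: "b 3 = 0" using rec[of 4] b0 b1 b2 by (simp add: sum.atLeast0_atMost_Suc numeral_eq_Suc)
 have b4: "b 4 = - 1 / 720" using rec[of 5] b0 b1 b2 b3 by (simp add: sum.atLeast0_atMost_Suc numeral_eq_Suc)
 have b5: "b 5 = 0" using rec[of 6] b0 b1 b2 b3 b4 by (simp add: sum.atLeast0_atMost_Suc numeral_eq_Suc)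
 have b6: "b 6 = 1 / 30240" using rec[of 7] b0 b1 b2 b3 b4 b5 by (simp add: sum.atLeast0_atMost_Suc numeral_eq_Suc)
 show "bernoulli 4 = - 1 / 30" using b4 by (simp add: bernoulli_def b_def fact_numeral)
 show "bernoulli 6 = 1 / 42" using b6 by (simp add: bernoulli_def b_def fact_numeral)
qed

section \<open>Eisenstein series as lattice sums\<close>

lemma has_sum_int:
 fixes f :: "int \<Rightarrow> complex"
 assumes "((\<lambda>n. f (int n)) has_sum A) UNIV" "((\<lambda>n. f (- int n - 1)) has_sum B) UNIV"
 shows "(f has_sum (A + B)) UNIV"
proof -
 have r1: "range int = {0..}"
 proof (intro equalityI subsetI)
  fix x :: int assume "x \<in> {0..}"
  then have "x = int (nat x)" by simp
  then show "x \<in> range int" by blast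
 qed auto
 have r2: "range (\<lambda>n. - int n - 1) = {..<0}"
 proof (intro equalityI subsetI)
  fix x :: int assume "x \<in> {..<0}"
  then have "x = - int (nat (- x - 1)) - 1" by simp
  then show "x \<in> range (\<lambda>n. - int n - 1)" by blast
 qed auto
 have "(f has_sum A) {0..}" unfolding r1 [symmetric] by (subst has_sum_reindex) (use assms(1) in \<open>auto simp: o_def\<close>)
 moreover have "(f has_sum B) {..<0}"
  unfolding r2 [symmetric] by (subst has_sum_reindex) (use assms(2) in \<open>auto simp: o_def inj_on_def\<close>)
 ultimately have "(f has_sum (A + B)) ({0..} \<union> {..<0})" by (rule has_sum_Un_disjoint) auto
 moreover have "{0..} \<union> {..<0} = (UNIV :: int set)" by auto
 ultimately show ?thesis by simp
qed

lemma has_sum_shift_nat: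
 fixes f :: "nat \<Rightarrow> complex"
 assumes "((\<lambda>n. f (Suc n)) has_sum S) UNIV" shows "(f has_sum (f 0 + S)) UNIV"
proof -
 have "(f has_sum S) (range Suc)" by (subst has_sum_reindex) (use assms in \<open>auto simp: o_def\<close>)
 moreover have "(f has_sum f 0) {0}" using has_sum_finite[of "{0}" f] by simp
 ultimately have "(f has_sum (f 0 + S)) ({0} \<union> range Suc)" by (intro has_sum_Un_disjoint) auto
 moreover have "{0} \<union> range Suc = UNIV" using not0_implies_Suc by auto
 ultimately show ?thesis by simp
qed

lemma summable_on_int_quadratic: "(\<lambda>c::int. 1 / (1 + real_of_int c ^ 2)) summable_on UNIV"
proof -
 have s: "summable (\<lambda>n. norm (1 / (1 + real n ^ 2)))"
 proof (rule summable_comparison_test'[of "\<lambda>n. inverse (real n ^ 2)" 1])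
  show "summable (\<lambda>n. inverse (real n ^ 2))" by (rule inverse_power_summable) simp
  fix n :: nat assume "n \<ge> 1"
  show "norm (norm (1 / (1 + real n ^ 2))) \<le> inverse (real n ^ 2)"
  proof -
   have "inverse (1 + real n ^ 2) \<le> inverse (real n ^ 2)" using \<open>n \<ge> 1\<close> by (intro le_imp_inverse_le) auto
   then show ?thesis by (simp add: inverse_eq_divide)
  qed
 qed
 then have 1: "(\<lambda>n. 1 / (1 + real n ^ 2)) summable_on UNIV" by (rule norm_summable_imp_summable_on)
 have r: "UNIV = range int \<union> range (\<lambda>n. - int n)"
 proof -
  have "x \<in> range int \<union> range (\<lambda>n. - int n)" for x :: int by (cases x rule: int_cases2) auto
  then show ?thesis by blast
 qed
 have "(\<lambda>c::int. 1 / (1 + real_of_int c ^ 2)) summable_on range int" by (subst summable_on_reindex) (use 1 in \<open>auto simp: o_def\<close>)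
 moreover have "(\<lambda>c::int. 1 / (1 + real_of_int c ^ 2)) summable_on range (\<lambda>n. - int n)"
  by (subst summable_on_reindex) (use 1 in \<open>auto simp: o_def inj_on_def\<close>)
 ultimately show ?thesis unfolding r by (rule summable_on_union)
qed

text \<open>For k > 0 the pair (0, 0) contributes \<open>inverse 0 = 0\<close>, so the Eisenstein
  sum may run over all pairs.\<close>

definition lattice_term :: "nat \<Rightarrow> complex \<Rightarrow> int \<times> int \<Rightarrow> complex" where
 "lattice_term k \<tau> = (\<lambda>(c, d). inverse ((of_int c * \<tau> + of_int d) ^ k))"

text \<open>From c^2 + d^2 \<le> K |c \<tau> + d|^2 the fourth power of |c \<tau> + d| dominates (1
  + c^2)(1 + d^2) up to a constant, and the reciprocals of these two factors can be summed
  separately. This uses k \<ge> 4.\<close>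

lemma lattice_term_bound:
 assumes "\<tau> \<in> HH" "k \<ge> 4"
 obtains C where "\<And>c d. norm (lattice_term k \<tau> (c, d)) \<le> C * (1 / (1 + real_of_int c ^ 2) * (1 / (1 + real_of_int d ^ 2)))"
proof -
 define x y where "x = Re \<tau>" and "y = Im \<tau>"
 have y: "y > 0" using assms by (simp add: y_def HH_iff)
 \<comment> \<open>The constant comes from d^2 \<le> 2 (c x + d)^2 + 2 (c x)^2, the remaining
   multiples of c^2 being absorbed by (c y)^2.\<close>
 define K where "K = 2 + (1 + 2 * x\<^sup>2) / y\<^sup>2"
 have K: "K \<ge> 2" using y by (simp add: K_def)
 define t0 where "t0 = sqrt (1 / K)"
 have t0: "t0 > 0" "t0\<^sup>2 = 1 / K" using K by (auto simp: t0_def)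
 define C where "C = 4 * (K\<^sup>2 / t0 ^ (k - 4))"
 have "norm (lattice_term k \<tau> (c, d)) \<le> C * (1 / (1 + real_of_int c ^ 2) * (1 / (1 + real_of_int d ^ 2)))" for c d
 proof (cases "c = 0 \<and> d = 0")
  case True
  then show ?thesis using assms K t0 by (simp add: lattice_term_def C_def power_0_left)
 next
  case False
  define c' d' where "c' = real_of_int c" and "d' = real_of_int d"
  define s where "s = c'\<^sup>2 + d'\<^sup>2"
  define t where "t = norm (of_int c * \<tau> + of_int d)"
  have "1 \<le> c\<^sup>2 + d\<^sup>2"
  proof -
   have "c\<^sup>2 + d\<^sup>2 \<noteq> 0" using False by (simp add: sum_power2_eq_zero_iff)
   moreover have "c\<^sup>2 + d\<^sup>2 \<ge> 0" by simp
   ultimately show ?thesis by linarith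
  qed
  then have s1: "s \<ge> 1" unfolding s_def c'_def d'_def by (metis of_int_1_le_iff of_int_add of_int_power)
  have t2: "t\<^sup>2 = (c' * x + d')\<^sup>2 + (c' * y)\<^sup>2" unfolding t_def cmod_power2 by (simp add: c'_def d'_def x_def y_def)
  have "d'\<^sup>2 \<le> 2 * (c' * x + d')\<^sup>2 + 2 * (c' * x)\<^sup>2"
  proof -
   have "0 \<le> (2 * (c' * x) + d')\<^sup>2" by simp
   then show ?thesis by (simp add: power2_eq_square algebra_simps)
  qed
  then have "s \<le> 2 * (c' * x + d')\<^sup>2 + c'\<^sup>2 * (1 + 2 * x\<^sup>2)" by (simp add: s_def power_mult_distrib algebra_simps)
  also have "c'\<^sup>2 * (1 + 2 * x\<^sup>2) = (1 + 2 * x\<^sup>2) / y\<^sup>2 * (c' * y)\<^sup>2" using y by (simp add: power_mult_distrib)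
  also have "2 * (c' * x + d')\<^sup>2 + (1 + 2 * x\<^sup>2) / y\<^sup>2 * (c' * y)\<^sup>2 \<le> K * (c' * x + d')\<^sup>2 + K * (c' * y)\<^sup>2"
   using y by (intro add_mono mult_right_mono) (auto simp: K_def)
  finally have sK: "s \<le> K * t\<^sup>2" by (simp add: t2 distrib_left)
  then have tl: "s / K \<le> t\<^sup>2" using K by (simp add: field_simps)
  have t_t0: "t0 \<le> t"
  proof (rule power2_le_imp_le)
   have "1 / K \<le> s / K" using s1 K by (intro divide_right_mono) auto
   then show "t0\<^sup>2 \<le> t\<^sup>2" using tl t0 by simp
   show "0 \<le> t" by (simp add: t_def)
  qed
  have "(s / K)\<^sup>2 \<le> (t\<^sup>2)\<^sup>2" using tl s1 K by (intro power_mono) auto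
  moreover have "t0 ^ (k - 4) \<le> t ^ (k - 4)" using t_t0 t0 by (intro power_mono) auto
  ultimately have "(s / K)\<^sup>2 * t0 ^ (k - 4) \<le> (t\<^sup>2)\<^sup>2 * t ^ (k - 4)" using t0 by (intro mult_mono) auto
  also have "(t\<^sup>2)\<^sup>2 * t ^ (k - 4) = t ^ k" using assms(2) by (simp add: power_mult [symmetric] power_add [symmetric])
  finally have tk: "(s / K)\<^sup>2 * t0 ^ (k - 4) \<le> t ^ k" .
  have pos: "(s / K)\<^sup>2 * t0 ^ (k - 4) > 0" using s1 K t0 by simp
  have "norm (lattice_term k \<tau> (c, d)) = inverse (t ^ k)" by (simp add: lattice_term_def t_def norm_inverse norm_power)
  also have "\<dots> \<le> inverse ((s / K)\<^sup>2 * t0 ^ (k - 4))" using tk pos by (rule le_imp_inverse_le)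
  also have "\<dots> = K\<^sup>2 / t0 ^ (k - 4) * inverse (s\<^sup>2)" using s1 K t0 by (simp add: field_simps)
  also have "\<dots> \<le> K\<^sup>2 / t0 ^ (k - 4) * (4 * (1 / (1 + c'\<^sup>2) * (1 / (1 + d'\<^sup>2))))"
  proof (rule mult_left_mono)
   have "(1 + c'\<^sup>2) * (1 + d'\<^sup>2) \<le> (2 * s) * (2 * s)"
   proof (rule mult_mono)
    show "1 + c'\<^sup>2 \<le> 2 * s" "1 + d'\<^sup>2 \<le> 2 * s"
    proof -
     have "c'\<^sup>2 \<le> s" "d'\<^sup>2 \<le> s" by (simp_all add: s_def)
     then show "1 + c'\<^sup>2 \<le> 2 * s" "1 + d'\<^sup>2 \<le> 2 * s" using s1 by simp_all
    qed
   qed (use s1 in auto)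
   also have "\<dots> = 4 * s\<^sup>2" by (simp add: power2_eq_square)
   finally have le: "(1 + c'\<^sup>2) * (1 + d'\<^sup>2) \<le> 4 * s\<^sup>2" .
   have p: "(1 + c'\<^sup>2) * (1 + d'\<^sup>2) > 0" by (intro mult_pos_pos add_pos_nonneg) auto
   have "inverse (4 * s\<^sup>2) \<le> inverse ((1 + c'\<^sup>2) * (1 + d'\<^sup>2))" using le p by (rule le_imp_inverse_le)
   then show "inverse (s\<^sup>2) \<le> 4 * (1 / (1 + c'\<^sup>2) * (1 / (1 + d'\<^sup>2)))" by (simp add: inverse_eq_divide)
  qed (use K t0 in auto)
  finally show ?thesis by (simp only: C_def c'_def d'_def mult_ac)
 qed
 then show thesis by (rule that)
qed

lemma lattice_abs_summable:
 assumes "\<tau> \<in> HH" "k \<ge> 4" shows "(\<lambda>x. norm (lattice_term k \<tau> x)) summable_on UNIV"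
proof -
 obtain C where C: "\<And>c d. norm (lattice_term k \<tau> (c, d)) \<le> C * (1 / (1 + real_of_int c ^ 2) * (1 / (1 + real_of_int d ^ 2)))"
  using lattice_term_bound[OF assms] by metis
 define g where "g c = 1 / (1 + real_of_int c ^ 2)" for c
 have g0: "g c \<ge> 0" for c by (simp add: g_def)
 have g: "g summable_on UNIV" unfolding g_def by (rule summable_on_int_quadratic)
 have "(\<lambda>x. norm (C * (g (fst x) * g (snd x)))) summable_on (Sigma UNIV (\<lambda>_. UNIV))"
  unfolding Infinite_Sum.abs_summable_on_Sigma_iff
 proof (intro conjI ballI)
  fix c
  have "(\<lambda>d. \<bar>C\<bar> * g c * g d) summable_on UNIV" by (rule summable_on_cmult_right[OF g])
  then show "(\<lambda>d. norm (C * (g (fst (c, d)) * g (snd (c, d))))) summable_on UNIV" using g0 by (simp add: abs_mult mult.assoc)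
 next
  have "(\<lambda>c. (\<bar>C\<bar> * infsum g UNIV) * g c) summable_on UNIV" by (rule summable_on_cmult_right[OF g])
  moreover have "(\<Sum>\<^sub>\<infinity>d. norm (C * (g (fst (c, d)) * g (snd (c, d))))) = (\<bar>C\<bar> * infsum g UNIV) * g c" for c
  proof -
   have "(\<Sum>\<^sub>\<infinity>d. norm (C * (g (fst (c, d)) * g (snd (c, d))))) = (\<Sum>\<^sub>\<infinity>d. (\<bar>C\<bar> * g c) * g d)"
    using g0 by (simp add: abs_mult mult.assoc)
   also have "\<dots> = (\<bar>C\<bar> * g c) * infsum g UNIV" by (rule infsum_cmult_right') 
   finally show ?thesis by (simp add: mult_ac)
  qed
  moreover have "infsum g UNIV \<ge> 0" by (rule infsum_nonneg) (rule g0)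
  ultimately show "(\<lambda>c. norm (\<Sum>\<^sub>\<infinity>d. norm (C * (g (fst (c, d)) * g (snd (c, d)))))) summable_on UNIV"
   using g0 by (simp add: abs_mult)
 qed
 then have s: "(\<lambda>x. norm (C * (g (fst x) * g (snd x)))) summable_on UNIV" by simp
 show ?thesis
 proof (rule Infinite_Sum.abs_summable_on_comparison_test[OF s])
  fix x :: "int \<times> int"
  obtain c d where x: "x = (c, d)" by (cases x)
  have "norm (lattice_term k \<tau> x) \<le> C * (g c * g d)" using C[of c d] by (simp add: x g_def)
  also have "\<dots> \<le> norm (C * (g (fst x) * g (snd x)))" by (simp add: x)
  finally show "norm (lattice_term k \<tau> x) \<le> norm (C * (g (fst x) * g (snd x)))" .
 qed
qed

lemma lattice_row_summable:
 assumes "\<tau> \<in> HH" "k \<ge> 4" shows "(\<lambda>d. lattice_term k \<tau> (c, d)) summable_on UNIV"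
proof -
 have "(\<lambda>x. norm (lattice_term k \<tau> x)) summable_on (Sigma UNIV (\<lambda>_. UNIV))" using lattice_abs_summable[OF assms] by simp
 then have "(\<lambda>d. norm (lattice_term k \<tau> (c, d))) summable_on UNIV" unfolding Infinite_Sum.abs_summable_on_Sigma_iff by blast
 then show ?thesis by (rule abs_summable_summable)
qed

text \<open>The terms with d \<ge> 0 form the Polygamma series at \<tau>; those with d < 0 form the
  one at 1 - \<tau>, because k is even.\<close>

lemma lipschitz_formula:
 assumes "\<tau> \<in> HH" "k \<ge> 4" "even k"
 shows "infsum (\<lambda>d. lattice_term k \<tau> (1, d)) UNIV = - polygamma_pair (k - 1) \<tau> / fact (k - 1)"
proof -
 define f where "f d = lattice_term k \<tau> (1, d)" for d
 have f: "f d = inverse ((\<tau> + of_int d) ^ k)" for d by (simp add: f_def lattice_term_def)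
 have sf: "f summable_on UNIV" unfolding f_def by (rule lattice_row_summable[OF assms(1,2)])
 have k: "Suc (k - 1) = k" using assms by simp
 have np: "\<tau> \<notin> \<int>\<^sub>\<le>\<^sub>0" "1 - \<tau> \<notin> \<int>\<^sub>\<le>\<^sub>0" using HH_not_nonpos[OF assms(1)] by auto
 have "(f \<circ> int) summable_on UNIV" by (subst summable_on_reindex [symmetric]) (auto intro: summable_on_subset_banach[OF sf])
 then have h1: "((\<lambda>n. f (int n)) has_sum infsum (\<lambda>n. f (int n)) UNIV) UNIV" by (simp add: o_def)
 have "(f \<circ> (\<lambda>n. - int n - 1)) summable_on UNIV"
  by (subst summable_on_reindex [symmetric]) (auto intro: summable_on_subset_banach[OF sf] simp: inj_on_def)
 then have h2: "((\<lambda>n. f (- int n - 1)) has_sum infsum (\<lambda>n. f (- int n - 1)) UNIV) UNIV" by (simp add: o_def)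
 have P1: "(\<lambda>n. inverse ((\<tau> + of_nat n) ^ Suc (k - 1))) sums ((-1) ^ Suc (k - 1) * Polygamma (k - 1) \<tau> / fact (k - 1))"
  by (rule Polygamma_LIMSEQ) (use np assms in \<open>auto intro: HH_not_Ints\<close>)
 have "(\<lambda>n. f (int n)) sums (Polygamma (k - 1) \<tau> / fact (k - 1))" using P1[unfolded k] assms(3) by (simp add: f)
 then have v1: "infsum (\<lambda>n. f (int n)) UNIV = Polygamma (k - 1) \<tau> / fact (k - 1)"
  using has_sum_imp_sums[OF h1] sums_unique2 by blast
 have P2: "(\<lambda>n. inverse ((1 - \<tau> + of_nat n) ^ Suc (k - 1))) sums ((-1) ^ Suc (k - 1) * Polygamma (k - 1) (1 - \<tau>) / fact (k - 1))"
  by (rule Polygamma_LIMSEQ) (use np assms in auto)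
 have "inverse ((1 - \<tau> + of_nat n) ^ k) = f (- int n - 1)" for n
 proof -
  have "(1 - \<tau> + of_nat n) = - (\<tau> + of_int (- int n - 1))" by simp
  then have "(1 - \<tau> + of_nat n) ^ k = (\<tau> + of_int (- int n - 1)) ^ k" using assms(3) by (simp only: power_minus_even)
  then show ?thesis by (simp only: f)
 qed
 then have "(\<lambda>n. f (- int n - 1)) sums (Polygamma (k - 1) (1 - \<tau>) / fact (k - 1))" using P2[unfolded k] assms(3) by simp
 then have v2: "infsum (\<lambda>n. f (- int n - 1)) UNIV = Polygamma (k - 1) (1 - \<tau>) / fact (k - 1)"
  using has_sum_imp_sums[OF h2] sums_unique2 by blast
 have "odd (k - 1)" using assms by simp
 then have "Polygamma (k - 1) \<tau> / fact (k - 1) + Polygamma (k - 1) (1 - \<tau>) / fact (k - 1) = - polygamma_pair (k - 1) \<tau> / fact (k - 1)"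
  by (simp add: polygamma_pair_def add_divide_distrib)
 then show ?thesis using infsumI[OF has_sum_int[OF h1 h2]] v1 v2 by (simp add: f_def)
qed

lemma infsum_even_int:
 fixes g :: "int \<Rightarrow> complex"
 assumes sg: "g summable_on UNIV" and ev: "\<And>d. g (- d) = g d"
 shows "infsum g UNIV = g 0 + 2 * infsum (\<lambda>n. g (int (Suc n))) UNIV"
proof -
 have "(g \<circ> (\<lambda>n. int (Suc n))) summable_on UNIV"
  by (subst summable_on_reindex [symmetric]) (auto intro: summable_on_subset_banach[OF sg] simp: inj_on_def)
 then have h: "((\<lambda>n. g (int (Suc n))) has_sum infsum (\<lambda>n. g (int (Suc n))) UNIV) UNIV" by (simp add: o_def)
 have h1: "((\<lambda>n. g (int n)) has_sum (g 0 + infsum (\<lambda>n. g (int (Suc n))) UNIV)) UNIV"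
  using has_sum_shift_nat[of "\<lambda>n. g (int n)", OF h] by simp
 have "g (- int n - 1) = g (int (Suc n))" for n
 proof -
  have "- int n - 1 = - int (Suc n)" by simp
  then show ?thesis by (simp only: ev)
 qed
 then have h2: "((\<lambda>n. g (- int n - 1)) has_sum infsum (\<lambda>n. g (int (Suc n))) UNIV) UNIV" using h by simp
 show ?thesis using infsumI[OF has_sum_int[OF h1 h2]] by simp
qed

lemma divisor_sigma_le: "divisor_sigma j n \<le> n ^ Suc j"
proof (cases "n = 0")
 case False
 have "divisor_sigma j n \<le> (\<Sum>m | m dvd n. n ^ j)"
  unfolding divisor_sigma_def using False by (intro sum_mono power_mono) (auto intro: dvd_imp_le)
 also have "\<dots> = card {m. m dvd n} * n ^ j" by simp
 also have "card {m. m dvd n} \<le> card {1..n}" using False by (intro card_mono) (auto intro: dvd_imp_le Suc_leI dvd_pos_nat)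
 finally show ?thesis by simp
qed (simp add: divisor_sigma_def)

lemma divisor_sigma_0 [simp]: "divisor_sigma j 0 = 0"
 by (simp add: divisor_sigma_def)

lemma divisor_sigma_q_expansion:
 obtains s where "has_q_expansion 1 (\<lambda>n. of_nat (divisor_sigma j n)) s"
proof
 show "has_q_expansion 1 (\<lambda>n. of_nat (divisor_sigma j n)) (\<lambda>\<tau>. \<Sum>n. of_nat (divisor_sigma j n) * qp 1 \<tau> ^ n)"
 proof (rule q_expansion_poly_growth[where C = 1 and p = "Suc j"])
  fix n
  show "norm (of_nat (divisor_sigma j n) :: complex) \<le> 1 * real n ^ Suc j"
   using divisor_sigma_le[of j n] by (metis mult_1 norm_of_nat of_nat_le_iff of_nat_power)
 qed simp
qed

lemma eisenstein_q_expansion: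
 "has_q_expansion 1 (\<lambda>n. if n = 0 then of_rat (- bernoulli k / (2 * of_nat k)) else of_nat (divisor_sigma (k - 1) n)) (eisenstein k)"
proof -
 obtain s where s: "has_q_expansion 1 (\<lambda>n. of_nat (divisor_sigma (k - 1) n)) s" by (rule divisor_sigma_q_expansion)
 define B where "B = (of_rat (- bernoulli k / (2 * of_nat k)) :: complex)"
 have "eisenstein k \<tau> = B + s \<tau>" if "\<tau> \<in> HH" for \<tau>
 proof -
  define g where "g n = of_nat (divisor_sigma (k - 1) n) * qp 1 \<tau> ^ n" for n
  have g: "g sums s \<tau>" unfolding g_def by (rule q_expansionD[OF s that])
  have "(\<Sum>n. g (Suc n)) = s \<tau>" using suminf_split_head[OF sums_summable[OF g]] sums_unique[OF g] by (simp add: g_def)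
  moreover have "exp (2 * of_real pi * \<i> * of_nat (Suc n) * \<tau>) = qp 1 \<tau> ^ Suc n" for n using qp_power[of "Suc n" \<tau> 1] by simp
  ultimately show ?thesis using that unfolding eisenstein_def B_def g_def by simp
 qed
 then have "has_q_expansion 1 (\<lambda>n. (if n = 0 then B else 0) + of_nat (divisor_sigma (k - 1) n)) (eisenstein k)"
  by (intro q_expansion_cong[OF q_expansion_add[OF q_expansion_const s]]) auto
 then show ?thesis by (rule q_expansion_cong) (auto simp: B_def)
qed

text \<open>The pairs (c, m) are regrouped by the product n = c m. Absolute convergence is checked
  on the regrouped side, where the inner sums are finite.\<close>

lemma lambert_series:
 fixes z :: complex
 assumes "\<tau> \<in> HH" "z = qp 1 \<tau>"
 shows "(\<Sum>\<^sub>\<infinity>c\<in>{1..}. \<Sum>\<^sub>\<infinity>m\<in>{1..}. of_nat m ^ j * z ^ (c * m)) = (\<Sum>\<^sub>\<infinity>n\<in>{1::nat..}. of_nat (divisor_sigma j n) * z ^ n)"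
proof -
 define f where "f = (\<lambda>(n, m). of_nat m ^ j * z ^ n :: complex)"
 define Sg where "Sg = Sigma {1::nat..} (\<lambda>n. {m. m dvd n})"
 obtain s where s: "has_q_expansion 1 (\<lambda>n. of_nat (divisor_sigma j n)) s" by (rule divisor_sigma_q_expansion)
 have fin: "finite {m. m dvd n}" if "n \<in> {1::nat..}" for n using that by (intro finite_divisors_nat) auto
 have "(\<lambda>x. norm (f x)) summable_on Sg" unfolding Sg_def Infinite_Sum.abs_summable_on_Sigma_iff
 proof (intro conjI ballI)
  show "(\<lambda>m. norm (f (n, m))) summable_on {m. m dvd n}" if "n \<in> {1..}" for n by (rule summable_on_finite[OF fin[OF that]])
  have "summable (\<lambda>n. norm (of_nat (divisor_sigma j n) * z ^ n))"
   by (rule q_series_summable[OF _ s]) (use norm_qp_less_1[of 1 \<tau>] assms in auto)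
  then have "summable (\<lambda>n. norm (norm (of_nat (divisor_sigma j n) * z ^ n)))" by simp
  then have "(\<lambda>n. norm (of_nat (divisor_sigma j n) * z ^ n)) summable_on UNIV" by (rule norm_summable_imp_summable_on)
  then have "(\<lambda>n. norm (of_nat (divisor_sigma j n) * z ^ n)) summable_on {1..}" by (rule summable_on_subset_banach) simp
  moreover have "norm (\<Sum>\<^sub>\<infinity>m\<in>{m. m dvd n}. norm (f (n, m))) = norm (of_nat (divisor_sigma j n) * z ^ n)" if "n \<in> {1..}" for n
  proof -
   have "(\<Sum>\<^sub>\<infinity>m\<in>{m. m dvd n}. norm (f (n, m))) = (\<Sum>m\<in>{m. m dvd n}. norm (f (n, m)))" by (rule infsum_finite[OF fin[OF that]])
   also have "\<dots> = real (divisor_sigma j n) * norm z ^ n"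
    by (simp add: f_def divisor_sigma_def norm_mult norm_power sum_distrib_right)
   finally show ?thesis by (simp add: norm_mult norm_power)
  qed
  ultimately show "(\<lambda>n. norm (\<Sum>\<^sub>\<infinity>m\<in>{m. m dvd n}. norm (f (n, m)))) summable_on {1..}"
   using summable_on_cong by (metis (no_types, lifting))
 qed
 then have sf: "f summable_on Sg" by (rule abs_summable_summable)
 have bij: "bij_betw (\<lambda>(c, m). (c * m, m)) ({1..} \<times> {1..}) Sg" unfolding bij_betw_def
 proof
  show "inj_on (\<lambda>(c, m). (c * m, m)) ({1..} \<times> {1::nat..})" by (auto simp: inj_on_def)
  show "(\<lambda>(c, m). (c * m, m)) ` ({1..} \<times> {1..}) = Sg"
  proof (intro equalityI subsetI)
   fix x assume "x \<in> Sg"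
   then obtain n m where x: "x = (n, m)" "n \<ge> 1" "m dvd n" by (auto simp: Sg_def)
   then obtain c where c: "n = m * c" by (auto elim: dvdE)
   then have "x = (\<lambda>(c, m). (c * m, m)) (c, m)" "(c, m) \<in> {1..} \<times> {1..}" using x by auto
   then show "x \<in> (\<lambda>(c, m). (c * m, m)) ` ({1..} \<times> {1..})" by blast
  qed (auto simp: Sg_def)
 qed
 have eq: "(\<lambda>x. f (case x of (c, m) \<Rightarrow> (c * m, m))) = (\<lambda>(c, m). of_nat m ^ j * z ^ (c * m))" by (auto simp: f_def)
 have "(\<lambda>(c, m). of_nat m ^ j * z ^ (c * m)) summable_on ({1..} \<times> {1..})"
  using summable_on_reindex_bij_betw[OF bij, of f] sf by (simp only: eq)
 from infsum_Sigma_banach[OF this]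
 have "(\<Sum>\<^sub>\<infinity>c\<in>{1..}. \<Sum>\<^sub>\<infinity>m\<in>{1..}. of_nat m ^ j * z ^ (c * m)) = infsum (\<lambda>(c, m). of_nat m ^ j * z ^ (c * m)) ({1..} \<times> {1..})"
  by simp
 also have "\<dots> = infsum f Sg" using infsum_reindex_bij_betw[OF bij, of f] by (simp only: eq)
 also have "\<dots> = (\<Sum>\<^sub>\<infinity>n\<in>{1..}. \<Sum>\<^sub>\<infinity>m\<in>{m. m dvd n}. f (n, m))"
  unfolding Sg_def by (rule infsum_Sigma_banach [symmetric]) (use sf in \<open>simp add: Sg_def\<close>)
 also have "\<dots> = (\<Sum>\<^sub>\<infinity>n\<in>{1..}. of_nat (divisor_sigma j n) * z ^ n)"
 proof (rule infsum_cong)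
  fix n :: nat assume "n \<in> {1..}"
  then show "(\<Sum>\<^sub>\<infinity>m\<in>{m. m dvd n}. f (n, m)) = of_nat (divisor_sigma j n) * z ^ n"
   by (subst infsum_finite[OF fin]) (auto simp: f_def divisor_sigma_def sum_distrib_right)
 qed
 finally show ?thesis .
qed

lemma infsum_q_series:
 assumes "has_q_expansion 1 a f" "\<tau> \<in> HH"
 shows "infsum (\<lambda>n. a n * qp 1 \<tau> ^ n) {1..} = f \<tau> - a 0"
proof -
 have "summable (\<lambda>n. norm (a n * qp 1 \<tau> ^ n))"
  by (rule q_series_summable[OF _ assms(1)]) (use norm_qp_less_1[of 1 \<tau>] assms(2) in auto)
 then have h: "((\<lambda>n. a n * qp 1 \<tau> ^ n) has_sum f \<tau>) UNIV" using q_expansionD[OF assms] by (rule norm_summable_imp_has_sum)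
 have "((\<lambda>n. a n * qp 1 \<tau> ^ n) has_sum (a 0 * qp 1 \<tau> ^ 0)) {0}" using has_sum_finite[of "{0}" "\<lambda>n. a n * qp 1 \<tau> ^ n"] by simp
 from has_sum_Diff[OF h this] have "((\<lambda>n. a n * qp 1 \<tau> ^ n) has_sum (f \<tau> - a 0)) (UNIV - {0})" by simp
 moreover have "UNIV - {0} = {1::nat..}" by auto
 ultimately show ?thesis by (simp add: infsumI)
qed

text \<open>The row c = 0 is twice a zeta value and gives the constant term; the rows c and -c agree
  and are evaluated by the Lipschitz formula at c \<tau>. The gain is that the lattice sum visibly
  transforms under inversion.\<close>

lemma lattice_sum_eisenstein:
 assumes \<tau>: "\<tau> \<in> HH" and k: "k \<ge> 4" "even k"
 shows "infsum (lattice_term k \<tau>) UNIV = 2 * cpi ^ k / fact (k - 1) * eisenstein k \<tau>"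
proof -
 define z where "z = qp 1 \<tau>"
 define S where "S c = infsum (\<lambda>d. lattice_term k \<tau> (c, d)) UNIV" for c
 define lam where "lam = cpi ^ k / fact (k - 1)"
 have summ: "lattice_term k \<tau> summable_on (Sigma UNIV (\<lambda>_. UNIV))"
  using abs_summable_summable[OF lattice_abs_summable[OF \<tau> k(1)]] by simp
 have "infsum (lattice_term k \<tau>) UNIV = infsum S UNIV" using infsum_Sigma_banach[OF summ] by (simp add: S_def [abs_def])
 also have "\<dots> = S 0 + 2 * infsum (\<lambda>n. S (int (Suc n))) UNIV"
 proof (rule infsum_even_int)
  show "S summable_on UNIV" unfolding S_def [abs_def]
   using summable_on_Sigma_banach[of "\<lambda>c d. lattice_term k \<tau> (c, d)" UNIV "\<lambda>_. UNIV"] summ by simp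
  fix c
  have "infsum (\<lambda>d. lattice_term k \<tau> (- c, - d)) UNIV = infsum (\<lambda>d. lattice_term k \<tau> (- c, d)) UNIV"
   by (rule infsum_reindex_bij_betw) (auto simp: bij_uminus)
  moreover have "lattice_term k \<tau> (- c, - d) = lattice_term k \<tau> (c, d)" for d
  proof -
   have "of_int (- c) * \<tau> + of_int (- d) = - (of_int c * \<tau> + of_int d)" by simp
   then show ?thesis using k(2) unfolding lattice_term_def by (simp only: prod.case power_minus_even)
  qed
  ultimately show "S (- c) = S c" by (simp add: S_def)
 qed
 also have "S 0 = - (of_rat (bernoulli k / fact k) * cpi ^ k)"
 proof -
  define g where "g d = lattice_term k \<tau> (0, d)" for d
  have g: "g d = inverse (of_int d ^ k)" for d by (simp add: g_def lattice_term_def)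
  have "S 0 = g 0 + 2 * infsum (\<lambda>n. g (int (Suc n))) UNIV" unfolding S_def g_def
  proof (rule infsum_even_int)
   show "(\<lambda>d. lattice_term k \<tau> (0, d)) summable_on UNIV" by (rule lattice_row_summable[OF \<tau> k(1)])
  qed (use k in \<open>simp add: lattice_term_def\<close>)
  moreover have "(g \<circ> (\<lambda>n. int (Suc n))) summable_on UNIV" unfolding g_def by (subst summable_on_reindex [symmetric])
    (auto intro: summable_on_subset_banach[OF lattice_row_summable[OF \<tau> k(1)]] simp: inj_on_def)
  then have "((\<lambda>n. g (int (Suc n))) has_sum infsum (\<lambda>n. g (int (Suc n))) UNIV) UNIV" by (simp add: o_def)
  from has_sum_imp_sums[OF this] have "(\<lambda>n. g (int (Suc n))) sums infsum (\<lambda>n. g (int (Suc n))) UNIV" .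
  moreover have "(\<lambda>n. g (int (Suc n))) sums (- (of_rat (bernoulli k / fact k) * cpi ^ k) / 2)"
   using euler_zeta_even[of k] k by (simp add: g)
  ultimately have "S 0 = g 0 + 2 * (- (of_rat (bernoulli k / fact k) * cpi ^ k) / 2)" using sums_unique2 by metis
  then show ?thesis using k by (simp add: g power_0_left)
 qed
 also have "infsum (\<lambda>n. S (int (Suc n))) UNIV = lam * (eisenstein k \<tau> - of_rat (- bernoulli k / (2 * of_nat k)))"
 proof -
  have pp: "has_q_expansion 1 (\<lambda>m. - (cpi ^ Suc (k - 1)) * of_nat m ^ (k - 1)) (polygamma_pair (k - 1))"
   by (rule polygamma_pair_q_expansion) (use k in simp)
  have Sc: "S (int c) = lam * (\<Sum>\<^sub>\<infinity>m\<in>{1..}. of_nat m ^ (k - 1) * z ^ (c * m))" if c: "c \<in> {1..}" for c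
  proof -
   have \<tau>c: "of_nat c * \<tau> \<in> HH" using c \<tau> by (simp add: HH_iff)
   have zc: "qp 1 (of_nat c * \<tau>) ^ m = z ^ (c * m)" for m
    by (simp add: z_def qp_def exp_of_nat_mult [symmetric] mult_ac power_mult)
   have "S (int c) = infsum (\<lambda>d. lattice_term k (of_nat c * \<tau>) (1, d)) UNIV" by (simp add: S_def lattice_term_def)
   also have "\<dots> = - polygamma_pair (k - 1) (of_nat c * \<tau>) / fact (k - 1)" by (rule lipschitz_formula[OF \<tau>c k])
   also have "polygamma_pair (k - 1) (of_nat c * \<tau>) =
     infsum (\<lambda>m. - (cpi ^ Suc (k - 1)) * of_nat m ^ (k - 1) * qp 1 (of_nat c * \<tau>) ^ m) {1..}"
    using infsum_q_series[OF pp \<tau>c] k by (simp add: power_0_left)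
   also have "\<dots> = infsum (\<lambda>m. - (cpi ^ Suc (k - 1)) * (of_nat m ^ (k - 1) * z ^ (c * m))) {1..}" by (simp only: zc mult.assoc)
   also have "\<dots> = - (cpi ^ Suc (k - 1)) * (\<Sum>\<^sub>\<infinity>m\<in>{1..}. of_nat m ^ (k - 1) * z ^ (c * m))" by (rule infsum_cmult_right')
   also have "Suc (k - 1) = k" using k by simp
   finally show ?thesis by (simp add: lam_def)
  qed
  have r: "range Suc = {1..}" by (auto simp: image_iff intro: Suc_pred' [symmetric]) (metis Suc_le_D)
  have "infsum (\<lambda>n. S (int (Suc n))) UNIV = infsum (\<lambda>c. S (int c)) (range Suc)" by (subst infsum_reindex) (auto simp: o_def)
  also have "\<dots> = infsum (\<lambda>c. lam * (\<Sum>\<^sub>\<infinity>m\<in>{1..}. of_nat m ^ (k - 1) * z ^ (c * m))) {1..}"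
   unfolding r by (rule infsum_cong) (rule Sc)
  also have "\<dots> = lam * (\<Sum>\<^sub>\<infinity>c\<in>{1..}. \<Sum>\<^sub>\<infinity>m\<in>{1..}. of_nat m ^ (k - 1) * z ^ (c * m))" by (rule infsum_cmult_right')
  also have "(\<Sum>\<^sub>\<infinity>c\<in>{1..}. \<Sum>\<^sub>\<infinity>m\<in>{1..}. of_nat m ^ (k - 1) * z ^ (c * m)) = (\<Sum>\<^sub>\<infinity>n\<in>{1::nat..}. of_nat (divisor_sigma (k - 1) n) * z ^ n)"
   by (rule lambert_series[OF \<tau> z_def])
  also have "\<dots> = (\<Sum>\<^sub>\<infinity>n\<in>{1::nat..}. (if n = 0 then of_rat (- bernoulli k / (2 * of_nat k)) else of_nat (divisor_sigma (k - 1) n)) * qp 1 \<tau> ^ n)"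
   unfolding z_def by (rule infsum_cong) auto
  also have "\<dots> = eisenstein k \<tau> - of_rat (- bernoulli k / (2 * of_nat k))"
   using infsum_q_series[OF eisenstein_q_expansion \<tau>] by simp
  finally show ?thesis .
 qed
 also have "- (of_rat (bernoulli k / fact k) * cpi ^ k) + 2 * (lam * (eisenstein k \<tau> - of_rat (- bernoulli k / (2 * of_nat k)))) = 2 * lam * eisenstein k \<tau>"
 proof -
  have "fact k = (of_nat k :: complex) * fact (k - 1)" using k by (simp add: fact_reduce)
  moreover have "of_rat (fact k) = (fact k :: complex)" by (metis of_nat_fact of_rat_of_nat_eq)
  ultimately have "of_rat (bernoulli k / fact k) * cpi ^ k = - 2 * (lam * of_rat (- bernoulli k / (2 * of_nat k)))"
   using k by (simp add: lam_def of_rat_divide of_rat_mult of_rat_minus mult.commute)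
  then show ?thesis by (simp add: right_diff_distrib)
 qed
 finally show ?thesis by (simp add: lam_def)
qed

section \<open>Transformation laws at level one\<close>

theorem eisenstein_S:
 assumes \<tau>: "\<tau> \<in> HH" and k: "k \<ge> 4" "even k"
 shows "eisenstein k (- 1 / \<tau>) = \<tau> ^ k * eisenstein k \<tau>"
proof -
 have \<tau>0: "\<tau> \<noteq> 0" using \<tau> by (auto simp: HH_iff)
 have \<tau>': "- 1 / \<tau> \<in> HH" using mob_HH[of "(0, - 1, 1, 0)" \<tau>] \<tau> by simp
 have "infsum (lattice_term k (- 1 / \<tau>)) UNIV = infsum (\<lambda>x. \<tau> ^ k * lattice_term k \<tau> (case x of (c, d) \<Rightarrow> (d, - c))) UNIV"
 proof (rule infsum_cong)
  fix x :: "int \<times> int"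
  obtain c d where x: "x = (c, d)" by (cases x)
  have "of_int c * (- 1 / \<tau>) + of_int d = (of_int d * \<tau> + of_int (- c)) / \<tau>" using \<tau>0 by (simp add: field_simps)
  then have "inverse ((of_int c * (- 1 / \<tau>) + of_int d) ^ k) = \<tau> ^ k * inverse ((of_int d * \<tau> + of_int (- c)) ^ k)"
   by (simp only: power_divide inverse_divide) (simp add: divide_inverse)
  then show "lattice_term k (- 1 / \<tau>) x = \<tau> ^ k * lattice_term k \<tau> (case x of (c, d) \<Rightarrow> (d, - c))"
   by (simp only: x lattice_term_def prod.case)
 qed
 also have "\<dots> = \<tau> ^ k * infsum (\<lambda>x. lattice_term k \<tau> (case x of (c, d) \<Rightarrow> (d, - c))) UNIV" by (rule infsum_cmult_right')
 also have "infsum (\<lambda>x. lattice_term k \<tau> (case x of (c, d) \<Rightarrow> (d, - c))) UNIV = infsum (lattice_term k \<tau>) UNIV"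
 proof (rule infsum_reindex_bij_betw)
  show "bij (\<lambda>x :: int \<times> int. case x of (c, d) \<Rightarrow> (d, - c))" by (rule bij_betw_byWitness[where f' = "\<lambda>(c, d). (- d, c)"]) auto
 qed
 finally have "2 * cpi ^ k / fact (k - 1) * eisenstein k (- 1 / \<tau>) = 2 * cpi ^ k / fact (k - 1) * (\<tau> ^ k * eisenstein k \<tau>)"
  unfolding lattice_sum_eisenstein[OF \<tau>' k] lattice_sum_eisenstein[OF \<tau> k] by simp
 then show ?thesis by simp
qed

text \<open>The Euclidean algorithm on the bottom row. Since the rules only multiply by S, its
  inverse is reached as S^3.\<close>

lemma SL2_induct [consumes 1, case_names one S T]:
 assumes "A \<in> SL2" and one: "P (1, 0, 0, 1)"
  and S: "\<And>A. A \<in> SL2 \<Longrightarrow> P A \<Longrightarrow> P (mm A (0, - 1, 1, 0))"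
  and T: "\<And>A j. A \<in> SL2 \<Longrightarrow> P A \<Longrightarrow> P (mm A (1, j, 0, 1))"
 shows "P A" using assms(1)
proof (induction "nat \<bar>m21 A\<bar>" arbitrary: A rule: less_induct)
 case less
 obtain a b c d where A: "A = (a, b, c, d)" by (cases A)
 have det: "a * d - b * c = 1" using less.prems by (simp add: A SL2_def)
 show ?case
 proof (cases "c = 0")
  case True
  then have "a * d = 1" using det by simp
  then have ad: "a = 1 \<and> d = 1 \<or> a = - 1 \<and> d = - 1" by (simp add: zmult_eq_1_iff)
  have "P (mm (1, 0, 0, 1) (0, - 1, 1, 0))" by (rule S[OF SL2_one(1) one])
  then have "P (mm (0, - 1, 1, 0) (0, - 1, 1, 0))" by (intro S SL2_one) simp
  then have "P (- 1, 0, 0, - 1)" by simp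
  then have "P (mm (- 1, 0, 0, - 1) (1, - b, 0, 1))" by (rule T[rotated]) (simp add: SL2_def)
  moreover have "P (mm (1, 0, 0, 1) (1, b, 0, 1))" by (rule T[OF SL2_one(1) one])
  ultimately show ?thesis using ad True by (auto simp: A)
 next
  case False
  define r q where "r = d mod c" and "q = d div c"
  have d: "d = q * c + r" by (simp add: r_def q_def)
  have "\<bar>r\<bar> < \<bar>c\<bar>" unfolding r_def by (rule abs_mod_less[OF False])
  \<comment> \<open>Chosen so that A = A' S^3 T^q; the lower left entry of \<open>A'\<close> is the
    remainder of d modulo c.\<close>
  define A' where "A' = (b - q * a, - a, r, - c)"
  have A'S: "A' \<in> SL2" using det d by (simp add: A'_def SL2_def algebra_simps)
  have "P A'" by (rule less.hyps[OF _ A'S]) (use \<open>\<bar>r\<bar> < \<bar>c\<bar>\<close> in \<open>simp add: A A'_def\<close>)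
  define S0 :: mat2 where "S0 = (0, - 1, 1, 0)"
  have S0: "S0 \<in> SL2" by (simp add: S0_def SL2_def)
  have 1: "P (mm A' S0)" unfolding S0_def by (rule S[OF A'S \<open>P A'\<close>])
  have 2: "P (mm (mm A' S0) S0)" unfolding S0_def by (rule S[OF SL2_mm[OF A'S S0] 1, unfolded S0_def])
  have 3: "P (mm (mm (mm A' S0) S0) S0)" unfolding S0_def by (rule S[OF SL2_mm[OF SL2_mm[OF A'S S0] S0] 2, unfolded S0_def])
  have "P (mm (mm (mm (mm A' S0) S0) S0) (1, q, 0, 1))" by (rule T[OF SL2_mm[OF SL2_mm[OF SL2_mm[OF A'S S0] S0] S0] 3])
  moreover have "mm (mm (mm (mm A' S0) S0) S0) (1, q, 0, 1) = A" by (simp add: A A'_def S0_def d algebra_simps)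
  ultimately show ?thesis by simp
 qed
qed

lemma invariant_level_one:
 assumes S: "\<And>\<tau>. \<tau> \<in> HH \<Longrightarrow> sl w (0, - 1, 1, 0) f \<tau> = f \<tau>"
  and T: "\<And>\<tau> j. \<tau> \<in> HH \<Longrightarrow> f (\<tau> + of_int j) = f \<tau>"
 shows "invariant w 1 f" unfolding invariant_def G0_1
proof (intro ballI)
 fix A \<tau> assume "A \<in> SL2" "\<tau> \<in> HH"
 then show "sl w A f \<tau> = f \<tau>"
 proof (induction A arbitrary: \<tau> rule: SL2_induct)
  case (S A)
  have "sl w (mm A (0, - 1, 1, 0)) f \<tau> = sl w (0, - 1, 1, 0) (sl w A f) \<tau>" using S by (intro sl_mm) (auto intro: SL2_det)
  also have "\<dots> = sl w (0, - 1, 1, 0) f \<tau>" using S by (intro sl_cong) auto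
  finally show ?case using assms(1) S by simp
 next
  case (T A j)
  have "sl w (mm A (1, j, 0, 1)) f \<tau> = sl w (1, j, 0, 1) (sl w A f) \<tau>" using T by (intro sl_mm) (auto intro: SL2_det)
  also have "\<dots> = sl w (1, j, 0, 1) f \<tau>" using T by (intro sl_cong) auto
  finally show ?case using assms(2)[OF T(3)] by (simp add: sl_shift)
 qed simp
qed

theorem eisenstein_invariant:
 assumes "k \<ge> 4" "even k" shows "invariant (int k) 1 (eisenstein k)"
proof (rule invariant_level_one)
 fix \<tau> assume \<tau>: "\<tau> \<in> HH"
 then have "\<tau> \<noteq> 0" by (auto simp: HH_iff)
 then show "sl (int k) (0, - 1, 1, 0) (eisenstein k) \<tau> = eisenstein k \<tau>"
  using eisenstein_S[OF \<tau> assms] by (simp add: sl_def power_int_minus)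
 fix j :: int
 have q: "qp 1 (\<tau> + of_int j) = qp 1 \<tau>"
 proof -
  have "2 * of_real pi * \<i> * (\<tau> + of_int j) / of_nat 1 = 2 * of_real pi * \<i> * \<tau> / of_nat 1 + \<i> * (of_int j * (of_real pi * 2))"
   by (simp add: algebra_simps)
  then show ?thesis unfolding qp_def by (simp only: exp_plus_2pin)
 qed
 have "\<tau> + of_int j \<in> HH" using \<tau> by (simp add: HH_iff)
 from q_expansionD[OF eisenstein_q_expansion this, of k] q
 show "eisenstein k (\<tau> + of_int j) = eisenstein k \<tau>"
  using sums_unique2[OF _ q_expansionD[OF eisenstein_q_expansion \<tau>, of k]] by (simp only:)
qed

section \<open>Eichler integrals and the coefficient field\<close>

text \<open>
  The period polynomials of the Eichler integral of \<open>f\<close> span a finite-dimensional rational subspace of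
  the complex numbers which is stable under multiplication by the Hecke eigenvalues. Hence the
  eigenvalues generate a number field.
\<close>

lemma deriv_eq_on_HH:
 assumes "\<And>\<tau>. \<tau> \<in> HH \<Longrightarrow> (F has_field_derivative F' \<tau>) (at \<tau>)" "\<tau> \<in> HH"
 shows "deriv F \<tau> = F' \<tau>" using assms DERIV_imp_deriv by blast

lemma higher_deriv_HH:
 assumes "F holomorphic_on HH" "\<tau> \<in> HH"
 shows "((deriv ^^ n) F has_field_derivative (deriv ^^ Suc n) F \<tau>) (at \<tau>)"
proof -
 have "(deriv ^^ n) F holomorphic_on HH" by (rule holomorphic_higher_deriv[OF assms(1) open_HH])
 then have "((deriv ^^ n) F has_field_derivative deriv ((deriv ^^ n) F) \<tau>) (at \<tau>)"
  by (rule holomorphic_derivI[OF _ open_HH assms(2)])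
 then show ?thesis by simp
qed

lemma higher_deriv_cong_HH:
 assumes "F holomorphic_on HH" "\<And>\<tau>. \<tau> \<in> HH \<Longrightarrow> F \<tau> = G \<tau>" "\<tau> \<in> HH"
 shows "(deriv ^^ n) F \<tau> = (deriv ^^ n) G \<tau>"
proof -
 have "G holomorphic_on HH" using assms(1,2) by (rule holomorphic_transform)
 then show ?thesis using higher_deriv_transform_within_open[OF assms(1) _ open_HH assms(3) assms(2)] by blast
qed

lemma higher_deriv_q_expansion:
 assumes "h > 0" "has_q_expansion h a F"
 shows "has_q_expansion h (\<lambda>n. (cpi * of_nat n / of_nat h) ^ j * a n) ((deriv ^^ j) F)"
proof (induction j)
 case 0
 then show ?case using assms by simp
next
 case (Suc j)
 obtain f' where f': "\<And>\<tau>. \<tau> \<in> HH \<Longrightarrow> ((deriv ^^ j) F has_field_derivative f' \<tau>) (at \<tau>)"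
  "has_q_expansion h (\<lambda>n. cpi * of_nat n / of_nat h * ((cpi * of_nat n / of_nat h) ^ j * a n)) f'"
  by (rule q_expansion_deriv[OF assms(1) Suc]) (rule that)
 show ?case by (rule q_expansion_cong[OF f'(2)]) (use deriv_eq_on_HH[OF f'(1)] in \<open>auto simp: mult_ac\<close>)
qed

lemma polynomial_of_higher_deriv_0:
 assumes "F holomorphic_on HH" "\<And>\<tau>. \<tau> \<in> HH \<Longrightarrow> (deriv ^^ m) F \<tau> = 0"
 shows "\<exists>c. \<forall>\<tau>\<in>HH. F \<tau> = (\<Sum>i<m. c i * \<tau> ^ i)" using assms
proof (induction m arbitrary: F)
 case 0
 then show ?case by simp
next
 case (Suc m)
 have "deriv F holomorphic_on HH" by (rule holomorphic_deriv[OF Suc.prems(1) open_HH])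
 moreover have "(deriv ^^ m) (deriv F) \<tau> = 0" if "\<tau> \<in> HH" for \<tau> using Suc.prems(2)[OF that] by (simp add: funpow_swap1)
 ultimately obtain c where c: "\<And>\<tau>. \<tau> \<in> HH \<Longrightarrow> deriv F \<tau> = (\<Sum>i<m. c i * \<tau> ^ i)" using Suc.IH[of "deriv F"] by blast
 define Q where "Q \<tau> = (\<Sum>i<m. c i / of_nat (Suc i) * \<tau> ^ Suc i)" for \<tau> :: complex
 have dQ: "(Q has_field_derivative (\<Sum>i<m. c i * \<tau> ^ i)) (at \<tau>)" for \<tau> unfolding Q_def
 proof (rule DERIV_sum)
  fix i
  have "((\<lambda>\<tau>. c i / of_nat (Suc i) * \<tau> ^ Suc i) has_field_derivative (c i / of_nat (Suc i) * (of_nat (Suc i) * \<tau> ^ i))) (at \<tau>)"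
   by (rule DERIV_cmult) (use DERIV_power[OF DERIV_ident, of "Suc i" \<tau> UNIV] in \<open>simp add: mult.commute\<close>)
  then show "((\<lambda>\<tau>. c i / of_nat (Suc i) * \<tau> ^ Suc i) has_field_derivative c i * \<tau> ^ i) (at \<tau>)" by (simp del: of_nat_Suc)
 qed
 have "((\<lambda>\<tau>. F \<tau> - Q \<tau>) has_field_derivative 0) (at \<tau> within HH)" if "\<tau> \<in> HH" for \<tau>
 proof -
  have "(F has_field_derivative (\<Sum>i<m. c i * \<tau> ^ i)) (at \<tau>)"
   using holomorphic_derivI[OF Suc.prems(1) open_HH that] c[OF that] by simp
  from DERIV_diff[OF this dQ] show ?thesis using has_field_derivative_at_within by force
 qed
 from has_field_derivative_zero_constant[OF convex_HH this]
 obtain c0 where c0: "\<And>\<tau>. \<tau> \<in> HH \<Longrightarrow> F \<tau> - Q \<tau> = c0" by blast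
 have "F \<tau> = (\<Sum>i<Suc m. (case i of 0 \<Rightarrow> c0 | Suc i \<Rightarrow> c i / of_nat (Suc i)) * \<tau> ^ i)" if "\<tau> \<in> HH" for \<tau>
  using c0[OF that] unfolding sum.lessThan_Suc_shift by (simp add: Q_def algebra_simps)
 then show ?case by blast
qed

lemma cuspidal_tendsto_0:
 assumes "cuspidal_at_infinity F"
 shows "((\<lambda>y. F (Complex 0 y)) \<longlongrightarrow> 0) at_top"
proof -
 obtain h a where F: "h > 0" "a 0 = 0" "has_q_expansion h a F" using assms by (auto simp: cuspidal_at_infinity_def)
 obtain C where C: "C \<ge> 0" "\<And>\<tau>. Im \<tau> \<ge> 1 \<Longrightarrow> norm (F \<tau>) \<le> C * exp (- (2 * pi * real 1 * Im \<tau> / real h))"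
  by (rule q_expansion_bound[OF F(1,3), of 1 1]) (use F(2) in auto)
 define e where "e = 2 * pi / real h"
 have e: "e > 0" using F(1) by (simp add: e_def)
 have lim: "((\<lambda>y. C * exp (- (e * y))) \<longlongrightarrow> C * 0) at_top"
 proof (intro tendsto_mult tendsto_const)
  have "filterlim (\<lambda>y. - (e * y)) at_bot at_top" unfolding filterlim_uminus_at_top [symmetric]
   by (rule filterlim_tendsto_pos_mult_at_top[OF tendsto_const e filterlim_ident])
  then show "((\<lambda>y. exp (- (e * y))) \<longlongrightarrow> 0) at_top" by (rule filterlim_compose[OF exp_at_bot])
 qed
 show ?thesis
 proof (rule Lim_null_comparison[where g = "\<lambda>y. C * exp (- (e * y))"])
  show "eventually (\<lambda>y. norm (F (Complex 0 y)) \<le> C * exp (- (e * y))) at_top"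
   using eventually_ge_at_top[of 1] by eventually_elim (use C(2)[of "Complex 0 _"] in \<open>simp add: e_def\<close>)
  show "((\<lambda>y. C * exp (- (e * y))) \<longlongrightarrow> 0) at_top" using lim by simp
 qed
qed

text \<open>A cuspidal function tends to 0 along the imaginary axis and a nonzero polynomial does
  not. This separates the two kinds of contributions in all period computations below.\<close>

lemma polynomial_cuspidal_0:
 assumes "cuspidal_at_infinity F" "\<And>\<tau>. \<tau> \<in> HH \<Longrightarrow> F \<tau> = poly p \<tau>"
 shows "p = 0"
proof (rule ccontr)
 assume p: "p \<noteq> 0"
 have t: "((\<lambda>y. F (Complex 0 y)) \<longlongrightarrow> 0) at_top" by (rule cuspidal_tendsto_0[OF assms(1)])
 have "eventually (\<lambda>y. F (Complex 0 y) = poly p (Complex 0 y)) at_top"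
  using eventually_gt_at_top[of 0] by eventually_elim (use assms(2) in \<open>auto simp: HH_iff\<close>)
 with t have t': "((\<lambda>y. poly p (Complex 0 y)) \<longlongrightarrow> 0) at_top" by (rule Lim_transform_eventually)
 show False
 proof (cases "Polynomial.degree p = 0")
  case True
  then obtain c where c: "p = [:c:]" using degree_0_id by metis
  then have "((\<lambda>y::real. c) \<longlongrightarrow> 0) at_top" using t' by simp
  then have "c = 0" by (simp add: tendsto_const_iff)
  then show False using p c by simp
 next
  case False
  then have "filterlim (poly p) at_infinity at_infinity" by (intro filterlim_poly_at_infinity) simp
  moreover have "filterlim (\<lambda>y. Complex 0 y) at_infinity at_top"
  proof -
   have "filterlim (\<lambda>y. norm (Complex 0 y)) at_top at_top"
   proof (rule filterlim_at_top_mono[OF filterlim_ident])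
    show "eventually (\<lambda>y. y \<le> norm (Complex 0 y)) at_top" by (auto simp: cmod_def intro!: always_eventually)
   qed
   then show ?thesis by (rule filterlim_norm_at_top_imp_at_infinity)
  qed
  ultimately have "filterlim (\<lambda>y. poly p (Complex 0 y)) at_infinity at_top" by (rule filterlim_compose)
  then show False using not_tendsto_and_filterlim_at_infinity[OF _ t'] by simp
 qed
qed

lemma cuspidal_diff: "cuspidal_at_infinity F \<Longrightarrow> cuspidal_at_infinity G \<Longrightarrow> cuspidal_at_infinity (\<lambda>\<tau>. F \<tau> - G \<tau>)"
 using cuspidal_add[OF _ cuspidal_cmult[of G "- 1"], of F] by simp

lemma cuspidal_holomorphic: "cuspidal_at_infinity F \<Longrightarrow> F holomorphic_on HH"
 unfolding cuspidal_at_infinity_def using q_expansion_holomorphic by blast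

lemma sum_poly: "\<exists>p. Polynomial.degree p \<le> n \<and> (\<forall>\<tau>. (\<Sum>i<Suc n. c i * \<tau> ^ i) = poly p \<tau>)" for c :: "nat \<Rightarrow> complex"
proof (intro exI[of _ "\<Sum>i<Suc n. Polynomial.monom (c i) i"] conjI allI)
 show "Polynomial.degree (\<Sum>i<Suc n. Polynomial.monom (c i) i) \<le> n"
  by (rule degree_sum_le) (auto intro: order_trans[OF degree_monom_le])
 fix \<tau>
 show "(\<Sum>i<Suc n. c i * \<tau> ^ i) = poly (\<Sum>i<Suc n. Polynomial.monom (c i) i) \<tau>" by (simp add: poly_sum poly_monom)
qed

lemma higher_deriv_polynomial:
 assumes "F holomorphic_on HH" "G holomorphic_on HH"
  "\<And>\<tau>. \<tau> \<in> HH \<Longrightarrow> (deriv ^^ Suc n) F \<tau> = (deriv ^^ Suc n) G \<tau>"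
 shows "\<exists>p. Polynomial.degree p \<le> n \<and> (\<forall>\<tau>\<in>HH. F \<tau> - G \<tau> = poly p \<tau>)"
proof -
 have "(\<lambda>\<tau>. F \<tau> - G \<tau>) holomorphic_on HH" using assms by (intro holomorphic_intros)
 moreover have "(deriv ^^ Suc n) (\<lambda>\<tau>. F \<tau> - G \<tau>) \<tau> = 0" if "\<tau> \<in> HH" for \<tau>
  using higher_deriv_diff[OF assms(1,2) open_HH that, of "Suc n"] assms(3)[OF that] by simp
 ultimately obtain c where "\<forall>\<tau>\<in>HH. F \<tau> - G \<tau> = (\<Sum>i<Suc n. c i * \<tau> ^ i)"
  using polynomial_of_higher_deriv_0[of "\<lambda>\<tau>. F \<tau> - G \<tau>" "Suc n"] by blast
 then show ?thesis using sum_poly[where c = c and n = n] by metis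
qed

lemma eichler_unique:
 assumes "cuspidal_at_infinity F" "cuspidal_at_infinity G"
  "\<And>\<tau>. \<tau> \<in> HH \<Longrightarrow> (deriv ^^ Suc n) F \<tau> = (deriv ^^ Suc n) G \<tau>" "\<tau> \<in> HH"
 shows "F \<tau> = G \<tau>"
proof -
 obtain p where p: "\<forall>\<tau>\<in>HH. F \<tau> - G \<tau> = poly p \<tau>"
  using higher_deriv_polynomial[OF assms(1,2)[THEN cuspidal_holomorphic] assms(3)] by blast
 have "p = 0" by (rule polynomial_cuspidal_0[OF cuspidal_diff[OF assms(1,2)]]) (use p in auto)
 then show ?thesis using p assms(4) by simp
qed

section \<open>Bol's identity and cuspidal primitives\<close>

lemma higher_deriv_linear_mult:
 assumes H: "H holomorphic_on HH" and "\<tau> \<in> HH"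
 shows "(deriv ^^ Suc n) (\<lambda>\<tau>. (c * \<tau> + d) * H \<tau>) \<tau> = (c * \<tau> + d) * (deriv ^^ Suc n) H \<tau> + of_nat (Suc n) * c * (deriv ^^ n) H \<tau>"
 using assms(2)
proof (induction n arbitrary: \<tau>)
 case 0
 have "((\<lambda>\<tau>. (c * \<tau> + d) * H \<tau>) has_field_derivative ((c * \<tau> + d) * deriv H \<tau> + c * H \<tau>)) (at \<tau>)"
  using holomorphic_derivI[OF H open_HH 0] by (auto intro!: derivative_eq_intros)
 then show ?case by (simp add: DERIV_imp_deriv)
next
 case (Suc n)
 have "((\<lambda>\<tau>. (c * \<tau> + d) * (deriv ^^ Suc n) H \<tau> + of_nat (Suc n) * c * (deriv ^^ n) H \<tau>) has_field_derivative
   ((c * \<tau> + d) * (deriv ^^ Suc (Suc n)) H \<tau> + c * (deriv ^^ Suc n) H \<tau> + of_nat (Suc n) * c * (deriv ^^ Suc n) H \<tau>)) (at \<tau>)"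
  using higher_deriv_HH[OF H Suc.prems, of "Suc n"] higher_deriv_HH[OF H Suc.prems, of n] by (auto intro!: derivative_eq_intros)
 then have "((deriv ^^ Suc n) (\<lambda>\<tau>. (c * \<tau> + d) * H \<tau>) has_field_derivative
   ((c * \<tau> + d) * (deriv ^^ Suc (Suc n)) H \<tau> + c * (deriv ^^ Suc n) H \<tau> + of_nat (Suc n) * c * (deriv ^^ Suc n) H \<tau>)) (at \<tau>)"
  by (rule has_field_derivative_transform_within_open[OF _ open_HH Suc.prems]) (simp add: Suc.IH del: funpow.simps of_nat_Suc)
 then have "deriv ((deriv ^^ Suc n) (\<lambda>\<tau>. (c * \<tau> + d) * H \<tau>)) \<tau> =
   (c * \<tau> + d) * (deriv ^^ Suc (Suc n)) H \<tau> + c * (deriv ^^ Suc n) H \<tau> + of_nat (Suc n) * c * (deriv ^^ Suc n) H \<tau>"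
  by (rule DERIV_imp_deriv)
 moreover have "(deriv ^^ Suc (Suc n)) (\<lambda>\<tau>. (c * \<tau> + d) * H \<tau>) \<tau> = deriv ((deriv ^^ Suc n) (\<lambda>\<tau>. (c * \<tau> + d) * H \<tau>)) \<tau>" by simp
 ultimately show ?case by (simp only: of_nat_Suc) (simp add: algebra_simps del: funpow.simps)
qed

text \<open>In the induction, lowering the weight by one means multiplying by the linear function
  \<open>J\<close>. The Leibniz rule for this factor produces exactly the term that cancels the
  derivative of the automorphy factor. The power of the determinant is due to the unnormalised
  \<open>sl\<close>.\<close>

theorem bol_identity:
 assumes A: "mdet A > 0" and F: "F holomorphic_on HH" and "\<tau> \<in> HH"
 shows "(deriv ^^ m) (sl (1 - int m) A F) \<tau> = of_int (mdet A) ^ m * sl (1 + int m) A ((deriv ^^ m) F) \<tau>" using assms(3)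
proof (induction m arbitrary: \<tau>)
 case 0
 then show ?case by simp
next
 case (Suc m)
 obtain a b c d where Aeq: "A = (a, b, c, d)" by (cases A)
 define J where "J \<tau> = of_int c * \<tau> + of_int d" for \<tau> :: complex
 define D where "D = (of_int (mdet A) :: complex)"
 define Fm where "Fm = (deriv ^^ m) F"
 define H where "H = sl (1 - int m) A F"
 have J0: "J \<tau> \<noteq> 0" if "\<tau> \<in> HH" for \<tau> using den_nonzero[OF A that] by (simp add: Aeq J_def)
 have Hh: "H holomorphic_on HH" unfolding H_def by (rule sl_holomorphic[OF A F])
 have S: "sl (1 - int (Suc m)) A F \<tau> = J \<tau> * H \<tau>" if "\<tau> \<in> HH" for \<tau>
 proof -
  have "J \<tau> powi (int m) = J \<tau> * J \<tau> powi (int m - 1)" using J0[OF that] by (simp add: power_int_diff)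
  then show ?thesis by (simp add: sl_def H_def Aeq J_def algebra_simps)
 qed
 have sl1: "sl (1 + int n) A g \<sigma> = g (mob A \<sigma>) * inverse (J \<sigma> ^ Suc n)" for g \<sigma> n
 proof -
  have "1 + int n = int (Suc n)" "den A \<sigma> = J \<sigma>" by (simp_all add: Aeq J_def)
  then show ?thesis unfolding sl_def by (simp only: power_int_minus power_int_of_nat)
 qed
 have Hm: "(deriv ^^ m) H \<sigma> = D ^ m * (Fm (mob A \<sigma>) * inverse (J \<sigma> ^ Suc m))" if "\<sigma> \<in> HH" for \<sigma>
  using Suc.IH[OF that] by (simp only: H_def D_def Fm_def sl1)
 have "(deriv ^^ Suc m) (sl (1 - int (Suc m)) A F) \<tau> = (deriv ^^ Suc m) (\<lambda>\<tau>. (of_int c * \<tau> + of_int d) * H \<tau>) \<tau>"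
  by (rule higher_deriv_cong_HH[OF sl_holomorphic[OF A F] _ Suc.prems]) (simp only: S J_def)
 also have "\<dots> = J \<tau> * (deriv ^^ Suc m) H \<tau> + of_nat (Suc m) * of_int c * (deriv ^^ m) H \<tau>"
  unfolding J_def by (rule higher_deriv_linear_mult[OF Hh Suc.prems])
 also have "(deriv ^^ m) H \<tau> = D ^ m * (Fm (mob A \<tau>) * inverse (J \<tau> ^ Suc m))" by (rule Hm[OF Suc.prems])
 also have "(deriv ^^ Suc m) H \<tau> = D ^ m * ((deriv ^^ Suc m) F (mob A \<tau>) * (D / J \<tau> ^ 2) * inverse (J \<tau> ^ Suc m) -
   Fm (mob A \<tau>) * (of_nat (Suc m) * of_int c * inverse (J \<tau> ^ Suc (Suc m))))"
 proof -
  have dJ: "(J has_field_derivative of_int c) (at \<tau>)" unfolding J_def by (auto intro!: derivative_eq_intros)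
  have dmu: "(mob A has_field_derivative (D / J \<tau> ^ 2)) (at \<tau>)"
  proof -
   have "((\<lambda>\<tau>. (of_int a * \<tau> + of_int b) / J \<tau>) has_field_derivative ((of_int a * J \<tau> - (of_int a * \<tau> + of_int b) * of_int c) / (J \<tau> * J \<tau>))) (at \<tau>)"
    by (rule DERIV_divide[OF _ dJ J0[OF Suc.prems]]) (auto intro!: derivative_eq_intros)
   moreover have "of_int a * J \<tau> - (of_int a * \<tau> + of_int b) * of_int c = D" by (simp add: J_def D_def Aeq algebra_simps)
   moreover have "(\<lambda>\<tau>. (of_int a * \<tau> + of_int b) / J \<tau>) = mob A" by (simp add: fun_eq_iff Aeq J_def)
   ultimately show ?thesis by (simp add: power2_eq_square)
  qed
  have dF: "((\<lambda>\<tau>. Fm (mob A \<tau>)) has_field_derivative ((deriv ^^ Suc m) F (mob A \<tau>) * (D / J \<tau> ^ 2))) (at \<tau>)"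
   unfolding Fm_def by (rule DERIV_chain2[OF higher_deriv_HH[OF F mob_HH[OF A Suc.prems]] dmu])
  have dI: "((\<lambda>\<tau>. inverse (J \<tau> ^ Suc m)) has_field_derivative (- (of_nat (Suc m) * of_int c * inverse (J \<tau> ^ Suc (Suc m))))) (at \<tau>)"
  proof -
   have "((\<lambda>\<tau>. J \<tau> ^ Suc m) has_field_derivative (of_nat (Suc m) * (of_int c * J \<tau> ^ m))) (at \<tau>)"
    using DERIV_power[OF dJ, of "Suc m"] by (simp add: mult_ac)
   then have "((\<lambda>\<tau>. inverse (J \<tau> ^ Suc m)) has_field_derivative (- (inverse (J \<tau> ^ Suc m) * (of_nat (Suc m) * (of_int c * J \<tau> ^ m)) * inverse (J \<tau> ^ Suc m)))) (at \<tau>)"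
    by (rule DERIV_inverse') (use J0[OF Suc.prems] in simp)
   moreover have "inverse (J \<tau> ^ Suc m) * (of_nat (Suc m) * (of_int c * J \<tau> ^ m)) * inverse (J \<tau> ^ Suc m) = of_nat (Suc m) * of_int c * inverse (J \<tau> ^ Suc (Suc m))"
    using J0[OF Suc.prems] by (simp add: field_simps del: of_nat_Suc)
   ultimately show ?thesis by (simp only:)
  qed
  have "((\<lambda>\<tau>. D ^ m * (Fm (mob A \<tau>) * inverse (J \<tau> ^ Suc m))) has_field_derivative
    (D ^ m * ((deriv ^^ Suc m) F (mob A \<tau>) * (D / J \<tau> ^ 2) * inverse (J \<tau> ^ Suc m) + (- (of_nat (Suc m) * of_int c * inverse (J \<tau> ^ Suc (Suc m)))) * Fm (mob A \<tau>)))) (at \<tau>)"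
   by (intro DERIV_cmult DERIV_mult dF dI)
  then have "((deriv ^^ m) H has_field_derivative
    (D ^ m * ((deriv ^^ Suc m) F (mob A \<tau>) * (D / J \<tau> ^ 2) * inverse (J \<tau> ^ Suc m) + (- (of_nat (Suc m) * of_int c * inverse (J \<tau> ^ Suc (Suc m)))) * Fm (mob A \<tau>)))) (at \<tau>)"
  proof (rule has_field_derivative_transform_within_open[OF _ open_HH Suc.prems])
   fix \<sigma> assume "\<sigma> \<in> HH"
   from Hm[OF this] show "D ^ m * (Fm (mob A \<sigma>) * inverse (J \<sigma> ^ Suc m)) = (deriv ^^ m) H \<sigma>" by simp
  qed
  then show ?thesis by (simp add: DERIV_imp_deriv mult.commute del: of_nat_Suc)
 qed
 finally have "(deriv ^^ Suc m) (sl (1 - int (Suc m)) A F) \<tau> = D ^ Suc m * ((deriv ^^ Suc m) F (mob A \<tau>) * inverse (J \<tau> ^ Suc (Suc m)))"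
  using J0[OF Suc.prems] by (simp add: field_simps power2_eq_square del: of_nat_Suc funpow.simps)
 moreover have "sl (1 + int (Suc m)) A ((deriv ^^ Suc m) F) \<tau> = (deriv ^^ Suc m) F (mob A \<tau>) * inverse (J \<tau> ^ Suc (Suc m))"
  by (rule sl1)
 ultimately show ?case by (simp add: D_def del: funpow.simps)
qed

lemma cuspidal_antiderivative:
 assumes "h > 0" "a 0 = 0" "has_q_expansion h a g"
 obtains F b where "b 0 = 0" "has_q_expansion h b F" "\<And>\<tau>. \<tau> \<in> HH \<Longrightarrow> (deriv ^^ j) F \<tau> = g \<tau>"
proof -
 define e where "e n = (cpi * of_nat n / of_nat h) ^ j" for n
 \<comment> \<open>At n = 0 the quotient is 0 whatever \<open>e 0\<close> is, because a 0 =
   0.\<close>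
 define b where "b n = a n / e n" for n
 define F where "F \<tau> = (\<Sum>n. b n * qp h \<tau> ^ n)" for \<tau>
 define C where "C = (real h / (2 * pi)) ^ j"
 have bn: "norm (b n) \<le> C * norm (a n)" for n
 proof (cases "n = 0")
  case False
  have "norm (e n) = (2 * pi * real n / real h) ^ j" by (simp add: e_def norm_power norm_mult norm_divide)
  moreover have "(2 * pi / real h) ^ j \<le> (2 * pi * real n / real h) ^ j"
   using False assms(1) by (intro power_mono divide_right_mono) auto
  ultimately have "inverse (norm (e n)) \<le> inverse ((2 * pi / real h) ^ j)" using assms(1) by (intro le_imp_inverse_le) auto
  also have "\<dots> = C" by (simp add: C_def power_inverse [symmetric])
  finally have "norm (a n) * inverse (norm (e n)) \<le> norm (a n) * C" by (intro mult_left_mono) auto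
  then show ?thesis by (simp add: b_def norm_divide) (simp add: divide_inverse mult.commute)
 qed (simp add: b_def assms(2))
 have e: "has_q_expansion h b F" unfolding has_q_expansion_iff
 proof
  fix \<tau> assume \<tau>: "\<tau> \<in> HH"
  have "summable (\<lambda>n. C * norm (a n * qp h \<tau> ^ n))"
   by (intro summable_mult q_series_summable[OF assms(1,3)] norm_qp_less_1[OF assms(1) \<tau>])
  then have "summable (\<lambda>n. b n * qp h \<tau> ^ n)"
  proof (rule summable_comparison_test'[where N = 0])
   fix n show "norm (b n * qp h \<tau> ^ n) \<le> C * norm (a n * qp h \<tau> ^ n)"
    using mult_right_mono[OF bn[of n], of "norm (qp h \<tau> ^ n)"] by (simp add: norm_mult mult.assoc)
  qed
  then show "(\<lambda>n. b n * qp h \<tau> ^ n) sums F \<tau>" unfolding F_def by (rule summable_sums)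
 qed
 have b0: "b 0 = 0" by (simp add: b_def assms(2))
 have "e n * b n = a n" for n
 proof (cases "n = 0")
  case False
  then have "e n \<noteq> 0" using assms(1) by (simp add: e_def)
  then show ?thesis by (simp add: b_def)
 qed (simp add: assms(2) b0)
 then have d: "has_q_expansion h a ((deriv ^^ j) F)"
  by (intro q_expansion_cong[OF higher_deriv_q_expansion[OF assms(1) e, of j]]) (auto simp: e_def)
 show thesis by (rule that[OF b0 e]) (use sums_unique2[OF q_expansionD[OF d] q_expansionD[OF assms(3)]] in blast)
qed

lemma poly_eq_HH:
 fixes p q :: "complex poly"
 assumes "\<And>\<tau>. \<tau> \<in> HH \<Longrightarrow> poly p \<tau> = poly q \<tau>" shows "p = q"
proof -
 have "cuspidal_at_infinity (\<lambda>_. 0)" using cuspidal_sum[of "{}"] by simp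
 then have "p - q = 0" by (rule polynomial_cuspidal_0) (use assms in simp)
 then show ?thesis by simp
qed

section \<open>Rational linear relations and the action on polynomials\<close>

global_interpretation rat_vs: vector_space "\<lambda>(q::rat) (x::complex). of_rat q * x"
 by standard (auto simp: ring_distribs of_rat_add of_rat_mult)

lemma rat_span_int: "x \<in> rat_vs.span S \<Longrightarrow> x * of_int z \<in> rat_vs.span S"
 using rat_vs.span_scale[of x S "of_int z"] by (simp add: mult.commute)

text \<open>The lowest nonzero coefficient of a relation is a multiple of \<open>x\<close>. With
  rational coefficients this makes 1/x a polynomial in x; with integral ones it puts a nonzero
  integer into an ideal containing x.\<close>

lemma lowest_term:
 fixes c :: "nat \<Rightarrow> complex"
 assumes "\<exists>i\<le>d. c i \<noteq> 0" "(\<Sum>i\<le>d. c i * x ^ i) = 0" "x \<noteq> 0"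
 obtains j where "c j \<noteq> 0" "j \<le> d" "c j = - (x * (\<Sum>i\<in>{Suc j..d}. c i * x ^ (i - Suc j)))"
proof -
 define j where "j = (LEAST i. c i \<noteq> 0)"
 obtain i0 where i0: "i0 \<le> d" "c i0 \<noteq> 0" using assms(1) by blast
 have j: "c j \<noteq> 0" "j \<le> d" using LeastI[of "\<lambda>i. c i \<noteq> 0", OF i0(2)] Least_le[of "\<lambda>i. c i \<noteq> 0", OF i0(2)] i0(1) by (auto simp: j_def)
 have lt: "c i = 0" if "i < j" for i using not_less_Least[of i "\<lambda>i. c i \<noteq> 0"] that by (auto simp: j_def)
 have "(\<Sum>i\<le>d. c i * x ^ i) = (\<Sum>i\<in>{j..d}. c i * x ^ i)" using lt by (intro sum.mono_neutral_right) (auto simp: not_le)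
 also have "\<dots> = c j * x ^ j + (\<Sum>i\<in>{Suc j..d}. c i * x ^ i)" using j by (simp add: sum.atLeast_Suc_atMost)
 also have "(\<Sum>i\<in>{Suc j..d}. c i * x ^ i) = x ^ Suc j * (\<Sum>i\<in>{Suc j..d}. c i * x ^ (i - Suc j))" unfolding sum_distrib_left
 proof (rule sum.cong)
  fix i assume "i \<in> {Suc j..d}"
  then have "x ^ i = x ^ Suc j * x ^ (i - Suc j)" by (simp only: power_add [symmetric]) simp
  then show "c i * x ^ i = x ^ Suc j * (c i * x ^ (i - Suc j))" by (simp only: mult.left_commute)
 qed simp
 finally have "x ^ j * (c j + x * (\<Sum>i\<in>{Suc j..d}. c i * x ^ (i - Suc j))) = 0" using assms(2) by (simp add: algebra_simps)
 then show thesis using that[OF j] assms(3) by (simp add: eq_neg_iff_add_eq_0)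
qed

lemma rat_relation:
 assumes "finite G" "\<And>i. i \<le> card G \<Longrightarrow> v i \<in> rat_vs.span G"
 shows "\<exists>c :: nat \<Rightarrow> rat. (\<exists>i\<le>card G. c i \<noteq> 0) \<and> (\<Sum>i\<le>card G. of_rat (c i) * v i) = 0"
proof (cases "inj_on v {..card G}")
 case True
 have "rat_vs.dependent (v ` {..card G})"
 proof (rule ccontr)
  assume "\<not> rat_vs.dependent (v ` {..card G})"
  then have "card (v ` {..card G}) \<le> card G"
   using rat_vs.independent_span_bound[OF assms(1), of "v ` {..card G}"] assms(2) by auto
  then show False using card_image[OF True] by simp
 qed
 then obtain u where u: "\<exists>x\<in>v ` {..card G}. u x \<noteq> 0" "(\<Sum>x\<in>v ` {..card G}. of_rat (u x) * x) = 0"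
  using rat_vs.dependent_finite[of "v ` {..card G}"] by auto
 have "(\<Sum>i\<le>card G. of_rat (u (v i)) * v i) = 0" using u(2) sum.reindex[OF True, of "\<lambda>x. of_rat (u x) * x"] by simp
 then show ?thesis using u(1) by (intro exI[of _ "u \<circ> v"]) auto
next
 case False
 then obtain i j where ij: "i \<le> card G" "j \<le> card G" "i \<noteq> j" "v i = v j" by (auto simp: inj_on_def)
 define c where "c n = (if n = i then 1 else if n = j then - 1 else 0 :: rat)" for n
 have "(\<Sum>n\<le>card G. of_rat (c n) * v n) = (\<Sum>n\<in>{i, j}. of_rat (c n) * v n)"
  using ij by (intro sum.mono_neutral_right) (auto simp: c_def)
 also have "\<dots> = 0" using ij by (simp add: c_def of_rat_minus)
 finally show ?thesis using ij(1) by (intro exI[of _ c]) (auto simp: c_def)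
qed

lemma coeff_int_poly_mult:
 assumes "\<And>i. Polynomial.coeff p i \<in> \<int>" "\<And>i. Polynomial.coeff q i \<in> \<int>"
 shows "Polynomial.coeff (p * q :: complex poly) i \<in> \<int>" unfolding coeff_mult by (intro Ints_sum Ints_mult assms)

lemma coeff_int_poly_power: "(\<And>i. Polynomial.coeff p i \<in> \<int>) \<Longrightarrow> Polynomial.coeff (p ^ n :: complex poly) i \<in> \<int>"
proof (induction n arbitrary: i)
 case 0
 then show ?case by (simp add: coeff_1)
qed (simp add: coeff_int_poly_mult)

text \<open>The action (c \<tau> + d)^n P((a \<tau> + b)/(c \<tau> + d)) on polynomials of degree at
  most n, written in coefficients. Integral matrices act with integral coefficients, so rational
  spans are preserved, see \<open>pact_span\<close>.\<close>

fun pact :: "nat \<Rightarrow> mat2 \<Rightarrow> complex poly \<Rightarrow> complex poly" where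
 "pact n (a, b, c, d) P = (\<Sum>i\<le>n. Polynomial.smult (Polynomial.coeff P i) ([:of_int b, of_int a:] ^ i * [:of_int d, of_int c:] ^ (n - i)))"

lemma poly_pact:
 assumes "Polynomial.degree P \<le> n" "mdet A > 0" "\<tau> \<in> HH"
 shows "poly (pact n A P) \<tau> = sl (- int n) A (poly P) \<tau>"
proof -
 obtain a b c d where A: "A = (a, b, c, d)" by (cases A)
 define J where "J = of_int d + \<tau> * of_int c"
 have J: "J \<noteq> 0" using den_nonzero[OF assms(2,3)] by (simp add: A J_def algebra_simps)
 define z where "z = of_int b + \<tau> * of_int a"
 have "sl (- int n) A (poly P) \<tau> = poly P (z / J) * J ^ n" by (simp add: sl_def A z_def J_def algebra_simps)
 also have "poly P (z / J) = (\<Sum>i\<le>n. Polynomial.coeff P i * (z / J) ^ i)"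
  unfolding poly_altdef using assms(1) by (intro sum.mono_neutral_left) (auto simp: coeff_eq_0)
 also have "\<dots> * J ^ n = (\<Sum>i\<le>n. Polynomial.coeff P i * (z ^ i * J ^ (n - i)))" unfolding sum_distrib_right
 proof (rule sum.cong)
  fix i assume "i \<in> {..n}"
  then have "J ^ n = J ^ i * J ^ (n - i)" by (simp add: power_add [symmetric])
  then show "Polynomial.coeff P i * (z / J) ^ i * J ^ n = Polynomial.coeff P i * (z ^ i * J ^ (n - i))"
   using J by (simp add: power_divide)
 qed simp
 finally show ?thesis by (simp add: A poly_sum z_def J_def)
qed

lemma pact_span:
 assumes "\<And>i. Polynomial.coeff P i \<in> rat_vs.span S" shows "Polynomial.coeff (pact n A P) j \<in> rat_vs.span S"
proof -
 obtain a b c d where A: "A = (a, b, c, d)" by (cases A)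
 have lin: "Polynomial.coeff [:of_int y, of_int x :: complex:] i \<in> \<int>" for i and x y :: int
  by (auto simp: coeff_pCons split: nat.splits)
 have "Polynomial.coeff ([:of_int b, of_int a:] ^ i * [:of_int d, of_int c :: complex:] ^ (n - i)) j \<in> \<int>" for i
  by (intro coeff_int_poly_mult coeff_int_poly_power lin)
 then show ?thesis unfolding A pact.simps coeff_sum coeff_smult by (intro rat_vs.span_sum) (metis Ints_cases rat_span_int assms)
qed

section \<open>Period polynomials and the field of coefficients\<close>

locale eichler =
 fixes k N :: nat and f :: "complex \<Rightarrow> complex"
 assumes k: "k \<ge> 2" and N: "N > 0" and nf: "newform k N f"
begin

abbreviation w :: int where "w \<equiv> - int (k - 2)"
abbreviation II :: mat2 where "II \<equiv> (1, 0, 0, 1)"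
abbreviation SS :: mat2 where "SS \<equiv> (0, - 1, 1, 0)"

lemma fc: "f \<in> cusp_forms k N" using nf by (simp add: newform_def new_subspace_def)

lemma finv: "invariant (int k) N f" using fc by (simp add: cusp_forms_iff)

text \<open>The Eichler integral of f|A: the (k-1)-fold primitive that vanishes at infinity, unique
  by \<open>eichler_unique\<close>. Each \<open>A\<close> has its own, since the functions f|A
  differ.\<close>

definition EI :: "mat2 \<Rightarrow> complex \<Rightarrow> complex" where
 "EI A = (SOME F. (\<exists>b. b 0 = 0 \<and> has_q_expansion N b F) \<and> (\<forall>\<tau>\<in>HH. (deriv ^^ (k - 1)) F \<tau> = sl (int k) A f \<tau>))"

lemma EI:
 assumes "A \<in> SL2"
 shows "\<exists>b. b 0 = 0 \<and> has_q_expansion N b (EI A)" "\<And>\<tau>. \<tau> \<in> HH \<Longrightarrow> (deriv ^^ (k - 1)) (EI A) \<tau> = sl (int k) A f \<tau>"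
proof -
 obtain a where a: "a 0 = 0" "has_q_expansion N a (sl (int k) A f)" using fc assms unfolding cusp_forms_iff by blast
 obtain F b where "b 0 = 0" "has_q_expansion N b F" "\<And>\<tau>. \<tau> \<in> HH \<Longrightarrow> (deriv ^^ (k - 1)) F \<tau> = sl (int k) A f \<tau>"
  by (rule cuspidal_antiderivative[OF N a, of "k - 1"]) (rule that)
 then have "\<exists>F. (\<exists>b. b 0 = 0 \<and> has_q_expansion N b F) \<and> (\<forall>\<tau>\<in>HH. (deriv ^^ (k - 1)) F \<tau> = sl (int k) A f \<tau>)" by blast
 from someI_ex[OF this] show "\<exists>b. b 0 = 0 \<and> has_q_expansion N b (EI A)"
  "\<And>\<tau>. \<tau> \<in> HH \<Longrightarrow> (deriv ^^ (k - 1)) (EI A) \<tau> = sl (int k) A f \<tau>" unfolding EI_def by blast+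
qed

lemma EI_cuspidal: "A \<in> SL2 \<Longrightarrow> cuspidal_at_infinity (EI A)"
 using EI(1) N unfolding cuspidal_at_infinity_def by blast

lemma EI_unique:
 assumes "A \<in> SL2" "cuspidal_at_infinity F" "\<And>\<tau>. \<tau> \<in> HH \<Longrightarrow> (deriv ^^ (k - 1)) F \<tau> = c * sl (int k) A f \<tau>" "\<tau> \<in> HH"
 shows "F \<tau> = c * EI A \<tau>"
proof (rule eichler_unique[OF assms(2) cuspidal_cmult[OF EI_cuspidal[OF assms(1)]] _ assms(4)])
 fix \<tau> assume \<tau>: "\<tau> \<in> HH"
 have "(deriv ^^ (k - 1)) (\<lambda>\<tau>. c * EI A \<tau>) \<tau> = c * (deriv ^^ (k - 1)) (EI A) \<tau>"
  by (rule higher_deriv_cmult[OF cuspidal_holomorphic[OF EI_cuspidal[OF assms(1)]] \<tau> open_HH])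
 moreover have "Suc (k - 2) = k - 1" using k by simp
 ultimately show "(deriv ^^ Suc (k - 2)) F \<tau> = (deriv ^^ Suc (k - 2)) (\<lambda>\<tau>. c * EI A \<tau>) \<tau>"
  using assms(3)[OF \<tau>] EI(2)[OF assms(1) \<tau>] by (simp only:)
qed

lemma EI_crel:
 assumes "A \<in> SL2" "B \<in> SL2" "crel N A B" "\<tau> \<in> HH" shows "EI A \<tau> = EI B \<tau>"
 using EI_unique[OF assms(2) EI_cuspidal[OF assms(1)], of 1] EI(2)[OF assms(1)] sl_crel[OF finv assms(1-3)] assms(4) by simp

lemma bol:
 assumes "mdet M > 0" "A \<in> SL2" "\<tau> \<in> HH"
 shows "(deriv ^^ (k - 1)) (sl w M (EI A)) \<tau> = of_int (mdet M) ^ (k - 1) * sl (int k) (mm A M) f \<tau>"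
proof -
 have "1 - int (k - 1) = w" "1 + int (k - 1) = int k" using k by auto
 then have "(deriv ^^ (k - 1)) (sl w M (EI A)) \<tau> = of_int (mdet M) ^ (k - 1) * sl (int k) M ((deriv ^^ (k - 1)) (EI A)) \<tau>"
  using bol_identity[OF assms(1) cuspidal_holomorphic[OF EI_cuspidal[OF assms(2)]] assms(3), of "k - 1"] by (simp only:)
 also have "sl (int k) M ((deriv ^^ (k - 1)) (EI A)) \<tau> = sl (int k) M (sl (int k) A f) \<tau>"
  by (rule sl_cong[OF assms(1,3) EI(2)[OF assms(2)]])
 also have "\<dots> = sl (int k) (mm A M) f \<tau>" using sl_mm[OF SL2_det[OF assms(2)] assms(1,3)] by simp
 finally show ?thesis .
qed

lemma period_ex:
 assumes "A \<in> SL2" "B \<in> SL2"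
 shows "\<exists>p. Polynomial.degree p \<le> k - 2 \<and> (\<forall>\<tau>\<in>HH. sl w B (EI A) \<tau> - EI (mm A B) \<tau> = poly p \<tau>)"
proof (rule higher_deriv_polynomial)
 show "sl w B (EI A) holomorphic_on HH"
  by (rule sl_holomorphic[OF SL2_det[OF assms(2)] cuspidal_holomorphic[OF EI_cuspidal[OF assms(1)]]])
 show "EI (mm A B) holomorphic_on HH" by (rule cuspidal_holomorphic[OF EI_cuspidal[OF SL2_mm[OF assms]]])
 fix \<tau> assume "\<tau> \<in> HH"
 moreover have "Suc (k - 2) = k - 1" using k by simp
 ultimately show "(deriv ^^ Suc (k - 2)) (sl w B (EI A)) \<tau> = (deriv ^^ Suc (k - 2)) (EI (mm A B)) \<tau>"
  using bol[OF SL2_det[OF assms(2)] assms(1)] EI(2)[OF SL2_mm[OF assms]] assms(2) by (simp only: SL2_def) simp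
qed

text \<open>The period polynomial measures the failure of the Eichler integrals to be permuted by
  \<open>B\<close>. It exists by Bol's identity: both functions have the same (k-1)-st
  derivative.\<close>

definition PP :: "mat2 \<Rightarrow> mat2 \<Rightarrow> complex poly" where
 "PP A B = (SOME p. Polynomial.degree p \<le> k - 2 \<and> (\<forall>\<tau>\<in>HH. sl w B (EI A) \<tau> - EI (mm A B) \<tau> = poly p \<tau>))"

lemma PP:
 assumes "A \<in> SL2" "B \<in> SL2"
 shows "Polynomial.degree (PP A B) \<le> k - 2" "\<And>\<tau>. \<tau> \<in> HH \<Longrightarrow> sl w B (EI A) \<tau> = EI (mm A B) \<tau> + poly (PP A B) \<tau>"
proof -
 have "Polynomial.degree (PP A B) \<le> k - 2 \<and> (\<forall>\<tau>\<in>HH. sl w B (EI A) \<tau> - EI (mm A B) \<tau> = poly (PP A B) \<tau>)"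
  unfolding PP_def by (rule someI_ex[OF period_ex[OF assms]])
 then show "Polynomial.degree (PP A B) \<le> k - 2" "\<And>\<tau>. \<tau> \<in> HH \<Longrightarrow> sl w B (EI A) \<tau> = EI (mm A B) \<tau> + poly (PP A B) \<tau>"
  by (auto simp: algebra_simps)
qed

lemma PP_eqI:
 assumes "A \<in> SL2" "B \<in> SL2" "\<And>\<tau>. \<tau> \<in> HH \<Longrightarrow> sl w B (EI A) \<tau> = EI (mm A B) \<tau> + poly p \<tau>"
 shows "PP A B = p" using PP(2)[OF assms(1,2)] assms(3) by (intro poly_eq_HH) (metis add_left_cancel)

lemma PP_cocycle:
 assumes A: "A \<in> SL2" and B: "B \<in> SL2" and C: "C \<in> SL2"
 shows "PP A (mm B C) = pact (k - 2) C (PP A B) + PP (mm A B) C"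
proof (rule PP_eqI[OF A SL2_mm[OF B C]])
 fix \<tau> assume \<tau>: "\<tau> \<in> HH"
 have "sl w (mm B C) (EI A) \<tau> = sl w C (sl w B (EI A)) \<tau>" by (rule sl_mm[OF SL2_det[OF B] SL2_det[OF C] \<tau>])
 also have "\<dots> = sl w C (\<lambda>\<tau>. EI (mm A B) \<tau> + poly (PP A B) \<tau>) \<tau>" by (rule sl_cong[OF SL2_det[OF C] \<tau> PP(2)[OF A B]])
 also have "\<dots> = sl w C (EI (mm A B)) \<tau> + sl w C (poly (PP A B)) \<tau>" by (rule sl_linear(1))
 also have "\<dots> = EI (mm (mm A B) C) \<tau> + poly (PP (mm A B) C) \<tau> + poly (pact (k - 2) C (PP A B)) \<tau>"
  using PP(2)[OF SL2_mm[OF A B] C \<tau>] poly_pact[OF PP(1)[OF A B] SL2_det[OF C] \<tau>] by simp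
 finally show "sl w (mm B C) (EI A) \<tau> = EI (mm A (mm B C)) \<tau> + poly (pact (k - 2) C (PP A B) + PP (mm A B) C) \<tau>"
  by (simp add: mm_assoc)
qed

lemma PP_shift:
 assumes A: "A \<in> SL2" shows "PP A (1, j, 0, 1) = 0"
proof (rule PP_eqI[OF A SL2_one(2)])
 fix \<tau> assume \<tau>: "\<tau> \<in> HH"
 have "cuspidal_at_infinity (\<lambda>\<tau>. EI A ((of_int 1 * \<tau> + of_int j) / of_int 1))"
  by (rule cuspidal_affine[OF EI_cuspidal[OF A]]) auto
 then have c: "cuspidal_at_infinity (sl w (1, j, 0, 1) (EI A))" by (rule cuspidal_cong) (simp add: sl_shift)
 have "sl w (1, j, 0, 1) (EI A) \<tau> = 1 * EI (mm A (1, j, 0, 1)) \<tau>"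
  by (rule EI_unique[OF SL2_mm[OF A SL2_one(2)] c _ \<tau>]) (use bol[OF _ A, of "(1, j, 0, 1)"] in simp)
 then show "sl w (1, j, 0, 1) (EI A) \<tau> = EI (mm A (1, j, 0, 1)) \<tau> + poly 0 \<tau>" by simp
qed

lemma PP_crel:
 assumes "A \<in> SL2" "A' \<in> SL2" "crel N A A'" and B: "B \<in> SL2" shows "PP A B = PP A' B"
proof (rule PP_eqI[OF assms(1) B])
 fix \<tau> assume \<tau>: "\<tau> \<in> HH"
 have "sl w B (EI A) \<tau> = sl w B (EI A') \<tau>" by (rule sl_cong[OF SL2_det[OF B] \<tau> EI_crel[OF assms(1-3)]])
 moreover have "EI (mm A B) \<tau> = EI (mm A' B) \<tau>" by (rule EI_crel) (use assms \<tau> crel_mm in \<open>auto intro: SL2_mm\<close>)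
 ultimately show "sl w B (EI A) \<tau> = EI (mm A B) \<tau> + poly (PP A' B) \<tau>" using PP(2)[OF assms(2) B \<tau>] by simp
qed

definition GY :: "complex set" where "GY = (\<lambda>(R, i). Polynomial.coeff (PP R SS) i) ` (Reps N \<times> {..k - 2})"

lemma finite_GY: "finite GY" unfolding GY_def using finite_Reps[OF N] by auto

text \<open>By the cocycle relation all period polynomials come from those of the generators.
  Translations have none, and for the inversion only the coset of \<open>A\<close> matters, so
  finitely many numbers span.\<close>

lemma PP_span: "B \<in> SL2 \<Longrightarrow> A \<in> SL2 \<Longrightarrow> Polynomial.coeff (PP A B) i \<in> rat_vs.span GY"
proof (induction B arbitrary: A i rule: SL2_induct)
 case one
 then show ?case by (simp add: PP_shift rat_vs.span_zero)
next
 case (S B)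
 have R: "rep N (mm A B) \<in> SL2" "crel N (mm A B) (rep N (mm A B))" using rep_props[OF SL2_mm[OF S(3,1)]] by auto
 have "PP A (mm B SS) = pact (k - 2) SS (PP A B) + PP (rep N (mm A B)) SS"
  unfolding PP_cocycle[OF S(3,1) SL2_one(3)] PP_crel[OF SL2_mm[OF S(3,1)] R SL2_one(3)] ..
 moreover have "Polynomial.coeff (PP (rep N (mm A B)) SS) i \<in> rat_vs.span GY"
 proof (cases "i \<le> k - 2")
  case True
  then show ?thesis using SL2_mm[OF S(3,1)] by (intro rat_vs.span_base) (auto simp: GY_def Reps_def)
 next
  case False
  then have "Polynomial.coeff (PP (rep N (mm A B)) SS) i = 0" using PP(1)[OF R(1) SL2_one(3)] by (intro coeff_eq_0) simp
  then show ?thesis using rat_vs.span_zero by simp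
 qed
 ultimately show ?case using rat_vs.span_add[OF pact_span[OF S(2)[OF S(3)], of "k - 2" SS i]] by (simp only: coeff_add)
next
 case (T B j)
 have "PP A (mm B (1, j, 0, 1)) = pact (k - 2) (1, j, 0, 1) (PP A B)"
  unfolding PP_cocycle[OF T(3,1) SL2_one(2)] PP_shift[OF SL2_mm[OF T(3,1)]] by (simp only: add_0_right)
 then show ?case using pact_span[OF T(2)[OF T(3)], of "k - 2" "(1, j, 0, 1)" i] by (simp only:)
qed

text \<open>Only the periods of \<open>f\<close> itself enter, that is the base point
  \<open>II\<close>: this is the space that the Hecke eigenvalues preserve, see
  \<open>q_coeff_Y\<close>.\<close>

definition Y :: "complex set" where
 "Y = rat_vs.span {Polynomial.coeff (PP II B) i | B i. B \<in> SL2}"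

lemma Y_subset: "Y \<subseteq> rat_vs.span GY"
 unfolding Y_def by (rule rat_vs.span_minimal) (use PP_span SL2_one(1) in auto)

lemma PP_Y: "B \<in> SL2 \<Longrightarrow> Polynomial.coeff (PP II B) i \<in> Y"
 unfolding Y_def by (rule rat_vs.span_base, rule CollectI) (intro exI[of _ B] exI[of _ i] conjI refl)

text \<open>By the Hermite form, \<open>M\<close> is a matrix in \<open>SL2\<close> followed by an
  affine map. The first factor produces a cuspidal function plus a period polynomial, and the second
  preserves both kinds.\<close>

lemma hecke_decomposition:
 assumes M: "mdet M > 0"
 shows "\<exists>P. (\<forall>i. Polynomial.coeff P i \<in> Y) \<and> cuspidal_at_infinity (\<lambda>\<tau>. sl w M (EI II) \<tau> - poly P \<tau>)"
proof -
 obtain B a b d where B: "B \<in> SL2" "a > 0" "d > 0" "M = mm B (a, b, 0, d)" using hermite[OF M] by metis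
 have det: "mdet (a, b, 0, d) > 0" using B by simp
 define P where "P = pact (k - 2) (a, b, 0, d) (PP II B)"
 have "Polynomial.coeff P i \<in> Y" for i using PP_Y[OF B(1)] unfolding P_def Y_def by (rule pact_span)
 moreover have "cuspidal_at_infinity (\<lambda>\<tau>. of_int d powi (- w) * EI B ((of_int a * \<tau> + of_int b) / of_int d))"
  by (intro cuspidal_cmult cuspidal_affine EI_cuspidal B)
 then have "cuspidal_at_infinity (\<lambda>\<tau>. sl w M (EI II) \<tau> - poly P \<tau>)"
 proof (rule cuspidal_cong)
  fix \<tau> assume \<tau>: "\<tau> \<in> HH"
  have "sl w M (EI II) \<tau> = sl w (a, b, 0, d) (sl w B (EI II)) \<tau>" unfolding B(4) by (rule sl_mm[OF SL2_det[OF B(1)] det \<tau>])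
  also have "\<dots> = sl w (a, b, 0, d) (\<lambda>\<tau>. EI (mm II B) \<tau> + poly (PP II B) \<tau>) \<tau>"
   by (rule sl_cong[OF det \<tau> PP(2)[OF SL2_one(1) B(1)]])
  also have "\<dots> = sl w (a, b, 0, d) (EI B) \<tau> + poly P \<tau>"
   unfolding sl_linear(1) P_def poly_pact[OF PP(1)[OF SL2_one(1) B(1)] det \<tau>] by simp
  finally show "of_int d powi (- w) * EI B ((of_int a * \<tau> + of_int b) / of_int d) = sl w M (EI II) \<tau> - poly P \<tau>"
   by (simp add: sl_tri)
 qed
 ultimately show ?thesis by blast
qed

text \<open>Both sides are cuspidal at infinity, and by Bol's identity the (k-1)-st derivative of
  the left side is T_n f. Uniqueness of the primitive transfers the eigenvalue.\<close>

lemma hecke_EI: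
 assumes n: "n \<ge> 1" and \<tau>: "\<tau> \<in> HH"
 shows "(\<Sum>(a, b)\<in>(SIGMA a:{a. a dvd n \<and> coprime a N}. {..<n div a}). sl w (int a, int b, 0, int (n div a)) (EI II) \<tau>) = q_coeff f n * EI II \<tau>"
proof (rule EI_unique[OF SL2_one(1) _ _ \<tau>])
 let ?D = "{a. a dvd n \<and> coprime a N}"
 let ?I = "SIGMA a:?D. {..<n div a}"
 have finD: "finite ?D" using n by (intro finite_subset[OF _ finite_divisors_nat[of n]]) auto
 have fin: "finite ?I" using finD by auto
 have pos: "a > 0" "n div a > 0" "a * (n div a) = n" if "a \<in> ?D" for a
  using that n by (auto simp: dvd_div_eq_0_iff intro: Nat.gr0I)
 have cusp: "cuspidal_at_infinity (sl w (int a, int b, 0, int (n div a)) (EI II))" if a: "a \<in> ?D" for a b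
 proof -
  have "cuspidal_at_infinity (\<lambda>\<tau>. of_int (int (n div a)) powi (- w) * EI II ((of_int (int a) * \<tau> + of_int (int b)) / of_int (int (n div a))))"
   using pos[OF a] by (intro cuspidal_cmult cuspidal_affine EI_cuspidal SL2_one(1)) auto
  then show ?thesis by (rule cuspidal_cong) (simp add: sl_tri)
 qed
 show "cuspidal_at_infinity (\<lambda>\<tau>. \<Sum>(a, b)\<in>?I. sl w (int a, int b, 0, int (n div a)) (EI II) \<tau>)"
  by (rule cuspidal_cong[OF cuspidal_sum[OF fin, of "\<lambda>(a, b). sl w (int a, int b, 0, int (n div a)) (EI II)"]])
   (use cusp in \<open>auto simp: case_prod_beta\<close>)
 fix \<tau> assume \<tau>: "\<tau> \<in> HH"
 have "(deriv ^^ (k - 1)) (\<lambda>\<tau>. \<Sum>(a, b)\<in>?I. sl w (int a, int b, 0, int (n div a)) (EI II) \<tau>) \<tau> =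
   (\<Sum>(a, b)\<in>?I. (deriv ^^ (k - 1)) (sl w (int a, int b, 0, int (n div a)) (EI II)) \<tau>)"
 proof -
  have "(deriv ^^ j) (\<lambda>\<tau>. \<Sum>x\<in>J. g x \<tau>) \<tau> = (\<Sum>x\<in>J. (deriv ^^ j) (g x) \<tau>)"
   if "finite J" "\<And>x. x \<in> J \<Longrightarrow> g x holomorphic_on HH" for j and J :: "(nat \<times> nat) set" and g using that
  proof (induction J rule: finite_induct)
   case empty
   have "(deriv ^^ j) (\<lambda>\<tau>::complex. 0::complex) = (\<lambda>_. 0)" by (induction j) auto
   then show ?case by simp
  next
   case (insert x J)
   have "(deriv ^^ j) (\<lambda>\<tau>. g x \<tau> + (\<Sum>x\<in>J. g x \<tau>)) \<tau> = (deriv ^^ j) (g x) \<tau> + (deriv ^^ j) (\<lambda>\<tau>. \<Sum>x\<in>J. g x \<tau>) \<tau>"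
    using insert by (intro higher_deriv_add[OF _ _ open_HH \<tau>] holomorphic_intros) auto
   then show ?case using insert by simp
  qed
  from this[OF fin, of "\<lambda>(a, b). sl w (int a, int b, 0, int (n div a)) (EI II)" "k - 1"] cuspidal_holomorphic[OF cusp]
  show ?thesis by (auto simp: case_prod_beta)
 qed
 also have "\<dots> = (\<Sum>(a, b)\<in>?I. of_nat n ^ (k - 1) * (f ((of_nat a * \<tau> + of_nat b) / of_nat (n div a)) / of_nat (n div a) ^ k))"
 proof (rule sum.cong)
  fix x assume "x \<in> ?I"
  then obtain a b where x: "x = (a, b)" "a \<in> ?D" by auto
  have "int a * int (n div a) = int n" using pos(3)[OF x(2)] by (metis of_nat_mult)
  then have d: "mdet (int a, int b, 0, int (n div a)) = int n" by simp
  have "(deriv ^^ (k - 1)) (sl w (int a, int b, 0, int (n div a)) (EI II)) \<tau> = of_int (int n) ^ (k - 1) * sl (int k) (int a, int b, 0, int (n div a)) f \<tau>"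
   using bol[OF _ SL2_one(1) \<tau>, of "(int a, int b, 0, int (n div a))"] n unfolding d by simp
  then show "(case x of (a, b) \<Rightarrow> (deriv ^^ (k - 1)) (sl w (int a, int b, 0, int (n div a)) (EI II)) \<tau>) =
    (case x of (a, b) \<Rightarrow> of_nat n ^ (k - 1) * (f ((of_nat a * \<tau> + of_nat b) / of_nat (n div a)) / of_nat (n div a) ^ k))"
   by (simp add: x sl_tri power_int_minus divide_inverse)
 qed simp
 also have "\<dots> = hecke k N n f \<tau>" unfolding hecke_def using finD by (simp add: sum.Sigma [symmetric] sum_distrib_left)
 also have "\<dots> = q_coeff f n * sl (int k) II f \<tau>" using hecke_eigenvalue[OF nf N n _ \<tau>] k by simp
 finally show "(deriv ^^ (k - 1)) (\<lambda>\<tau>. \<Sum>(a, b)\<in>?I. sl w (int a, int b, 0, int (n div a)) (EI II) \<tau>) \<tau> = q_coeff f n * sl (int k) II f \<tau>" .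
qed

lemma q_coeff_Y:
 assumes "y \<in> Y" shows "q_coeff f n * y \<in> Y"
proof (cases "n = 0")
 case True
 then show ?thesis using cusp_form_q_expansion(2)[OF fc N] rat_vs.span_zero by (simp add: Y_def)
next
 case False
 then have n: "n \<ge> 1" by simp
 have gen: "q_coeff f n * Polynomial.coeff (PP II B) i \<in> Y" if B: "B \<in> SL2" for B i
 proof -
  define I where "I = (SIGMA a:{a. a dvd n \<and> coprime a N}. {..<n div a})"
  define MM where "MM x = (case x of (a, b) \<Rightarrow> (int a, int b, 0 :: int, int (n div a)))" for x
  have "finite {a. a dvd n \<and> coprime a N}" using n by (intro finite_subset[OF _ finite_divisors_nat[of n]]) auto
  then have fin: "finite I" unfolding I_def by auto
  have det: "mdet (MM x) > 0" if "x \<in> I" for x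
   using that n by (auto simp: I_def MM_def dvd_div_eq_0_iff intro!: mult_pos_pos Nat.gr0I)
  have "\<forall>x\<in>I. \<exists>P. (\<forall>i. Polynomial.coeff P i \<in> Y) \<and> cuspidal_at_infinity (\<lambda>\<tau>. sl w (mm (MM x) B) (EI II) \<tau> - poly P \<tau>)"
   using det SL2_det[OF B] by (intro ballI hecke_decomposition) (simp add: mdet_mm)
  then obtain P where P: "\<And>x i. x \<in> I \<Longrightarrow> Polynomial.coeff (P x) i \<in> Y"
   "\<And>x. x \<in> I \<Longrightarrow> cuspidal_at_infinity (\<lambda>\<tau>. sl w (mm (MM x) B) (EI II) \<tau> - poly (P x) \<tau>)" by metis
  \<comment> \<open>The slash by \<open>B\<close> of T_n applied to \<open>EI II\<close> is computed
    term by term and through the eigenvalue. The difference of the two cuspidal parts is a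
    polynomial, hence 0, so the polynomial parts agree.\<close>
  have "cuspidal_at_infinity (\<lambda>\<tau>. (\<Sum>x\<in>I. sl w (mm (MM x) B) (EI II) \<tau> - poly (P x) \<tau>) - q_coeff f n * EI B \<tau>)"
   by (intro cuspidal_diff cuspidal_sum fin P cuspidal_cmult EI_cuspidal B)
  then have "Polynomial.smult (q_coeff f n) (PP II B) - (\<Sum>x\<in>I. P x) = 0"
  proof (rule polynomial_cuspidal_0)
   fix \<tau> assume \<tau>: "\<tau> \<in> HH"
   have "(\<Sum>x\<in>I. sl w (mm (MM x) B) (EI II) \<tau>) = (\<Sum>x\<in>I. sl w B (sl w (MM x) (EI II)) \<tau>)"
    by (intro sum.cong refl sl_mm det SL2_det B \<tau>)
   also have "\<dots> = sl w B (\<lambda>\<tau>. \<Sum>x\<in>I. sl w (MM x) (EI II) \<tau>) \<tau>" by (rule sl_linear(4) [symmetric])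
   also have "\<dots> = sl w B (\<lambda>\<tau>. q_coeff f n * EI II \<tau>) \<tau>"
    by (rule sl_cong[OF SL2_det[OF B] \<tau>]) (use hecke_EI[OF n] in \<open>simp add: I_def MM_def case_prod_beta\<close>)
   also have "\<dots> = q_coeff f n * (EI B \<tau> + poly (PP II B) \<tau>)" using PP(2)[OF SL2_one(1) B \<tau>] by (simp add: sl_linear(3))
   finally show "(\<Sum>x\<in>I. sl w (mm (MM x) B) (EI II) \<tau> - poly (P x) \<tau>) - q_coeff f n * EI B \<tau> =
     poly (Polynomial.smult (q_coeff f n) (PP II B) - (\<Sum>x\<in>I. P x)) \<tau>" by (simp add: sum_subtractf poly_sum algebra_simps)
  qed
  then have "Polynomial.smult (q_coeff f n) (PP II B) = (\<Sum>x\<in>I. P x)" by simp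
  then have "q_coeff f n * Polynomial.coeff (PP II B) i = (\<Sum>x\<in>I. Polynomial.coeff (P x) i)" by (metis coeff_smult coeff_sum)
  then show ?thesis using P(1) unfolding Y_def by (simp add: rat_vs.span_sum)
 qed
 show ?thesis using assms unfolding Y_def
 proof (induction rule: rat_vs.span_induct_alt)
  case base
  then show ?case by (simp add: rat_vs.span_zero)
 next
  case (step c x y)
  then have "q_coeff f n * x \<in> Y" using gen by auto
  then have "of_rat c * (q_coeff f n * x) + q_coeff f n * y \<in> Y"
   using step(2) unfolding Y_def by (intro rat_vs.span_add rat_vs.span_scale)
  moreover have "of_rat c * (q_coeff f n * x) + q_coeff f n * y = q_coeff f n * (of_rat c * x + y)" by (simp add: ring_distribs)
  ultimately show ?case unfolding Y_def by (simp only:)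
 qed
qed

text \<open>Without periods the functions \<open>EI A\<close> would be permuted by
  \<open>SL2\<close> in weight 2 - k \<le> 0 and vanish at all cusps. Then
  \<open>high_order_vanishes\<close> with m = 1 makes them 0, and with them
  \<open>f\<close>.\<close>

lemma Y_nonzero: "\<exists>y\<in>Y. y \<noteq> 0"
proof (rule ccontr)
 assume neg: "\<not> (\<exists>y\<in>Y. y \<noteq> 0)"
 have "PP II B = 0" if "B \<in> SL2" for B using neg PP_Y[OF that] by (intro poly_eqI) auto
 then have inv: "sl w B (EI II) \<tau> = EI B \<tau>" if "B \<in> SL2" "\<tau> \<in> HH" for B \<tau> using PP(2)[OF SL2_one(1) that] that by simp
 have inv': "sl w B (EI A) \<tau> = EI (mm A B) \<tau>" if "A \<in> SL2" "B \<in> SL2" "\<tau> \<in> HH" for A B \<tau>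
 proof -
  have "sl w B (EI A) \<tau> = sl w B (sl w A (EI II)) \<tau>"
   by (rule sl_cong[OF SL2_det[OF that(2)] that(3)]) (use inv[OF that(1)] in simp)
  also have "\<dots> = EI (mm A B) \<tau>"
   using inv[OF SL2_mm[OF that(1,2)] that(3)] sl_mm[OF SL2_det[OF that(1)] SL2_det[OF that(2)] that(3)] by simp
  finally show ?thesis .
 qed
 have EIrep: "EI (rep N A) \<tau> = EI A \<tau>" if "A \<in> SL2" "\<tau> \<in> HH" for A \<tau>
  using EI_crel[OF rep_props(1)[OF that(1)] that(1) crel_sym[OF rep_props(2)[OF that(1)]] that(2)] .
 have repR: "rep N A \<in> Reps N" if "A \<in> SL2" for A using that by (simp add: Reps_def)
 have 0: "EI (rep N II) \<tau> = 0" if "\<tau> \<in> HH" for \<tau>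
 proof (rule high_order_vanishes[where FF = "EI ` Reps N" and h = N and m = 1 and w = w and ?F0.0 = "EI (rep N II)" and ?\<tau>0.0 = \<tau>])
  show "finite (EI ` Reps N)" using finite_Reps[OF N] by simp
  show "N > 0" by (rule N)
  show "w * int N \<le> 6 * int 1" by (simp add: order_trans[of _ 0])
  show "EI (rep N II) \<in> EI ` Reps N" using repR SL2_one by simp
  show "\<tau> \<in> HH" by fact
 next
  fix F assume "F \<in> EI ` Reps N"
  then obtain R where R: "R \<in> SL2" "F = EI R" using Reps_SL2[of N] by blast
  show "\<exists>a. has_q_expansion N a F \<and> (\<forall>n<1. a n = 0)" using EI(1)[OF R(1)] R(2) by auto
  show "\<exists>G\<in>EI ` Reps N. \<forall>\<tau>\<in>HH. F (\<tau> + of_int j) = G \<tau>" for j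
   using inv'[OF R(1) SL2_one(2)] EIrep[OF SL2_mm[OF R(1) SL2_one(2)]] repR[OF SL2_mm[OF R(1) SL2_one(2)]]
   by (intro bexI[of _ "EI (rep N (mm R (1, j, 0, 1)))"]) (auto simp: R(2) sl_shift)
  show "\<exists>G\<in>EI ` Reps N. \<forall>\<tau>\<in>HH. norm (F (- 1 / \<tau>)) = norm (G \<tau>) * norm \<tau> powi w"
  proof (intro bexI[of _ "EI (rep N (mm R SS))"] ballI)
   fix \<tau> assume \<tau>: "\<tau> \<in> HH"
   then have "norm \<tau> \<noteq> 0" by (auto simp: HH_iff)
   moreover have "norm (F (- 1 / \<tau>)) * norm \<tau> ^ (k - 2) = norm (EI (mm R SS) \<tau>)"
    using inv'[OF R(1) SL2_one(3) \<tau>] by (simp add: sl_def R(2) norm_mult [symmetric] norm_power [symmetric])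
   ultimately show "norm (F (- 1 / \<tau>)) = norm (EI (rep N (mm R SS)) \<tau>) * norm \<tau> powi w"
    using EIrep[OF SL2_mm[OF R(1) SL2_one(3)] \<tau>] by (simp add: power_int_minus field_simps)
  qed (use repR SL2_mm[OF R(1) SL2_one(3)] in auto)
 qed auto
 then have "EI II \<tau> = 0" if "\<tau> \<in> HH" for \<tau> using EIrep[OF SL2_one(1) that] that by simp
 then have "(deriv ^^ (k - 1)) (EI II) \<tau> = (deriv ^^ (k - 1)) (\<lambda>_. 0) \<tau>" if "\<tau> \<in> HH" for \<tau>
  by (intro higher_deriv_cong_HH[OF cuspidal_holomorphic[OF EI_cuspidal[OF SL2_one(1)]] _ that])
 moreover have "(deriv ^^ j) (\<lambda>\<tau>::complex. 0::complex) = (\<lambda>_. 0)" for j by (induction j) auto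
 ultimately have f0: "f \<tau> = 0" if "\<tau> \<in> HH" for \<tau> using EI(2)[OF SL2_one(1) that] that by simp
 have "has_q_expansion 1 (\<lambda>n. if n = 0 then 0 else 0) f" by (rule q_expansion_cong[OF q_expansion_const]) (use f0 in auto)
 then have "q_coeff f = (\<lambda>n. if n = 0 then 0 else 0)" by (rule q_coeff_eq)
 moreover have "q_coeff f 1 = 1" using nf by (simp add: newform_def)
 ultimately show False by simp
qed

text \<open>The multiplier ring of \<open>Y\<close>. It contains the Hecke eigenvalues, and
  multiplying a nonzero y in \<open>Y\<close> embeds it into a finite-dimensional rational
  space.\<close>

definition KY :: "complex set" where "KY = {x. \<forall>y\<in>Y. x * y \<in> Y}"

lemma KY_relation:
 assumes "\<And>i. i \<le> card GY \<Longrightarrow> v i \<in> KY"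
 shows "\<exists>c :: nat \<Rightarrow> rat. (\<exists>i\<le>card GY. c i \<noteq> 0) \<and> (\<Sum>i\<le>card GY. of_rat (c i) * v i) = 0"
proof -
 obtain y where y: "y \<in> Y" "y \<noteq> 0" using Y_nonzero by blast
 have "\<exists>c :: nat \<Rightarrow> rat. (\<exists>i\<le>card GY. c i \<noteq> 0) \<and> (\<Sum>i\<le>card GY. of_rat (c i) * (v i * y)) = 0"
  by (rule rat_relation[OF finite_GY]) (use assms y Y_subset in \<open>auto simp: KY_def\<close>)
 then show ?thesis using y(2) by (simp add: mult.assoc [symmetric] sum_distrib_right [symmetric])
qed

lemma KY_closed:
 shows "1 \<in> KY" "x \<in> KY \<Longrightarrow> y \<in> KY \<Longrightarrow> x + y \<in> KY" "x \<in> KY \<Longrightarrow> y \<in> KY \<Longrightarrow> x * y \<in> KY"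
  "x \<in> KY \<Longrightarrow> of_rat c * x \<in> KY" "finite J \<Longrightarrow> (\<And>i. i \<in> J \<Longrightarrow> g i \<in> KY) \<Longrightarrow> sum g J \<in> KY"
  "x \<in> KY \<Longrightarrow> x ^ n \<in> KY"
proof -
 show 1: "1 \<in> KY" by (simp add: KY_def)
 show a: "x + y \<in> KY" if "x \<in> KY" "y \<in> KY" for x y
  using that unfolding KY_def Y_def by (auto simp: ring_distribs intro: rat_vs.span_add)
 show m: "x * y \<in> KY" if "x \<in> KY" "y \<in> KY" for x y using that by (auto simp: KY_def mult.assoc)
 show "of_rat c * x \<in> KY" if "x \<in> KY" for x using that unfolding KY_def Y_def by (auto simp: mult.assoc intro: rat_vs.span_scale)
 have z: "0 \<in> KY" unfolding KY_def Y_def by (simp add: rat_vs.span_zero)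
 show "sum g J \<in> KY" if "finite J" "\<And>i. i \<in> J \<Longrightarrow> g i \<in> KY" using that by (induction J rule: finite_induct) (auto intro: a z)
 show "x ^ n \<in> KY" if "x \<in> KY" for x by (induction n) (auto intro: 1 m that)
qed

lemma KY_inverse:
 assumes x: "x \<in> KY" "x \<noteq> 0" shows "inverse x \<in> KY"
proof -
 obtain c :: "nat \<Rightarrow> rat" where c: "\<exists>i\<le>card GY. c i \<noteq> 0" "(\<Sum>i\<le>card GY. of_rat (c i) * x ^ i) = 0"
  using KY_relation[of "\<lambda>i. x ^ i"] KY_closed(6)[OF x(1)] by auto
 obtain j where j: "(of_rat (c j) :: complex) \<noteq> 0" "j \<le> card GY"
  "of_rat (c j) = - (x * (\<Sum>i\<in>{Suc j..card GY}. of_rat (c i) * x ^ (i - Suc j)))"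
  by (rule lowest_term[where c = "\<lambda>i. of_rat (c i)", OF _ c(2) x(2)]) (use c(1) that in auto)
 from j(3) have "x * (\<Sum>i\<in>{Suc j..card GY}. of_rat (c i) * x ^ (i - Suc j)) = - of_rat (c j)" by simp
 then have "of_rat (- inverse (c j)) * (x * (\<Sum>i\<in>{Suc j..card GY}. of_rat (c i) * x ^ (i - Suc j))) = 1"
  using j(1) by (simp add: of_rat_minus of_rat_inverse)
 then have "inverse x = of_rat (- inverse (c j)) * (\<Sum>i\<in>{Suc j..card GY}. of_rat (c i) * x ^ (i - Suc j))"
  by (intro inverse_unique) (simp add: mult_ac)
 moreover have "\<dots> \<in> KY" by (intro KY_closed x) simp
 ultimately show ?thesis by (simp only:)
qed

text \<open>Finiteness of the degree of the coefficient field, phrased as a relation among any d + 1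
  elements. This is the form that can be reduced modulo a prime.\<close>

theorem coeff_field_relation:
 "\<exists>d. \<forall>v. (\<forall>i\<le>d. v i \<in> coeff_field f) \<longrightarrow> (\<exists>c :: nat \<Rightarrow> rat. (\<exists>i\<le>d. c i \<noteq> 0) \<and> (\<Sum>i\<le>d. of_rat (c i) * v i) = 0)"
proof -
 interpret U: field "ring_of_type_algebra :: complex ring" by rule
 have ops: "\<zero>\<^bsub>ring_of_type_algebra\<^esub> = (0::complex)" "\<one>\<^bsub>ring_of_type_algebra\<^esub> = (1::complex)"
  "x \<oplus>\<^bsub>ring_of_type_algebra\<^esub> y = x + y" "x \<otimes>\<^bsub>ring_of_type_algebra\<^esub> y = x * y"
  "carrier (ring_of_type_algebra :: complex ring) = UNIV" for x y :: complex by (simp_all add: ring_of_type_algebra_def)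
 have neg: "\<ominus>\<^bsub>ring_of_type_algebra\<^esub> x = - x" for x :: complex using U.minus_equality[of "- x" x] by (simp add: ops)
 have inv: "inv\<^bsub>ring_of_type_algebra\<^esub> x = inverse x" if "x \<noteq> 0" for x :: complex
  using U.inv_unique'[of x "inverse x"] that by (simp add: ops)
 have "coeff_field f \<subseteq> KY"
 proof
  fix x assume "x \<in> coeff_field f"
  then show "x \<in> KY" unfolding coeff_field_def
  proof induction
   case (incl h)
   then show ?case using q_coeff_Y by (auto simp: KY_def)
  next
   case (a_inv h)
   then show ?case using KY_closed(4)[of h "- 1"] by (simp add: neg of_rat_minus)
  next
   case (m_inv h)
   then show ?case using KY_inverse by (simp add: inv ops)
  qed (simp_all add: ops KY_closed)
 qed
 then have *: "\<forall>v. (\<forall>i\<le>card GY. v i \<in> coeff_field f) \<longrightarrow> (\<exists>c :: nat \<Rightarrow> rat. (\<exists>i\<le>card GY. c i \<noteq> 0) \<and> (\<Sum>i\<le>card GY. of_rat (c i) * v i) = 0)"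
  using KY_relation by blast
 show ?thesis using * by (rule exI[of _ "card GY"])
qed

end

section \<open>Localisation of the ring of integers\<close>

text \<open>Clearing denominators and dividing by the gcd leaves coefficients not all divisible by
  \<open>l\<close>, so the relation survives reduction modulo \<open>l\<close>.\<close>

lemma int_relation:
 fixes c :: "nat \<Rightarrow> rat" and v :: "nat \<Rightarrow> complex"
 assumes "\<exists>i\<le>d. c i \<noteq> 0" "(\<Sum>i\<le>d. of_rat (c i) * v i) = 0" and l: "l \<ge> 2"
 obtains z :: "nat \<Rightarrow> int" where "\<exists>i\<le>d. \<not> int l dvd z i" "(\<Sum>i\<le>d. of_int (z i) * v i) = 0"
proof -
 have "\<exists>D>0. \<forall>i\<le>n. \<exists>z. of_int D * c i = of_int z" for n
 proof (induction n)
  case 0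
  obtain a b where "quotient_of (c 0) = (a, b)" by (cases "quotient_of (c 0)")
  then have "b > 0" "of_int b * c 0 = of_int a" using quotient_of_denom_pos[of "c 0" a b] quotient_of_div[of "c 0" a b] by auto
  then show ?case by (intro exI[of _ b]) auto
 next
  case (Suc n)
  then obtain D where D: "D > 0" "\<forall>i\<le>n. \<exists>z. of_int D * c i = of_int z" by blast
  obtain a b where "quotient_of (c (Suc n)) = (a, b)" by (cases "quotient_of (c (Suc n))")
  then have b: "b > 0" "of_int b * c (Suc n) = of_int a" using quotient_of_denom_pos[of "c (Suc n)" a b] quotient_of_div[of "c (Suc n)" a b] by auto
  have "\<exists>z. of_int (D * b) * c i = of_int z" if i: "i \<le> Suc n" for i
  proof (cases "i = Suc n")
   case True
   then show ?thesis using b by (intro exI[of _ "D * a"]) simp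
  next
   case False
   then have "i \<le> n" using i by simp
   then obtain z where "of_int D * c i = of_int z" using D(2) by blast
   then show ?thesis by (intro exI[of _ "b * z"]) (simp add: mult_ac)
  qed
  then show ?case using D b by (intro exI[of _ "D * b"]) auto
 qed
 from this[of d] obtain D where D: "D > 0" "\<forall>i\<le>d. \<exists>z. of_int D * c i = of_int z" by blast
 then obtain z0 where z0: "\<And>i. i \<le> d \<Longrightarrow> of_int D * c i = of_int (z0 i)" by metis
 define g where "g = Gcd (z0 ` {..d})"
 obtain i0 where i0: "i0 \<le> d" "c i0 \<noteq> 0" using assms(1) by blast
 have "of_int (z0 i0) \<noteq> (0 :: rat)" using z0[OF i0(1)] i0(2) D(1) by (metis mult_eq_0_iff of_int_0_eq_iff less_irrefl)
 then have "z0 i0 \<noteq> 0" by simp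
 then have g0: "g > 0" using i0(1) unfolding g_def by (metis Gcd_0_iff Gcd_int_greater_eq_0 atMost_iff imageI insert_iff order_le_less singletonD subset_iff empty_iff)
 define z where "z i = z0 i div g" for i
 have gz: "g * z i = z0 i" if "i \<le> d" for i
  unfolding z_def using that by (intro dvd_mult_div_cancel) (auto simp: g_def intro: Gcd_dvd)
 have "\<exists>i\<le>d. \<not> int l dvd z i"
 proof (rule ccontr)
  assume "\<not> (\<exists>i\<le>d. \<not> int l dvd z i)"
  then have "g * int l dvd z0 i" if "i \<le> d" for i using gz[OF that] that by (metis dvd_refl mult_dvd_mono)
  then have "g * int l dvd g" unfolding g_def by (intro Gcd_greatest) auto
  then have "g * int l \<le> g" using g0 by (intro zdvd_imp_le)
  moreover have "g * 2 \<le> g * int l" using g0 l by (intro mult_left_mono) auto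
  ultimately show False using g0 by simp
 qed
 moreover have "of_int g * (\<Sum>i\<le>d. of_int (z i) * v i) = of_int D * (\<Sum>i\<le>d. of_rat (c i) * v i)" unfolding sum_distrib_left
 proof (rule sum.cong)
  fix i assume "i \<in> {..d}"
  then have "of_int g * of_int (z i) = (of_int (z0 i) :: complex)" "of_int (z0 i) = of_int D * c i" using gz[of i] z0[of i] by (simp_all flip: of_int_mult)
  moreover from this(2) have "(of_int (z0 i) :: complex) = of_int D * of_rat (c i)" by (metis of_rat_mult of_rat_of_int_eq)
  ultimately show "of_int g * (of_int (z i) * v i) = of_int D * (of_rat (c i) * v i)" by (simp only: mult.assoc [symmetric])
 qed simp
 then have "(\<Sum>i\<le>d. of_int (z i) * v i) = 0" using assms(2) g0 by simp
 ultimately show thesis by (rule that)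
qed

lemma is_subring_of_int: assumes "is_subring R" shows "of_int n \<in> R"
proof -
 have "of_nat m \<in> R" for m by (induction m) (auto intro: is_subringD[OF assms])
 then show ?thesis by (cases n rule: int_cases2) (auto intro: is_subringD[OF assms])
qed

text \<open>R/lR has dimension at most d over the field with l elements: any d + 1 elements satisfy
  a rational relation, whose primitive form is nontrivial modulo l. Congruence modulo l is written
  as \<open>(a - z) / of_nat l \<in> R\<close>.\<close>

lemma finite_residues:
 assumes R: "is_subring R" and l: "Factorial_Ring.prime l"
  and rel: "\<And>v. (\<And>i. i \<le> d \<Longrightarrow> v i \<in> R) \<Longrightarrow> \<exists>c :: nat \<Rightarrow> rat. (\<exists>i\<le>d. c i \<noteq> 0) \<and> (\<Sum>i\<le>d. of_rat (c i) * v i) = 0"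
 shows "\<exists>Z. finite Z \<and> Z \<subseteq> R \<and> (\<forall>a\<in>R. \<exists>z\<in>Z. (a - z) / of_nat l \<in> R)"
proof -
 have l0: "l > 0" "l \<ge> 2" using l by (auto simp: prime_gt_0_nat prime_ge_2_nat)
 \<comment> \<open>Linear independence of v 0, ..., v (n - 1) in R/lR over the prime field. A system
   of greatest length spans, and \<open>Z\<close> lists its combinations with coefficients from 0 to
   l - 1.\<close>
 define ind where "ind n v \<longleftrightarrow> (\<forall>i<n. v i \<in> R) \<and> (\<forall>c. (\<Sum>i<n. of_int (c i) * v i) / of_nat l \<in> R \<longrightarrow> (\<forall>i<n. int l dvd c i))"
  for n and v :: "nat \<Rightarrow> complex"
 have bound: "n \<le> d" if "ind n v" for n v
 proof (rule ccontr)
  assume "\<not> n \<le> d"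
  then have dn: "d < n" by simp
  have "v i \<in> R" if "i \<le> d" for i using \<open>ind n v\<close> that dn by (simp add: ind_def)
  from rel[of v, OF this] obtain c :: "nat \<Rightarrow> rat" where "(\<exists>i\<le>d. c i \<noteq> 0) \<and> (\<Sum>i\<le>d. of_rat (c i) * v i) = 0" ..
  note c = this[THEN conjunct1] this[THEN conjunct2]
  obtain z :: "nat \<Rightarrow> int" where z: "\<exists>i\<le>d. \<not> int l dvd z i" "(\<Sum>i\<le>d. of_int (z i) * v i) = 0"
   by (rule int_relation[OF c l0(2)]) (rule that)
  define z' where "z' i = (if i \<le> d then z i else 0)" for i
  have "(\<Sum>i<n. of_int (z' i) * v i) = (\<Sum>i\<le>d. of_int (z i) * v i)"
   using dn by (intro sum.mono_neutral_cong_right) (auto simp: z'_def)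
  then have "(\<Sum>i<n. of_int (z' i) * v i) / of_nat l \<in> R" using z(2) is_subringD(2)[OF R] by simp
  then have "\<forall>i<n. int l dvd z' i" using \<open>ind n v\<close> unfolding ind_def by blast
  then have "int l dvd z i" if "i \<le> d" for i using that dn by (auto simp: z'_def dest: spec[of _ i])
  then show False using z(1) by blast
 qed
 have ind0: "ind 0 (\<lambda>_. 0)" by (simp add: ind_def)
 define n where "n = (GREATEST n. \<exists>v. ind n v)"
 have "\<exists>v. ind n v" unfolding n_def by (rule GreatestI_nat[of _ 0 d]) (use bound ind0 in auto)
 then obtain v where v: "ind n v" by blast
 have max: "\<not> ind (Suc n) u" for u using Greatest_le_nat[of "\<lambda>n. \<exists>v. ind n v" "Suc n" d] bound unfolding n_def by auto
 define Z where "Z = (\<lambda>c. \<Sum>i<n. of_int (c i) * v i) ` ({..<n} \<rightarrow>\<^sub>E {0..<int l})"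
 have "finite Z" unfolding Z_def by (intro finite_imageI finite_PiE) auto
 moreover have "Z \<subseteq> R" using v unfolding Z_def ind_def
  by (auto intro!: is_subring_sum[OF R] is_subringD(4)[OF R] is_subring_of_int[OF R])
 moreover have "\<exists>z\<in>Z. (a - z) / of_nat l \<in> R" if a: "a \<in> R" for a
 proof -
  have "\<not> ind (Suc n) (v(n := a))" by (rule max)
  moreover have "\<forall>i<Suc n. (v(n := a)) i \<in> R" using v a by (auto simp: ind_def)
  ultimately obtain c where c: "(\<Sum>i<Suc n. of_int (c i) * (v(n := a)) i) / of_nat l \<in> R" "\<not> (\<forall>i<Suc n. int l dvd c i)"
   unfolding ind_def by blast
  have s: "(\<Sum>i<Suc n. of_int (c i) * (v(n := a)) i) = (\<Sum>i<n. of_int (c i) * v i) + of_int (c n) * a" by simp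
  have cn: "\<not> int l dvd c n"
  proof
   assume dv: "int l dvd c n"
   then obtain q where q: "c n = int l * q" by blast
   have "(\<Sum>i<n. of_int (c i) * v i) / of_nat l = (\<Sum>i<Suc n. of_int (c i) * (v(n := a)) i) / of_nat l - of_int q * a"
    unfolding s using l0 by (simp add: q field_simps)
   also have "\<dots> \<in> R" by (intro is_subringD[OF R] c a is_subring_of_int[OF R])
   finally have "\<forall>i<n. int l dvd c i" using v unfolding ind_def by blast
   then show False using c(2) dv by (auto simp: less_Suc_eq)
  qed
  then have "coprime (int l) (c n)" using l by (simp add: prime_imp_coprime)
  then obtain y where y: "[c n * y = 1] (mod int l)" using cong_solve_coprime_int by (metis coprime_commute)
  then obtain q where q: "c n * y = 1 + int l * q" by (metis cong_iff_lin cong_sym)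
  \<comment> \<open>The relation is solved for \<open>a\<close> with the inverse \<open>y\<close> of
    its last coefficient. The value \<open>undefined\<close> beyond n is the extensionality required
    by the function set in \<open>Z\<close>.\<close>
  define e where "e i = (if i < n then (- c i * y) mod int l else undefined)" for i
  define z where "z = (\<Sum>i<n. of_int (e i) * v i)"
  have "e \<in> {..<n} \<rightarrow>\<^sub>E {0..<int l}" using l0(1) by (auto simp: e_def PiE_iff extensional_def)
  then have "z \<in> Z" by (auto simp: Z_def z_def)
  moreover have "(a - z) / of_nat l \<in> R"
  proof -
   have gen: "A = S * Y + l' * B - l' * C \<Longrightarrow> l' \<noteq> 0 \<Longrightarrow> A / l' = S / l' * Y + B - C" for A S Y l' B C :: complex
    by (simp add: add_divide_distrib diff_divide_distrib)
   define m where "m i = (- c i * y) div int l" for i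
   have e: "- c i * y = int l * m i + e i" if "i < n" for i using that by (simp add: e_def m_def)
   have "(\<Sum>i<n. of_int (c i) * v i) * of_int y = - (of_nat l * (\<Sum>i<n. of_int (m i) * v i) + z)"
    unfolding z_def sum_distrib_left sum_distrib_right sum.distrib [symmetric] sum_negf [symmetric]
   proof (rule sum.cong)
    fix i assume "i \<in> {..<n}"
    then have "c i * y = - (int l * m i + e i)" using e[of i] by simp
    then have "(of_int (c i) * of_int y :: complex) = - (of_nat l * of_int (m i) + of_int (e i))"
     by (metis (no_types, lifting) of_int_add of_int_minus of_int_mult of_int_of_nat_eq)
    then have "of_int (c i) * of_int y * v i = - (of_nat l * of_int (m i) + of_int (e i)) * v i" by simp
    then show "of_int (c i) * v i * of_int y = - (of_nat l * (of_int (m i) * v i) + of_int (e i) * v i)"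
     by (simp add: algebra_simps)
   qed simp
   then have "((\<Sum>i<n. of_int (c i) * v i) + of_int (c n) * a) * of_int y = of_int (c n * y) * a - z - of_nat l * (\<Sum>i<n. of_int (m i) * v i)"
    by (simp add: algebra_simps)
   also have "of_int (c n * y) * a = a + of_nat l * (of_int q * a)" unfolding q by (simp add: algebra_simps)
   finally have "a - z = ((\<Sum>i<n. of_int (c i) * v i) + of_int (c n) * a) * of_int y + of_nat l * (\<Sum>i<n. of_int (m i) * v i) - of_nat l * (of_int q * a)"
    by (simp add: algebra_simps)
   then have "(a - z) / of_nat l = ((\<Sum>i<n. of_int (c i) * v i) + of_int (c n) * a) / of_nat l * of_int y + (\<Sum>i<n. of_int (m i) * v i) - of_int q * a"
    by (rule gen) (use l0 in simp)
   also have "\<dots> \<in> R" using c(1) v unfolding s ind_def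
    by (intro is_subringD(3,4,6)[OF R] is_subring_of_int[OF R] is_subring_sum[OF R] a) auto
   finally show ?thesis .
  qed
  ultimately show ?thesis by blast
 qed
 ultimately show ?thesis by blast
qed

text \<open>The properties of the ring of integers from which a local generator of \<open>L\<close>
  is found: finite residues modulo l, and \<open>closed\<close>, which is integral closedness for
  the polynomials X^j - X^i - r.\<close>

locale integers_at_prime =
 fixes R L :: "complex set" and l :: nat
 assumes R: "is_subring R" and LR: "L \<subseteq> R"
  and L_add: "\<And>x y. x \<in> L \<Longrightarrow> y \<in> L \<Longrightarrow> x + y \<in> L" and L_mult: "\<And>a x. a \<in> R \<Longrightarrow> x \<in> L \<Longrightarrow> a * x \<in> L"
  and one_L: "1 \<notin> L" and L_max: "\<And>a. a \<in> R \<Longrightarrow> a \<notin> L \<Longrightarrow> \<exists>b\<in>R. a * b - 1 \<in> L"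
  and l_L: "of_nat l \<in> L" and l0: "l > 0"
  and residues: "\<exists>Z. finite Z \<and> Z \<subseteq> R \<and> (\<forall>a\<in>R. \<exists>z\<in>Z. (a - z) / of_nat l \<in> R)"
  and closed: "\<And>x i j. x * of_nat l \<in> R \<Longrightarrow> i < j \<Longrightarrow> x ^ j - x ^ i \<in> R \<Longrightarrow> x \<in> R"
begin

lemmas R_intros = is_subringD[OF R] is_subring_power[OF R]

lemma L_diff: "x \<in> L \<Longrightarrow> y \<in> L \<Longrightarrow> x - y \<in> L"
 using L_add[of x "- y"] L_mult[of "- 1" y] R_intros(1,5) by auto

lemma multiple_L: "a / of_nat l \<in> R \<Longrightarrow> a \<in> L"
 using L_mult[OF _ l_L, of "a / of_nat l"] l0 by simp

lemma L_prime: assumes "a \<in> R" "b \<in> R" "a \<notin> L" "b \<notin> L" shows "a * b \<notin> L"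
proof
 assume ab: "a * b \<in> L"
 obtain c where c: "c \<in> R" "a * c - 1 \<in> L" using L_max assms by blast
 have "c * (a * b) - b * (a * c - 1) \<in> L" using L_mult ab c assms by (intro L_diff) auto
 moreover have "c * (a * b) - b * (a * c - 1) = b" by (simp add: algebra_simps)
 ultimately show False using assms by simp
qed

lemma L_prime_prod: "finite J \<Longrightarrow> (\<And>j. j \<in> J \<Longrightarrow> s j \<in> R \<and> s j \<notin> L) \<Longrightarrow> prod s J \<in> R \<and> prod s J \<notin> L"
 by (induction J rule: finite_induct) (use L_prime R_intros in \<open>auto simp: one_L\<close>)

lemma pigeonhole:
 assumes "\<And>n::nat. g n \<in> R" shows "\<exists>i j. i < j \<and> (g j - g i) / of_nat l \<in> R"
proof -
 obtain Z where Z: "finite Z" "\<forall>a\<in>R. \<exists>z\<in>Z. (a - z) / of_nat l \<in> R" using residues by blast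
 then have "\<forall>n. \<exists>z. z \<in> Z \<and> (g n - z) / of_nat l \<in> R" using assms by blast
 from choice[OF this] obtain r where r: "\<And>n. r n \<in> Z" "\<And>n. (g n - r n) / of_nat l \<in> R" by blast
 have "\<not> inj r" using Z(1) r(1) by (meson finite_imageD finite_subset image_subset_iff infinite_UNIV_nat)
 then obtain i j where "i \<noteq> j" "r i = r j" by (auto simp: inj_def)
 then obtain i j where ij: "i < j" "r i = r j" by (metis linorder_neqE_nat)
 have "(g j - r j) / of_nat l - (g i - r i) / of_nat l \<in> R" using r(2) by (intro R_intros)
 then show ?thesis using ij by (auto simp: diff_divide_distrib)
qed

text \<open>
  An element \<open>b\<close> whose principal ideal is minimal modulo \<open>l\<close>, locally at \<open>L\<close>, is annihilated by
  \<open>L\<close> modulo \<open>l\<close> up to a factor outside \<open>L\<close>; so \<open>b / l\<close> inverts \<open>L\<close>.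
\<close>

lemma inverse_element: "\<exists>x y. y \<in> L \<and> (\<forall>z\<in>L. x * z \<in> R) \<and> x * y \<notin> L"
proof -
 obtain Z where Z: "finite Z" "Z \<subseteq> R" "\<forall>a\<in>R. \<exists>z\<in>Z. (a - z) / of_nat l \<in> R" using residues by blast
 \<comment> \<open>\<open>sp b\<close> records the image of the ideal generated by \<open>b\<close>
   in the finite ring R/lR, and \<open>P b\<close> says that \<open>b\<close> is nonzero there after
   localisation at \<open>L\<close>. A least cardinality takes the place of a descending
   chain.\<close>
 define sp where "sp b = {z \<in> Z. \<exists>c\<in>R. (z - b * c) / of_nat l \<in> R}" for b
 define P where "P b \<longleftrightarrow> b \<in> R \<and> (\<forall>s\<in>R. s \<notin> L \<longrightarrow> s * b / of_nat l \<notin> R)" for b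
 have "P 1" using multiple_L R_intros(1) by (auto simp: P_def)
 from ex_has_least_nat[of P, OF this, of "\<lambda>b. card (sp b)"]
 obtain b where b: "P b" "\<And>b'. P b' \<Longrightarrow> card (sp b) \<le> card (sp b')" by blast
 have bR: "b \<in> R" using b(1) by (simp add: P_def)
 have "\<exists>s\<in>R. s \<notin> L \<and> s * (b * z) / of_nat l \<in> R" if z: "z \<in> L" for z
 proof (rule ccontr)
  assume "\<not> (\<exists>s\<in>R. s \<notin> L \<and> s * (b * z) / of_nat l \<in> R)"
  then have "P (b * z)" using bR z LR R_intros(4) by (auto simp: P_def)
  then have "card (sp b) \<le> card (sp (b * z))" by (rule b(2))
  moreover have sub: "sp (b * z) \<subseteq> sp b" unfolding sp_def using z LR R_intros(4) by (auto simp: mult.assoc)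
  moreover have fin: "finite (sp b)" using Z(1) by (simp add: sp_def)
  ultimately have eq: "sp (b * z) = sp b" using card_mono[OF fin sub] by (intro card_subset_eq[OF fin sub]) simp
  obtain z' where z': "z' \<in> Z" "(b - z') / of_nat l \<in> R" using Z(3) bR by blast
  have "(z' - b * 1) / of_nat l = - ((b - z') / of_nat l)" by (simp add: minus_divide_left)
  then have "(z' - b * 1) / of_nat l \<in> R" using R_intros(5)[OF z'(2)] by simp
  then have "z' \<in> sp b" using z'(1) R_intros(1) unfolding sp_def by blast
  then obtain c where c: "c \<in> R" "(z' - b * z * c) / of_nat l \<in> R" using eq by (auto simp: sp_def)
  have "(b - z') / of_nat l + (z' - b * z * c) / of_nat l \<in> R" using z' c by (intro R_intros)
  then have "(1 - c * z) * b / of_nat l \<in> R" by (simp add: add_divide_distrib [symmetric] algebra_simps)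
  moreover have cz: "c * z \<in> L" using L_mult c z by blast
  then have "1 - c * z \<notin> L" using L_add[of "1 - c * z" "c * z"] one_L by auto
  moreover have "1 - c * z \<in> R" using cz LR R_intros by auto
  ultimately show False using b(1) by (auto simp: P_def)
 qed
 then obtain s where s: "\<And>z. z \<in> L \<Longrightarrow> s z \<in> R \<and> s z \<notin> L \<and> s z * (b * z) / of_nat l \<in> R" by metis
 define S where "S = prod s (Z \<inter> L)"
 have S: "S \<in> R" "S \<notin> L" using L_prime_prod[of "Z \<inter> L" s] Z(1) s by (auto simp: S_def)
 define x where "x = S * b / of_nat l"
 have xL: "x * z \<in> R" if z: "z \<in> L" for z
 proof -
  obtain z' where z': "z' \<in> Z" "(z - z') / of_nat l \<in> R" using Z(3) z LR by blast
  have "z' \<in> L" using L_diff[OF z multiple_L[OF z'(2)]] by simp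
  then have z'L: "z' \<in> Z \<inter> L" using z' by simp
  have "S = s z' * prod s (Z \<inter> L - {z'})" unfolding S_def by (rule prod.remove) (use Z(1) z'L in auto)
  then have "x * z' = prod s (Z \<inter> L - {z'}) * (s z' * (b * z') / of_nat l)" by (simp add: x_def)
  moreover have "prod s (Z \<inter> L - {z'}) \<in> R" using L_prime_prod[of "Z \<inter> L - {z'}" s] Z(1) s by auto
  ultimately have "x * z' \<in> R" using s z'L R_intros(4) by (metis IntD2)
  moreover have "x * (z - z') = S * b * ((z - z') / of_nat l)" by (simp add: x_def)
  then have "x * (z - z') \<in> R" using S bR z' R_intros(4) by metis
  ultimately have "x * z' + x * (z - z') \<in> R" by (rule R_intros(6))
  then show ?thesis by (simp add: algebra_simps)
 qed
 have xR: "x \<notin> R" using b(1) S by (auto simp: P_def x_def)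
 \<comment> \<open>Otherwise \<open>L\<close> would be stable under \<open>x\<close>. Then all x^n l
   lie in R, two of them agree modulo l after pigeonholing, and \<open>closed\<close> puts
   \<open>x\<close> into R.\<close>
 have "\<exists>y\<in>L. x * y \<notin> L"
 proof (rule ccontr)
  assume "\<not> (\<exists>y\<in>L. x * y \<notin> L)"
  then have "x ^ n * of_nat l \<in> L" for n by (induction n) (auto simp: l_L mult.assoc)
  then have "\<exists>i j. i < j \<and> (x ^ j * of_nat l - x ^ i * of_nat l) / of_nat l \<in> R" using LR by (intro pigeonhole) auto
  then obtain i j where "i < j" "x ^ j - x ^ i \<in> R" using l0 by (auto simp: diff_divide_distrib)
  moreover have "x * of_nat l \<in> R" using S bR R_intros l0 by (simp add: x_def)
  ultimately show False using closed xR by blast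
 qed
 then show ?thesis using xL by blast
qed

end

section \<open>The ring of integers of the coefficient field at L\<close>

lemma coeff_integers_ops:
 "x \<oplus>\<^bsub>coeff_integers f\<^esub> y = x + y" "x \<otimes>\<^bsub>coeff_integers f\<^esub> y = x * y"
 "\<zero>\<^bsub>coeff_integers f\<^esub> = 0" "\<one>\<^bsub>coeff_integers f\<^esub> = 1"
 "carrier (coeff_integers f) = {x \<in> coeff_field f. algebraic_int x}"
 by (simp_all add: coeff_integers_def ring_of_type_algebra_def)

text \<open>The ring axioms are contained in the hypothesis
  \<open>maximalideal L (coeff_integers f)\<close>; here they are turned into statements about
  complex arithmetic.\<close>

lemma coeff_integers_subring:
 assumes "ring (coeff_integers f)" shows "is_subring (carrier (coeff_integers f))" "cring (coeff_integers f)"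
  "\<And>x. x \<in> carrier (coeff_integers f) \<Longrightarrow> \<ominus>\<^bsub>coeff_integers f\<^esub> x = - x"
proof -
 interpret ring "coeff_integers f" by fact
 show neg: "\<ominus>\<^bsub>coeff_integers f\<^esub> x = - x" if "x \<in> carrier (coeff_integers f)" for x
  using r_neg[OF that] by (simp add: coeff_integers_ops eq_neg_iff_add_eq_0 add.commute)
 have "x - y \<in> carrier (coeff_integers f)" if "x \<in> carrier (coeff_integers f)" "y \<in> carrier (coeff_integers f)" for x y
  using a_closed[OF that(1) a_inv_closed[OF that(2)]] neg[OF that(2)] by (simp only: coeff_integers_ops(1)) simp
 then show "is_subring (carrier (coeff_integers f))"
  unfolding is_subring_def using one_closed m_closed by (simp only: coeff_integers_ops(2,4)) blast
 show "cring (coeff_integers f)" by unfold_locales (simp add: coeff_integers_ops mult.commute)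
qed

lemma inverse_coeff_field: "x \<in> coeff_field f \<Longrightarrow> x \<noteq> 0 \<Longrightarrow> inverse x \<in> coeff_field f"
proof -
 interpret U: field "ring_of_type_algebra :: complex ring" by rule
 assume x: "x \<in> coeff_field f" "x \<noteq> 0"
 have "inv\<^bsub>ring_of_type_algebra\<^esub> x = inverse x" using U.inv_unique'[of x "inverse x"] x(2) by (simp add: ring_of_type_algebra_def)
 then show ?thesis using x generate_field.m_inv[of x ring_of_type_algebra "range (q_coeff f)"]
  by (simp add: coeff_field_def ring_of_type_algebra_def)
qed

lemma coeff_field_mult: "x \<in> coeff_field f \<Longrightarrow> y \<in> coeff_field f \<Longrightarrow> x * y \<in> coeff_field f"
 using generate_field.eng_mult[of x ring_of_type_algebra "range (q_coeff f)" y]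
 by (simp add: coeff_field_def ring_of_type_algebra_def)

lemma residual_char_dvd:
 assumes "ideal L (coeff_integers f)"
 shows "of_nat n \<in> L \<longleftrightarrow> residual_char (coeff_integers f) L dvd n"
proof -
 interpret ideal L "coeff_integers f" by fact
 let ?R = "coeff_integers f"
 let ?Q = "?R Quot L"
 interpret Q: ring ?Q by (rule quotient_is_ring)
 have nR: "of_nat n \<in> carrier ?R" for n using is_subring_of_int[OF coeff_integers_subring(1)[OF ring_axioms], of "int n"] by simp
 have one: "\<one>\<^bsub>?Q\<^esub> = L +>\<^bsub>?R\<^esub> 1" by (simp add: FactRing_def coeff_integers_ops)
 have pow: "\<one>\<^bsub>?Q\<^esub> [^]\<^bsub>add_monoid ?Q\<^esub> n = L +>\<^bsub>?R\<^esub> of_nat n" for n :: nat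
 proof (induction n)
  case 0
  have "L +>\<^bsub>?R\<^esub> 0 = L" using a_coset_join2[of 0 L] additive_subgroup.zero_closed[OF is_additive_subgroup] nR[of 0] a_subgroup
   by (simp add: coeff_integers_ops(3))
  then show ?case by (simp add: FactRing_def)
 next
  case (Suc n)
  have "\<one>\<^bsub>?Q\<^esub> [^]\<^bsub>add_monoid ?Q\<^esub> Suc n = (L +>\<^bsub>?R\<^esub> of_nat n) <+>\<^bsub>?R\<^esub> (L +>\<^bsub>?R\<^esub> 1)"
   using Suc by (simp add: one FactRing_def coeff_integers_ops(4))
  also have "\<dots> = L +>\<^bsub>?R\<^esub> (of_nat n + 1)" using a_rcos_sum[of "of_nat n" 1] nR[of n] nR[of 1] by (simp add: coeff_integers_ops(1))
  finally show ?case by (simp add: add.commute)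
 qed
 have "of_nat n \<in> L \<longleftrightarrow> L +>\<^bsub>?R\<^esub> of_nat n = L" using a_coset_join2[OF nR a_subgroup] a_rcos_self[OF nR, of n] by blast
 also have "\<dots> \<longleftrightarrow> \<one>\<^bsub>?Q\<^esub> [^]\<^bsub>add_monoid ?Q\<^esub> n = \<one>\<^bsub>add_monoid ?Q\<^esub>" by (simp only: pow) (simp add: FactRing_def)
 also have "\<dots> \<longleftrightarrow> residual_char ?R L dvd n" unfolding residual_char_def by (rule group.pow_eq_id[OF Q.add.is_group]) simp
 finally show ?thesis .
qed

theorem coeff_integers_at_prime:
 assumes nf: "newform k N f" "N > 0" "k \<ge> 2" and L: "maximalideal L (coeff_integers f)"
  and l: "l = residual_char (coeff_integers f) L"
 shows "Factorial_Ring.prime l" "integers_at_prime (carrier (coeff_integers f)) L l"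
proof -
 interpret maximalideal L "coeff_integers f" by fact
 let ?R = "carrier (coeff_integers f)"
 interpret ei: eichler k N f by unfold_locales (use nf in auto)
 have R: "is_subring ?R" by (rule coeff_integers_subring(1)[OF ring_axioms])
 obtain d where d: "\<And>v. (\<forall>i\<le>d. v i \<in> coeff_field f) \<longrightarrow> (\<exists>c :: nat \<Rightarrow> rat. (\<exists>i\<le>d. c i \<noteq> 0) \<and> (\<Sum>i\<le>d. of_rat (c i) * v i) = 0)"
  using ei.coeff_field_relation by blast
 have rel: "\<exists>c :: nat \<Rightarrow> rat. (\<exists>i\<le>d. c i \<noteq> 0) \<and> (\<Sum>i\<le>d. of_rat (c i) * v i) = 0"
  if "\<And>i. i \<le> d \<Longrightarrow> v i \<in> ?R" for v using d[of v] that by (auto simp: coeff_integers_ops)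
 have LR: "L \<subseteq> ?R" by (rule a_subset)
 have L_add: "x + y \<in> L" if "x \<in> L" "y \<in> L" for x y using additive_subgroup.a_closed[OF is_additive_subgroup that] by (simp add: coeff_integers_ops)
 have L_mult: "a * x \<in> L" if "a \<in> ?R" "x \<in> L" for a x using I_l_closed[OF that(2,1)] by (simp add: coeff_integers_ops)
 have L0: "0 \<in> L" using additive_subgroup.zero_closed[OF is_additive_subgroup] by (simp add: coeff_integers_ops)
 have one_L: "1 \<notin> L" using one_imp_carrier I_notcarr by (auto simp: coeff_integers_ops(4))
 have L_max: "\<exists>b\<in>?R. a * b - 1 \<in> L" if a: "a \<in> ?R" "a \<notin> L" for a
 proof -
  interpret cr: cring "coeff_integers f" by (rule coeff_integers_subring(2)[OF ring_axioms])
  let ?J = "L <+>\<^bsub>coeff_integers f\<^esub> PIdl\<^bsub>coeff_integers f\<^esub> a"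
  have J: "z \<in> ?J \<longleftrightarrow> (\<exists>m\<in>L. \<exists>b\<in>?R. z = a * b + m)" for z
   by (auto simp: set_add_def' cgenideal_def coeff_integers_ops(1,2) add.commute mult.commute)
  have J_id: "ideal ?J (coeff_integers f)" by (rule add_ideals[OF is_ideal cr.cgenideal_ideal[OF a(1)]])
  have "L \<subseteq> ?J" unfolding J subset_iff using is_subringD(2)[OF R] by force
  then have "?J = L \<or> ?J = ?R" by (rule I_maximal[OF J_id]) (rule subsetI, rule ideal.Icarr[OF J_id])
  moreover have "a \<in> ?J" unfolding J using L0 is_subringD(1)[OF R] by force
  ultimately have "1 \<in> ?J" using a(2) is_subringD(1)[OF R] by metis
  then obtain b m where b: "1 = a * b + m" "b \<in> ?R" "m \<in> L" unfolding J by blast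
  have "- 1 * m \<in> L" using L_mult b is_subringD(1,5)[OF R] by blast
  moreover have "a * b - 1 = - 1 * m" using b(1) by (simp add: algebra_simps)
  ultimately have "a * b - 1 \<in> L" by (simp only:)
  then show ?thesis using b(2) by blast
 qed
 have L_prime: "of_nat a \<in> L \<or> of_nat b \<in> L" if ab: "of_nat (a * b) \<in> L" for a b :: nat
 proof (rule ccontr)
  assume neg: "\<not> (of_nat a \<in> L \<or> of_nat b \<in> L)"
  have nR: "of_nat n \<in> ?R" for n using is_subring_of_int[OF R, of "int n"] by simp
  obtain c where c: "c \<in> ?R" "of_nat a * c - 1 \<in> L" using L_max neg nR by blast
  have "c * of_nat (a * b) + (- of_nat b) * (of_nat a * c - 1) \<in> L" by (intro L_add L_mult c ab is_subringD(5)[OF R] nR)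
  moreover have "c * of_nat (a * b) + (- of_nat b) * (of_nat a * c - 1) = of_nat b" by (simp add: algebra_simps)
  ultimately show False using neg by simp
 qed
 note dvd = residual_char_dvd[OF is_ideal, folded l]
 \<comment> \<open>If no positive integer lay in \<open>L\<close>, then 2 would be invertible modulo
   \<open>L\<close>, giving x = 2 c - 1 in \<open>L\<close>. It is nonzero because 1/2 is not an
   algebraic integer, and \<open>lowest_term\<close> applied to its powers puts a nonzero integer
   into \<open>L\<close>.\<close>
 have lpos: "l > 0"
 proof (rule ccontr)
  assume "\<not> l > 0"
  then have no: "of_nat n \<notin> L" if "n > 0" for n using dvd[of n] that by auto
  obtain c where c: "c \<in> ?R" "of_nat 2 * c - 1 \<in> L" using L_max[of "of_nat 2"] no[of 2] is_subring_of_int[OF R, of 2] by auto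
  define x where "x = 2 * c - 1"
  have "x \<noteq> 0"
  proof
   assume "x = 0"
   then have c2: "c = of_rat (1 / 2)" by (simp add: x_def of_rat_divide field_simps)
   then have "c \<in> \<rat>" by (simp only: Rats_of_rat)
   then have "c \<in> \<int>" using c(1) rational_algebraic_int_is_int by (auto simp: coeff_integers_ops)
   then obtain z where "c = of_int z" by (rule Ints_cases)
   then have "(of_int (2 * z) :: complex) = of_int 1" using c2 by (simp add: of_rat_divide mult.commute)
   then have "2 * z = 1" by (simp only: of_int_eq_iff)
   then show False by presburger
  qed
  have x: "x \<in> L" using c(2) by (simp add: x_def)
  have "x ^ i \<in> ?R" for i using x LR by (intro is_subring_power[OF R]) auto
  from rel[of "\<lambda>i. x ^ i", OF this] obtain cc :: "nat \<Rightarrow> rat" where "(\<exists>i\<le>d. cc i \<noteq> 0) \<and> (\<Sum>i\<le>d. of_rat (cc i) * x ^ i) = 0" ..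
  note cc = this[THEN conjunct1] this[THEN conjunct2]
  obtain z :: "nat \<Rightarrow> int" where z: "\<exists>i\<le>d. \<not> int 2 dvd z i" "(\<Sum>i\<le>d. of_int (z i) * x ^ i) = 0"
   by (rule int_relation[OF cc order_refl]) (rule that)
  obtain j where j: "(of_int (z j) :: complex) \<noteq> 0" "j \<le> d"
   "of_int (z j) = - (x * (\<Sum>i\<in>{Suc j..d}. of_int (z i) * x ^ (i - Suc j)))"
   by (rule lowest_term[where c = "\<lambda>i. of_int (z i)", OF _ z(2) \<open>x \<noteq> 0\<close>]) (use z(1) that in \<open>auto intro: dvd_0_right\<close>)
  from j(3) have "of_int (z j) = (- (\<Sum>i\<in>{Suc j..d}. of_int (z i) * x ^ (i - Suc j))) * x" by simp
  moreover have "x ^ i \<in> ?R" for i using x LR by (intro is_subring_power[OF R]) auto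
  then have "- (\<Sum>i\<in>{Suc j..d}. of_int (z i) * x ^ (i - Suc j)) \<in> ?R"
   by (intro is_subringD(4,5)[OF R] is_subring_sum[OF R] is_subring_of_int[OF R])
  ultimately have "of_int (z j) \<in> L" using L_mult x by metis
  then have "of_int (z j) * of_int (z j) \<in> L" using L_mult is_subring_of_int[OF R] by blast
  moreover have "(of_nat (nat (z j * z j)) :: complex) = of_int (z j) * of_int (z j)" by (simp add: of_nat_nat flip: of_int_mult)
  moreover have "nat (z j * z j) > 0" using j(1) by (auto simp: zero_less_mult_iff linorder_neq_iff)
  ultimately show False using no[of "nat (z j * z j)"] by simp
 qed
 have l_L: "of_nat l \<in> L" using dvd[of l] by simp
 show prime: "Factorial_Ring.prime l"
 proof (rule prime_natI)
  show "l \<ge> 2" using dvd[of 1] one_L lpos by (cases l) auto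
  fix a b :: nat assume "l dvd a * b"
  then show "l dvd a \<or> l dvd b" using L_prime[of a b] dvd by blast
 qed
 show "integers_at_prime ?R L l"
 proof (unfold_locales; (rule R LR L_add L_mult one_L L_max l_L lpos)?)
  show "\<exists>Z. finite Z \<and> Z \<subseteq> ?R \<and> (\<forall>a\<in>?R. \<exists>z\<in>Z. (a - z) / of_nat l \<in> ?R)" by (rule finite_residues[OF R prime rel])
  fix x i j assume x: "x * of_nat l \<in> ?R" "i < j" "x ^ j - x ^ i \<in> ?R"
  have "inverse (of_nat l) \<in> coeff_field f"
   using lpos is_subring_of_int[OF R, of "int l"] by (intro inverse_coeff_field) (auto simp: coeff_integers_ops)
  then have "x * of_nat l * inverse (of_nat l) \<in> coeff_field f"
   using coeff_field_mult[of "x * of_nat l" f] x(1) by (simp add: coeff_integers_ops)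
  moreover have "x * of_nat l * inverse (of_nat l) = x" using lpos by (simp add: mult.assoc)
  ultimately have "x \<in> coeff_field f" by (simp only:)
  moreover have "algebraic_int x"
  proof (rule algebraic_int_root)
   \<comment> \<open>Monic of degree j because i < j. Its value at \<open>x\<close> is an algebraic
     integer, hence so is \<open>x\<close>.\<close>
   let ?p = "Polynomial.monom 1 j - Polynomial.monom (1::complex) i"
   show "algebraic_int (x ^ j - x ^ i)" using x(3) by (simp add: coeff_integers_ops)
   show "poly ?p x = x ^ j - x ^ i" by (simp add: poly_monom)
   show "\<forall>i. Polynomial.coeff ?p i \<in> \<int>" by simp
   have deg: "Polynomial.degree ?p = j"
    using x(2) degree_add_eq_left[of "- Polynomial.monom (1::complex) i" "Polynomial.monom 1 j"] by (simp add: degree_monom_eq)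
   show "Polynomial.lead_coeff ?p = 1" "0 < Polynomial.degree ?p" unfolding deg using x(2) by auto
  qed
  ultimately show "x \<in> ?R" by (simp add: coeff_integers_ops)
 qed
qed

lemma ideal_pow_Suc: "L [^]\<^bsub>ideals_set R\<^esub> Suc n = ideal_prod R (L [^]\<^bsub>ideals_set R\<^esub> n) L"
 by (simp add: nat_pow_def ideals_set_def)

lemma ideal_prod_linear:
 assumes "a \<in> I \<cdot>\<^bsub>coeff_integers f\<^esub> J" "\<And>i j. i \<in> I \<Longrightarrow> j \<in> J \<Longrightarrow> c * (i * j) \<in> S" "\<And>x y. x \<in> S \<Longrightarrow> y \<in> S \<Longrightarrow> x + y \<in> S"
 shows "c * a \<in> S" using assms(1) by induction (use assms(2,3) in \<open>auto simp: coeff_integers_ops ring_distribs\<close>)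

text \<open>The element \<open>y\<close> generates \<open>L\<close> locally: x L lies in R and x y
  is a unit at \<open>L\<close>, so elements of L^n are y^n times elements of \<open>V\<close>. The
  main point is that l is y^e times a unit with e = \<open>ord_ideal\<close>, which turns the
  exponent of ideals into one of valuations.\<close>

theorem coeff_integers_valuation:
 assumes nf: "newform k N f" "N > 0" "k \<ge> 2" and L: "maximalideal L (coeff_integers f)"
  and l: "l = residual_char (coeff_integers f) L"
 obtains V where "complex_valuation_ring V" "Factorial_Ring.prime l" "of_nat l \<in> complex_valuation_ring.mx V"
  "\<And>r s x y. int r > int (ord_ideal (coeff_integers f) L (of_nat l)) * s \<Longrightarrow> r > 0 \<Longrightarrow> cong_local (coeff_integers f) L r x y \<Longrightarrow>
    x - y \<in> complex_valuation_ring.mx V \<and> (x - y) * of_nat l powi (- s) \<in> complex_valuation_ring.mx V"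
proof -
 let ?R = "coeff_integers f"
 define IS where "IS = ideals_set ?R"
 interpret maximalideal L ?R by fact
 interpret P: integers_at_prime "carrier ?R" L l by (rule coeff_integers_at_prime(2)[OF assms])
 interpret cr: cring ?R by (rule coeff_integers_subring(2)[OF ring_axioms])
 interpret IM: comm_monoid IS unfolding IS_def by (rule cr.ideals_set_is_comm_monoid)
 have prime: "Factorial_Ring.prime l" by (rule coeff_integers_at_prime(1)[OF assms])
 define pw where "pw n = L [^]\<^bsub>IS\<^esub> n" for n :: nat
 have pw0: "pw 0 = carrier ?R" by (simp add: pw_def IS_def ideals_set_def)
 have pwS: "pw (Suc n) = pw n \<cdot>\<^bsub>?R\<^esub> L" for n unfolding pw_def IS_def by (rule ideal_pow_Suc)
 have LI: "L \<in> carrier IS" using is_ideal by (simp add: IS_def ideals_set_def)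
 have pwI: "pw n \<in> carrier IS" for n unfolding pw_def by (rule IM.nat_pow_closed[OF LI])
 have pwR: "pw n \<subseteq> carrier ?R" for n using pwI[of n] by (auto simp: IS_def ideals_set_def dest: ideal.Icarr)
 obtain x y where xy: "y \<in> L" "\<And>z. z \<in> L \<Longrightarrow> x * z \<in> carrier ?R" "x * y \<notin> L" using P.inverse_element by blast
 have "z \<in> L" if "z \<in> extended_ideal L (carrier ?R)" for z using that
 proof induction
  case zero
  then show ?case using P.L_diff[OF P.l_L P.l_L] by simp
 next
  case (step z l' a)
  then show ?case using P.L_add[OF P.L_mult[of a l'] step(4)] by (simp add: mult.commute)
 qed
 then have "1 \<notin> extended_ideal L (carrier ?R)" using P.one_L by blast
 then obtain V where V: "is_subring V" "carrier ?R \<subseteq> V" "1 \<notin> extended_ideal L V" "\<And>x. x \<notin> V \<Longrightarrow> inverse x \<in> V"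
  by (rule exists_valuation_ring[OF P.R _ P.LR]) (rule that)
 interpret V: complex_valuation_ring V by unfold_locales (use V in auto)
 have Lmx: "z \<in> V.mx" if z: "z \<in> L" for z
 proof -
  have "inverse z \<notin> V" if "z \<noteq> 0"
  proof
   assume "inverse z \<in> V"
   then have "z * inverse z + 0 \<in> extended_ideal L V" using z by (intro extended_ideal.intros)
   then show False using V(3) that by simp
  qed
  then show ?thesis using z P.LR V(2) unfolding V.mx_def by auto
 qed
 have unit: "s \<notin> V.mx" if s: "s \<in> carrier ?R" "s \<notin> L" for s
 proof
  assume "s \<in> V.mx"
  obtain b where b: "b \<in> carrier ?R" "s * b - 1 \<in> L" using P.L_max[OF s] by blast
  have "b * s - (s * b - 1) \<in> V.mx" using V.mx_diff[OF V.mx_mult[OF _ \<open>s \<in> V.mx\<close>] Lmx[OF b(2)], of b] V(2) b(1) by blast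
  then show False using V.one_notin_mx by (simp add: mult.commute)
 qed
 have iunit: "inverse s \<in> V" if "s \<in> carrier ?R" "s \<notin> L" for s using V.unitD unit[OF that] V(2) that by blast
 have xyR: "x * y \<in> carrier ?R" using xy by blast
 have y0: "y \<noteq> 0" using xy(3) P.L_diff[OF P.l_L P.l_L] by auto
 have x0: "x \<noteq> 0" using xy(3) P.L_diff[OF P.l_L P.l_L] by auto
 have xpw: "x ^ n * a \<in> carrier ?R" if "a \<in> pw n" for n a using that
 proof (induction n arbitrary: a)
  case (Suc n)
  show ?case
  proof (rule ideal_prod_linear[OF Suc.prems[unfolded pwS]])
   fix i j assume "i \<in> pw n" "j \<in> L"
   then have "(x ^ n * i) * (x * j) \<in> carrier ?R" using P.R_intros(4)[OF Suc.IH xy(2)] by blast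
   then show "x ^ Suc n * (i * j) \<in> carrier ?R" by (simp add: mult_ac)
  qed (rule P.R_intros(6))
 qed (simp add: pw0)
 have pwV: "a / y ^ n \<in> V" if "a \<in> pw n" for n a
 proof -
  have "inverse (x * y) ^ n * (x ^ n * a) \<in> V"
   using V.V_intros(4)[OF V.V_intros(8)[OF iunit[OF xyR xy(3)]], of "x ^ n * a" n] xpw[OF that] V(2) by blast
  moreover have "inverse (x * y) ^ n * (x ^ n * a) = a / y ^ n" using x0 y0 by (simp add: field_simps power_inverse)
  ultimately show ?thesis by simp
 qed
 have ypw: "y ^ n \<in> pw n" for n
 proof (induction n)
  case (Suc n)
  have "y ^ n \<otimes>\<^bsub>?R\<^esub> y \<in> pw n \<cdot>\<^bsub>?R\<^esub> L" by (rule ideal_prod.prod[OF Suc xy(1)])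
  then show ?case by (simp add: pwS coeff_integers_ops mult.commute)
 qed (use P.R_intros(1) in \<open>simp add: pw0\<close>)
 have lR: "of_nat l \<in> carrier ?R" using P.l_L P.LR by blast
 have PId: "PIdl\<^bsub>?R\<^esub> (of_nat l) = {a * of_nat l | a. a \<in> carrier ?R}" by (auto simp: cgenideal_def coeff_integers_ops)
 have PIc: "PIdl\<^bsub>?R\<^esub> (of_nat l) \<in> carrier IS" using cr.cgenideal_ideal[OF lR] by (simp add: IS_def ideals_set_def)
 have sub: "I \<cdot>\<^bsub>?R\<^esub> J \<subseteq> I" if "ideal I ?R" "ideal J ?R" for I J using ideal_prod_inter[OF that] by blast
 define D where "D n \<longleftrightarrow> pw n divides\<^bsub>IS\<^esub> (PIdl\<^bsub>?R\<^esub> (of_nat l))" for n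
 have DE: "\<exists>J. ideal J ?R \<and> PIdl\<^bsub>?R\<^esub> (of_nat l) = pw n \<cdot>\<^bsub>?R\<^esub> J" if "D n" for n
  using that by (auto simp: D_def factor_def IS_def ideals_set_def)
 have lpw: "of_nat l \<in> pw n" if "D n" for n
 proof -
  obtain J where J: "ideal J ?R" "PIdl\<^bsub>?R\<^esub> (of_nat l) = pw n \<cdot>\<^bsub>?R\<^esub> J" using DE[OF \<open>D n\<close>] by blast
  have "ideal (pw n) ?R" using pwI[of n] by (simp add: IS_def ideals_set_def)
  from sub[OF this J(1)] J(2) have "PIdl\<^bsub>?R\<^esub> (of_nat l) \<subseteq> pw n" by simp
  moreover have "1 * of_nat l \<in> PIdl\<^bsub>?R\<^esub> (of_nat l)" unfolding PId using P.R_intros(1) by blast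
  ultimately show ?thesis by auto
 qed
 have ymx: "y \<in> V.mx" by (rule Lmx[OF xy(1)])
 have ynmx: "y ^ n \<in> V.mx" if "n > 0" for n
  using that V.mx_mult[OF V.V_intros(8)[of y "n - 1"] ymx] ymx V.mx_subset by (cases n) (auto simp: mult.commute)
 \<comment> \<open>The \<open>GREATEST\<close> in \<open>ord_ideal\<close> needs a bound. Two powers
   of \<open>y\<close> agree modulo l, and since y^(j-i) - 1 is a unit of \<open>V\<close>, l
   divides y^i in \<open>V\<close>; so L^n can divide (l) only for n \<le> i.\<close>
 have "\<exists>i. \<forall>n. D n \<longrightarrow> n \<le> i"
 proof -
  have "y ^ n \<in> carrier ?R" for n using ypw pwR by blast
  from P.pigeonhole[OF this] obtain i j where ij: "i < j" "(y ^ j - y ^ i) / of_nat l \<in> carrier ?R" by blast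
  have "y ^ (j - i) - 1 \<notin> V.mx"
  proof
   assume "y ^ (j - i) - 1 \<in> V.mx"
   from V.mx_diff[OF ynmx this, of "j - i"] ij V.one_notin_mx show False by simp
  qed
  moreover have yV: "y \<in> V" using ymx V.mx_subset by blast
  then have "y ^ (j - i) - 1 \<in> V" by (intro V.V_intros)
  ultimately have iV: "inverse (y ^ (j - i) - 1) \<in> V" and ne: "y ^ (j - i) - 1 \<noteq> 0"
   using V.unitD[of "y ^ (j - i) - 1"] V.mx_0 by auto
  have "inverse (y ^ (j - i) - 1) * ((y ^ j - y ^ i) / of_nat l) \<in> V" using V.V_intros(4)[OF iV] ij(2) V(2) by blast
  moreover have "y ^ j = y ^ (j - i) * y ^ i" using ij(1) by (simp add: power_add [symmetric])
  then have "y ^ j - y ^ i = (y ^ (j - i) - 1) * y ^ i" by (simp add: algebra_simps)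
  then have "inverse (y ^ (j - i) - 1) * ((y ^ j - y ^ i) / of_nat l) = y ^ i / of_nat l" using ne by simp
  ultimately have yl: "y ^ i / of_nat l \<in> V" by (simp only:)
  have "n \<le> i" if "D n" for n
  proof (rule ccontr)
   assume "\<not> n \<le> i"
   then have n: "n = i + (n - i)" "n - i > 0" by auto
   have "of_nat l / y ^ n * (y ^ i / of_nat l) \<in> V" using V.V_intros(4)[OF pwV[OF lpw[OF \<open>D n\<close>]] yl] .
   moreover have "of_nat l / y ^ n * (y ^ i / of_nat l) = inverse (y ^ (n - i))"
    using P.l0 y0 by (subst n(1), subst power_add) (simp add: field_simps)
   ultimately show False using ynmx[OF n(2)] y0 unfolding V.mx_def by (metis (mono_tags, lifting) mem_Collect_eq power_not_zero)
  qed
  then show ?thesis by blast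
 qed
 then obtain i where bound: "\<And>n. D n \<Longrightarrow> n \<le> i" by blast
 have "D 0" unfolding D_def using IM.l_one[OF PIc] PIc by (auto simp: factor_def pw_def intro!: bexI[of _ "PIdl\<^bsub>?R\<^esub> (of_nat l)"])
 define e where "e = ord_ideal ?R L (of_nat l)"
 have e_eq: "e = (GREATEST n. D n)" by (simp add: e_def ord_ideal_def D_def pw_def IS_def)
 have De: "D e" unfolding e_eq by (rule GreatestI_nat[of D 0 i, OF \<open>D 0\<close> bound])
 have nD: "\<not> D (Suc e)" using Greatest_le_nat[of D "Suc e" i, OF _ bound] by (auto simp: e_eq)
 obtain J where J: "ideal J ?R" "PIdl\<^bsub>?R\<^esub> (of_nat l) = pw e \<cdot>\<^bsub>?R\<^esub> J" using DE[OF De] by blast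
 interpret J: ideal J ?R by (rule J(1))
 have JR: "j \<in> carrier ?R" if "j \<in> J" for j by (rule J.Icarr[OF that])
 have Jadd: "u + v \<in> J" if "u \<in> J" "v \<in> J" for u v using additive_subgroup.a_closed[OF J.is_additive_subgroup that] by (simp add: coeff_integers_ops)
 have Jmult: "a * u \<in> J" if "a \<in> carrier ?R" "u \<in> J" for a u using J.I_l_closed[OF that(2,1)] by (simp add: coeff_integers_ops)
 have J0: "0 \<in> J" using additive_subgroup.zero_closed[OF J.is_additive_subgroup] by (simp add: coeff_integers_ops)
 \<comment> \<open>If \<open>J\<close> were contained in \<open>L\<close>, then J' = J + x J would
   be an ideal of R with L J' = J, and L^(e+1) would divide (l), against the choice of
   \<open>e\<close>.\<close>
 have "\<not> J \<subseteq> L"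
 proof
  assume JL: "J \<subseteq> L"
  define J' where "J' = {j + x * j' | j j'. j \<in> J \<and> j' \<in> J}"
  have J'I: "z \<in> J'" if "z = j + x * j'" "j \<in> J" "j' \<in> J" for z j j' using that by (auto simp: J'_def)
  have J'R: "J' \<subseteq> carrier ?R"
  proof
   fix z assume "z \<in> J'"
   then obtain j j' where z: "z = j + x * j'" "j \<in> J" "j' \<in> J" unfolding J'_def by blast
   show "z \<in> carrier ?R" unfolding z(1) by (rule P.R_intros(6)[OF JR[OF z(2)] xy(2)]) (use JL z in blast)
  qed
  have J'add: "u + v \<in> J'" if uv: "u \<in> J'" "v \<in> J'" for u v
  proof -
   obtain a b where a: "u = a + x * b" "a \<in> J" "b \<in> J" using uv(1) unfolding J'_def by blast
   obtain c d where c: "v = c + x * d" "c \<in> J" "d \<in> J" using uv(2) unfolding J'_def by blast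
   have "u + v = (a + c) + x * (b + d)" by (simp add: a(1) c(1) algebra_simps)
   then show ?thesis by (rule J'I) (intro Jadd a c)+
  qed
  have J'mult: "r * u \<in> J'" if ru: "r \<in> carrier ?R" "u \<in> J'" for r u
  proof -
   obtain a b where a: "u = a + x * b" and m: "a \<in> J" "b \<in> J" using ru(2) unfolding J'_def by blast
   have "r * u = r * a + x * (r * b)" by (simp add: a algebra_simps)
   then show ?thesis by (rule J'I) (intro Jmult m ru)+
  qed
  have iJ': "ideal J' ?R"
  proof (rule idealI[OF ring_axioms])
   show "subgroup J' (add_monoid ?R)"
   proof (rule add.subgroupI)
    show "J' \<subseteq> carrier ?R" by (rule J'R)
    show "J' \<noteq> {}" using J'I[OF refl J0 J0] by blast
    fix u v assume uv: "u \<in> J'" "v \<in> J'"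
    then show "u \<oplus>\<^bsub>?R\<^esub> v \<in> J'" using J'add by (simp add: coeff_integers_ops)
    have "- 1 * u \<in> J'" by (rule J'mult[OF P.R_intros(5)[OF P.R_intros(1)] uv(1)])
    then show "\<ominus>\<^bsub>?R\<^esub> u \<in> J'" using coeff_integers_subring(3)[OF ring_axioms] J'R uv by auto
   qed
   fix u v assume "u \<in> J'" "v \<in> carrier ?R"
   from J'mult[OF this(2,1)] show "v \<otimes>\<^bsub>?R\<^esub> u \<in> J'" "u \<otimes>\<^bsub>?R\<^esub> v \<in> J'" by (simp_all add: coeff_integers_ops(2) mult.commute)
  qed
  have "L \<cdot>\<^bsub>?R\<^esub> J' = J"
  proof
   show "L \<cdot>\<^bsub>?R\<^esub> J' \<subseteq> J"
   proof
    fix a assume "a \<in> L \<cdot>\<^bsub>?R\<^esub> J'"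
    then have "1 * a \<in> J"
    proof (rule ideal_prod_linear)
     fix z u assume z: "z \<in> L" "u \<in> J'"
     then obtain j j' where u: "u = j + x * j'" "j \<in> J" "j' \<in> J" unfolding J'_def by blast
     have "z * j + (x * z) * j' \<in> J" by (rule Jadd[OF Jmult[OF subsetD[OF P.LR z(1)] u(2)] Jmult[OF xy(2)[OF z(1)] u(3)]])
     then show "1 * (z * u) \<in> J" by (simp add: u(1) algebra_simps)
    qed (rule Jadd)
    then show "a \<in> J" by simp
   qed
   show "J \<subseteq> L \<cdot>\<^bsub>?R\<^esub> J'"
   proof
    fix j assume j: "j \<in> J"
    obtain b where b: "b \<in> carrier ?R" "x * y * b - 1 \<in> L" using P.L_max[OF xyR xy(3)] by blast
    have "- 1 * (x * y * b - 1) \<in> L" by (rule P.L_mult[OF P.R_intros(5)[OF P.R_intros(1)] b(2)])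
    then have 1: "(- 1 * (x * y * b - 1)) \<otimes>\<^bsub>?R\<^esub> j \<in> L \<cdot>\<^bsub>?R\<^esub> J'" by (rule ideal_prod.prod) (rule J'I[OF _ j J0], simp)
    have "b * y \<in> L" by (rule P.L_mult[OF b(1) xy(1)])
    then have "(b * y) \<otimes>\<^bsub>?R\<^esub> (x * j) \<in> L \<cdot>\<^bsub>?R\<^esub> J'" by (rule ideal_prod.prod) (rule J'I[OF _ J0 j], simp)
    from ideal_prod.sum[OF 1 this] show "j \<in> L \<cdot>\<^bsub>?R\<^esub> J'" by (simp add: coeff_integers_ops algebra_simps)
   qed
  qed
  then have "pw e \<otimes>\<^bsub>IS\<^esub> (L \<otimes>\<^bsub>IS\<^esub> J') = PIdl\<^bsub>?R\<^esub> (of_nat l)" using J(2) by (simp add: IS_def ideals_set_def)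
  moreover have J'c: "J' \<in> carrier IS" using iJ' by (simp add: IS_def ideals_set_def)
  ultimately have "(pw e \<otimes>\<^bsub>IS\<^esub> L) \<otimes>\<^bsub>IS\<^esub> J' = PIdl\<^bsub>?R\<^esub> (of_nat l)" using IM.m_assoc[OF pwI LI J'c] by simp
  moreover have "pw e \<otimes>\<^bsub>IS\<^esub> L = pw (Suc e)" by (simp add: pw_def)
  ultimately have "D (Suc e)" unfolding D_def factor_def using J'c by auto
  then show False using nD by simp
 qed
 then obtain j where j: "j \<in> J" "j \<notin> L" by blast
 define u where "u = of_nat l / y ^ e"
 have u0: "u \<noteq> 0" using P.l0 y0 by (simp add: u_def)
 have uV: "u \<in> V" unfolding u_def by (rule pwV[OF lpw[OF De]])
 \<comment> \<open>For \<open>j\<close> in \<open>J\<close> outside \<open>L\<close>, the product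
   y^e j is a multiple of l, which exhibits 1/u as an element of \<open>V\<close>.\<close>
 have iuV: "inverse u \<in> V"
 proof -
  have "y ^ e \<otimes>\<^bsub>?R\<^esub> j \<in> PIdl\<^bsub>?R\<^esub> (of_nat l)" unfolding J(2) by (rule ideal_prod.prod[OF ypw j(1)])
  then obtain a where a: "a \<in> carrier ?R" "y ^ e * j = a * of_nat l" by (auto simp: PId coeff_integers_ops)
  have "inverse j * a \<in> V" using V.V_intros(4)[OF iunit[OF JR[OF j(1)] j(2)]] a(1) V(2) by blast
  moreover have "j \<noteq> 0" using j(2) P.L_diff[OF P.l_L P.l_L] by auto
  then have "inverse j * a = inverse u" using a(2) P.l0 y0 by (simp add: u_def field_simps)
  ultimately show ?thesis by simp
 qed
 have upow: "u powi n \<in> V" for n using V.V_intros(8)[OF uV] V.V_intros(8)[OF iuV] by (cases "n \<ge> 0") (auto simp: power_int_def)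
 show thesis
 proof (rule that[OF V.complex_valuation_ring_axioms prime Lmx[OF P.l_L]])
  fix r s x' y'
  assume r: "int r > int (ord_ideal (coeff_integers f) L (of_nat l)) * s" "r > 0" and c: "cong_local (coeff_integers f) L r x' y'"
  obtain a t where at: "a \<in> pw r" "t \<in> carrier ?R" "t \<notin> L" "x' - y' = a / t" using c by (auto simp: cong_local_def pw_def IS_def)
  define v where "v = inverse t * (a / y ^ r)"
  have vV: "v \<in> V" unfolding v_def by (rule V.V_intros(4)[OF iunit[OF at(2,3)] pwV[OF at(1)]])
  have eq: "x' - y' = v * y ^ r" using y0 by (simp add: v_def at(4) field_simps)
  \<comment> \<open>The exponent of \<open>y\<close> left over after division by l^s, that is by
    y^(e s) times a unit. It is positive by the strict inequality assumed for
    \<open>r\<close>.\<close>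
  define m where "m = nat (int r - int e * s)"
  have m: "m > 0" "int m = int r - int e * s" using r(1) by (auto simp: m_def e_def)
  have "of_nat l = y powi (int e) * u" using y0 by (simp add: u_def)
  then have "of_nat l powi (- s) = y powi (- (int e * s)) * u powi (- s)"
   by (simp only: power_int_mult_distrib power_int_mult [symmetric]) simp
  moreover have "y ^ r * y powi (- (int e * s)) = y powi (int r + - (int e * s))" using y0 by (subst power_int_add) auto
  then have "y ^ r * y powi (- (int e * s)) = y ^ m" using m(2) by (metis add_uminus_conv_diff power_int_of_nat)
  ultimately have "(x' - y') * of_nat l powi (- s) = v * u powi (- s) * y ^ m" by (simp add: eq mult_ac)
  moreover have "v * u powi (- s) * y ^ m \<in> V.mx" by (rule V.mx_mult[OF V.V_intros(4)[OF vV upow] ynmx[OF m(1)]])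
  ultimately have "(x' - y') * of_nat l powi (- s) \<in> V.mx" by (simp only:)
  then show "x' - y' \<in> V.mx \<and> (x' - y') * of_nat l powi (- s) \<in> V.mx" using V.mx_mult[OF vV ynmx[OF r(2)]] unfolding eq by blast
 qed
qed

section \<open>Congruences between expansions\<close>

lemma linear_relation:
 fixes a :: "'i \<Rightarrow> nat \<Rightarrow> complex"
 assumes "finite J" "card J > m"
 shows "\<exists>c. (\<exists>j\<in>J. c j \<noteq> 0) \<and> (\<forall>n<m. (\<Sum>j\<in>J. c j * a j n) = 0)" using assms
proof (induction m arbitrary: J a)
 case 0
 then have "J \<noteq> {}" by auto
 then show ?case by (intro exI[of _ "\<lambda>_. 1"]) auto
next
 case (Suc m)
 show ?case
 proof (cases "\<forall>j\<in>J. a j m = 0")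
  case True
  obtain c where c: "\<exists>j\<in>J. c j \<noteq> 0" "\<forall>n<m. (\<Sum>j\<in>J. c j * a j n) = 0" using Suc.IH[OF Suc.prems(1), of a] Suc.prems(2) by auto
  moreover have "(\<Sum>j\<in>J. c j * a j m) = 0" using True by simp
  ultimately show ?thesis by (intro exI[of _ c]) (auto simp: less_Suc_eq)
 next
  case False
  then obtain i where i: "i \<in> J" "a i m \<noteq> 0" by blast
  define J' where "J' = J - {i}"
  have J': "finite J'" "card J' > m" using Suc.prems i by (auto simp: J'_def)
  define a' where "a' j n = a j n - a j m / a i m * a i n" for j n
  obtain c where c: "\<exists>j\<in>J'. c j \<noteq> 0" "\<forall>n<m. (\<Sum>j\<in>J'. c j * a' j n) = 0" using Suc.IH[OF J', of a'] by blast
  define t where "t = (\<Sum>j\<in>J'. c j * a j m) / a i m"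
  define c' where "c' j = (if j = i then - t else c j)" for j
  have s: "(\<Sum>j\<in>J. c' j * a j n) = (\<Sum>j\<in>J'. c j * a j n) - t * a i n" for n
  proof -
   have "(\<Sum>j\<in>J. c' j * a j n) = c' i * a i n + (\<Sum>j\<in>J'. c' j * a j n)"
    unfolding J'_def by (rule sum.remove) (use Suc.prems i in auto)
   also have "(\<Sum>j\<in>J'. c' j * a j n) = (\<Sum>j\<in>J'. c j * a j n)" by (rule sum.cong) (auto simp: c'_def J'_def)
   finally show ?thesis by (simp add: c'_def)
  qed
  have "(\<Sum>j\<in>J'. c j * a' j n) = (\<Sum>j\<in>J'. c j * a j n) - t * a i n" for n
   unfolding a'_def t_def sum_divide_distrib sum_distrib_right sum_subtractf [symmetric]
   by (rule sum.cong) (simp_all add: right_diff_distrib)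
  then have "(\<Sum>j\<in>J. c' j * a j n) = 0" if "n < m" for n using c(2) that unfolding s by simp
  moreover have "(\<Sum>j\<in>J. c' j * a j m) = 0" unfolding s using i by (simp add: t_def)
  moreover have "\<exists>j\<in>J. c' j \<noteq> 0" using c(1) by (auto simp: c'_def J'_def)
  ultimately show ?thesis by (intro exI[of _ c']) (auto simp: less_Suc_eq)
 qed
qed

section \<open>Reduction of expansions modulo the maximal ideal\<close>

context complex_valuation_ring
begin

definition qint :: "complex set \<Rightarrow> (complex \<Rightarrow> complex) \<Rightarrow> bool" where
 "qint I F \<longleftrightarrow> (\<exists>h>0. \<exists>a. has_q_expansion h a F \<and> (\<forall>n. a n \<in> I))"

text \<open>One notion for \<open>V\<close>, \<open>mx\<close> and later \<open>J\<close>, so that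
  closure arguments are made once.\<close>

definition is_id :: "complex set \<Rightarrow> bool" where
 "is_id I \<longleftrightarrow> 0 \<in> I \<and> (\<forall>x\<in>I. \<forall>y\<in>I. x + y \<in> I) \<and> (\<forall>v\<in>V. \<forall>x\<in>I. v * x \<in> I)"

lemma id_V: "is_id V" and id_mx: "is_id mx"
 using V_intros mx_0 mx_add mx_mult by (auto simp: is_id_def)

lemma is_idD:
 assumes "is_id I"
 shows "0 \<in> I" "x \<in> I \<Longrightarrow> y \<in> I \<Longrightarrow> x + y \<in> I" "v \<in> V \<Longrightarrow> x \<in> I \<Longrightarrow> v * x \<in> I"
  "(\<And>i. i \<in> S \<Longrightarrow> g i \<in> I) \<Longrightarrow> sum g S \<in> I" "x \<in> I \<Longrightarrow> - x \<in> I" "x \<in> I \<Longrightarrow> y \<in> I \<Longrightarrow> x - y \<in> I"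
proof -
 show 0: "0 \<in> I" and a: "\<And>x y. x \<in> I \<Longrightarrow> y \<in> I \<Longrightarrow> x + y \<in> I" and m: "\<And>v x. v \<in> V \<Longrightarrow> x \<in> I \<Longrightarrow> v * x \<in> I"
  using assms by (auto simp: is_id_def)
 show "sum g S \<in> I" if "\<And>i. i \<in> S \<Longrightarrow> g i \<in> I" using that by (induction S rule: infinite_finite_induct) (auto intro: 0 a)
 show n: "- x \<in> I" if "x \<in> I" for x using m[of "- 1" x] that V_intros(1,5) by auto
 show "x - y \<in> I" if "x \<in> I" "y \<in> I" for x y using a[OF that(1) n[OF that(2)]] by simp
qed

lemma qint_cong: "qint I F \<Longrightarrow> (\<And>\<tau>. \<tau> \<in> HH \<Longrightarrow> F \<tau> = G \<tau>) \<Longrightarrow> qint I G"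
 unfolding qint_def using q_expansion_cong by metis

lemma qint_common:
 assumes "qint I F" "qint I' G" "0 \<in> I" "0 \<in> I'"
 obtains h a b where "h > 0" "has_q_expansion h a F" "has_q_expansion h b G" "\<And>n. a n \<in> I" "\<And>n. b n \<in> I'"
proof -
 obtain h a where F: "h > 0" "has_q_expansion h a F" "\<And>n. a n \<in> I" using assms(1) by (auto simp: qint_def)
 obtain g b where G: "g > 0" "has_q_expansion g b G" "\<And>n. b n \<in> I'" using assms(2) by (auto simp: qint_def)
 have "has_q_expansion (h * g) (\<lambda>n. if h dvd n then b (n div h) else 0) G"
  using q_expansion_refine[OF F(1) G(2)] by (simp add: mult.commute)
 from that[OF _ q_expansion_refine[OF G(1) F(2)] this] show thesis using F G assms(3,4) by simp
qed

lemma qint_mult: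
 assumes "is_id I" "qint V F" "qint I G" shows "qint I (\<lambda>\<tau>. F \<tau> * G \<tau>)"
proof -
 obtain h a b where ab: "h > 0" "has_q_expansion h a F" "has_q_expansion h b G" "\<And>n. a n \<in> V" "\<And>n. b n \<in> I"
  by (rule qint_common[OF assms(2,3) is_idD(1)[OF id_V] is_idD(1)[OF assms(1)]]) (rule that)
 have "(\<Sum>i\<le>n. a i * b (n - i)) \<in> I" for n by (rule is_idD(4)[OF assms(1)]) (rule is_idD(3)[OF assms(1) ab(4,5)])
 then show ?thesis unfolding qint_def using ab(1) q_expansion_mult[OF ab(1-3)] by (intro exI conjI) auto
qed

lemma qint_add:
 assumes "is_id I" "qint I F" "qint I G" shows "qint I (\<lambda>\<tau>. F \<tau> + G \<tau>)"
proof -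
 obtain h a b where ab: "h > 0" "has_q_expansion h a F" "has_q_expansion h b G" "\<And>n. a n \<in> I" "\<And>n. b n \<in> I"
  by (rule qint_common[OF assms(2,3) is_idD(1)[OF assms(1)] is_idD(1)[OF assms(1)]]) (rule that)
 then show ?thesis unfolding qint_def using q_expansion_add[OF ab(2,3)] is_idD(2)[OF assms(1)] by (intro exI conjI) auto
qed

lemma qint_const: "is_id I \<Longrightarrow> c \<in> I \<Longrightarrow> qint I (\<lambda>_. c)"
 unfolding qint_def using q_expansion_const[of 1 c] is_idD(1) by (intro exI[of _ 1] exI[of _ "\<lambda>n. if n = 0 then c else 0"]) auto

lemma qint_sum:
 "is_id I \<Longrightarrow> (\<And>i. i \<in> S \<Longrightarrow> qint I (F i)) \<Longrightarrow> qint I (\<lambda>\<tau>. \<Sum>i\<in>S. F i \<tau>)"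
 by (induction S rule: infinite_finite_induct) (auto intro: qint_const is_idD(1) qint_add)

lemma qint_affine:
 assumes "is_id I" "qint I F" "t > 0" "d > 0"
 shows "qint I (\<lambda>\<tau>. F ((of_int t * \<tau> + of_int b) / of_int d))"
proof -
 obtain h a where F: "h > 0" "has_q_expansion h a F" "\<And>n. a n \<in> I" using assms(2) by (auto simp: qint_def)
 have td: "nat t > 0" "nat d > 0" "of_nat (nat t) = (of_int t :: complex)" "of_nat (nat d) = (of_int d :: complex)" using assms(3,4) by auto
 let ?z = "qp (h * nat d) (of_int b)"
 have z: "?z \<in> V" by (rule root_of_unity_in_V(1)[OF qp_root]) (use F(1) td(2) in simp_all)
 have "a n * ?z ^ n \<in> I" for n using is_idD(3)[OF assms(1) V_intros(8)[OF z] F(3)] by (simp add: mult.commute)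
 then show ?thesis unfolding qint_def using q_expansion_affine[OF td(1,2) F(2), of b] F(1) td is_idD(1)[OF assms(1)]
  by (intro exI[of _ "h * nat d"] conjI exI[of _ "\<lambda>n. if nat t dvd n then a (n div nat t) * ?z ^ (n div nat t) else 0"]) auto
qed

lemma qint_level_one:
 assumes "invariant w 1 G" "qint I G"
 obtains a where "has_q_expansion 1 a G" "\<And>n. a n \<in> I"
proof -
 obtain h a where a: "h > 0" "has_q_expansion h a G" "\<And>n. a n \<in> I" using assms(2) by (auto simp: qint_def)
 have "G (\<tau> + of_nat 1) = G \<tau>" if "\<tau> \<in> HH" for \<tau> using sl_periodic[OF assms(1) SL2_one(1) that] by simp
 from q_expansion_descend(1)[of 1 h a G] a this have "has_q_expansion 1 (\<lambda>n. a (n * h)) G" by simp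
 then show thesis using a(3) that by blast
qed

text \<open>The reduction of \<open>F\<close> modulo \<open>mx\<close>, in width \<open>h\<close>,
  is a power series of exact order \<open>d\<close>.\<close>

definition ld :: "nat \<Rightarrow> (complex \<Rightarrow> complex) \<Rightarrow> nat \<Rightarrow> bool" where
 "ld h F d \<longleftrightarrow> (\<exists>a. has_q_expansion h a F \<and> (\<forall>n. a n \<in> V) \<and> (\<forall>n<d. a n \<in> mx) \<and> a d \<notin> mx)"

lemma ld_mult:
 assumes "h > 0" "ld h F d" "ld h G e" shows "ld h (\<lambda>\<tau>. F \<tau> * G \<tau>) (d + e)"
proof -
 obtain a where a: "has_q_expansion h a F" "\<And>n. a n \<in> V" "\<And>n. n < d \<Longrightarrow> a n \<in> mx" "a d \<notin> mx" using assms(2) by (auto simp: ld_def)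
 obtain b where b: "has_q_expansion h b G" "\<And>n. b n \<in> V" "\<And>n. n < e \<Longrightarrow> b n \<in> mx" "b e \<notin> mx" using assms(3) by (auto simp: ld_def)
 have small: "a i * b j \<in> mx" if "i < d \<or> j < e" for i j
  using that mx_mult[OF b(2) a(3), of i j] mx_mult[OF a(2) b(3), of j i] by (auto simp: mult.commute)
 have V: "(\<Sum>i\<le>n. a i * b (n - i)) \<in> V" for n by (intro V_intros a b)
 have m: "(\<Sum>i\<le>n. a i * b (n - i)) \<in> mx" if "n < d + e" for n using that by (intro mx_sum small) auto
 have "(\<Sum>i\<le>d + e. a i * b (d + e - i)) = a d * b e + (\<Sum>i\<in>{..d + e} - {d}. a i * b (d + e - i))" by (subst sum.remove[of _ d]) auto
 moreover have "(\<Sum>i\<in>{..d + e} - {d}. a i * b (d + e - i)) \<in> mx" by (intro mx_sum small) auto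
 moreover have "a d * b e \<notin> mx" by (rule unit_mult_notin_mx[OF a(2,4) b(4)])
 ultimately have "(\<Sum>i\<le>d + e. a i * b (d + e - i)) \<notin> mx" using mx_diff by fastforce
 then show ?thesis unfolding ld_def using q_expansion_mult[OF assms(1) a(1) b(1)] V m by blast
qed

lemma ld_refine: assumes "t > 0" "ld h F d" shows "ld (h * t) F (d * t)"
proof -
 obtain a where a: "has_q_expansion h a F" "\<And>n. a n \<in> V" "\<And>n. n < d \<Longrightarrow> a n \<in> mx" "a d \<notin> mx" using assms(2) by (auto simp: ld_def)
 then show ?thesis unfolding ld_def using q_expansion_refine[OF assms(1) a(1)] assms(1) V_intros(2) mx_0
  by (intro exI[of _ "\<lambda>n. if t dvd n then a (n div t) else 0"]) (auto simp: less_mult_imp_div_less)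
qed

lemma ld_mod:
 assumes "ld h F d" "has_q_expansion h b (\<lambda>\<tau>. G \<tau> - F \<tau>)" "\<And>n. b n \<in> mx" shows "ld h G d"
proof -
 obtain a where a: "has_q_expansion h a F" "\<And>n. a n \<in> V" "\<And>n. n < d \<Longrightarrow> a n \<in> mx" "a d \<notin> mx" using assms(1) by (auto simp: ld_def)
 have "has_q_expansion h (\<lambda>n. a n + b n) G" by (rule q_expansion_cong[OF q_expansion_add[OF a(1) assms(2)]]) auto
 moreover have "a d + b d \<notin> mx" using mx_diff[OF _ assms(3), of "a d + b d" d] a(4) by auto
 ultimately show ?thesis unfolding ld_def using a assms(3) mx_subset mx_add
  by (intro exI[of _ "\<lambda>n. a n + b n"]) (auto intro!: V_intros(6))
qed

lemma ld_descend:
 assumes "h > 0" "ld h F d" "has_q_expansion 1 b F" shows "\<exists>d'. d = d' * h \<and> ld 1 F d'"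
proof -
 obtain a where a: "has_q_expansion h a F" "\<And>n. a n \<in> V" "\<And>n. n < d \<Longrightarrow> a n \<in> mx" "a d \<notin> mx" using assms(2) by (auto simp: ld_def)
 have "has_q_expansion h (\<lambda>n. if h dvd n then b (n div h) else 0) F" using q_expansion_refine[OF assms(1,3)] by simp
 from q_expansion_unique[OF assms(1) a(1) this] have ab: "a n = (if h dvd n then b (n div h) else 0)" for n by (rule fun_cong)
 have "h dvd d" using a(4) mx_0 by (metis ab)
 then obtain d' where d: "d = d' * h" by (metis dvdE mult.commute)
 have b: "b n = a (n * h)" for n using assms(1) by (simp add: ab)
 have "ld 1 F d'" unfolding ld_def using assms a by (intro exI[of _ b]) (auto simp: b d)
 then show ?thesis using d by blast
qed

text \<open>Reductions of pairwise different orders are linearly independent. On the other hand,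
  more than m forms have a nontrivial combination vanishing to order m, which is 0 by
  \<open>high_order_vanishes\<close>. Made primitive, this relation reduces to one among the
  reductions.\<close>

theorem sturm_mod:
 assumes J: "finite J" "card J > m" and m: "m > 0" "w \<le> 6 * int m"
  and inv: "\<And>j. j \<in> J \<Longrightarrow> invariant w 1 (G j)" and ld: "\<And>j. j \<in> J \<Longrightarrow> ld 1 (G j) (d j)" and inj: "inj_on d J"
 shows False
proof -
 obtain a where a: "\<And>j. j \<in> J \<Longrightarrow> has_q_expansion 1 (a j) (G j)" "\<And>j n. j \<in> J \<Longrightarrow> a j n \<in> V"
  "\<And>j n. j \<in> J \<Longrightarrow> n < d j \<Longrightarrow> a j n \<in> mx" "\<And>j. j \<in> J \<Longrightarrow> a j (d j) \<notin> mx" using ld unfolding ld_def by metis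
 obtain c where c: "\<exists>j\<in>J. c j \<noteq> 0" "\<forall>n<m. (\<Sum>j\<in>J. c j * a j n) = 0" using linear_relation[OF J, of a] by blast
 define F where "F \<tau> = (\<Sum>j\<in>J. c j * G j \<tau>)" for \<tau>
 have F: "has_q_expansion 1 (\<lambda>n. \<Sum>j\<in>J. c j * a j n) F" unfolding F_def by (intro q_expansion_sum J q_expansion_cmult a)
 have Finv: "invariant w 1 F" unfolding invariant_def
 proof (intro ballI)
  fix A \<tau> assume "A \<in> G0 1" "\<tau> \<in> HH"
  then show "sl w A F \<tau> = F \<tau>" using invariantD[OF inv] unfolding F_def sl_linear(4) sl_linear(3) by (auto intro!: sum.cong)
 qed
 have 0: "F \<tau> = 0" if "\<tau> \<in> HH" for \<tau>
 proof (rule high_order_vanishes[where FF = "{F}" and h = 1 and m = m and w = w and ?F0.0 = F and ?\<tau>0.0 = \<tau>])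
  fix G' assume G': "G' \<in> {F}"
  show "\<exists>a. has_q_expansion 1 a G' \<and> (\<forall>n<m. a n = 0)" using G' F c(2) by blast
  show "\<exists>G\<in>{F}. \<forall>\<tau>\<in>HH. G' (\<tau> + of_int j) = G \<tau>" for j
   using G' invariantD[OF Finv, of "(1, j, 0, 1)"] by (simp add: sl_shift G0_def SL2_def)
  show "\<exists>G\<in>{F}. \<forall>\<tau>\<in>HH. norm (G' (- 1 / \<tau>)) = norm (G \<tau>) * norm \<tau> powi w"
  proof (intro bexI[of _ F] ballI)
   fix \<tau> assume \<tau>: "\<tau> \<in> HH"
   then have "\<tau> \<noteq> 0" by (auto simp: HH_iff)
   have "F (- 1 / \<tau>) * \<tau> powi (- w) = F \<tau>" using invariantD[OF Finv, of "(0, - 1, 1, 0)", OF _ \<tau>] by (simp add: sl_def G0_def SL2_def)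
   then have "F (- 1 / \<tau>) = F \<tau> * \<tau> powi w" using \<open>\<tau> \<noteq> 0\<close> by (simp add: power_int_minus field_simps)
   then show "norm (G' (- 1 / \<tau>)) = norm (F \<tau>) * norm \<tau> powi w" using G' by (simp add: norm_mult norm_power_int)
  qed simp
 qed (use m that in auto)
 have "has_q_expansion 1 (\<lambda>n. if n = 0 then 0 else 0) F" by (rule q_expansion_cong[OF q_expansion_const]) (use 0 in auto)
 then have rel: "(\<Sum>j\<in>J. c j * a j n) = 0" for n using q_expansion_unique[OF _ F] by (auto dest: fun_cong[of _ _ n])
 obtain j0 where j0: "j0 \<in> J" "c j0 \<noteq> 0" "\<forall>i\<in>J. c i / c j0 \<in> V" using dominating_element[OF J(1)] c(1) by blast
 define e where "e j = c j / c j0" for j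
 define U where "U = {j \<in> J. e j \<notin> mx}"
 have "j0 \<in> U" using j0 one_notin_mx by (simp add: U_def e_def)
 \<comment> \<open>Among the indices with unit coefficient the one of least order is taken; at its
   leading exponent all other terms lie in \<open>mx\<close>.\<close>
 then obtain j1 where j1: "j1 \<in> U" "\<And>j. j \<in> U \<Longrightarrow> d j1 \<le> d j" using ex_has_least_nat[of "\<lambda>j. j \<in> U" j0 d] by blast
 have j1J: "j1 \<in> J" "e j1 \<notin> mx" "e j1 \<in> V" using j1 j0(3) by (auto simp: U_def e_def)
 have "e j * a j (d j1) \<in> mx" if j: "j \<in> J" "j \<noteq> j1" for j
 proof (cases "j \<in> U")
  case True
  then have "d j1 < d j" using j1(2)[OF True] inj j j1J by (metis inj_onD le_neq_implies_less)
  then show ?thesis using mx_mult[of "e j"] a(3) j j0(3) by (simp add: e_def)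
 next
  case False
  then show ?thesis using mx_mult[OF a(2), of j "e j"] j by (simp add: U_def mult.commute)
 qed
 then have "(\<Sum>j\<in>J - {j1}. e j * a j (d j1)) \<in> mx" by (intro mx_sum) auto
 moreover have "(\<Sum>j\<in>J. e j * a j (d j1)) = e j1 * a j1 (d j1) + (\<Sum>j\<in>J - {j1}. e j * a j (d j1))"
  by (rule sum.remove) (use J j1J in auto)
 moreover have "(\<Sum>j\<in>J. e j * a j (d j1)) = 0" using rel[of "d j1"] by (simp add: e_def sum_divide_distrib [symmetric])
 ultimately have "e j1 * a j1 (d j1) \<in> mx" using mx_uminus by (metis add_eq_0_iff2)
 then show False using unit_mult_notin_mx[OF j1J(3,2) a(4)[OF j1J(1)]] by simp
qed

end

subsection \<open>The discriminant\<close>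

lemma invariant_mult:
 assumes "invariant v N F" "invariant w N G" shows "invariant (v + w) N (\<lambda>\<tau>. F \<tau> * G \<tau>)"
 unfolding invariant_def using sl_mult assms SL2_det[OF G0_SL2] by (auto simp: invariant_def)

lemma invariant_power: "invariant w N F \<Longrightarrow> invariant (int n * w) N (\<lambda>\<tau>. F \<tau> ^ n)"
proof (induction n)
 case 0
 then show ?case by (simp add: invariant_def sl_def)
next
 case (Suc n)
 then have "invariant (w + int n * w) N (\<lambda>\<tau>. F \<tau> * F \<tau> ^ n)" by (intro invariant_mult) auto
 then show ?case by (simp add: algebra_simps)
qed

lemma invariant_cmult: "invariant w N F \<Longrightarrow> invariant w N (\<lambda>\<tau>. c * F \<tau>)"
 by (simp add: invariant_def sl_linear(3))

lemma invariant_diff: "invariant w N F \<Longrightarrow> invariant w N G \<Longrightarrow> invariant w N (\<lambda>\<tau>. F \<tau> - G \<tau>)"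
 by (simp add: invariant_def sl_linear(2))

text \<open>The factors 240 and -504 are the inverses of the constant terms -B_4/8 and
  -B_6/12.\<close>

definition E4 :: "complex \<Rightarrow> complex" where "E4 \<tau> = 240 * eisenstein 4 \<tau>"
definition E6 :: "complex \<Rightarrow> complex" where "E6 \<tau> = - 504 * eisenstein 6 \<tau>"
definition Delta :: "complex \<Rightarrow> complex" where "Delta \<tau> = 1 / 1728 * (E4 \<tau> ^ 3 - E6 \<tau> ^ 2)"

text \<open>Integral coefficients with leading coefficient 1: the order does not change under
  reduction modulo any maximal ideal, see \<open>intlead_ld\<close>.\<close>

definition intlead :: "(complex \<Rightarrow> complex) \<Rightarrow> nat \<Rightarrow> bool" where
 "intlead F d \<longleftrightarrow> (\<exists>z :: nat \<Rightarrow> int. has_q_expansion 1 (\<lambda>n. of_int (z n)) F \<and> (\<forall>n<d. z n = 0) \<and> z d = 1)"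

lemma intlead_mult: assumes "intlead F d" "intlead G e" shows "intlead (\<lambda>\<tau>. F \<tau> * G \<tau>) (d + e)"
proof -
 obtain a :: "nat \<Rightarrow> int" where a: "has_q_expansion 1 (\<lambda>n. of_int (a n)) F" "\<And>n. n < d \<Longrightarrow> a n = 0" "a d = 1" using assms(1) by (auto simp: intlead_def)
 obtain b :: "nat \<Rightarrow> int" where b: "has_q_expansion 1 (\<lambda>n. of_int (b n)) G" "\<And>n. n < e \<Longrightarrow> b n = 0" "b e = 1" using assms(2) by (auto simp: intlead_def)
 have "has_q_expansion 1 (\<lambda>n. of_int (\<Sum>i\<le>n. a i * b (n - i))) (\<lambda>\<tau>. F \<tau> * G \<tau>)" using q_expansion_mult[OF _ a(1) b(1)] by simp
 moreover have 0: "a i * b (n - i) = 0" if "n < d + e \<or> n = d + e \<and> i \<noteq> d" "i \<le> n" for n i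
 proof (cases "i < d")
  case False
  then have "n - i < e" using that by auto
  then show ?thesis using b(2) by simp
 qed (use a(2) in simp)
 have "\<forall>n<d + e. (\<Sum>i\<le>n. a i * b (n - i)) = 0" "(\<Sum>i\<in>{..d + e} - {d}. a i * b (d + e - i)) = 0"
  by (intro allI impI sum.neutral ballI 0; auto)+
 moreover have "(\<Sum>i\<le>d + e. a i * b (d + e - i)) = a d * b e + (\<Sum>i\<in>{..d + e} - {d}. a i * b (d + e - i))"
  by (subst sum.remove[of _ d]) auto
 ultimately show ?thesis unfolding intlead_def using a(3) b(3) by (intro exI[of _ "\<lambda>n. \<Sum>i\<le>n. a i * b (n - i)"] conjI) simp_all
qed

lemma intlead_power: "intlead F d \<Longrightarrow> intlead (\<lambda>\<tau>. F \<tau> ^ n) (d * n)"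
proof (induction n)
 case 0
 have "has_q_expansion 1 (\<lambda>n. of_int (if n = 0 then 1 else 0)) (\<lambda>_. 1)" by (rule q_expansion_cong[OF q_expansion_const]) auto
 then show ?case unfolding intlead_def by (intro exI[of _ "\<lambda>n. if n = 0 then 1 else 0"]) auto
next
 case (Suc n)
 then show ?case using intlead_mult[of F d "\<lambda>\<tau>. F \<tau> ^ n" "d * n"] by simp
qed

lemma intlead_A_op: assumes "p > 0" "intlead F d" shows "intlead (A_op p F) (p * d)"
proof -
 obtain a :: "nat \<Rightarrow> int" where a: "has_q_expansion 1 (\<lambda>n. of_int (a n)) F" "\<And>n. n < d \<Longrightarrow> a n = 0" "a d = 1" using assms(2) by (auto simp: intlead_def)
 have "has_q_expansion 1 (\<lambda>n. of_int (if p dvd n then a (n div p) else 0)) (A_op p F)"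
  by (rule q_expansion_cong[OF q_expansion_scale[OF assms(1) a(1)]]) (auto simp: A_op_def)
 then show ?thesis unfolding intlead_def using a(2,3) assms(1)
  by (intro exI[of _ "\<lambda>n. if p dvd n then a (n div p) else 0"]) (auto elim!: dvdE)
qed

lemma E4_lead: "intlead E4 0" and E4_inv: "invariant 4 1 E4" and Delta_lead: "intlead Delta 1" and Delta_inv: "invariant 12 1 Delta"
proof -
 show E4i: "invariant 4 1 E4" using invariant_cmult[OF eisenstein_invariant[of 4]] by (simp add: E4_def [abs_def])
 have E6i: "invariant 6 1 E6" using invariant_cmult[OF eisenstein_invariant[of 6], of "- 504"] by (simp add: E6_def [abs_def])
 show "invariant 12 1 Delta" unfolding Delta_def [abs_def]
  by (intro invariant_cmult invariant_diff) (use invariant_power[OF E4i, of 3] invariant_power[OF E6i, of 2] in simp_all)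
 obtain A where A: "has_q_expansion 1 (\<lambda>n. of_nat (divisor_sigma 3 n)) A" by (rule divisor_sigma_q_expansion)
 obtain B where B: "has_q_expansion 1 (\<lambda>n. of_nat (divisor_sigma 5 n)) B" by (rule divisor_sigma_q_expansion)
 have eA: "E4 \<tau> = 1 + 240 * A \<tau>" if "\<tau> \<in> HH" for \<tau>
 proof -
  have "has_q_expansion 1 (\<lambda>n. (if n = 0 then 1 / 240 else 0) + of_nat (divisor_sigma 3 n)) (eisenstein 4)"
   by (rule q_expansion_cong[OF eisenstein_q_expansion[of 4]]) (auto simp: bernoulli_values of_rat_divide)
  then have "eisenstein 4 \<tau> = 1 / 240 + A \<tau>"
   using sums_unique2[OF q_expansionD[OF _ that] q_expansionD[OF q_expansion_add[OF q_expansion_const A] that]] by blast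
  then show ?thesis by (simp add: E4_def)
 qed
 have eB: "E6 \<tau> = 1 - 504 * B \<tau>" if "\<tau> \<in> HH" for \<tau>
 proof -
  have "has_q_expansion 1 (\<lambda>n. (if n = 0 then - 1 / 504 else 0) + of_nat (divisor_sigma 5 n)) (eisenstein 6)"
   by (rule q_expansion_cong[OF eisenstein_q_expansion[of 6]]) (auto simp: bernoulli_values of_rat_divide of_rat_minus)
  then have "eisenstein 6 \<tau> = - 1 / 504 + B \<tau>"
   using sums_unique2[OF q_expansionD[OF _ that] q_expansionD[OF q_expansion_add[OF q_expansion_const B] that]] by blast
  then show ?thesis by (simp add: E6_def)
 qed
 have "has_q_expansion 1 (\<lambda>n. of_int ((if n = 0 then 1 else 0) + 240 * int (divisor_sigma 3 n))) E4"
  by (rule q_expansion_cong[OF q_expansion_add[OF q_expansion_const q_expansion_cmult[OF A]]]) (auto simp: eA)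
 then show "intlead E4 0" unfolding intlead_def by (intro exI[of _ "\<lambda>n. (if n = 0 then 1 else 0) + 240 * int (divisor_sigma 3 n)"]) simp
 \<comment> \<open>In (E4^3 - E6^2)/1728 only the linear terms, with coefficients (5 sigma_3 + 7
   sigma_5)/12, are not obviously integral. They are, because 12 divides 5 m^3 + 7 m^5.\<close>
 have "\<exists>z. 12 * z = int (5 * divisor_sigma 3 n + 7 * divisor_sigma 5 n)" for n
 proof -
  have "12 dvd 5 * m ^ 3 + 7 * m ^ 5" for m :: nat
  proof -
   have "m mod 12 = 0 \<or> m mod 12 = 1 \<or> m mod 12 = 2 \<or> m mod 12 = 3 \<or> m mod 12 = 4 \<or> m mod 12 = 5 \<or> m mod 12 = 6
    \<or> m mod 12 = 7 \<or> m mod 12 = 8 \<or> m mod 12 = 9 \<or> m mod 12 = 10 \<or> m mod 12 = 11" by presburger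
   then have "(5 * (m mod 12) ^ 3 + 7 * (m mod 12) ^ 5) mod 12 = 0" by (elim disjE) simp_all
   moreover have "[5 * (m mod 12) ^ 3 + 7 * (m mod 12) ^ 5 = 5 * m ^ 3 + 7 * m ^ 5] (mod 12)"
    by (intro cong_add cong_mult cong_pow cong_refl) (simp_all add: cong_def)
   ultimately show ?thesis by (simp add: cong_def dvd_eq_mod_eq_0)
  qed
  then have "12 dvd (\<Sum>m | m dvd n. 5 * m ^ 3 + 7 * m ^ 5)" by (intro dvd_sum)
  then have "12 dvd 5 * divisor_sigma 3 n + 7 * divisor_sigma 5 n" by (simp add: divisor_sigma_def sum.distrib sum_distrib_left)
  then obtain q where "5 * divisor_sigma 3 n + 7 * divisor_sigma 5 n = 12 * q" by blast
  then show ?thesis by (intro exI[of _ "int q"]) simp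
 qed
 then obtain z where z: "\<And>n. 12 * z n = int (5 * divisor_sigma 3 n + 7 * divisor_sigma 5 n)" by metis
 define s3 s5 where "s3 n = int (divisor_sigma 3 n)" and "s5 n = int (divisor_sigma 5 n)" for n
 define cv where "cv a b n = (\<Sum>i\<le>n. a i * b (n - i))" for a b :: "nat \<Rightarrow> int" and n
 have cv: "has_q_expansion 1 (\<lambda>n. of_int (cv a b n)) (\<lambda>\<tau>. F \<tau> * G \<tau>)"
  if "has_q_expansion 1 (\<lambda>n. of_int (a n)) F" "has_q_expansion 1 (\<lambda>n. of_int (b n)) G" for a b F G
  using q_expansion_mult[OF _ that] by (simp add: cv_def)
 have A': "has_q_expansion 1 (\<lambda>n. of_int (s3 n)) A" and B': "has_q_expansion 1 (\<lambda>n. of_int (s5 n)) B"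
  using A B by (simp_all add: s3_def s5_def)
 define zz where "zz n = z n + 100 * cv s3 s3 n + 8000 * cv s3 (cv s3 s3) n - 147 * cv s5 s5 n" for n
 have lin: "has_q_expansion 1 (\<lambda>n. of_int (z n)) (\<lambda>\<tau>. 5 / 12 * A \<tau> + 7 / 12 * B \<tau>)"
 proof (rule q_expansion_cong[OF q_expansion_add[OF q_expansion_cmult[OF A] q_expansion_cmult[OF B]]])
  fix n
  have "of_int (12 * z n) = (of_int (int (5 * divisor_sigma 3 n + 7 * divisor_sigma 5 n)) :: complex)" by (simp only: z)
  then show "5 / 12 * of_nat (divisor_sigma 3 n) + 7 / 12 * of_nat (divisor_sigma 5 n) = (of_int (z n) :: complex)" by (simp add: field_simps)
 qed simp
 have "has_q_expansion 1 (\<lambda>n. of_int (zz n)) Delta"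
 proof (rule q_expansion_cong[OF q_expansion_diff[OF q_expansion_add[OF q_expansion_add[OF lin q_expansion_cmult[OF cv[OF A' A'], of 100]]
    q_expansion_cmult[OF cv[OF A' cv[OF A' A']], of 8000]] q_expansion_cmult[OF cv[OF B' B'], of 147]]])
  fix \<tau> assume "\<tau> \<in> HH"
  then show "5 / 12 * A \<tau> + 7 / 12 * B \<tau> + 100 * (A \<tau> * A \<tau>) + 8000 * (A \<tau> * (A \<tau> * A \<tau>)) - 147 * (B \<tau> * B \<tau>) = Delta \<tau>"
   unfolding Delta_def eA[OF \<open>\<tau> \<in> HH\<close>] eB[OF \<open>\<tau> \<in> HH\<close>] by (simp add: power2_eq_square power3_eq_cube algebra_simps)
 qed (simp add: zz_def)
 moreover have d1: "divisor_sigma j (Suc 0) = 1" for j by (simp add: divisor_sigma_def)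
 have z0: "z 0 = 0" "z 1 = 1" using z[of 0] z[of 1] by (simp_all add: d1)
 have "zz 0 = 0" "zz 1 = 1" using z0 by (simp_all add: zz_def cv_def s3_def s5_def d1)
 ultimately show "intlead Delta 1" unfolding intlead_def by (intro exI[of _ zz]) auto
qed

lemma (in complex_valuation_ring) intlead_ld: "intlead F d \<Longrightarrow> ld 1 F d"
proof -
 assume "intlead F d"
 then obtain z :: "nat \<Rightarrow> int" where "has_q_expansion 1 (\<lambda>n. of_int (z n)) F" "\<forall>n<d. z n = 0" "z d = 1" unfolding intlead_def by blast
 then show ?thesis unfolding ld_def using of_int_in_V one_notin_mx mx_0 by (intro exI[of _ "\<lambda>n. of_int (z n)"]) auto
qed

section \<open>Behaviour at the cusps\<close>

lemma sl_level_one: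
 assumes F: "invariant w 1 F" and A: "mdet A > 0" "A' \<in> SL2" "a > 0" "d > 0" "e > 0"
  and eq: "mm (int e, 0, 0, 1) A = mm A' (a, b, 0, d)" and \<tau>: "\<tau> \<in> HH"
 shows "sl w A (A_op e F) \<tau> = of_int d powi (- w) * F ((of_int a * \<tau> + of_int b) / of_int d)"
proof -
 have e: "A_op e F = sl w (int e, 0, 0, 1) F" by (simp add: fun_eq_iff A_op_def sl_tri)
 have "sl w A (A_op e F) \<tau> = sl w (mm (int e, 0, 0, 1) A) F \<tau>" unfolding e using A \<tau> by (intro sl_mm [symmetric]) auto
 also have "\<dots> = sl w (a, b, 0, d) (sl w A' F) \<tau>" unfolding eq using A \<tau> by (intro sl_mm) (auto intro: SL2_det)
 also have "\<dots> = sl w (a, b, 0, d) F \<tau>" using invariantD[OF F, unfolded G0_1, OF A(2)] A \<tau> by (intro sl_cong) auto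
 finally show ?thesis by (simp add: sl_tri mult.commute)
qed

lemma A_op_invariant:
 assumes "invariant w 1 F" "e dvd N" "e > 0" shows "invariant w N (A_op e F)" unfolding invariant_def
proof (intro ballI)
 fix A \<tau> assume A: "A \<in> G0 N" and \<tau>: "\<tau> \<in> HH"
 obtain a b c d where A': "A = (a, b, c, d)" by (cases A)
 have "int e dvd int N" "int N dvd c" using A assms(2) by (auto simp: G0_def A')
 then obtain c' where c: "c = int e * c'" by (meson dvd_trans dvdE)
 have det: "a * d - b * c = 1" using G0_SL2[OF A] by (simp add: SL2_def A')
 have "sl w A (A_op e F) \<tau> = of_int 1 powi (- w) * F ((of_int (int e) * \<tau> + of_int 0) / of_int 1)"
 proof (rule sl_level_one[OF assms(1), where A' = "(a, int e * b, c', d)"])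
  show "(a, int e * b, c', d) \<in> SL2" using det by (simp add: SL2_def c algebra_simps)
  show "mm (int e, 0, 0, 1) A = mm (a, int e * b, c', d) (int e, 0, 0, 1)" by (simp add: A' c)
 qed (use A assms(3) \<tau> in \<open>auto intro: SL2_det G0_SL2\<close>)
 then show "sl w A (A_op e F) \<tau> = A_op e F \<tau>" by (simp add: A_op_def)
qed

section \<open>Atkin-Lehner matrices of square-free level\<close>

lemma prime_prod_dvd:
 assumes "finite S" "\<And>p. p \<in> S \<Longrightarrow> Factorial_Ring.prime p" "\<And>p. p \<in> S \<Longrightarrow> int p dvd c"
 shows "int (\<Prod>S) dvd c" using assms
proof (induction S rule: finite_induct)
 case (insert p S)
 have "coprime p (\<Prod>S)" using insert by (intro prod_coprime_right) (auto intro: primes_coprime)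
 then have "coprime (int p) (int (\<Prod>S))" by (simp only: coprime_int_iff)
 then have "int p * int (\<Prod>S) dvd c" using insert by (intro divides_mult) (simp_all del: of_nat_prod)
 then show ?case using insert by simp
qed simp

text \<open>The numbers \<open>x p\<close> and \<open>y p\<close> give an Atkin-Lehner matrix (p x,
  y; N, p) of determinant p, of the same shape as \<open>W\<close>.\<close>

locale level =
 fixes P :: "nat set" and N :: nat and x y :: "nat \<Rightarrow> int"
 assumes finP: "finite P" and primes: "\<And>p. p \<in> P \<Longrightarrow> Factorial_Ring.prime p" and N: "N = \<Prod>P"
  and xy: "\<And>p. p \<in> P \<Longrightarrow> int p * x p - int (N div p) * y p = 1"
begin

lemma prod_pos: "D \<subseteq> P \<Longrightarrow> \<Prod>D > 0"
 using primes prime_gt_0_nat by (intro prod_pos) auto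

lemma N_split: assumes "p \<in> P" shows "N = p * \<Prod>(P - {p})" "N div p = \<Prod>(P - {p})"
proof -
 show e: "N = p * \<Prod>(P - {p})" unfolding N using prod.remove[OF finP assms, of "\<lambda>p. p"] by simp
 show "N div p = \<Prod>(P - {p})" unfolding e using prime_gt_0_nat[OF primes[OF assms]] by simp
qed

lemma finite_sub: "D \<subseteq> P \<Longrightarrow> finite D" using finP finite_subset by blast

text \<open>A matrix of this shape and determinant e is a product of the matrices for the primes in
  \<open>D\<close> and an element of \<open>G0 N\<close>; one prime is split off at a time. The
  forms are indexed by sets because each step may change the form, as it does for Eisenstein
  series.\<close>

lemma AL_matrix:
 assumes F: "\<And>p D \<tau>. p \<in> P \<Longrightarrow> D \<subseteq> P \<Longrightarrow> p \<notin> D \<Longrightarrow> \<tau> \<in> HH \<Longrightarrow>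
   sl w (int p * x p, y p, int N, int p) (F D) \<tau> = \<kappa> p * F (insert p D) \<tau>"
  and inv: "\<And>D. D \<subseteq> P \<Longrightarrow> invariant w N (F D)"
  and D: "D \<subseteq> P" "D0 \<subseteq> P" "D \<inter> D0 = {}" and e: "e = int (\<Prod>D)"
  and det: "mdet (e * a, b, int N * c, e * d) = e" and \<tau>: "\<tau> \<in> HH"
 shows "sl w (e * a, b, int N * c, e * d) (F D0) \<tau> = (\<Prod>p\<in>D. \<kappa> p) * F (D0 \<union> D) \<tau>" using finite_sub[OF D(1)] D e det
proof (induction D arbitrary: D0 a b c d e rule: finite_induct)
 case empty
 then have "(a, b, int N * c, d) \<in> G0 N" by (simp add: G0_def SL2_def)
 then show ?case using invariantD[OF inv[OF empty(2)] _ \<tau>] empty by simp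
next
 case (insert p D)
 have p: "p \<in> P" "p \<notin> D0" "p > 0" using insert primes prime_gt_0_nat by auto
 define e' where "e' = int (\<Prod>D)"
 have e': "e = int p * e'" using insert by (simp add: e'_def)
 have e'0: "e' > 0" unfolding e'_def using prod_pos[of D] insert.prems(1) by (simp only: of_nat_0_less_iff) simp
 have "\<Prod>D dvd \<Prod>(P - {p})" using insert finP by (intro prod_dvd_prod_subset) auto
 then obtain m where m: "\<Prod>(P - {p}) = \<Prod>D * m" by blast
 have N': "int N = int p * e' * int m" using N_split(1)[OF p(1)] m by (simp add: e'_def)
 have one: "int p * x p - e' * int m * y p = 1" using xy[OF p(1)] unfolding N_split(2)[OF p(1)] m e'_def by simp
 \<comment> \<open>The entries of the inverse of the matrix for p times the given matrix, with the
   division by p already carried out.\<close>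
 define a' b' c' d' where "a' = int p * a - y p * int m * c" and "b' = b - y p * e' * d"
  and "c' = x p * c - e' * a" and "d' = x p * int p * d - int m * b"
 define W' where "W' = (e' * a', b', int N * c', e' * d')"
 have "mm (int p * x p, y p, int N, int p) W' = (e * a * (int p * x p - e' * int m * y p), b * (int p * x p - e' * int m * y p),
   int N * c * (int p * x p - e' * int m * y p), e * d * (int p * x p - e' * int m * y p))"
  unfolding W'_def a'_def b'_def c'_def d'_def e' N' by (simp add: algebra_simps)
 then have W: "mm (int p * x p, y p, int N, int p) W' = (e * a, b, int N * c, e * d)" unfolding one by simp
 have dp: "mdet (int p * x p, y p, int N, int p) = int p * (int p * x p - e' * int m * y p)" unfolding N' by (simp add: algebra_simps)
 have "int p * mdet W' = e" using mdet_mm[of "(int p * x p, y p, int N, int p)" W'] insert.prems(5) dp unfolding W one by simp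
 then have dW': "mdet W' = e'" using p(3) unfolding e' by simp
 have "sl w (e * a, b, int N * c, e * d) (F D0) \<tau> = sl w W' (sl w (int p * x p, y p, int N, int p) (F D0)) \<tau>"
  unfolding W [symmetric] using dp one dW' e'0 p(3) \<tau> by (intro sl_mm) auto
 also have "\<dots> = sl w W' (\<lambda>\<tau>. \<kappa> p * F (insert p D0) \<tau>) \<tau>" using dW' e'0 \<tau> F[OF p(1) insert.prems(2) p(2)] by (intro sl_cong) auto
 also have "\<dots> = \<kappa> p * ((\<Prod>p\<in>D. \<kappa> p) * F (insert p D0 \<union> D) \<tau>)" unfolding sl_linear(3) W'_def
  by (subst insert.IH) (use insert p dW' in \<open>auto simp: e'_def W'_def\<close>)
 finally show ?case using insert by simp
qed

text \<open>With e the product of the primes not dividing the lower left entry, g times the scalar e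
  is an Atkin-Lehner matrix of determinant e times (1, j; 0, e). So the expansion at any cusp comes
  from the expansion at infinity of another member of the family.\<close>

theorem AL_cusp:
 assumes F: "\<And>p D \<tau>. p \<in> P \<Longrightarrow> D \<subseteq> P \<Longrightarrow> p \<notin> D \<Longrightarrow> \<tau> \<in> HH \<Longrightarrow>
   sl w (int p * x p, y p, int N, int p) (F D) \<tau> = \<kappa> p * F (insert p D) \<tau>"
  and inv: "\<And>D. D \<subseteq> P \<Longrightarrow> invariant w N (F D)"
  and g: "g \<in> SL2" and D: "D = {p \<in> P. \<not> int p dvd m21 g}" and j: "int (\<Prod>D) dvd m22 g - j * m21 g" and \<tau>: "\<tau> \<in> HH"
 shows "sl w g (F {}) \<tau> = (\<Prod>p\<in>D. \<kappa> p) * F D ((\<tau> + of_int j) / of_nat (\<Prod>D))"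
proof -
 obtain a b c d where gg: "g = (a, b, c, d)" by (cases g)
 define e where "e = int (\<Prod>D)"
 have DP: "D \<subseteq> P" using D by auto
 have e0: "e > 0" unfolding e_def using prod_pos[OF DP] by (simp only: of_nat_0_less_iff)
 have det: "a * d - b * c = 1" using g by (simp add: gg SL2_def)
 have "int (\<Prod>(P - D)) dvd c" using finP primes by (intro prime_prod_dvd) (auto simp: D gg)
 then obtain c' where c': "c = int (\<Prod>(P - D)) * c'" by blast
 have "N = \<Prod>D * \<Prod>(P - D)" unfolding N using prod.subset_diff[OF DP finP, of "\<lambda>p. p"] by (simp add: mult.commute)
 then have Nc: "e * c = int N * c'" by (simp add: c' e_def)
 obtain d' where d': "d - j * c = e * d'" using j unfolding gg e_def by (auto elim: dvdE)
 define W where "W = (e * a, b - j * a, int N * c', e * d')"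
 have "mdet W = e * (a * d - b * c)" unfolding W_def Nc [symmetric] d' [symmetric] by (simp add: algebra_simps)
 then have dW: "mdet W = e" by (simp add: det)
 have WW: "mm W (1, j, 0, e) = mm g (e, 0, 0, e)" unfolding W_def Nc [symmetric] d' [symmetric] gg by (simp add: algebra_simps)
 have \<tau>': "(\<tau> + of_int j) / of_int e \<in> HH" using mob_HH[of "(1, j, 0, e)" \<tau>] e0 \<tau> by simp
 have "sl w (mm g (e, 0, 0, e)) (F {}) \<tau> = sl w (e, 0, 0, e) (sl w g (F {})) \<tau>"
  using g e0 \<tau> by (intro sl_mm) (auto intro: SL2_det)
 also have "\<dots> = sl w g (F {}) \<tau> * of_int e powi (- w)" using e0 by (simp add: sl_tri)
 finally have 1: "sl w (mm g (e, 0, 0, e)) (F {}) \<tau> = sl w g (F {}) \<tau> * of_int e powi (- w)" .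
 have "sl w (mm W (1, j, 0, e)) (F {}) \<tau> = sl w (1, j, 0, e) (sl w W (F {})) \<tau>" using dW e0 \<tau> by (intro sl_mm) auto
 also have "\<dots> = sl w W (F {}) ((\<tau> + of_int j) / of_int e) * of_int e powi (- w)" by (simp add: sl_tri)
 also have "sl w W (F {}) ((\<tau> + of_int j) / of_int e) = (\<Prod>p\<in>D. \<kappa> p) * F ({} \<union> D) ((\<tau> + of_int j) / of_int e)"
  unfolding W_def by (rule AL_matrix[OF F inv DP _ _ e_def _ \<tau>']) (use dW in \<open>auto simp: W_def\<close>)
 finally have "sl w g (F {}) \<tau> * of_int e powi (- w) = (\<Prod>p\<in>D. \<kappa> p) * F D ((\<tau> + of_int j) / of_int e) * of_int e powi (- w)"
  using 1 unfolding WW by simp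
 moreover have "(of_int e :: complex) powi (- w) \<noteq> 0" "(of_int e :: complex) = of_nat (\<Prod>D)"
  using e0 by (simp_all only: power_int_eq_0_iff of_int_eq_0_iff) (simp_all add: e_def)
 ultimately show ?thesis by (simp only: mult_cancel_right) simp
qed

lemma cusp_shift: assumes "D = {p \<in> P. \<not> int p dvd c}" shows "\<exists>j. int (\<Prod>D) dvd d - j * c"
proof -
 have "coprime c (int (\<Prod>D))" unfolding of_nat_prod
 proof (rule prod_coprime_right)
  fix p assume "p \<in> D"
  then have "Factorial_Ring.prime (int p)" "\<not> int p dvd c" using primes assms by auto
  then show "coprime c (int p)" by (metis coprime_commute prime_imp_coprime)
 qed
 then obtain u where u: "[c * u = 1] (mod int (\<Prod>D))" using cong_solve_coprime_int by blast
 have "[d - d * u * c = d - d * 1] (mod int (\<Prod>D))"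
  unfolding mult.assoc by (intro cong_diff cong_refl cong_mult) (use u in \<open>simp add: mult.commute\<close>)
 then show ?thesis by (intro exI[of _ "d * u"]) (simp add: cong_0_iff)
qed

end

subsection \<open>Eisenstein series of squarefree level\<close>

text \<open>The product of the operators 1 - x(p) A_p, applied to E_k and multiplied out over the
  subsets of \<open>S\<close>.\<close>

definition FF :: "nat \<Rightarrow> nat set \<Rightarrow> (nat \<Rightarrow> complex) \<Rightarrow> complex \<Rightarrow> complex" where
 "FF k S x \<tau> = (\<Sum>D\<in>Pow S. (\<Prod>p\<in>D. - x p) * A_op (\<Prod>D) (eisenstein k) \<tau>)"

lemma sum_Pow_insert:
 assumes "finite S" "p \<notin> S"
 shows "(\<Sum>D\<in>Pow (insert p S). g D) = (\<Sum>D\<in>Pow S. g D + g (insert p D) :: complex)"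
proof -
 have "Pow S \<inter> insert p ` Pow S = {}" using assms(2) by auto
 then have "(\<Sum>D\<in>Pow (insert p S). g D) = (\<Sum>D\<in>Pow S. g D) + (\<Sum>D\<in>insert p ` Pow S. g D)"
  unfolding Pow_insert using assms(1) by (intro sum.union_disjoint) auto
 moreover have "inj_on (insert p) (Pow S)" using assms(2) by (auto simp: inj_on_def)
 ultimately show ?thesis by (simp add: sum.reindex sum.distrib)
qed

lemma FF_insert:
 assumes "finite S" "p \<notin> S"
 shows "FF k (insert p S) x \<tau> =
  (\<Sum>D\<in>Pow S. (\<Prod>p\<in>D. - x p) * (A_op (\<Prod>D) (eisenstein k) \<tau> - x p * A_op (p * \<Prod>D) (eisenstein k) \<tau>))"
 unfolding FF_def sum_Pow_insert[OF assms]
proof (rule sum.cong)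
 fix D assume "D \<in> Pow S"
 then have D: "finite D" "p \<notin> D" using assms finite_subset by auto
 show "(\<Prod>p\<in>D. - x p) * A_op (\<Prod>D) (eisenstein k) \<tau> + (\<Prod>p\<in>insert p D. - x p) * A_op (\<Prod>(insert p D)) (eisenstein k) \<tau> =
   (\<Prod>p\<in>D. - x p) * (A_op (\<Prod>D) (eisenstein k) \<tau> - x p * A_op (p * \<Prod>D) (eisenstein k) \<tau>)" using D by (simp add: algebra_simps)
qed simp

lemma foldr_bracket_FF:
 "distinct ps \<Longrightarrow> foldr (bracket_plus k) ps (eisenstein k) = FF k (set ps) (\<lambda>p. of_nat p ^ (k - 1))"
proof (induction ps)
 case Nil
 show ?case by (simp add: FF_def fun_eq_iff A_op_def)
next
 case (Cons p ps)
 then have 1: "finite (set ps)" "p \<notin> set ps" and 2: "foldr (bracket_plus k) ps (eisenstein k) = FF k (set ps) (\<lambda>p. of_nat p ^ (k - 1))" by auto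
 have "foldr (bracket_plus k) (p # ps) (eisenstein k) = bracket_plus k p (FF k (set ps) (\<lambda>p. of_nat p ^ (k - 1)))" by (simp add: 2)
 then show ?case unfolding list.set fun_eq_iff FF_insert[OF 1] bracket_plus_def
  by (simp add: FF_def A_op_def sum_distrib_left sum_subtractf right_diff_distrib mult_ac)
qed

text \<open>
  The weights \<open>wts k {}\<close> give the Eisenstein series \<open>E\<close> itself; \<open>wts k D\<close> describes its expansion at a cusp
  for which \<open>D\<close> is the set of primes not dividing \<open>c\<close>.
\<close>

definition wts :: "nat \<Rightarrow> nat set \<Rightarrow> nat \<Rightarrow> complex" where
 "wts k D p = (if p \<in> D then of_nat p else of_nat p ^ (k - 1))"

definition cE :: "nat \<Rightarrow> complex" where "cE k = of_rat (- bernoulli k / (2 * of_nat k))"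

definition cF :: "nat \<Rightarrow> nat set \<Rightarrow> (nat \<Rightarrow> complex) \<Rightarrow> nat \<Rightarrow> complex" where
 "cF k S x n = (\<Sum>D\<in>Pow S. (\<Prod>p\<in>D. - x p) * (if \<Prod>D dvd n then
   (if n = 0 then cE k else of_nat (divisor_sigma (k - 1) (n div \<Prod>D))) else 0))"

lemma FF_q_expansion:
 assumes "finite S" "\<And>p. p \<in> S \<Longrightarrow> p > 0" shows "has_q_expansion 1 (cF k S x) (FF k S x)"
 unfolding FF_def [abs_def] cF_def [abs_def]
proof (intro q_expansion_sum q_expansion_cmult)
 fix D assume D: "D \<in> Pow S"
 have "\<Prod>D > 0" using assms(2) D by (intro prod_pos) auto
 from q_expansion_scale[OF this eisenstein_q_expansion[of k]]
 show "has_q_expansion 1 (\<lambda>n. if \<Prod>D dvd n then if n = 0 then cE k else of_nat (divisor_sigma (k - 1) (n div \<Prod>D)) else 0) (A_op (\<Prod>D) (eisenstein k))"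
  by (rule q_expansion_cong) (auto simp: A_op_def cE_def elim!: dvdE)
qed (use assms in simp)

lemma cF_0: assumes "finite S" shows "cF k S x 0 = cE k * (\<Prod>p\<in>S. 1 - x p)"
proof -
 have "(\<Prod>p\<in>S. - x p + 1) = (\<Sum>D\<in>Pow S. (\<Prod>p\<in>D. - x p) * (\<Prod>p\<in>S - D. 1))" by (rule prod_add[OF assms])
 then have "(\<Prod>p\<in>S. 1 - x p) = (\<Sum>D\<in>Pow S. \<Prod>p\<in>D. - x p)" by simp
 then show ?thesis by (simp add: cF_def sum_distrib_left mult.commute)
qed

lemma cF_prime:
 assumes "finite S" "\<And>q. q \<in> S \<Longrightarrow> Factorial_Ring.prime q" "p \<in> S" "k \<ge> 2"
 shows "cF k S (wts k {}) p = 1"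
proof -
 have p: "Factorial_Ring.prime p" "p > 1" using assms prime_gt_1_nat by auto
 have "cF k S (wts k {}) p = (\<Sum>D\<in>{{}, {p}}. (\<Prod>p\<in>D. - wts k {} p) * (if \<Prod>D dvd p then
   (if p = 0 then cE k else of_nat (divisor_sigma (k - 1) (p div \<Prod>D))) else 0))" unfolding cF_def
 proof (rule sum.mono_neutral_right)
  show "\<forall>D\<in>Pow S - {{}, {p}}. (\<Prod>p\<in>D. - wts k {} p) * (if \<Prod>D dvd p then
   (if p = 0 then cE k else of_nat (divisor_sigma (k - 1) (p div \<Prod>D))) else 0) = 0"
  proof
   fix D assume D: "D \<in> Pow S - {{}, {p}}"
   then have "finite D" using assms(1) finite_subset by auto
   have "\<not> D \<subseteq> {p}" using D by auto
   then obtain q where q: "q \<in> D" "q \<noteq> p" by auto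
   then have "q dvd \<Prod>D" "Factorial_Ring.prime q" using \<open>finite D\<close> D assms(2) by auto
   then have "\<not> \<Prod>D dvd p" using q(2) p(1) primes_dvd_imp_eq dvd_trans by blast
   then show "(\<Prod>p\<in>D. - wts k {} p) * (if \<Prod>D dvd p then
   (if p = 0 then cE k else of_nat (divisor_sigma (k - 1) (p div \<Prod>D))) else 0) = 0" by simp
  qed
 qed (use assms in auto)
 also have "\<dots> = of_nat (divisor_sigma (k - 1) p) - of_nat p ^ (k - 1) * of_nat (divisor_sigma (k - 1) 1)"
  using p by (simp add: wts_def)
 also have "{m. m dvd p} = {1, p}" using p by (auto simp: prime_nat_iff)
 then have "divisor_sigma (k - 1) p = 1 + p ^ (k - 1)" using p by (simp add: divisor_sigma_def)
 finally show ?thesis by (simp add: divisor_sigma_def)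
qed

lemma (in level) FF_invariant: assumes "k \<ge> 4" "even k" shows "invariant (int k) N (FF k P z)"
 unfolding invariant_def
proof (intro ballI)
 fix A \<tau> assume A: "A \<in> G0 N" "\<tau> \<in> HH"
 have "sl (int k) A (A_op (\<Prod>D) (eisenstein k)) \<tau> = A_op (\<Prod>D) (eisenstein k) \<tau>" if "D \<in> Pow P" for D
  using that prod_pos[of D] prod_dvd_prod_subset[OF finP, of D] A
  by (intro invariantD[OF A_op_invariant[OF eisenstein_invariant[OF assms]]]) (auto simp: N)
 then show "sl (int k) A (FF k P z) \<tau> = FF k P z \<tau>" unfolding FF_def [abs_def] sl_linear(4) sl_linear(3) by (intro sum.cong) auto
qed

text \<open>The matrix for p takes E(s \<tau>) to E(p s \<tau>) and back, with a factor p^(-k). This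
  turns 1 - p^(k-1) A_p into -1/p times 1 - p A_p and leaves the factors of the other primes
  alone.\<close>

lemma (in level) FF_AL:
 assumes k: "k \<ge> 4" "even k" and p: "p \<in> P" "p \<notin> D" and \<tau>: "\<tau> \<in> HH"
 shows "sl (int k) (int p * x p, y p, int N, int p) (FF k P (wts k D)) \<tau> = - 1 / of_nat p * FF k P (wts k (insert p D)) \<tau>"
proof -
 define S where "S = P - {p}"
 have S: "finite S" "p \<notin> S" "P = insert p S" using finP p by (auto simp: S_def)
 have p0: "p > 0" using primes[OF p(1)] by (rule prime_gt_0_nat)
 define W where "W = (int p * x p, y p, int N, int p)"
 define E where "E = eisenstein k"
 have E: "invariant (int k) 1 E" unfolding E_def by (rule eisenstein_invariant[OF k])
 have "N = p * \<Prod>S" "N div p = \<Prod>S" using N_split[OF p(1)] by (simp_all add: S_def)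
 note N' = this
 have dW: "mdet W > 0"
 proof -
  have "mdet W = int p * (int p * x p - int (\<Prod>S) * y p)" unfolding W_def N'(1) by (simp add: algebra_simps)
  then show ?thesis using xy[OF p(1)] p0 unfolding N'(2) by simp
 qed
 have step: "sl (int k) W (A_op (\<Prod>D) E) \<tau> = A_op (p * \<Prod>D) E \<tau>" "sl (int k) W (A_op (p * \<Prod>D) E) \<tau> = A_op (\<Prod>D) E \<tau> / of_nat p ^ k"
  if D: "D \<in> Pow S" for D
 proof -
  define s where "s = \<Prod>D"
  have s0: "s > 0" unfolding s_def using prod_pos[of D] D S by auto
  have "s dvd \<Prod>S" unfolding s_def using D S(1) by (intro prod_dvd_prod_subset) auto
  then obtain m where m: "\<Prod>S = s * m" by blast
  have one: "int p * x p - int s * int m * y p = 1" using xy[OF p(1)] unfolding N'(2) m by simp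
  have "sl (int k) W (A_op s E) \<tau> = of_int 1 powi (- int k) * E ((of_int (int (p * s)) * \<tau> + of_int 0) / of_int 1)"
  proof (rule sl_level_one[OF E dW, where A' = "(x p, int s * y p, int m, int p)"])
   show "(x p, int s * y p, int m, int p) \<in> SL2" using one by (simp add: SL2_def algebra_simps)
   show "mm (int s, 0, 0, 1) W = mm (x p, int s * y p, int m, int p) (int (p * s), 0, 0, 1)" by (simp add: W_def N'(1) m)
  qed (use s0 p0 \<tau> in simp_all)
  then show "sl (int k) W (A_op (\<Prod>D) E) \<tau> = A_op (p * \<Prod>D) E \<tau>" by (simp add: A_op_def s_def)
  have "sl (int k) W (A_op (p * s) E) \<tau> = of_int (int p) powi (- int k) * E ((of_int (int (p * s)) * \<tau> + of_int 0) / of_int (int p))"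
  proof (rule sl_level_one[OF E dW, where A' = "(int p * x p, int s * y p, int m, 1)"])
   show "(int p * x p, int s * y p, int m, 1) \<in> SL2" using one by (simp add: SL2_def algebra_simps)
   show "mm (int (p * s), 0, 0, 1) W = mm (int p * x p, int s * y p, int m, 1) (int (p * s), 0, 0, int p)" by (simp add: W_def N'(1) m)
  qed (use s0 p0 \<tau> in simp_all)
  moreover have "(of_int (int (p * s)) * \<tau> + of_int 0) / of_int (int p) = of_nat s * \<tau>" using p0 by simp
  ultimately show "sl (int k) W (A_op (p * \<Prod>D) E) \<tau> = A_op (\<Prod>D) E \<tau> / of_nat p ^ k"
   unfolding s_def [symmetric] by (simp only: A_op_def) (simp add: power_int_minus divide_inverse mult.commute)
 qed
 have wp: "wts k D p / of_nat p ^ k = 1 / of_nat p" "wts k (insert p D) p = of_nat p"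
  using p p0 k by (simp_all add: wts_def power_pred[of k])
 have "sl (int k) W (FF k P (wts k D)) \<tau> = (\<Sum>D'\<in>Pow S. (\<Prod>p\<in>D'. - wts k D p) *
   (sl (int k) W (A_op (\<Prod>D') E) \<tau> - wts k D p * sl (int k) W (A_op (p * \<Prod>D') E) \<tau>))"
  unfolding S(3) FF_insert[OF S(1,2), abs_def] sl_linear(4) sl_linear(3) sl_linear(2) E_def ..
 also have "\<dots> = (\<Sum>D'\<in>Pow S. - 1 / of_nat p * ((\<Prod>q\<in>D'. - wts k (insert p D) q) *
   (A_op (\<Prod>D') E \<tau> - wts k (insert p D) p * A_op (p * \<Prod>D') E \<tau>)))"
 proof (rule sum.cong)
  fix D' assume D': "D' \<in> Pow S"
  have 1: "(\<Prod>q\<in>D'. - wts k D q) = (\<Prod>q\<in>D'. - wts k (insert p D) q)" using D' S(2) by (intro prod.cong) (auto simp: wts_def)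
  have "A_op (p * \<Prod>D') E \<tau> - wts k D p * (A_op (\<Prod>D') E \<tau> / of_nat p ^ k) = A_op (p * \<Prod>D') E \<tau> - wts k D p / of_nat p ^ k * A_op (\<Prod>D') E \<tau>" by simp
  also have "\<dots> = - 1 / of_nat p * (A_op (\<Prod>D') E \<tau> - of_nat p * A_op (p * \<Prod>D') E \<tau>)" unfolding wp using p0 by (simp add: field_simps)
  finally show "(\<Prod>p\<in>D'. - wts k D p) * (sl (int k) W (A_op (\<Prod>D') E) \<tau> - wts k D p * sl (int k) W (A_op (p * \<Prod>D') E) \<tau>) =
   - 1 / of_nat p * ((\<Prod>q\<in>D'. - wts k (insert p D) q) * (A_op (\<Prod>D') E \<tau> - wts k (insert p D) p * A_op (p * \<Prod>D') E \<tau>))"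
   unfolding step[OF D'] wp 1 by (simp only: mult.left_commute)
 qed simp
 also have "\<dots> = - 1 / of_nat p * FF k P (wts k (insert p D)) \<tau>" unfolding S(3) FF_insert[OF S(1,2)] sum_distrib_left E_def ..
 finally show ?thesis unfolding W_def .
qed

section \<open>The exceptional prime\<close>

context complex_valuation_ring
begin

lemma unit_powi: assumes "z \<in> V" "z \<notin> mx" shows "z powi n \<in> V"
 using V_intros(8)[OF assms(1)] V_intros(8)[OF unitD[OF assms]] by (cases "n \<ge> 0") (auto simp: power_int_def)

lemma V_prod: "(\<And>i. i \<in> S \<Longrightarrow> g i \<in> V) \<Longrightarrow> prod g S \<in> V"
 by (induction S rule: infinite_finite_induct) (auto intro: V_intros)

lemma unit_prod: "(\<And>i. i \<in> S \<Longrightarrow> g i \<in> V \<and> g i \<notin> mx) \<Longrightarrow> prod g S \<notin> mx"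
 by (induction S rule: infinite_finite_induct) (use unit_mult_notin_mx in \<open>auto simp: one_notin_mx\<close>)

lemma tri_unit: assumes "a * d = int e" "of_nat e \<notin> mx" shows "of_int d \<notin> mx"
proof
 assume "of_int d \<in> mx"
 then have "of_int a * of_int d \<in> mx" by (intro mx_mult of_int_in_V)
 moreover have "(of_int a * of_int d :: complex) = of_nat e" using arg_cong[OF assms(1), of "of_int :: int \<Rightarrow> complex"] by simp
 ultimately show False using assms(2) by simp
qed

text \<open>The only denominators at the other cusps are powers of divisors of \<open>e\<close>, and
  these are units because \<open>e\<close> is one.\<close>

lemma qint_A_op:
 assumes F: "invariant w 1 F" "qint V F" and e: "e > 0" "of_nat e \<notin> mx" and R: "R \<in> SL2"
 shows "qint V (sl w R (A_op e F))"
proof -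
 have "mdet (mm (int e, 0, 0, 1) R) = int e" using R by (simp add: mdet_mm SL2_def)
 then obtain B a b d where B: "B \<in> SL2" "a > 0" "d > 0" "a * d = int e" "mm (int e, 0, 0, 1) R = mm B (a, b, 0, d)"
  using hermite[of "mm (int e, 0, 0, 1) R"] e(1) by (metis of_nat_0_less_iff)
 have "qint V (\<lambda>\<tau>. of_int d powi (- w) * F ((of_int a * \<tau> + of_int b) / of_int d))"
  by (intro qint_mult[OF id_V] qint_const[OF id_V] unit_powi of_int_in_V tri_unit[OF B(4) e(2)] qint_affine[OF id_V] F B)
 then show ?thesis by (rule qint_cong) (use sl_level_one[OF F(1) SL2_det[OF R] B(1-3) e(1) B(5)] in simp)
qed

end

lemma level_exists:
 assumes "finite P" "\<And>p. p \<in> P \<Longrightarrow> Factorial_Ring.prime p" shows "\<exists>x y. level P (\<Prod>P) x y"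
proof -
 have "\<exists>u v. int p * u - int (\<Prod>P div p) * v = 1" if p: "p \<in> P" for p
 proof -
  have "\<Prod>P = p * \<Prod>(P - {p})" using prod.remove[OF assms(1) p, of "\<lambda>p. p"] by simp
  then have d: "\<Prod>P div p = \<Prod>(P - {p})" using prime_gt_0_nat[OF assms(2)[OF p]] by simp
  have "coprime p (\<Prod>(P - {p}))" using assms p by (intro prod_coprime_right) (auto intro: primes_coprime)
  then have "coprime (int p) (int (\<Prod>P div p))" unfolding d by (simp only: coprime_int_iff)
  then obtain u v where "u * int p + v * int (\<Prod>P div p) = 1" using bezout_int[of "int p" "int (\<Prod>P div p)"] by (metis coprime_imp_gcd_eq_1)
  then show ?thesis by (intro exI[of _ u] exI[of _ "- v"]) (simp add: algebra_simps)
 qed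
 then obtain x y where "\<And>p. p \<in> P \<Longrightarrow> int p * x p - int (\<Prod>P div p) * y p = 1" by metis
 then have "level P (\<Prod>P) x y" using assms by unfold_locales auto
 then show ?thesis by blast
qed

text \<open>In the application \<open>lam\<close> is l^s, where s is the l-adic valuation of \<rho>.
  Both congruences are kept because s may be negative, and then the one divided by
  \<open>lam\<close> is the weaker one.\<close>

locale eisenstein_congruence = complex_valuation_ring V + level P N x y for V P N x y +
 fixes k :: nat and f :: "complex \<Rightarrow> complex" and lam \<rho> :: complex
 assumes k: "k \<ge> 4" "even k" and nf: "newform k N f" and lam: "lam \<noteq> 0"
  and cong: "\<And>n. q_coeff f n - cF k P (wts k {}) n \<in> mx" "\<And>n. (q_coeff f n - cF k P (wts k {}) n) / lam \<in> mx"
  and \<rho>_def: "\<rho> = cE k * (\<Prod>p\<in>P. 1 - of_nat p)" and \<rho>0: "\<rho> \<noteq> 0" and \<rho>V: "lam / \<rho> \<in> V"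
begin

text \<open>The elements of valuation greater than max(0, v(lam)).\<close>

definition J where "J = {z \<in> mx. z / lam \<in> mx}"

abbreviation "c \<equiv> q_coeff f"

text \<open>The quotient of 1 - p^(k-1) by 1 - p: the ratio of the constant terms at the cusps with
  p | c and at the others, up to units.\<close>

definition sg :: "nat \<Rightarrow> complex" where "sg p = (\<Sum>i<k - 1. of_nat p ^ i)"

lemma id_J: "is_id J"
 unfolding is_id_def J_def using mx_0 mx_add mx_mult by (auto simp: add_divide_distrib mult.assoc simp flip: times_divide_eq_right)

lemma J_mx: "z \<in> J \<Longrightarrow> z \<in> mx" by (simp add: J_def)

lemma J_\<rho>: assumes "z \<in> J" shows "z / \<rho> \<in> mx"
proof -
 have "lam / \<rho> * (z / lam) \<in> mx" using assms \<rho>V by (intro mx_mult) (auto simp: J_def)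
 then show ?thesis using lam by simp
qed

lemma coeff_J: "c n - cF k P (wts k {}) n \<in> J" using cong by (simp add: J_def)

lemma c_J: "p \<in> P \<Longrightarrow> c p - 1 \<in> J"
 using coeff_J[of p] cF_prime[OF finP primes, of p k] k by simp

lemma unit_of_J: assumes "z - 1 \<in> J" shows "z \<in> V" "z \<notin> mx" "1 / z - 1 \<in> J"
proof -
 show V: "z \<in> V" using V_intros(6)[OF subsetD[OF mx_subset J_mx[OF assms]] V_intros(1)] by simp
 show m: "z \<notin> mx" using mx_diff[OF _ J_mx[OF assms], of z] one_notin_mx by auto
 have "- inverse z * (z - 1) \<in> J" using unitD[OF V m] assms by (intro is_idD(3)[OF id_J] V_intros(5))
 moreover have "z \<noteq> 0" using m mx_0 by auto
 then have "- inverse z * (z - 1) = 1 / z - 1" by (simp add: field_simps)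
 ultimately show "1 / z - 1 \<in> J" by simp
qed

lemma prod_J:
 assumes "finite D" "\<And>p. p \<in> D \<Longrightarrow> u p \<in> V \<and> v p \<in> V \<and> u p - v p \<in> J" shows "prod u D - prod v D \<in> J" using assms
proof (induction D rule: finite_induct)
 case empty
 then show ?case using is_idD(1)[OF id_J] by simp
next
 case (insert p D)
 have "u p * (prod u D - prod v D) + prod v D * (u p - v p) \<in> J" using insert by (intro is_idD(2,3)[OF id_J] V_prod) auto
 then show ?case using insert by (simp add: algebra_simps)
qed

lemma fc: "f \<in> cusp_forms k N" using nf by (simp add: newform_def new_subspace_def)

lemma N0: "N > 0" unfolding N by (rule prod_pos) simp

lemma f_exp: "has_q_expansion 1 c f" "c 0 = 0" using cusp_form_q_expansion[OF fc N0] by auto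

lemma atkin_lehner: assumes p: "p \<in> P" shows "atkin_lehner k N p (N div p) f (x p) (y p)"
proof
 show "k \<ge> 2" using k by simp
 show "N = p * (N div p)" "N div p > 0" using N_split[OF p] prod_pos[of "P - {p}"] by auto
 show "coprime p (N div p)" unfolding N_split(2)[OF p] using p primes by (intro prod_coprime_right) (auto intro: primes_coprime)
qed (use primes p nf xy in auto)

lemma c_sq: "p \<in> P \<Longrightarrow> c p ^ 2 = of_nat p ^ (k - 2)"
 using atkin_lehner.c_squared[OF atkin_lehner] by (simp add: atkin_lehner.c_def[OF atkin_lehner])

lemma f_AL: assumes p: "p \<in> P" and \<tau>: "\<tau> \<in> HH"
 shows "sl (int k) (int p * x p, y p, int N, int p) f \<tau> = - 1 / of_nat p * (1 / c p) * f \<tau>"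
proof -
 have p0: "p > 0" using primes[OF p] by (rule prime_gt_0_nat)
 have "of_nat p ^ (k - 1) = (of_nat p * c p * c p :: complex)" using c_sq[OF p] k power_Suc[of "of_nat p :: complex" "k - 2"]
  by (simp add: power2_eq_square mult.assoc Suc_diff_Suc numeral_2_eq_2)
 moreover have "c p \<noteq> 0" using c_sq[OF p] p0 by auto
 ultimately have "- (c p / of_nat p ^ (k - 1)) = - 1 / of_nat p * (1 / c p)" using p0 by (simp add: field_simps)
 then show ?thesis using atkin_lehner.f_W[OF atkin_lehner[OF p] \<tau>]
  by (simp add: atkin_lehner.c_def[OF atkin_lehner[OF p]] atkin_lehner.W_def[OF atkin_lehner[OF p]])
qed

text \<open>The coefficient \<open>c p\<close> is congruent to a_p(E) = 1, and its square is p^(k-2)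
  by the Atkin-Lehner theory.\<close>

lemma pow_J: assumes "p \<in> P" shows "of_nat p ^ (k - 2) - 1 \<in> J"
proof -
 have "(c p + 1) * (c p - 1) \<in> J"
  using c_J[OF assms] unit_of_J(1)[OF c_J[OF assms]] by (intro is_idD(3)[OF id_J] V_intros(6) V_intros(1))
 then show ?thesis unfolding c_sq[OF assms, symmetric] by (simp add: algebra_simps power2_eq_square)
qed

lemma p_unit: assumes "p \<in> P" shows "of_nat p \<notin> mx"
proof
 assume "of_nat p \<in> mx"
 then have "of_nat p ^ (k - 3) * of_nat p \<in> mx" by (intro mx_mult V_intros(8) of_nat_in_V)
 moreover have "k - 2 = Suc (k - 3)" using k by simp
 then have "of_nat p ^ (k - 3) * of_nat p = (of_nat p ^ (k - 2) :: complex)" by simp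
 ultimately show False using mx_diff[OF _ J_mx[OF pow_J[OF assms]]] one_notin_mx by fastforce
qed

lemma inv_p_V: "p \<in> P \<Longrightarrow> - 1 / of_nat p \<in> V"
 using V_intros(5)[OF unitD[OF of_nat_in_V p_unit]] by (simp add: divide_inverse)

lemma sg_V: "sg p \<in> V" unfolding sg_def by (intro V_intros of_nat_in_V)

lemma sg: "(1 - of_nat p) * sg p = 1 - of_nat p ^ (k - 1)"
 unfolding sg_def by (rule one_diff_power_eq [symmetric])

lemma wts_V: "wts k D p \<in> V" unfolding wts_def by (auto intro: V_intros of_nat_in_V)

lemma wts_J: assumes "p \<in> P" shows "wts k D p - wts k {} p \<in> J"
proof -
 have "- of_nat p * (of_nat p ^ (k - 2) - 1) \<in> J" using pow_J[OF assms] by (intro is_idD(3)[OF id_J] V_intros(5) of_nat_in_V)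
 moreover have "k - 1 = Suc (k - 2)" using k by simp
 then have "- of_nat p * (of_nat p ^ (k - 2) - 1) = (of_nat p - of_nat p ^ (k - 1) :: complex)" by (simp add: algebra_simps)
 ultimately show ?thesis using is_idD(1)[OF id_J] by (simp add: wts_def)
qed

lemma cF_V: "n > 0 \<Longrightarrow> cF k S (wts k D) n \<in> V"
 unfolding cF_def by (intro is_idD(4)[OF id_V] V_intros(4) V_prod V_intros(5) wts_V) (auto intro: of_nat_in_V V_intros(2))

text \<open>Since p - p^(k-1) lies in \<open>J\<close>, the Eisenstein series belonging to the
  various cusps have congruent coefficients. Index 0 is excluded because \<open>cE k\<close> need
  not lie in \<open>V\<close>.\<close>

lemma cF_J: assumes "n > 0" shows "cF k P (wts k D) n - cF k P (wts k {}) n \<in> J"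
 unfolding cF_def sum_subtractf [symmetric] left_diff_distrib [symmetric]
proof (rule is_idD(4)[OF id_J])
 fix D' assume D': "D' \<in> Pow P"
 define z where "z = (if \<Prod>D' dvd n then if n = 0 then cE k else of_nat (divisor_sigma (k - 1) (n div \<Prod>D')) else 0)"
 have "z \<in> V" using assms by (auto simp: z_def intro: of_nat_in_V V_intros(2))
 moreover have "(\<Prod>p\<in>D'. - wts k D p) - (\<Prod>p\<in>D'. - wts k {} p) \<in> J"
 proof (rule prod_J)
  fix p assume "p \<in> D'"
  then show "- wts k D p \<in> V \<and> - wts k {} p \<in> V \<and> - wts k D p - - wts k {} p \<in> J"
   using is_idD(5)[OF id_J wts_J[of p D]] D' by (auto intro: V_intros(5) wts_V)
 qed (use D' finite_sub in auto)
 ultimately have "z * ((\<Prod>p\<in>D'. - wts k D p) - (\<Prod>p\<in>D'. - wts k {} p)) \<in> J" by (rule is_idD(3)[OF id_J])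
 then show "((\<Prod>p\<in>D'. - wts k D p) - (\<Prod>p\<in>D'. - wts k {} p)) *
   (if \<Prod>D' dvd n then if n = 0 then cE k else of_nat (divisor_sigma (k - 1) (n div \<Prod>D')) else 0) \<in> J"
  unfolding z_def by (simp only: mult.commute)
qed

lemma const_term:
 assumes "S \<subseteq> P" "D \<subseteq> S" shows "(\<Prod>p\<in>S. 1 - wts k D p) = (\<Prod>p\<in>S. 1 - of_nat p) * (\<Prod>p\<in>S - D. sg p)"
proof -
 have fin: "finite S" using assms finite_sub by auto
 have "(\<Prod>p\<in>S. 1 - wts k D p) = (\<Prod>p\<in>S. (1 - of_nat p) * (if p \<in> D then 1 else sg p))" by (rule prod.cong) (auto simp: wts_def sg)
 also have "\<dots> = (\<Prod>p\<in>S. 1 - of_nat p) * (\<Prod>p\<in>S. if p \<in> D then 1 else sg p)" by (rule prod.distrib)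
 also have "(\<Prod>p\<in>S. if p \<in> D then 1 else sg p) = (\<Prod>p\<in>S - D. sg p)" using fin by (intro prod.mono_neutral_cong_right) auto
 finally show ?thesis .
qed

text \<open>The constant term of E is \<rho> times the product of all \<open>sg p\<close>, and that
  of \<open>f\<close> is 0; after division by \<rho> the product lies in \<open>mx\<close>.\<close>

lemma bad_prime_exists: "\<exists>p\<in>P. sg p \<in> mx"
proof (rule ccontr)
 assume "\<not> (\<exists>p\<in>P. sg p \<in> mx)"
 then have "prod sg P \<notin> mx" using sg_V by (intro unit_prod) auto
 moreover have "- (cF k P (wts k {}) 0) \<in> J" using coeff_J[of 0] f_exp(2) by simp
 then have "- (cF k P (wts k {}) 0) / \<rho> \<in> mx" by (rule J_\<rho>)
 moreover have "cF k P (wts k {}) 0 = \<rho> * prod sg P" unfolding cF_0[OF finP] \<rho>_def using const_term[of P "{}"] by simp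
 ultimately show False using mx_uminus[of "- prod sg P"] \<rho>0 by simp
qed

definition ep :: "nat set \<Rightarrow> complex" where "ep D = (\<Prod>p\<in>D. - 1 / of_nat p)"

lemma ep_V: "D \<subseteq> P \<Longrightarrow> ep D \<in> V" unfolding ep_def by (intro V_prod inv_p_V) auto

text \<open>Modulo \<open>mx\<close> the form (f - E)/\<rho> is constant at every cusp: the other
  coefficients of \<open>f\<close> and of the transformed E differ by elements of \<open>J\<close>,
  and division by \<rho> maps \<open>J\<close> into \<open>mx\<close>.\<close>

lemma h_cusp:
 assumes g: "g \<in> SL2" and D: "D = {p \<in> P. \<not> int p dvd m21 g}"
 shows "qint mx (\<lambda>\<tau>. (sl (int k) g f \<tau> - sl (int k) g (FF k P (wts k {})) \<tau>) / \<rho> + ep D * (\<Prod>p\<in>P - D. sg p))"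
proof -
 have DP: "D \<subseteq> P" using D by auto
 obtain j where j: "int (\<Prod>D) dvd m22 g - j * m21 g" using cusp_shift[OF D] by blast
 define \<gamma> where "\<gamma> = (\<Prod>p\<in>D. 1 / c p)"
 define e where "e = int (\<Prod>D)"
 have e0: "e > 0" unfolding e_def using prod_pos[OF DP] by (simp only: of_nat_0_less_iff)
 have \<gamma>J: "\<gamma> - 1 \<in> J"
 proof -
  have "\<gamma> - (\<Prod>p\<in>D. 1) \<in> J" unfolding \<gamma>_def
  proof (rule prod_J)
   fix p assume "p \<in> D"
   then have "1 / c p - 1 \<in> J" using unit_of_J(3)[OF c_J[of p]] DP by auto
   then show "1 / c p \<in> V \<and> 1 \<in> V \<and> 1 / c p - 1 \<in> J" using unit_of_J(1) V_intros(1) by blast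
  qed (rule finite_sub[OF DP])
  then show ?thesis by simp
 qed
 \<comment> \<open>The added constant cancels the constant term of \<open>FF k P (wts k D)\<close>
   exactly, by \<open>const_term\<close>; only the other coefficients are treated by
   congruences.\<close>
 define G where "G \<tau> = 1 / \<rho> * (\<gamma> * f \<tau> - FF k P (wts k D) \<tau> + \<rho> * (\<Prod>p\<in>P - D. sg p))" for \<tau>
 define a where "a n = 1 / \<rho> * (\<gamma> * c n - cF k P (wts k D) n + (if n = 0 then \<rho> * (\<Prod>p\<in>P - D. sg p) else 0))" for n
 have "has_q_expansion 1 a G" unfolding a_def [abs_def] G_def [abs_def]
  by (intro q_expansion_cmult q_expansion_add q_expansion_diff f_exp FF_q_expansion finP q_expansion_const)
   (use primes prime_gt_0_nat in auto)
 moreover have "a n \<in> mx" for n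
 proof (cases "n = 0")
  case True
  have "a 0 = 0" unfolding a_def cF_0[OF finP] const_term[OF order_refl DP] \<rho>_def f_exp(2) by simp
  then show ?thesis using True mx_0 by simp
 next
  case False
  have cV: "c n \<in> V" using V_intros(6)[OF subsetD[OF mx_subset cong(1)[of n]] cF_V[of n P "{}"]] False by simp
  have "c n * (\<gamma> - 1) + (c n - cF k P (wts k {}) n) - (cF k P (wts k D) n - cF k P (wts k {}) n) \<in> J"
   using False by (intro is_idD(6)[OF id_J is_idD(2)[OF id_J is_idD(3)[OF id_J cV \<gamma>J] coeff_J]] cF_J) simp
  from J_\<rho>[OF this] show ?thesis using False by (simp add: a_def right_diff_distrib diff_divide_distrib mult.commute)
 qed
 ultimately have "qint mx G" unfolding qint_def by (intro exI[of _ 1]) auto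
 then have "qint mx (\<lambda>\<tau>. ep D * G ((of_int 1 * \<tau> + of_int j) / of_int e))"
  by (intro qint_mult[OF id_mx] qint_const[OF id_V] ep_V DP qint_affine[OF id_mx] e0) simp_all
 then show ?thesis
 proof (rule qint_cong)
  fix \<tau> assume \<tau>: "\<tau> \<in> HH"
  define \<tau>' where "\<tau>' = (\<tau> + of_int j) / of_nat (\<Prod>D)"
  have f: "sl (int k) g f \<tau> = ep D * \<gamma> * f \<tau>'"
   using AL_cusp[where F = "\<lambda>_. f" and \<kappa> = "\<lambda>p. - 1 / of_nat p * (1 / c p)", OF f_AL _ g D j \<tau>] fc
   unfolding \<tau>'_def [symmetric] prod.distrib ep_def \<gamma>_def by (simp add: cusp_forms_iff)
  have E: "sl (int k) g (FF k P (wts k {})) \<tau> = ep D * FF k P (wts k D) \<tau>'"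
   using AL_cusp[where F = "\<lambda>D. FF k P (wts k D)" and \<kappa> = "\<lambda>p. - 1 / of_nat p", OF FF_AL[OF k] FF_invariant[OF k] g D j \<tau>]
   unfolding \<tau>'_def [symmetric] ep_def by simp
  have "(of_int 1 * \<tau> + of_int j) / of_int e = \<tau>'" by (simp add: \<tau>'_def e_def)
  then show "ep D * G ((of_int 1 * \<tau> + of_int j) / of_int e) =
    (sl (int k) g f \<tau> - sl (int k) g (FF k P (wts k {})) \<tau>) / \<rho> + ep D * (\<Prod>p\<in>P - D. sg p)"
   unfolding f E G_def using \<rho>0 by (simp add: field_simps)
 qed
qed

end

section \<open>The exceptional prime and the final count\<close>

locale exceptional_prime = eisenstein_congruence +
 fixes p0 :: nat
 assumes p0P: "p0 \<in> P" and p0_mx: "sg p0 \<in> mx"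
begin

definition "PM = P - {p0}"
definition "M = \<Prod>PM"
definition "\<beta> = cE k * (\<Prod>p\<in>PM. 1 - of_nat p)"

lemma PM: "PM \<subseteq> P" "finite PM" "p0 \<notin> PM" "\<And>p. p \<in> P \<longleftrightarrow> p = p0 \<or> p \<in> PM" using p0P finP by (auto simp: PM_def)

lemma NM: "N = p0 * M" unfolding M_def PM_def by (rule N_split(1)[OF p0P])

lemma M0: "M > 0" unfolding M_def by (rule prod_pos[OF PM(1)])

lemma p0_pos: "p0 > 0" using primes[OF p0P] by (rule prime_gt_0_nat)

lemma \<rho>\<beta>: "\<rho> = \<beta> * (1 - of_nat p0)"
 unfolding \<rho>_def \<beta>_def PM_def using prod.remove[OF finP p0P, of "\<lambda>p. 1 - of_nat p :: complex"] by (simp add: mult_ac)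

lemma \<beta>0: "\<beta> \<noteq> 0" using \<rho>0 \<rho>\<beta> by auto

text \<open>Since 1 + p0 s = \<open>sg p0\<close> lies in \<open>mx\<close>, s is a unit; and (p0 -
  1) s = p0^(k-2) - 1 lies in \<open>J\<close>.\<close>

lemma p0_J: "of_nat p0 - 1 \<in> J"
proof -
 define s where "s = (\<Sum>i<k - 2. of_nat p0 ^ i :: complex)"
 have sV: "s \<in> V" unfolding s_def by (intro V_intros of_nat_in_V)
 have "k - 1 = Suc (k - 2)" using k by simp
 then have sg: "sg p0 = 1 + of_nat p0 * s" unfolding sg_def s_def by (simp only: sum.lessThan_Suc_shift) (simp add: sum_distrib_left)
 have sm: "s \<notin> mx"
 proof
  assume "s \<in> mx"
  then have "sg p0 - of_nat p0 * s \<in> mx" using p0_mx by (intro mx_diff mx_mult of_nat_in_V)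
  then show False using one_notin_mx by (simp add: sg)
 qed
 then have *: "inverse s * (of_nat p0 ^ (k - 2) - 1) \<in> J" using unitD[OF sV] pow_J[OF p0P] by (intro is_idD(3)[OF id_J])
 have "(of_nat p0 ^ (k - 2) - 1 :: complex) = (of_nat p0 - 1) * s" unfolding s_def by (rule power_diff_1_eq)
 moreover have "s \<noteq> 0" using sm mx_0 by auto
 ultimately have "inverse s * (of_nat p0 ^ (k - 2) - 1) = of_nat p0 - 1" by simp
 then show ?thesis using * by (simp only:)
qed

text \<open>For p0 = 2 the difference p0 - 1 in \<open>J\<close> would be 1. The three residues 0,
  1, 2 modulo p0 are needed in the final count.\<close>

lemma p0_ge_3: "p0 \<ge> 3"
proof -
 have "p0 \<noteq> 2" using J_mx[OF p0_J] one_notin_mx by auto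
 then show ?thesis using prime_ge_2_nat[OF primes[OF p0P]] by simp
qed

lemma \<beta>_mx: "1 / \<beta> \<in> mx"
proof -
 have "- ((of_nat p0 - 1) / \<rho>) \<in> mx" by (intro mx_uminus J_\<rho> p0_J)
 moreover have "- ((of_nat p0 - 1) / \<rho>) = 1 / \<beta>" using \<rho>0 \<beta>0 unfolding \<rho>\<beta> by (simp add: field_simps)
 ultimately show ?thesis by simp
qed

text \<open>As 1/\<beta> lies in \<open>mx\<close>, division by \<beta> kills everything except the
  constant terms, which are themselves multiples of \<beta>.\<close>

lemma E_cusp:
 assumes g: "g \<in> SL2" and D: "D = {p \<in> PM. \<not> int p dvd m21 g}"
 shows "qint mx (\<lambda>\<tau>. sl (int k) g (FF k PM (wts k {})) \<tau> / \<beta> - ep D * (\<Prod>p\<in>PM - D. sg p))"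
  "invariant (int k) N (FF k PM (wts k {}))"
proof -
 have pr: "Factorial_Ring.prime p" if "p \<in> PM" for p using primes PM(1) that by auto
 obtain x' y' where "level PM (\<Prod>PM) x' y'" using level_exists[OF PM(2) pr] by blast
 then interpret LM: level PM M x' y' by (simp add: M_def)
 show "invariant (int k) N (FF k PM (wts k {}))" using LM.FF_invariant[OF k] G0_mono[of M N] NM unfolding invariant_def by auto
 have DP: "D \<subseteq> PM" using D by auto
 obtain j where j: "int (\<Prod>D) dvd m22 g - j * m21 g" using LM.cusp_shift[OF D] by blast
 define e where "e = int (\<Prod>D)"
 have e0: "e > 0" unfolding e_def using LM.prod_pos[OF DP] by (simp only: of_nat_0_less_iff)
 define G where "G \<tau> = 1 / \<beta> * (FF k PM (wts k D) \<tau> - \<beta> * (\<Prod>p\<in>PM - D. sg p))" for \<tau>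
 define a where "a n = 1 / \<beta> * (cF k PM (wts k D) n - (if n = 0 then \<beta> * (\<Prod>p\<in>PM - D. sg p) else 0))" for n
 have "has_q_expansion 1 a G" unfolding a_def [abs_def] G_def [abs_def]
  by (intro q_expansion_cmult q_expansion_diff FF_q_expansion PM q_expansion_const) (use pr prime_gt_0_nat in auto)
 moreover have "a n \<in> mx" for n
 proof (cases "n = 0")
  case True
  have "a 0 = 0" unfolding a_def cF_0[OF PM(2)] const_term[OF PM(1) DP] \<beta>_def by simp
  then show ?thesis using True mx_0 by simp
 next
  case False
  then show ?thesis using mx_mult[OF cF_V[of n PM D] \<beta>_mx] by (simp add: a_def)
 qed
 ultimately have "qint mx G" unfolding qint_def by (intro exI[of _ 1]) auto
 then have "qint mx (\<lambda>\<tau>. ep D * G ((of_int 1 * \<tau> + of_int j) / of_int e))"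
  using DP PM(1) by (intro qint_mult[OF id_mx] qint_const[OF id_V] ep_V qint_affine[OF id_mx] e0) auto
 then show "qint mx (\<lambda>\<tau>. sl (int k) g (FF k PM (wts k {})) \<tau> / \<beta> - ep D * (\<Prod>p\<in>PM - D. sg p))"
 proof (rule qint_cong)
  fix \<tau> assume \<tau>: "\<tau> \<in> HH"
  define \<tau>' where "\<tau>' = (\<tau> + of_int j) / of_nat (\<Prod>D)"
  have E: "sl (int k) g (FF k PM (wts k {})) \<tau> = ep D * FF k PM (wts k D) \<tau>'"
   using LM.AL_cusp[where F = "\<lambda>D. FF k PM (wts k D)" and \<kappa> = "\<lambda>p. - 1 / of_nat p", OF LM.FF_AL[OF k] LM.FF_invariant[OF k] g D j \<tau>]
   unfolding \<tau>'_def [symmetric] ep_def by simp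
  have "(of_int 1 * \<tau> + of_int j) / of_int e = \<tau>'" by (simp add: \<tau>'_def e_def)
  then show "ep D * G ((of_int 1 * \<tau> + of_int j) / of_int e) = sl (int k) g (FF k PM (wts k {})) \<tau> / \<beta> - ep D * (\<Prod>p\<in>PM - D. sg p)"
   unfolding E G_def using \<beta>0 by (simp add: field_simps)
 qed
qed

text \<open>
  Modulo the maximal ideal, \<open>\<Psi>\<close> is an indicator of the cosets with \<open>p\<^sub>0 | c\<close>: it is a constant on these
  and zero on the others.
\<close>

definition \<Psi> :: "complex \<Rightarrow> complex" where
 "\<Psi> \<tau> = 1 / \<beta> * FF k PM (wts k {}) \<tau> - of_nat p0 / \<rho> * (f \<tau> - FF k P (wts k {}) \<tau>)"

definition eg :: "mat2 \<Rightarrow> complex" where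
 "eg g = (let D = {p \<in> PM. \<not> int p dvd m21 g} in if int p0 dvd m21 g then ep D * (\<Prod>p\<in>PM - D. sg p) else 0)"

lemma eg_V: "eg g \<in> V"
 unfolding eg_def Let_def using PM(1) by (auto intro!: V_intros(4) ep_V V_prod sg_V V_intros(2))

lemma \<Psi>_inv: "invariant (int k) N \<Psi>"
 unfolding \<Psi>_def [abs_def] using E_cusp(2)[OF SL2_one(1) refl] fc
 by (intro invariant_diff invariant_cmult FF_invariant k) (auto simp: cusp_forms_iff)

text \<open>If p0 divides c, the contribution of (f - E)/\<rho> carries the factor
  \<open>sg p0\<close> and disappears. Otherwise it is 1/p0 times the constant of the other series,
  and the factor p0 in \<Psi> makes the two cancel.\<close>

lemma \<Psi>_cusp: assumes g: "g \<in> SL2" shows "qint mx (\<lambda>\<tau>. sl (int k) g \<Psi> \<tau> - eg g)"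
proof -
 define D' where "D' = {p \<in> PM. \<not> int p dvd m21 g}"
 define D where "D = {p \<in> P. \<not> int p dvd m21 g}"
 define s where "s = (\<Prod>p\<in>PM - D'. sg p)"
 define t where "t = (\<Prod>p\<in>P - D. sg p)"
 define A where "A \<tau> = sl (int k) g (FF k PM (wts k {})) \<tau> / \<beta> - ep D' * s" for \<tau>
 define B where "B \<tau> = (sl (int k) g f \<tau> - sl (int k) g (FF k P (wts k {})) \<tau>) / \<rho> + ep D * t" for \<tau>
 have A: "qint mx A" unfolding A_def [abs_def] s_def by (rule E_cusp(1)[OF g D'_def])
 have B: "qint mx B" unfolding B_def [abs_def] t_def by (rule h_cusp[OF g D_def])
 have D'P: "D' \<subseteq> P" "finite D'" using PM by (auto simp: D'_def)
 have const: "ep D' * s + of_nat p0 * (ep D * t) - eg g \<in> mx"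
 proof (cases "int p0 dvd m21 g")
  case True
  then have "D = D'" "P - D = insert p0 (PM - D')" using PM by (auto simp: D_def D'_def)
  then have "ep D' * s + of_nat p0 * (ep D * t) - eg g = of_nat p0 * (ep D' * s) * sg p0"
   using True PM by (simp add: eg_def s_def t_def D'_def [symmetric])
  moreover have "of_nat p0 * (ep D' * s) * sg p0 \<in> mx"
   unfolding s_def by (intro mx_mult p0_mx V_intros(4) of_nat_in_V ep_V D'P V_prod sg_V)
  ultimately show ?thesis by (simp only:)
 next
  case False
  then have "D = insert p0 D'" "P - D = PM - D'" "p0 \<notin> D'" using PM by (auto simp: D_def D'_def)
  then have "of_nat p0 * (ep D * t) = - (ep D' * s)" using D'P(2) p0_pos by (simp add: ep_def s_def t_def)
  then show ?thesis using False mx_0 by (simp add: eg_def)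
 qed
 have "qint mx (\<lambda>\<tau>. A \<tau> + (- of_nat p0 * B \<tau> + (ep D' * s + of_nat p0 * (ep D * t) - eg g)))"
  by (intro qint_add[OF id_mx] A B const qint_mult[OF id_mx] qint_const[OF id_mx] qint_const[OF id_V] V_intros(5) of_nat_in_V)
 then show ?thesis
 proof (rule qint_cong)
  fix \<tau>
  show "A \<tau> + (- of_nat p0 * B \<tau> + (ep D' * s + of_nat p0 * (ep D * t) - eg g)) = sl (int k) g \<Psi> \<tau> - eg g"
   unfolding A_def B_def \<Psi>_def [abs_def] sl_linear using \<rho>0 \<beta>0 by (simp add: algebra_simps add_divide_distrib diff_divide_distrib)
 qed
qed

text \<open>The substitution M \<tau> separates the cusps: at cosets with c prime to M the expansion
  in width M starts at exponent M, at all others strictly later. The M-th power trivialises the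
  roots of unity in these leading coefficients, so that they add up instead of cancelling.\<close>

definition \<Theta> :: "complex \<Rightarrow> complex" where "\<Theta> = A_op M (\<lambda>\<tau>. Delta \<tau> ^ M)"

lemma Delta_pow_inv: "invariant (int M * 12) 1 (\<lambda>\<tau>. Delta \<tau> ^ M)" by (rule invariant_power[OF Delta_inv])

lemma M_unit: "of_nat M \<notin> mx"
 unfolding M_def of_nat_prod using PM(1) p_unit by (intro unit_prod) (auto intro: of_nat_in_V)

lemma intlead_qint: "intlead F d \<Longrightarrow> qint V F"
 unfolding intlead_def qint_def using of_int_in_V by (metis zero_less_one)

lemma \<Theta>_cusp:
 assumes R: "R \<in> SL2"
 shows "\<exists>a. has_q_expansion M a (sl (int M * 12) R \<Theta>) \<and> (\<forall>n. a n \<in> V) \<and>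
  a M = (if coprime (m21 R) (int M) then of_nat M powi (- (int M * 12)) else 0)"
proof -
 obtain z :: "nat \<Rightarrow> int" where z: "has_q_expansion 1 (\<lambda>n. of_int (z n)) (\<lambda>\<tau>. Delta \<tau> ^ M)" "\<And>n. n < M \<Longrightarrow> z n = 0" "z M = 1"
  using intlead_power[OF Delta_lead, of M] by (auto simp: intlead_def)
 let ?A = "mm (int M, 0, 0, 1) R"
 obtain r1 r2 r3 r4 where RR: "R = (r1, r2, r3, r4)" by (cases R)
 have det: "r1 * r4 - r2 * r3 = 1" using R by (simp add: RR SL2_def)
 have "mdet ?A = int M" using R by (simp add: mdet_mm SL2_def)
 then obtain B a b d where B: "B \<in> SL2" "a > 0" "d > 0" "a * d = int M" "?A = mm B (a, b, 0, d)"
  "m21 ?A = m21 B * a" "\<And>x. x dvd fst ?A \<Longrightarrow> x dvd m21 ?A \<Longrightarrow> x dvd a" using hermite[of ?A] M0 by (metis of_nat_0_less_iff)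
 have a1: "coprime (m21 R) (int M) \<longleftrightarrow> a = 1"
 proof
  assume cop: "coprime (m21 R) (int M)"
  have "a dvd m21 R" "a dvd int M" using B(6) by (simp_all add: RR B(4) [symmetric])
  then show "a = 1" using cop B(2) by (metis coprime_common_divisor zdvd1_eq abs_of_pos)
 next
  assume "a = 1"
  show "coprime (m21 R) (int M)"
  proof (rule coprimeI)
   fix q assume "q dvd m21 R" "q dvd int M"
   then show "is_unit q" using B(7)[of q] \<open>a = 1\<close> by (simp add: RR)
  qed
 qed
 define t where "t = nat a"
 define d' where "d' = nat d"
 have td: "t > 0" "d' > 0" "int t = a" "int d' = d" "t * d' = M" using B(2-4) by (auto simp: t_def d'_def nat_mult_distrib [symmetric])
 define h where "h n = (if t dvd n then of_int (z (n div t)) * qp d' (of_int b) ^ (n div t) else 0)" for n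
 have "has_q_expansion d' h (\<lambda>\<tau>. Delta ((of_nat t * \<tau> + of_int b) / of_nat d') ^ M)"
  using q_expansion_affine[OF td(1,2) z(1), of b] by (simp only: mult_1 h_def [abs_def])
 from q_expansion_cmult[OF q_expansion_refine[OF td(1) this], of "of_int d powi (- (int M * 12))"]
 have ex: "has_q_expansion M (\<lambda>n. of_int d powi (- (int M * 12)) * (if t dvd n then h (n div t) else 0))
   (\<lambda>\<tau>. of_int d powi (- (int M * 12)) * Delta ((of_nat t * \<tau> + of_int b) / of_nat d') ^ M)" using td(5) by (simp only: mult.commute)
 have "has_q_expansion M (\<lambda>n. of_int d powi (- (int M * 12)) * (if t dvd n then h (n div t) else 0)) (sl (int M * 12) R \<Theta>)"
 proof (rule q_expansion_cong[OF ex])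
  fix \<tau> assume "\<tau> \<in> HH"
  from sl_level_one[OF Delta_pow_inv SL2_det[OF R] B(1-3) M0 B(5) this]
  show "of_int d powi (- (int M * 12)) * Delta ((of_nat t * \<tau> + of_int b) / of_nat d') ^ M = sl (int M * 12) R \<Theta> \<tau>"
   by (simp add: \<Theta>_def flip: td(3,4))
 qed simp
 moreover have root: "qp d' (of_int b) ^ d' = 1" by (rule qp_root[OF td(2)])
 have dV: "of_int d powi (- (int M * 12)) \<in> V" by (intro unit_powi of_int_in_V tri_unit[OF B(4) M_unit])
 have "h n \<in> V" for n unfolding h_def using root_of_unity_in_V(1)[OF root td(2)] by (auto intro: V_intros of_int_in_V)
 then have "of_int d powi (- (int M * 12)) * (if t dvd n then h (n div t) else 0) \<in> V" for n using dV V_intros(2,4) by auto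
 moreover have "of_int d powi (- (int M * 12)) * (if t dvd M then h (M div t) else 0) =
   (if coprime (m21 R) (int M) then of_nat M powi (- (int M * 12)) else 0)"
 proof (cases "a = 1")
  case True
  then have "t = 1" "d' = M" "d = int M" using td B(4) by auto
  then show ?thesis using a1 True root z(3) by (simp add: h_def)
 next
  case False
  then have t1: "t > 1" using td by (cases t) auto
  have "M div t = d'" unfolding td(5) [symmetric] using td(1) by simp
  moreover have "z (d' div t) = 0"
  proof (rule z(2))
   have "d' div t < d'" using t1 td by simp
   also have "d' \<le> M" unfolding td(5) [symmetric] using td(1) by simp
   finally show "d' div t < M" .
  qed
  ultimately have "h (M div t) = 0" by (simp add: h_def)
  then show ?thesis using a1 False by simp
 qed
 ultimately show ?thesis by blast
qed

definition T :: "complex \<Rightarrow> complex" where "T \<tau> = (\<Sum>R\<in>Reps N. eg R * sl (int M * 12) R \<Theta> \<tau>)"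

text \<open>The coefficient at exponent M comes from the cosets with p0 | c and c prime to M. There
  are M of them, each with the same unit contribution, and M itself is a unit; so the reduction of
  \<open>T\<close> is not 0.\<close>

lemma T_ld: "\<exists>d. ld M T d"
proof -
 obtain a where a: "\<And>R. R \<in> SL2 \<Longrightarrow> has_q_expansion M (a R) (sl (int M * 12) R \<Theta>)" "\<And>R n. R \<in> SL2 \<Longrightarrow> a R n \<in> V"
  "\<And>R. R \<in> SL2 \<Longrightarrow> a R M = (if coprime (m21 R) (int M) then of_nat M powi (- (int M * 12)) else 0)" using \<Theta>_cusp by metis
 define b where "b n = (\<Sum>R\<in>Reps N. eg R * a R n)" for n
 have fin: "finite (Reps N)" by (rule finite_Reps[OF N0])
 have RS: "R \<in> SL2" if "R \<in> Reps N" for R using Reps_SL2 that by blast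
 have T: "has_q_expansion M b T" unfolding b_def [abs_def] T_def [abs_def] by (intro q_expansion_sum fin q_expansion_cmult a RS)
 have bV: "b n \<in> V" for n unfolding b_def by (intro V_intros(7) V_intros(4) eg_V a RS)
 define Q where "Q = {R \<in> Reps N. int p0 dvd m21 R \<and> coprime (m21 R) (int M)}"
 have eQ: "eg R = ep PM" if "R \<in> Q" for R
 proof -
  have "\<not> int p dvd m21 R" if p: "p \<in> PM" for p
  proof
   assume "int p dvd m21 R"
   moreover have "p dvd M" unfolding M_def using PM(2) p by (intro dvd_prodI)
   then have "int p dvd int M" by simp
   ultimately have "is_unit (int p)" using \<open>R \<in> Q\<close> by (auto simp: Q_def dest: coprime_common_divisor)
   then show False using primes[of p] PM(1) p by (auto simp: prime_nat_iff)
  qed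
  then have "{p \<in> PM. \<not> int p dvd m21 R} = PM" by auto
  then show ?thesis using that by (simp add: eg_def Q_def)
 qed
 have cop: "coprime p0 M" unfolding M_def by (intro prod_coprime_right primes_coprime primes p0P) (use PM in auto)
 have "card Q = M"
 proof -
  have g: "(1, 0, int p0, 1) \<in> SL2" by (simp add: SL2_def)
  have c: "coprime (m21 (1, 0, int p0, 1)) (int M)" using cop by simp
  note ty = Reps_of_type[OF NM cop N0 g _ c]
  show ?thesis unfolding Q_def ty(1)[simplified] by (subst card_image) (use ty(2) in auto)
 qed
 have "b M = (\<Sum>R\<in>Q. eg R * a R M)" unfolding b_def
 proof (rule sum.mono_neutral_right)
  show "\<forall>R\<in>Reps N - Q. eg R * a R M = 0"
  proof
   fix R assume "R \<in> Reps N - Q"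
   then have "eg R = 0 \<or> a R M = 0" using a(3)[OF RS, of R] by (auto simp: Q_def eg_def Let_def simp del: m21.simps)
   then show "eg R * a R M = 0" by auto
  qed
 qed (use fin in \<open>auto simp: Q_def\<close>)
 also have "\<dots> = (\<Sum>R\<in>Q. ep PM * of_nat M powi (- (int M * 12)))" using eQ RS a(3) by (intro sum.cong) (auto simp: Q_def)
 also have "\<dots> = of_nat M * (ep PM * of_nat M powi (- (int M * 12)))" by (simp add: \<open>card Q = M\<close>)
 finally have bM: "b M = of_nat M * (ep PM * of_nat M powi (- (int M * 12)))" .
 have "of_nat M powi (- (int M * 12)) \<notin> mx"
 proof
  assume "of_nat M powi (- (int M * 12)) \<in> mx"
  then have "of_nat M powi (int M * 12) * of_nat M powi (- (int M * 12)) \<in> mx" by (intro mx_mult unit_powi of_nat_in_V M_unit)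
  then show False using M0 one_notin_mx by (simp add: power_int_minus)
 qed
 moreover have "ep PM \<notin> mx" unfolding ep_def
 proof (rule unit_prod)
  fix p assume "p \<in> PM"
  then have p: "p \<in> P" "p > 0" using PM(1) primes prime_gt_0_nat by auto
  have "- 1 / of_nat p \<notin> mx"
  proof
   assume "- 1 / of_nat p \<in> mx"
   then have "- of_nat p * (- 1 / of_nat p) \<in> mx" by (intro mx_mult V_intros(5) of_nat_in_V)
   then show False using p one_notin_mx by simp
  qed
  then show "- 1 / of_nat p \<in> V \<and> - 1 / of_nat p \<notin> mx" using inv_p_V[OF p(1)] by blast
 qed
 ultimately have "b M \<notin> mx" unfolding bM by (intro unit_mult_notin_mx of_nat_in_V M_unit ep_V PM)
 define d where "d = (LEAST n. b n \<notin> mx)"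
 have 1: "b d \<notin> mx" unfolding d_def using LeastI[of "\<lambda>n. b n \<notin> mx" M] \<open>b M \<notin> mx\<close> .
 have 2: "b n \<in> mx" if "n < d" for n using not_less_Least[of n "\<lambda>n. b n \<notin> mx"] that unfolding d_def by simp
 show ?thesis unfolding ld_def by (rule exI[of _ d], rule exI[of _ b]) (simp add: T bV 1 2)
qed

text \<open>Where \<open>eg R\<close> is nonzero, \<open>R\<close> lies in \<open>G0 p0\<close> and
  fixes \<phi>, while \<open>H\<close> is fixed by all of \<open>SL2\<close>. So modulo
  \<open>mx\<close> the trace is \<phi> H times \<open>T\<close>, and the orders add; they are
  compared in width M.\<close>

lemma trace_ld:
 assumes G: "invariant w 1 G" "intlead G a" and H: "invariant v 1 H" "intlead H b" and T: "ld M T d"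
 shows "\<exists>Y d'. invariant (int k + (int M * 12 + (w + v))) 1 Y \<and> ld 1 Y d' \<and> d' * M = (p0 * a + b) * M + d"
proof -
 define \<phi> where "\<phi> = A_op p0 G"
 define F where "F \<tau> = \<Psi> \<tau> * (\<Theta> \<tau> * (\<phi> \<tau> * H \<tau>))" for \<tau>
 let ?w = "int k + (int M * 12 + (w + v))"
 define Y where "Y = trace ?w N 1 F"
 have \<phi>_inv: "invariant w p0 \<phi>" unfolding \<phi>_def by (rule A_op_invariant[OF G(1) dvd_refl p0_pos])
 have "invariant w N \<phi>" "invariant (int M * 12) N \<Theta>" "invariant v N H"
  using G0_mono[of p0 N] NM \<phi>_inv A_op_invariant[OF Delta_pow_inv, of M N] M0 H(1) G0_mono[of 1 N] unfolding invariant_def \<Theta>_def by auto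
 then have "invariant ?w N F" unfolding F_def [abs_def] by (intro invariant_mult \<Psi>_inv)
 then have Yi: "invariant ?w 1 Y" unfolding Y_def by (rule trace_invariant[OF _ N0]) simp
 have R1: "relReps N 1 = Reps N" unfolding relReps_def G0_1 using Reps_SL2 by blast
 have RS: "R \<in> SL2" if "R \<in> Reps N" for R using Reps_SL2 that by blast
 have q\<Theta>: "qint V (sl (int M * 12) R \<Theta>)" if "R \<in> Reps N" for R using \<Theta>_cusp[OF RS[OF that]] M0 unfolding qint_def by blast
 have q\<phi>: "qint V (sl w R \<phi>)" if "R \<in> Reps N" for R
  unfolding \<phi>_def by (rule qint_A_op[OF G(1) intlead_qint[OF G(2)] p0_pos p_unit[OF p0P] RS[OF that]])
 have slH: "sl v R H \<tau> = H \<tau>" if "R \<in> Reps N" "\<tau> \<in> HH" for R \<tau> using invariantD[OF H(1), unfolded G0_1, OF RS] that by blast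
 have "qint mx (\<lambda>\<tau>. \<Sum>R\<in>Reps N. (sl (int M * 12) R \<Theta> \<tau> * (sl w R \<phi> \<tau> * H \<tau>)) * (sl (int k) R \<Psi> \<tau> - eg R))"
  by (intro qint_sum[OF id_mx] qint_mult[OF id_mx] qint_mult[OF id_V] q\<Theta> q\<phi> intlead_qint[OF H(2)] \<Psi>_cusp RS)
 then have mod: "qint mx (\<lambda>\<tau>. Y \<tau> - \<phi> \<tau> * H \<tau> * T \<tau>)"
 proof (rule qint_cong)
  fix \<tau> assume \<tau>: "\<tau> \<in> HH"
  have "Y \<tau> - \<phi> \<tau> * H \<tau> * T \<tau> = (\<Sum>R\<in>Reps N. sl ?w R F \<tau> - \<phi> \<tau> * H \<tau> * (eg R * sl (int M * 12) R \<Theta> \<tau>))"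
   unfolding Y_def trace_def R1 T_def sum_distrib_left sum_subtractf ..
  also have "\<dots> = (\<Sum>R\<in>Reps N. (sl (int M * 12) R \<Theta> \<tau> * (sl w R \<phi> \<tau> * H \<tau>)) * (sl (int k) R \<Psi> \<tau> - eg R))"
  proof (rule sum.cong)
   fix R assume R: "R \<in> Reps N"
   have 1: "sl ?w R F \<tau> = sl (int k) R \<Psi> \<tau> * (sl (int M * 12) R \<Theta> \<tau> * (sl w R \<phi> \<tau> * H \<tau>))"
    unfolding F_def [abs_def] sl_mult[OF SL2_det[OF RS[OF R]] \<tau>] slH[OF R \<tau>] ..
   have 2: "eg R * \<phi> \<tau> = eg R * sl w R \<phi> \<tau>"
   proof (cases "int p0 dvd m21 R")
    case True
    then show ?thesis using invariantD[OF \<phi>_inv _ \<tau>, of R] RS[OF R] by (simp add: G0_def)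
   qed (simp add: eg_def)
   have "\<phi> \<tau> * H \<tau> * (eg R * sl (int M * 12) R \<Theta> \<tau>) = (eg R * \<phi> \<tau>) * (H \<tau> * sl (int M * 12) R \<Theta> \<tau>)" by (simp only: mult_ac)
   then show "sl ?w R F \<tau> - \<phi> \<tau> * H \<tau> * (eg R * sl (int M * 12) R \<Theta> \<tau>) =
     (sl (int M * 12) R \<Theta> \<tau> * (sl w R \<phi> \<tau> * H \<tau>)) * (sl (int k) R \<Psi> \<tau> - eg R)" unfolding 1 2 by (simp only:) (simp add: algebra_simps)
  qed simp
  finally show "(\<Sum>R\<in>Reps N. (sl (int M * 12) R \<Theta> \<tau> * (sl w R \<phi> \<tau> * H \<tau>)) * (sl (int k) R \<Psi> \<tau> - eg R)) = Y \<tau> - \<phi> \<tau> * H \<tau> * T \<tau>" by simp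
 qed
 then obtain h e where he: "h > 0" "has_q_expansion h e (\<lambda>\<tau>. Y \<tau> - \<phi> \<tau> * H \<tau> * T \<tau>)" "\<And>n. e n \<in> mx" by (auto simp: qint_def)
 have he': "has_q_expansion (M * h) (\<lambda>n. if M dvd n then e (n div M) else 0) (\<lambda>\<tau>. Y \<tau> - \<phi> \<tau> * H \<tau> * T \<tau>)"
  using q_expansion_refine[OF M0 he(2)] by (simp only: mult.commute)
 have "ld 1 (\<lambda>\<tau>. \<phi> \<tau> * H \<tau>) (p0 * a + b)" unfolding \<phi>_def by (intro intlead_ld intlead_mult intlead_A_op p0_pos G H)
 then have "ld (1 * (M * h)) (\<lambda>\<tau>. \<phi> \<tau> * H \<tau>) ((p0 * a + b) * (M * h))" using M0 he(1) by (intro ld_refine) auto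
 moreover have "ld (M * h) T (d * h)" by (rule ld_refine[OF he(1) T])
 ultimately have "ld (M * h) (\<lambda>\<tau>. \<phi> \<tau> * H \<tau> * T \<tau>) ((p0 * a + b) * (M * h) + d * h)" using M0 he(1) by (intro ld_mult) auto
 then have ldY: "ld (M * h) Y ((p0 * a + b) * (M * h) + d * h)" by (rule ld_mod[OF _ he']) (use he(3) mx_0 in auto)
 then have "qint V Y" unfolding ld_def qint_def using M0 he(1) by (metis nat_0_less_mult_iff)
 then obtain y' where "has_q_expansion 1 y' Y" by (rule qint_level_one[OF Yi])
 then obtain d' where d': "(p0 * a + b) * (M * h) + d * h = d' * (M * h)" "ld 1 Y d'" using ld_descend[OF _ ldY] M0 he(1) by auto
 have "h * (d' * M) = h * ((p0 * a + b) * M + d)" using d'(1) by (simp add: algebra_simps)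
 then have "d' * M = (p0 * a + b) * M + d" using he(1) by simp
 then show ?thesis using Yi d'(2) by blast
qed

theorem contradiction: False
proof -
 obtain d where d: "ld M T d" using T_ld by blast
 \<comment> \<open>\<open>m\<close> is the weight contributed by \<Psi>, \<Theta> and H together;
   with G of weight 12 m the total is w = 13 m. This is at most 6 times 3 m, whereas
   \<open>I\<close> has 3 (m + 1) elements.\<close>
 define m where "m = k + 12 * M + 24"
 define I where "I = {..m} \<times> {..2::nat}"
 \<comment> \<open>Level one forms of weight 12 n and order exactly i, for every i \<le> n.\<close>
 define g where "g n i \<tau> = Delta \<tau> ^ i * E4 \<tau> ^ (3 * (n - i))" for n i \<tau>
 have inv: "invariant (12 * int n) 1 (g n i)" if "i \<le> n" for n i
 proof -
  have "invariant (int i * 12 + int (3 * (n - i)) * 4) 1 (g n i)" unfolding g_def [abs_def]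
   by (intro invariant_mult invariant_power Delta_inv E4_inv)
  moreover have "int i * 12 + int (3 * (n - i)) * 4 = 12 * int n" using that by (simp add: of_nat_diff algebra_simps)
  ultimately show ?thesis by simp
 qed
 have lead: "intlead (g n i) i" for n i
  unfolding g_def [abs_def] using intlead_mult[OF intlead_power[OF Delta_lead, of i] intlead_power[OF E4_lead, of "3 * (n - i)"]] by simp
 define w where "w = int k + (int M * 12 + (12 * int m + 12 * int 2))"
 have "\<forall>x\<in>I. \<exists>Y d'. invariant w 1 Y \<and> ld 1 Y d' \<and> d' * M = (p0 * fst x + snd x) * M + d"
  unfolding w_def I_def by (intro ballI trace_ld[OF inv lead inv lead d]) auto
 then obtain Y d' where Y: "\<And>x. x \<in> I \<Longrightarrow> invariant w 1 (Y x)" "\<And>x. x \<in> I \<Longrightarrow> ld 1 (Y x) (d' x)"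
  "\<And>x. x \<in> I \<Longrightarrow> d' x * M = (p0 * fst x + snd x) * M + d" by metis
 have "inj_on d' I"
 proof (rule inj_onI)
  fix x y assume xy: "x \<in> I" "y \<in> I" "d' x = d' y"
  then have "(p0 * fst x + snd x) * M + d = (p0 * fst y + snd y) * M + d" using Y(3) by metis
  then have eq: "p0 * fst x + snd x = p0 * fst y + snd y" using M0 by simp
  \<comment> \<open>As b \<le> 2 < p0, the pair (a, b) is recovered from p0 a + b by division with
    remainder.\<close>
  have lt: "snd x < p0" "snd y < p0" using xy p0_ge_3 by (auto simp: I_def)
  have "fst x = fst y" using arg_cong[OF eq, of "\<lambda>z. z div p0"] lt by simp
  then show "x = y" using eq by (simp add: prod_eq_iff)
 qed
 moreover have "card I > 2 * m + m" by (simp add: I_def)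
 ultimately show False by (intro sturm_mod[of I "2 * m + m" w Y d'] Y) (auto simp: I_def w_def m_def)
qed

end

theorem (in eisenstein_congruence) no_congruence: False
proof -
 obtain p where p: "p \<in> P" "sg p \<in> mx" using bad_prime_exists by blast
 interpret exceptional_prime V P N x y k f lam \<rho> p by unfold_locales (use p in auto)
 show False by (rule contradiction)
qed

text \<open>Integers prime to l are units of \<open>V\<close>, so \<open>q\<close> and the power of
  l with the same valuation differ by a unit. The half stated here is what bounds
  \<open>lam / \<rho>\<close>.\<close>

lemma (in complex_valuation_ring) padic_unit:
 assumes l: "Factorial_Ring.prime l" "of_nat l \<in> mx" and q: "q \<noteq> 0"
 shows "of_nat l powi padic_val l q / of_rat q \<in> V"
proof -
 obtain a b where ab: "quotient_of q = (a, b)" by (cases "quotient_of q")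
 have qab: "q = of_int a / of_int b" "b > 0" using quotient_of_div[OF ab] quotient_of_denom_pos[OF ab] .
 then have a0: "a \<noteq> 0" "b \<noteq> 0" using q by auto
 define i j where "i = multiplicity (int l) a" and "j = multiplicity (int l) b"
 have nu: "\<not> is_unit (int l)" using l(1) by (auto simp: prime_nat_iff)
 obtain a' where a': "a = int l ^ i * a'" "\<not> int l dvd a'" using multiplicity_decompose'[OF a0(1) nu] i_def by metis
 obtain b' where b': "b = int l ^ j * b'" "\<not> int l dvd b'" using multiplicity_decompose'[OF a0(2) nu] j_def by metis
 have l0: "l > 0" using l(1) by (rule prime_gt_0_nat)
 have "of_int a' \<notin> mx"
 proof
  assume m: "of_int a' \<in> mx"
  have "coprime (int l) a'" using a'(2) l(1) by (simp add: prime_imp_coprime)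
  then obtain u v where uv: "u * int l + v * a' = 1" using bezout_int[of "int l" a'] by (metis coprime_imp_gcd_eq_1)
  have "of_int u * of_nat l + of_int v * of_int a' \<in> mx" by (intro mx_add mx_mult of_int_in_V l m)
  moreover have "of_int u * of_nat l + of_int v * of_int a' = (1 :: complex)"
   using arg_cong[OF uv, of "of_int :: int \<Rightarrow> complex"] by simp
  ultimately show False using one_notin_mx by simp
 qed
 then have "of_int b' * inverse (of_int a') \<in> V" by (intro V_intros(4) unitD of_int_in_V)
 moreover have "of_nat l powi padic_val l q / of_rat q = of_int b' * inverse (of_int a' :: complex)"
 proof -
  have "padic_val l q = int i - int j" by (simp add: padic_val_def ab i_def j_def)
  then have "of_nat l powi padic_val l q = (of_nat l ^ i / of_nat l ^ j :: complex)" using l0 by (simp add: power_int_diff)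
  moreover have "(of_rat q :: complex) = of_int a / of_int b" by (simp add: qab of_rat_divide)
  ultimately have "of_nat l powi padic_val l q / of_rat q = (of_nat l ^ i / of_nat l ^ j) / (of_int a / of_int b :: complex)" by simp
  then show ?thesis using l0 a0 unfolding a'(1) b'(1) by (simp add: field_simps)
 qed
 ultimately show ?thesis by simp
qed

section \<open>From the valuation ring back to the stated inequality\<close>

theorem theorem3p2:
  fixes N k r l :: nat
    and ps :: "nat list"
    and f :: "complex \<Rightarrow> complex"
    and L :: "complex set"
  assumes "N > 0" and "squarefree N"
    and "distinct ps" and "set ps = prime_factors N"
    and "k \<ge> 2" and "even k"
    and "newform k N f"
    and "maximalideal L (coeff_integers f)"
    and "r > 0"
    and "forms_congruent (coeff_integers f) L r f (foldr (bracket_plus k) ps (eisenstein k))"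
    and "l = residual_char (coeff_integers f) L"
  shows "int r \<le> int (ord_ideal (coeff_integers f) L (of_nat l)) *
           padic_val l (- bernoulli k / (2 * of_nat k) * (\<Prod>p\<leftarrow>ps. 1 - of_nat p))"
proof (rule ccontr)
 assume neg: "\<not> ?thesis"
 define P where "P = set ps"
 define q where "q = - bernoulli k / (2 * of_nat k) * (\<Prod>p\<leftarrow>ps. 1 - of_nat p)"
 define s where "s = padic_val l q"
 define \<rho> where "\<rho> = cE k * (\<Prod>p\<in>P. 1 - of_nat p)"
 have primes: "Factorial_Ring.prime p" if "p \<in> P" for p using that assms(4) by (auto simp: P_def)
 have "N = (\<Prod>p\<in>P. p ^ multiplicity p N)" using prime_factorization_nat[OF assms(1)] assms(4) by (simp add: P_def)
 also have "\<dots> = \<Prod>P" using squarefree_factorial_semiring'[of N] assms(1,2,4) by (intro prod.cong) (auto simp: P_def)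
 finally have NP: "N = \<Prod>P" .
 have ql: "(\<Prod>p\<leftarrow>ps. 1 - of_nat p :: rat) = (\<Prod>p\<in>P. 1 - of_nat p)" unfolding P_def using assms(3) by (simp add: prod.distinct_set_conv_list)
 have q\<rho>: "of_rat q = \<rho>" unfolding q_def ql \<rho>_def cE_def of_rat_mult of_rat_prod by (simp add: of_rat_diff)
 \<comment> \<open>Even Bernoulli numbers are nonzero and 1 is not prime, so
   \<open>padic_val l q\<close> is a genuine valuation and not the value that the definition assigns
   to 0.\<close>
 have "q \<noteq> 0" unfolding q_def ql using bernoulli_even_nonzero[OF assms(6,5)] assms(5) primes[of 1] by (auto simp: P_def)
 then have \<rho>0: "\<rho> \<noteq> 0" using q\<rho> by auto
 have wts: "(\<lambda>p. of_nat p ^ (k - 1)) = wts k {}" by (simp add: fun_eq_iff wts_def)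
 have E: "q_coeff (foldr (bracket_plus k) ps (eisenstein k)) = cF k P (wts k {})"
  unfolding foldr_bracket_FF[OF assms(3)] wts P_def [symmetric]
  by (rule q_coeff_eq[OF FF_q_expansion]) (use primes prime_gt_0_nat in \<open>auto simp: P_def\<close>)
 obtain V where V: "complex_valuation_ring V" and l: "Factorial_Ring.prime l" "of_nat l \<in> complex_valuation_ring.mx V"
  and cl: "\<And>r s x y. int r > int (ord_ideal (coeff_integers f) L (of_nat l)) * s \<Longrightarrow> r > 0 \<Longrightarrow> cong_local (coeff_integers f) L r x y \<Longrightarrow>
    x - y \<in> complex_valuation_ring.mx V \<and> (x - y) * of_nat l powi (- s) \<in> complex_valuation_ring.mx V"
  by (rule coeff_integers_valuation[OF assms(7,1,5,8,11)]) (rule that)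
 interpret complex_valuation_ring V by (rule V)
 define lam where "lam = (of_nat l powi s :: complex)"
 have lam0: "lam \<noteq> 0" using prime_gt_0_nat[OF l(1)] by (simp add: lam_def power_int_eq_0_iff)
 have \<rho>V: "lam / \<rho> \<in> V" using padic_unit[OF l \<open>q \<noteq> 0\<close>] by (simp add: lam_def s_def q\<rho>)
 have "cong_local (coeff_integers f) L r (q_coeff f n) (cF k P (wts k {}) n)" for n
  using assms(10) unfolding forms_congruent_def E by blast
 \<comment> \<open>The negated inequality r > e s is the hypothesis of the valuation statement, with
   s the valuation of \<open>q\<close>.\<close>
 then have cl': "q_coeff f n - cF k P (wts k {}) n \<in> mx \<and> (q_coeff f n - cF k P (wts k {}) n) * of_nat l powi (- s) \<in> mx" for n
  by (intro cl[OF _ assms(9)]) (use neg in \<open>simp_all only: s_def q_def not_le\<close>)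
 have cong: "q_coeff f n - cF k P (wts k {}) n \<in> mx" "(q_coeff f n - cF k P (wts k {}) n) / lam \<in> mx" for n
  using cl'[of n] by (simp_all only: lam_def power_int_minus divide_inverse)
 show False
 proof (cases "k = 2")
  \<comment> \<open>In weight 2 the weights p^(k-1) are p itself, so the constant term of E is
    \<rho>. As \<open>f\<close> has constant term 0, \<rho>/lam would lie in \<open>mx\<close>
    although lam/\<rho> lies in \<open>V\<close>.\<close>
  case True
  have fc: "f \<in> cusp_forms k N" using assms(7) by (simp add: newform_def new_subspace_def)
  have "cF k P (wts k {}) 0 = \<rho>" by (subst cF_0) (simp_all add: P_def \<rho>_def wts_def True)
  then have "- \<rho> / lam \<in> mx" using cong(2)[of 0] cusp_form_q_expansion(2)[OF fc assms(1)] by simp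
  from mx_mult[OF \<rho>V this] show False using \<rho>0 lam0 mx_uminus[of "- 1"] one_notin_mx by simp
 next
  case False
  then have k4: "k \<ge> 4" using assms(5,6) by (auto elim!: evenE)
  obtain x y where xy: "level P (\<Prod>P) x y" using level_exists[of P] primes by (auto simp: P_def)
  interpret level P N x y unfolding NP by (rule xy)
  interpret eisenstein_congruence V P N x y k f lam \<rho>
   by unfold_locales (use k4 assms(6,7) lam0 cong \<rho>0 \<rho>V in \<open>simp_all add: \<rho>_def\<close>)
  show False by (rule no_congruence)
 qed
qed

end
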